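(* Let $q>1$, $T\in(0,\infty]$, let $\mathcal{S}$ be a closed set in $\mathbb{R}^N$ with $\mathcal{S}\neq\mathbb{R}^N$, and $u_0\in\mathcal{M}^+(\mathbb{R}^N\setminus\mathcal{S})$. Let $u$ be any nonnegative classical solution of (E) in $Q_{\mathbb{R}^N,T}$ (or any nonnegative weak solution if $q\le2$) with initial trace $(\mathcal{S},u_0)$. Then there exists a measure $\gamma\in\mathcal{M}^+(\mathbb{R}^N)$ concentrated on $\mathcal{S}$ such that $t^{1/(q-1)}u(\cdot,t)$ converges weak-$*$ to $\gamma$ (i.e. against every $\psi\in C_c(\mathbb{R}^N)$) as $t\to0$. Moreover $\gamma\in L^\infty_{loc}(\mathbb{R}^N)$; in particular if $|\mathcal{S}|=0$ then $\gamma=0$, and if $\mathcal{S}$ is compact then $\gamma\in L^\infty(\mathbb{R}^N)$.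
   Context: Equation (E) is $u_t-\Delta u+|\nabla u|^q=0$, $Q_{\Omega,T}=\Omega\times(0,T)$. A weak solution of (E) in $Q_{\Omega,T}$ is a function $u\in C((0,T);L^1_{loc}(\Omega))\cap L^1_{loc}((0,T);W^{1,1}_{loc}(\Omega))$ with $|\nabla u|^q\in L^1_{loc}(Q_{\Omega,T})$ satisfying (E) in the sense of distributions in $Q_{\Omega,T}$; a classical solution is $u\in C^{2,1}(Q_{\Omega,T})$ satisfying (E) pointwise. $\mathcal{M}^+(A)$ is the set of nonnegative Radon measures on $A$. A nonnegative weak solution $u$ has initial trace $(\mathcal{S},u_0)$, where $\mathcal{S}\subset\Omega$ is relatively closed, $\mathcal{R}=\Omega\setminus\mathcal{S}$ and $u_0\in\mathcal{M}^+(\mathcal{R})$, if $\lim_{t\to0}\int_{\mathcal{R}}u(\cdot,t)\psi\,dx=\int_{\mathcal{R}}\psi\,du_0$ for all $\psi\in C_c(\mathcal{R})$, and $\lim_{t\to0}\int_{B(x_0,\varepsilon)\cap\Omega}u(\cdot,t)dx=\infty$ for all $x_0\in\mathcal{S}$, $\varepsilon>0$. *)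

theory Defs
  imports "HOL-Analysis.Analysis"
begin

definition supp_cl :: "('b::topological_space \<Rightarrow> real) \<Rightarrow> 'b set" where
  "supp_cl f = closure {z. f z \<noteq> 0}"

definition Cc :: "'b::topological_space set \<Rightarrow> ('b \<Rightarrow> real) set" where
  "Cc A = {f. continuous_on UNIV f \<and> compact (supp_cl f) \<and> supp_cl f \<subseteq> A}"

fun Ck :: "nat \<Rightarrow> ('b::real_normed_vector \<Rightarrow> real) \<Rightarrow> bool" where
  "Ck 0 f = continuous_on UNIV f"
| "Ck (Suc k) f = (continuous_on UNIV f \<and>
      (\<exists>Df. (\<forall>z. (f has_derivative Df z) (at z)) \<and> (\<forall>v. Ck k (\<lambda>z. Df z v))))"

definition smooth :: "('b::real_normed_vector \<Rightarrow> real) \<Rightarrow> bool" where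
  "smooth f = (\<forall>k. Ck k f)"

definition test_fun :: "'b::real_normed_vector set \<Rightarrow> ('b \<Rightarrow> real) set" where
  "test_fun A = {f. smooth f \<and> compact (supp_cl f) \<and> supp_cl f \<subseteq> A}"

definition dd :: "('b::real_normed_vector \<Rightarrow> real) \<Rightarrow> 'b \<Rightarrow> 'b \<Rightarrow> real" where
  "dd f v z = frechet_derivative f (at z) v"

definition Qdom :: "ereal \<Rightarrow> ('a::euclidean_space \<times> real) set" where
  "Qdom T = {(x, t). 0 < t \<and> ereal t < T}"

definition classical_solution :: "real \<Rightarrow> ereal \<Rightarrow> ('a::euclidean_space \<Rightarrow> real \<Rightarrow> real) \<Rightarrow> bool" where
  "classical_solution q T u \<longleftrightarrow>
    (\<exists>(Du :: 'a \<Rightarrow> real \<Rightarrow> 'a) (D2 :: 'a \<Rightarrow> real \<Rightarrow> 'a \<Rightarrow> 'a) (ut :: 'a \<Rightarrow> real \<Rightarrow> real).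
       continuous_on (Qdom T) (\<lambda>(x, t). u x t) \<and>
       continuous_on (Qdom T) (\<lambda>(x, t). Du x t) \<and>
       (\<forall>v. continuous_on (Qdom T) (\<lambda>(x, t). D2 x t v)) \<and>
       continuous_on (Qdom T) (\<lambda>(x, t). ut x t) \<and>
       (\<forall>(x, t) \<in> Qdom T.
          ((\<lambda>y. u y t) has_derivative (\<lambda>h. Du x t \<bullet> h)) (at x) \<and>
          ((\<lambda>y. Du y t) has_derivative D2 x t) (at x) \<and>
          ((\<lambda>s. u x s) has_real_derivative ut x t) (at t) \<and>
          ut x t - (\<Sum>b\<in>Basis. D2 x t b \<bullet> b) + norm (Du x t) powr q = 0))"

definition weak_solution :: "real \<Rightarrow> ereal \<Rightarrow> ('a::euclidean_space \<Rightarrow> real \<Rightarrow> real) \<Rightarrow> bool" where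
  "weak_solution q T u \<longleftrightarrow>
    (\<exists>g :: 'a \<Rightarrow> real \<Rightarrow> 'a.
       \<comment> \<open>C((0,T); L^1_loc(R^N))\<close>
       (\<forall>t. 0 < t \<and> ereal t < T \<longrightarrow>
          (\<lambda>x. u x t) \<in> borel_measurable lebesgue \<and>
          (\<forall>K. compact K \<longrightarrow> set_integrable lebesgue K (\<lambda>x. u x t)) \<and>
          (\<forall>K. compact K \<longrightarrow>
             ((\<lambda>s. \<integral>\<^sup>+x\<in>K. ennreal \<bar>u x s - u x t\<bar> \<partial>lebesgue) \<longlongrightarrow> 0)
               (at t within {s. 0 < s \<and> ereal s < T}))) \<and>
       \<comment> \<open>L^1_loc((0,T); W^{1,1}_loc(R^N)), g being the weak spatial gradient\<close>
       (\<lambda>(x, t). u x t) \<in> borel_measurable lebesgue \<and>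
       (\<lambda>(x, t). g x t) \<in> borel_measurable lebesgue \<and>
       (\<forall>K. compact K \<and> K \<subseteq> Qdom T \<longrightarrow>
          set_integrable lebesgue K (\<lambda>(x, t). u x t) \<and>
          set_integrable lebesgue K (\<lambda>(x, t). g x t) \<and>
          set_integrable lebesgue K (\<lambda>(x, t). norm (g x t) powr q)) \<and>
       (\<forall>\<phi> \<in> test_fun (Qdom T). \<forall>b \<in> Basis.
          (\<integral>z. (case z of (x, t) \<Rightarrow> u x t) * dd \<phi> (b, 0) z \<partial>lebesgue)
            = - (\<integral>z. (case z of (x, t) \<Rightarrow> g x t \<bullet> b) * \<phi> z \<partial>lebesgue)) \<and>
       \<comment> \<open>the equation in the sense of distributions\<close>
       (\<forall>\<phi> \<in> test_fun (Qdom T).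
          (\<integral>z. (case z of (x, t) \<Rightarrow>
                   - u x t * dd \<phi> (0, 1) z
                   - u x t * (\<Sum>b\<in>Basis. dd (dd \<phi> (b, 0)) (b, 0) z)
                   + norm (g x t) powr q * \<phi> z) \<partial>lebesgue) = 0))"

text \<open>Initial trace (S, u0) of a nonnegative solution in R^N x (0,T).
  u0 is a nonnegative Radon measure on R = R^N - S, represented as a Borel measure on R^N
  which vanishes on S and is finite on compact subsets of R.\<close>
definition radon_on :: "'a::euclidean_space set \<Rightarrow> 'a measure \<Rightarrow> bool" where
  "radon_on R \<mu> \<longleftrightarrow> sets \<mu> = sets borel \<and> emeasure \<mu> (- R) = 0 \<and>
      (\<forall>K. compact K \<and> K \<subseteq> R \<longrightarrow> emeasure \<mu> K < \<infinity>)"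

definition has_initial_trace ::
    "('a::euclidean_space \<Rightarrow> real \<Rightarrow> real) \<Rightarrow> 'a set \<Rightarrow> 'a measure \<Rightarrow> bool" where
  "has_initial_trace u S u0 \<longleftrightarrow>
     (\<forall>\<psi> \<in> Cc (- S).
        ((\<lambda>t. \<integral>x. u x t * \<psi> x \<partial>lebesgue) \<longlongrightarrow> (\<integral>x. \<psi> x \<partial>u0)) (at_right 0)) \<and>
     (\<forall>x0 \<in> S. \<forall>\<epsilon> > 0.
        ((\<lambda>t. \<integral>\<^sup>+x\<in>ball x0 \<epsilon>. ennreal (u x t) \<partial>lebesgue) \<longlongrightarrow> \<infinity>) (at_right 0))"

end

theory Submission
  imports Defs
begin

text \<open>
  Write \<open>\<alpha> = 1 / (q - 1)\<close>. For every \<open>h\<close>, comparison of a nonnegative solution with a multiple of the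
  solution seen from a point moving with constant velocity gives the affine Harnack inequalities behind
  \<open>norm (grad u) powr q \<le> u / ((q - 1) * t)\<close>. Hence \<open>t powr \<alpha> * u\<close> is bounded by a multiple of
  \<open>(1 + norm x) powr (q / (q - 1))\<close>, because the trace is finite somewhere off \<open>S\<close>, and the gradient bound
  together with the equation makes suitably weighted masses of \<open>t powr \<alpha> * u\<close> almost monotone in time, so
  that they converge as \<open>t\<close> tends to \<open>0\<close>. The limit functional is dominated by a multiple of Lebesgue measure
  with locally bounded density, hence has a density by the Radon-Nikodym theorem; off \<open>S\<close> the masses of \<open>u\<close>
  converge and \<open>t powr \<alpha>\<close> tends to \<open>0\<close>, so the density vanishes there.

  No regularity theory is used: by Jensen's inequality the space-time mollifications of a weak solution are
  smooth subsolutions, with a defect that tends to \<open>0\<close> in \<open>L1\<close>, and all estimates are proved for such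
  approximants. A classical solution is its own approximant.
\<close>

text \<open>No growth at infinity is prescribed, so every comparison has to produce its own control
  there: by Young's inequality the absorption bounds the mass of any bump by the mass of one fixed
  bump at an earlier time, and the exponent \<open>q / (q - 1)\<close> of all growth bounds is that
  of the Legendre transform of \<open>m powr q\<close>. The approximants are subsolutions whose
  defect is small only in L1, so a pointwise maximum principle is out of reach. What is propagated
  instead is the integral of \<open>Jp K y\<close>, a convex penalty of the negative part with
  \<open>Jp2 \<ge> K * (- Jp1)\<close>: its second derivative absorbs an error quadratic in the
  gradient. An error of order \<open>q\<close> lies below a small constant plus a quadratic globally
  when \<open>q \<le> 2\<close>; for larger \<open>q\<close> this is true on bounded sets of
  gradients, and a classical solution has such bounds on compact sets. Hence the two alternatives on
  \<open>u\<close>. The weight \<open>t powr (1 / (q - 1))\<close> is forced by the gradient bound: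
  the derivative of the weight compensates what the absorption can take away, and only a diffusion
  term is left.\<close>

section \<open>Spatial calculus of C2 functions and integration by parts\<close>

definition lap :: "('a::euclidean_space => 'a) => real" where
 "lap D = (\<Sum>b\<in>Basis. D b \<bullet> b)"

text \<open>Gradient and Hessian are carried as data. Continuity of the Hessian is asked one
  direction at a time, as in the notion of classical solution; this is what the Laplacian
  needs.\<close>

definition C2 :: "('a::euclidean_space => real) => ('a => 'a) => ('a => 'a => 'a) => bool" where
 "C2 f G D \<longleftrightarrow>
  (\<forall>x. (f has_derivative (%h. G x \<bullet> h)) (at x)) \<and>
  (\<forall>x. (G has_derivative D x) (at x)) \<and>
  (\<forall>v. continuous_on UNIV (%x. D x v))"

lemma continuous_on_compose_pair:
 assumes c: "continuous_on (A \<times> B) (%(x, y). f x y)"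
  and g: "continuous_on S g" and h: "continuous_on S h"
  and sub: "\<And>z. z \<in> S ==> g z \<in> A \<and> h z \<in> B"
 shows "continuous_on S (%z. f (g z) (h z))"
proof -
 have "continuous_on S (%z. (%(x, y). f x y) (g z, h z))"
  by (rule continuous_on_compose2[OF c]) (use sub in \<open>auto intro!: continuous_intros g h\<close>)
 then show ?thesis by simp
qed

lemma continuous_on_swap:
 assumes c: "continuous_on (A \<times> B) (%(x, y). f x y)"
 shows "continuous_on (B \<times> A) (%(y, x). f x y)"
 unfolding split_beta
 by (rule continuous_on_compose_pair[OF c]) (auto intro!: continuous_intros)

lemma continuous_on_slice:
 assumes c: "continuous_on (A \<times> B) (%(x, y). f x y)" and "y \<in> B"
 shows "continuous_on A (%x. f x y)"
 by (rule continuous_on_compose_pair[OF c]) (use assms in \<open>auto intro!: continuous_intros\<close>)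

lemma C2_continuous:
 assumes "C2 f G D"
 shows "continuous_on UNIV f" "continuous_on UNIV G"
 using assms unfolding C2_def
 by (meson continuous_at_imp_continuous_on has_derivative_continuous)+

lemma C2_lap_continuous:
 assumes "C2 f G D"
 shows "continuous_on UNIV (%x. lap (D x))"
 using assms unfolding C2_def lap_def
 by (intro continuous_intros) auto

lemma C2_translate:
 assumes "C2 f G D"
 shows "C2 (%x. f (x - c)) (%x. G (x - c)) (%x. D (x - c))"
 unfolding C2_def
proof (intro conjI allI)
 fix x v
 have *: "((%x. x - c) has_derivative (%h. h)) (at x)"
  by (auto intro!: derivative_eq_intros)
 have f: "(f has_derivative (%h. G (x - c) \<bullet> h)) (at (x - c))"
  and G: "(G has_derivative D (x - c)) (at (x - c))"
  using assms by (auto simp: C2_def)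
 show "((%x. f (x - c)) has_derivative (%h. G (x - c) \<bullet> h)) (at x)"
  using has_derivative_compose[OF * f] .
 show "((%x. G (x - c)) has_derivative D (x - c)) (at x)"
  using has_derivative_compose[OF * G] by simp
 have "continuous_on UNIV (%x. D x v)"
  using assms by (auto simp: C2_def)
 from continuous_on_compose2[OF this, of UNIV "%x. x - c"]
 show "continuous_on UNIV (%x. D (x - c) v)"
  by (simp add: continuous_on_diff)
qed

lemma C2_add:
 assumes "C2 f F D" "C2 g G E"
 shows "C2 (%x. f x + g x) (%x. F x + G x) (%x v. D x v + E x v)"
 using assms unfolding C2_def
 by (auto intro!: derivative_eq_intros continuous_intros simp: inner_add_left)

lemma C2_cmult:
 assumes "C2 f F D"
 shows "C2 (%x. c * f x) (%x. c *\<^sub>R F x) (%x v. c *\<^sub>R D x v)"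
 using assms unfolding C2_def
 by (auto intro!: derivative_eq_intros continuous_intros)

lemma C2_const: "C2 (%x. c) (%x. 0) (%x v. 0)"
 unfolding C2_def inner_zero_left by auto

lemma lap_add: "lap (%v. D v + E v) = lap D + lap E"
 by (simp add: lap_def inner_add_left sum.distrib)

lemma lap_cmult: "lap (%v. c *\<^sub>R D v) = c * lap D"
 by (simp add: lap_def sum_distrib_left)

text \<open>Writing radial functions through \<open>x \<bullet> x\<close> instead of
  \<open>norm x\<close> keeps them smooth at the origin, so one-variable derivatives on
  \<open>r \<ge> 0\<close> suffice.\<close>

lemma C2_radial:
 fixes th th1 th2 :: "real => real"
 assumes 1: "\<And>r. r \<ge> 0 ==> (th has_real_derivative th1 r) (at r)"
  and 2: "\<And>r. r \<ge> 0 ==> (th1 has_real_derivative th2 r) (at r)"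
  and 3: "continuous_on {0..} th2"
 shows "C2 (%x::'a::euclidean_space. th (x \<bullet> x))
      (%x. (2 * th1 (x \<bullet> x)) *\<^sub>R x)
      (%x v. (4 * th2 (x \<bullet> x) * (x \<bullet> v)) *\<^sub>R x + (2 * th1 (x \<bullet> x)) *\<^sub>R v)"
 unfolding C2_def
proof (intro conjI allI)
 fix x v :: 'a
 have sq: "((%x::'a. x \<bullet> x) has_derivative (%h. 2 * (x \<bullet> h))) (at x)"
  by (auto intro!: derivative_eq_intros simp: inner_commute)
 show "((%x. th (x \<bullet> x)) has_derivative (%h. ((2 * th1 (x \<bullet> x)) *\<^sub>R x) \<bullet> h)) (at x)"
  using has_derivative_compose[OF sq, of th "(*) (th1 (x \<bullet> x))"] 1[of "x \<bullet> x"]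
  by (simp add: has_field_derivative_def mult_ac)
 have "((%x. th1 (x \<bullet> x)) has_derivative (%h. th2 (x \<bullet> x) * (2 * (x \<bullet> h)))) (at x)"
  using has_derivative_compose[OF sq, of th1 "(*) (th2 (x \<bullet> x))"] 2[of "x \<bullet> x"]
  by (simp add: has_field_derivative_def)
 then show "((%x. (2 * th1 (x \<bullet> x)) *\<^sub>R x) has_derivative
   (%v. (4 * th2 (x \<bullet> x) * (x \<bullet> v)) *\<^sub>R x + (2 * th1 (x \<bullet> x)) *\<^sub>R v)) (at x)"
  by (auto intro!: derivative_eq_intros simp: mult_ac)
 have "continuous_on UNIV (%x::'a. th2 (x \<bullet> x))"
  by (rule continuous_on_compose2[OF 3]) (auto intro!: continuous_intros)
 moreover have "continuous_on {0..} th1"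
  using 2 by (meson DERIV_isCont atLeast_iff continuous_at_imp_continuous_on)
 then have "continuous_on UNIV (%x::'a. th1 (x \<bullet> x))"
  by (rule continuous_on_compose2) (auto intro!: continuous_intros)
 ultimately show "continuous_on UNIV
   (%x. (4 * th2 (x \<bullet> x) * (x \<bullet> v)) *\<^sub>R x + (2 * th1 (x \<bullet> x)) *\<^sub>R v)"
  by (intro continuous_intros)
qed

lemma lap_radial:
 fixes x :: "'a::euclidean_space"
 shows "lap (%v. (a * (x \<bullet> v)) *\<^sub>R x + b *\<^sub>R v) = a * (x \<bullet> x) + b * DIM('a)"
proof -
 have "(\<Sum>v\<in>Basis. (x \<bullet> v) * (x \<bullet> v)) = x \<bullet> x"
  by (simp flip: euclidean_inner)
 then have *: "(\<Sum>v\<in>Basis. a * (x \<bullet> v) * (x \<bullet> v)) = a * (x \<bullet> x)"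
  by (simp add: sum_distrib_left[symmetric] mult.assoc)
 have "lap (%v. (a * (x \<bullet> v)) *\<^sub>R x + b *\<^sub>R v) = (\<Sum>v\<in>Basis. a * (x \<bullet> v) * (x \<bullet> v) + b)"
  unfolding lap_def by (rule sum.cong) (auto simp: inner_add_left)
 also have "\<dots> = a * (x \<bullet> x) + b * DIM('a)"
  using * by (simp add: sum.distrib)
 finally show ?thesis .
qed

lemma integrable_compact_support:
 fixes f :: "'a::euclidean_space => 'b::{banach, second_countable_topology}"
 assumes f: "continuous_on UNIV f" and "\<And>x. norm x > R ==> f x = 0"
 shows "integrable lborel f"
proof -
 have "integrable lborel (%x. indicator (cball 0 R) x *\<^sub>R f x)"
  by (rule borel_integrable_compact) (auto intro: continuous_on_subset[OF f])
 moreover have "indicator (cball 0 R) x *\<^sub>R f x = f x" for x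
  using assms(2)[of x] by (auto simp: indicator_def)
 ultimately show ?thesis by simp
qed

lemma integral_lborel_translate:
 fixes f :: "'a::euclidean_space => 'b::{banach, second_countable_topology}"
 assumes "f \<in> borel_measurable borel"
 shows "(LBINT x. f (c + x)) = (LBINT x. f x)"
proof -
 have "(LBINT x. f x) = (\<integral>x. f x \<partial>distr lborel borel ((+) c))"
  by (simp add: lborel_distr_plus)
 also have "\<dots> = (LBINT x. f (c + x))"
  by (rule integral_distr) (use assms in auto)
 finally show ?thesis by simp
qed

text \<open>A bridge to the gauge integral over a box, for which continuity in a parameter and
  differentiation under the integral sign are available.\<close>

lemma lborel_integral_eq_cbox:
 fixes f :: "'a::euclidean_space => real"
 assumes c: "continuous_on UNIV f" and supp: "\<And>x. norm x > R ==> f x = 0"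
 shows "(LBINT x. f x) = integral (cbox (- R *\<^sub>R One) (R *\<^sub>R One)) f"
  (is "_ = integral ?B _")
proof -
 have zero: "f x = 0" if x: "x \<notin> ?B" for x
 proof (rule supp)
  obtain b where "b \<in> Basis" "\<bar>x \<bullet> b\<bar> > R"
   using x by (force simp: mem_box)
  then show "norm x > R"
   using Basis_le_norm[of b x] by simp
 qed
 have "integrable lborel f"
  using c supp by (rule integrable_compact_support)
 then have "(f has_integral (LBINT x. f x)) UNIV"
  by (rule has_integral_integral_lborel)
 then have "integral UNIV f = (LBINT x. f x)"
  by (rule integral_unique)
 moreover have "f = (%x. if x \<in> ?B then f x else 0)"
  using zero by auto
 ultimately show ?thesis
  by (metis integral_restrict_UNIV)
qed

lemma continuous_on_lborel_integral:
 fixes P :: "'a::euclidean_space => real => real"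
 assumes supp: "\<And>x r. r \<in> {s..t} ==> norm x > R ==> P x r = 0"
  and c: "continuous_on (UNIV \<times> {s..t}) (%(x, r). P x r)"
 shows "continuous_on {s..t} (%r. LBINT x. P x r)"
proof -
 let ?B = "cbox (- R *\<^sub>R One) (R *\<^sub>R One) :: 'a set"
 have "continuous_on ({s..t} \<times> ?B) (%(r, x). P x r)"
  by (rule continuous_on_subset[OF continuous_on_swap[OF c]]) auto
 then have "continuous_on {s..t} (%r. integral ?B (%x. P x r))"
  by (rule integral_continuous_on_param)
 moreover have "(LBINT x. P x r) = integral ?B (%x. P x r)" if "r \<in> {s..t}" for r
  using that by (intro lborel_integral_eq_cbox continuous_on_slice[OF c] supp)
 ultimately show ?thesis
  using continuous_on_cong by (metis (mono_tags, lifting))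
qed

lemma leibniz_compact_support:
 fixes P :: "'a::euclidean_space => real => real"
 assumes supp: "\<And>x r. r \<in> {s..t} ==> norm x > R ==> P x r = 0"
  and der: "\<And>x r. r \<in> {s..t} ==> (P x has_real_derivative P' x r) (at r within {s..t})"
  and c: "\<And>r. r \<in> {s..t} ==> continuous_on UNIV (%x. P x r)"
  and c': "continuous_on (UNIV \<times> {s..t}) (%(x, r). P' x r)"
  and "s < t" and r: "r \<in> {s..t}"
 shows "((%r. LBINT x. P x r) has_real_derivative (LBINT x. P' x r)) (at r within {s..t})"
proof -
 let ?B = "cbox (- R *\<^sub>R One) (R *\<^sub>R One) :: 'a set"
 \<comment> \<open>Outside the support \<open>P x\<close> is constantly zero on the whole interval.
   Since \<open>s < t\<close>, one-sided derivatives within it are unique, so the derivative is zero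
   there as well.\<close>
 have supp': "P' x r = 0" if "r \<in> {s..t}" "norm x > R" for x r
 proof -
  have "(P x has_real_derivative P' x r) (at r within {s..t})"
   by (rule der) fact
  then have 1: "((%_. 0) has_real_derivative P' x r) (at r within {s..t})"
   by (rule has_field_derivative_transform_within[where d=1])
    (use that supp in auto)
  have 2: "((%_. 0) has_real_derivative 0) (at r within {s..t})"
   by simp
  have "P' x r * 1 = 0 * 1"
   using
    vector_derivative_unique_within_closed_interval[of s t r "%_. 0::real" "P' x r" 0] 1 2 that \<open>s < t\<close>
   by (simp add: has_real_derivative_iff_has_vector_derivative)
  then show ?thesis by simp
 qed
 have "((%r. integral ?B (%x. P x r)) has_real_derivative integral ?B (%x. P' x r)) (at r within {s..t})"
 proof (rule leibniz_rule_field_derivative)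
  show "continuous_on ({s..t} \<times> ?B) (%(r, x). P' x r)"
   by (rule continuous_on_subset[OF continuous_on_swap[OF c']]) auto
  show "(%x. P x r) integrable_on ?B" if "r \<in> {s..t}" for r
   by (rule integrable_continuous) (use c[OF that] continuous_on_subset in blast)
 qed (use der r in auto)
 moreover have "(LBINT x. P x r) = integral ?B (%x. P x r)" if "r \<in> {s..t}" for r
  using that c supp by (intro lborel_integral_eq_cbox) auto
 moreover have "(LBINT x. P' x r) = integral ?B (%x. P' x r)"
  using r by (intro lborel_integral_eq_cbox supp' continuous_on_slice[OF c'])
 ultimately show ?thesis
  using has_field_derivative_transform_within[of "%r. integral ?B (%x. P x r)" _ r "{s..t}" 1] r
  by auto
qed

text \<open>By translation invariance the integral of \<open>F (x + r *\<^sub>R b)\<close> does not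
  depend on \<open>r\<close>; differentiating under the integral at \<open>r = 0\<close> gives the
  claim. This replaces the divergence theorem.\<close>

lemma integral_directional_derivative_zero:
 fixes F F' :: "'a::euclidean_space => real"
 assumes der: "\<And>x. ((%r. F (x + r *\<^sub>R b)) has_real_derivative F' x) (at 0)"
  and c: "continuous_on UNIV F" and c': "continuous_on UNIV F'"
  and supp: "\<And>x. norm x > R ==> F x = 0"
 shows "(LBINT x. F' x) = 0"
proof -
 have 1: "((%r. LBINT x. F (x + r *\<^sub>R b)) has_real_derivative (LBINT x. F' (x + 0 *\<^sub>R b)))
   (at 0 within {-1..1})"
 proof (rule leibniz_compact_support[where R = "R + norm b"])
  fix x r assume r: "r \<in> {-1..1::real}"
  have "F (x + r *\<^sub>R b) = 0" if "norm x > R + norm b"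
  proof (rule supp)
   have "norm (r *\<^sub>R b) \<le> norm b"
    using r by (simp add: mult_left_le_one_le abs_le_iff)
   then show "norm (x + r *\<^sub>R b) > R"
    using norm_diff_ineq[of x "r *\<^sub>R b"] that by linarith
  qed
  then show "norm x > R + norm b ==> F (x + r *\<^sub>R b) = 0" .
  have "((%h. F ((x + r *\<^sub>R b) + h *\<^sub>R b)) has_real_derivative F' (x + r *\<^sub>R b)) (at 0)"
   by (rule der)
  then have "((%h. F (x + (h + r) *\<^sub>R b)) has_real_derivative F' (x + r *\<^sub>R b)) (at 0)"
   by (simp add: algebra_simps)
  then have "((%r. F (x + r *\<^sub>R b)) has_real_derivative F' (x + r *\<^sub>R b)) (at r)"
   using DERIV_at_within_shift[of "%r. F (x + r *\<^sub>R b)" "F' (x + r *\<^sub>R b)" r 0 UNIV]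
   by (simp add: add.commute)
  then show "((%r. F (x + r *\<^sub>R b)) has_real_derivative F' (x + r *\<^sub>R b)) (at r within {-1..1})"
   by (rule has_field_derivative_at_within)
 next
  show "continuous_on (UNIV \<times> {- 1..1}) (%(x, r). F' (x + r *\<^sub>R b))"
   by (auto simp: split_beta intro!: continuous_intros continuous_on_compose2[OF c'])
 qed (auto intro!: continuous_intros continuous_on_compose2[OF c])
 have "(LBINT x. F (x + r *\<^sub>R b)) = (LBINT x. F x)" for r
  using integral_lborel_translate[of F "r *\<^sub>R b"] c
  by (simp add: add.commute borel_measurable_continuous_onI)
 with 1 have 1: "((%r. LBINT x. F x) has_real_derivative (LBINT x. F' x)) (at 0 within {-1..1})"
  by simp
 have 2: "((%r. LBINT x. F x) has_real_derivative 0) (at 0 within {-1..1})"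
  by simp
 show ?thesis
  using vector_derivative_unique_within_closed_interval[of "-1" 1 0 "%r. LBINT x. F x"] 1 2
  by (simp add: has_real_derivative_iff_has_vector_derivative)
qed

lemma has_derivative_imp_directional:
 assumes "(f has_derivative f') (at x)"
 shows "((%r. f (x + r *\<^sub>R b)) has_vector_derivative f' b) (at 0)"
proof -
 have 1: "((%r. x + r *\<^sub>R b) has_derivative (%r. r *\<^sub>R b)) (at 0)"
  by (auto intro!: derivative_eq_intros)
 have "(f has_derivative f') (at (x + 0 *\<^sub>R b))"
  using assms by simp
 from has_derivative_compose[OF 1 this] show ?thesis
  unfolding has_vector_derivative_def
  using linear_simps(5)[OF has_derivative_bounded_linear[OF assms]] by simp
qed

lemma integration_by_parts_direction:
 fixes f g :: "'a::euclidean_space => real"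
 assumes f: "\<And>x. (f has_derivative (%h. F x \<bullet> h)) (at x)" and F: "continuous_on UNIV F"
  and g: "\<And>x. (g has_derivative (%h. G x \<bullet> h)) (at x)" and G: "continuous_on UNIV G"
  and supp: "\<And>x. norm x > R ==> g x = 0 \<and> G x = 0"
 shows "(LBINT x. (F x \<bullet> b) * g x) = - (LBINT x. f x * (G x \<bullet> b))"
proof -
 have cf: "continuous_on UNIV f" and cg: "continuous_on UNIV g"
  using f g by (meson continuous_at_imp_continuous_on has_derivative_continuous)+
 have "(LBINT x. (F x \<bullet> b) * g x + f x * (G x \<bullet> b)) = 0"
 proof (rule integral_directional_derivative_zero[where R = R and F = "%x. f x * g x" and b = b])
  fix x
  show "((%r. f (x + r *\<^sub>R b) * g (x + r *\<^sub>R b)) has_real_derivative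
    (F x \<bullet> b) * g x + f x * (G x \<bullet> b)) (at 0)"
   using has_derivative_imp_directional[OF f, of x b] has_derivative_imp_directional[OF g, of x b]
   unfolding has_real_derivative_iff_has_vector_derivative[symmetric]
   by (auto intro!: derivative_eq_intros)
 qed (use supp in \<open>auto intro!: continuous_intros cf cg F G\<close>)
 moreover have "integrable lborel (%x. (F x \<bullet> b) * g x)" "integrable lborel (%x. f x * (G x \<bullet> b))"
  by (rule integrable_compact_support[where R = R];
    use supp in \<open>auto intro!: continuous_intros cf cg F G\<close>)+
 ultimately show ?thesis
  by simp
qed

lemma C2_green:
 fixes f g :: "'a::euclidean_space => real"
 assumes f: "C2 f F D"
  and g: "\<And>x. (g has_derivative (%h. G x \<bullet> h)) (at x)" and G: "continuous_on UNIV G"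
  and supp: "\<And>x. norm x > R ==> g x = 0 \<and> G x = 0"
 shows "(LBINT x. lap (D x) * g x) = - (LBINT x. F x \<bullet> G x)"
proof -
 have cg: "continuous_on UNIV g"
  using g by (meson continuous_at_imp_continuous_on has_derivative_continuous)
 have cD: "continuous_on UNIV (%x. D x b)" for b
  using f by (auto simp: C2_def)
 note cF = C2_continuous(2)[OF f]
 have 1: "(LBINT x. (D x b \<bullet> b) * g x + (F x \<bullet> b) * (G x \<bullet> b)) = 0" for b
 proof (rule integral_directional_derivative_zero[where R = R and F = "%x. (F x \<bullet> b) * g x" and b = b])
  fix x
  have "((%r. F (x + r *\<^sub>R b)) has_vector_derivative D x b) (at 0)"
   using f by (intro has_derivative_imp_directional) (auto simp: C2_def)
  then have "((%r. F (x + r *\<^sub>R b) \<bullet> b) has_real_derivative D x b \<bullet> b) (at 0)"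
   unfolding has_real_derivative_iff_has_vector_derivative
   by (rule bounded_linear.has_vector_derivative[OF bounded_linear_inner_left])
  then show "((%r. (F (x + r *\<^sub>R b) \<bullet> b) * g (x + r *\<^sub>R b)) has_real_derivative
    (D x b \<bullet> b) * g x + (F x \<bullet> b) * (G x \<bullet> b)) (at 0)"
   using has_derivative_imp_directional[OF g, of x b]
   unfolding has_real_derivative_iff_has_vector_derivative[symmetric]
   by (auto intro!: derivative_eq_intros)
 qed (use supp in \<open>auto intro!: continuous_intros cg cF cD G\<close>)
 have "(LBINT x. lap (D x) * g x + F x \<bullet> G x)
   = (LBINT x. (\<Sum>b\<in>Basis. (D x b \<bullet> b) * g x + (F x \<bullet> b) * (G x \<bullet> b)))"
  by (rule Bochner_Integration.integral_cong)
   (simp_all add: lap_def sum.distrib sum_distrib_right flip: euclidean_inner)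
 also have "\<dots> = (\<Sum>b\<in>Basis. LBINT x. (D x b \<bullet> b) * g x + (F x \<bullet> b) * (G x \<bullet> b))"
  by (rule Bochner_Integration.integral_sum, rule integrable_compact_support[where R = R])
   (use supp in \<open>auto intro!: continuous_intros cg cF cD G\<close>)
 finally have "(LBINT x. lap (D x) * g x + F x \<bullet> G x) = 0"
  using 1 by simp
 moreover have "integrable lborel (%x. lap (D x) * g x)" "integrable lborel (%x. F x \<bullet> G x)"
  by (rule integrable_compact_support[where R = R];
    use supp in \<open>auto intro!: continuous_intros cg cF C2_lap_continuous[OF f] G\<close>)+
 ultimately show ?thesis
  by simp
qed

text \<open>Green's identity is applied on both sides. The second half is redone by hand because
  there the function without compact support plays the role of the test function, and the support
  comes from the differentiated factor.\<close>

lemma C2_lap_symmetric: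
 fixes f g :: "'a::euclidean_space => real"
 assumes f: "C2 f F D" and g: "C2 g G E"
  and supp: "\<And>x. norm x > R ==> g x = 0 \<and> G x = 0 \<and> E x = (%v. 0)"
 shows "(LBINT x. lap (D x) * g x) = (LBINT x. f x * lap (E x))"
proof -
 have "(LBINT x. lap (D x) * g x) = - (LBINT x. F x \<bullet> G x)"
  by (rule C2_green[OF f, where R = R]) (use g C2_continuous[OF g] supp in \<open>auto simp: C2_def\<close>)
 moreover have "(LBINT x. lap (E x) * f x + G x \<bullet> F x) = 0"
 proof -
  note c = C2_continuous[OF f] C2_continuous[OF g]
  have cE: "continuous_on UNIV (%x. E x b)" for b
   using g by (auto simp: C2_def)
  have 1: "(LBINT x. (E x b \<bullet> b) * f x + (G x \<bullet> b) * (F x \<bullet> b)) = 0" for b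
  proof (rule integral_directional_derivative_zero[where R = R and F = "%x. (G x \<bullet> b) * f x" and b = b])
   fix x
   have "((%r. G (x + r *\<^sub>R b)) has_vector_derivative E x b) (at 0)"
    using g by (intro has_derivative_imp_directional) (auto simp: C2_def)
   then have "((%r. G (x + r *\<^sub>R b) \<bullet> b) has_real_derivative E x b \<bullet> b) (at 0)"
    unfolding has_real_derivative_iff_has_vector_derivative
    by (rule bounded_linear.has_vector_derivative[OF bounded_linear_inner_left])
   moreover have "((%r. f (x + r *\<^sub>R b)) has_vector_derivative (F x \<bullet> b)) (at 0)"
    using f has_derivative_imp_directional[of f "%h. F x \<bullet> h" x b] by (auto simp: C2_def)
   ultimately show "((%r. (G (x + r *\<^sub>R b) \<bullet> b) * f (x + r *\<^sub>R b)) has_real_derivative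
     (E x b \<bullet> b) * f x + (G x \<bullet> b) * (F x \<bullet> b)) (at 0)"
    unfolding has_real_derivative_iff_has_vector_derivative[symmetric]
    by (auto intro!: derivative_eq_intros)
  qed (use supp in \<open>auto intro!: continuous_intros c cE\<close>)
  have "(LBINT x. lap (E x) * f x + G x \<bullet> F x)
    = (LBINT x. (\<Sum>b\<in>Basis. (E x b \<bullet> b) * f x + (G x \<bullet> b) * (F x \<bullet> b)))"
   by (rule Bochner_Integration.integral_cong)
    (simp_all add: lap_def sum.distrib sum_distrib_right flip: euclidean_inner)
  also have "\<dots> = (\<Sum>b\<in>Basis. LBINT x. (E x b \<bullet> b) * f x + (G x \<bullet> b) * (F x \<bullet> b))"
   by (rule Bochner_Integration.integral_sum, rule integrable_compact_support[where R = R])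
    (use supp in \<open>auto intro!: continuous_intros c cE\<close>)
  finally show ?thesis
   using 1 by simp
 qed
 moreover have "lap (E x) = 0" if "norm x > R" for x
  using supp[OF that] by (simp add: lap_def)
 then have "integrable lborel (%x. lap (E x) * f x)" "integrable lborel (%x. G x \<bullet> F x)"
  by (intro integrable_compact_support[where R = R];
    use supp in \<open>auto intro!: continuous_intros C2_continuous[OF f] C2_continuous[OF g]
     C2_lap_continuous[OF g]\<close>)+
 ultimately show ?thesis
  by (simp add: mult.commute inner_commute)
qed

lemma increment_le_of_derivative_le:
 fixes f :: "real => real"
 assumes "s \<le> t" and der: "\<And>r. r \<in> {s..t} ==> (f has_real_derivative f' r) (at r within {s..t})"
  and le: "\<And>r. r \<in> {s..t} ==> f' r \<le> c"
 shows "f t - f s \<le> c * (t - s)"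
proof -
 obtain r where "r \<in> {s..t}" "f t - f s = f' r * (t - s)"
  using mvt_very_simple[of s t f "%r. (*) (f' r)"] der assms(1)
  by (auto simp: has_field_derivative_def)
 then show ?thesis
  using le[of r] assms(1) by (simp add: mult_right_mono)
qed

lemma increment_le_integral_of_derivative_le:
 fixes f e :: "real => real"
 assumes "s \<le> t" and der: "\<And>r. r \<in> {s..t} ==> (f has_real_derivative f' r) (at r within {s..t})"
  and le: "\<And>r. r \<in> {s..t} ==> f' r \<le> e r" and e: "continuous_on {s..t} e"
 shows "f t - f s \<le> integral {s..t} e"
proof -
 have "(f t - integral {s..t} e) - (f s - integral {s..s} e) \<le> 0 * (t - s)"
 proof (rule increment_le_of_derivative_le[OF assms(1)])
  fix r assume r: "r \<in> {s..t}"
  show "((%r. f r - integral {s..r} e) has_real_derivative (f' r - e r)) (at r within {s..t})"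
   by (intro derivative_intros der r integral_has_real_derivative[OF e])
  show "f' r - e r \<le> 0" using le[OF r] by simp
 qed
 then show ?thesis by simp
qed

section \<open>Space-time regularity and subsolutions\<close>

definition C21 :: "real => real => ('a::euclidean_space => real => real) => ('a => real => 'a)
  => ('a => real => 'a => 'a) => ('a => real => real) => bool" where
 "C21 a b f G D ft \<longleftrightarrow>
  (\<forall>t\<in>{a<..<b}. C2 (%x. f x t) (%x. G x t) (%x. D x t)) \<and>
  (\<forall>x. \<forall>t\<in>{a<..<b}. ((%s. f x s) has_real_derivative ft x t) (at t)) \<and>
  continuous_on (UNIV \<times> {a<..<b}) (%(x, t). f x t) \<and>
  continuous_on (UNIV \<times> {a<..<b}) (%(x, t). G x t) \<and>
  (\<forall>v. continuous_on (UNIV \<times> {a<..<b}) (%(x, t). D x t v)) \<and>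
  continuous_on (UNIV \<times> {a<..<b}) (%(x, t). ft x t)"

text \<open>The sign makes the residual nonnegative for subsolutions. For a mollified weak solution
  it will be the gap in Jensen's inequality.\<close>

definition resid :: "real => ('a::euclidean_space => real => 'a) => ('a => real => 'a => 'a)
  => ('a => real => real) => 'a => real => real" where
 "resid q G D ft x t = lap (D x t) - norm (G x t) powr q - ft x t"

definition subsol :: "real => real => real => ('a::euclidean_space => real => real) => ('a => real => 'a)
  => ('a => real => 'a => 'a) => ('a => real => real) => bool" where
 "subsol q a b f G D ft \<longleftrightarrow> C21 a b f G D ft \<and>
  (\<forall>x. \<forall>t\<in>{a<..<b}. f x t \<ge> 0 \<and> resid q G D ft x t \<ge> 0)"

lemma subsolD:
 assumes "subsol q a b f G D ft" "t \<in> {a<..<b}"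
 shows "C2 (%x. f x t) (%x. G x t) (%x. D x t)" "(f x has_real_derivative ft x t) (at t)"
  "f x t \<ge> 0" "resid q G D ft x t \<ge> 0"
 using assms by (auto simp: subsol_def C21_def)

lemma C21_continuous:
 assumes "C21 a b f G D ft" "A \<subseteq> {a<..<b}"
 shows "continuous_on (UNIV \<times> A) (%(x, t). f x t)"
  "continuous_on (UNIV \<times> A) (%(x, t). G x t)"
  "continuous_on (UNIV \<times> A) (%(x, t). D x t v)"
  "continuous_on (UNIV \<times> A) (%(x, t). ft x t)"
  "continuous_on (UNIV \<times> A) (%(x, t). lap (D x t))"
proof -
 have sub: "UNIV \<times> A \<subseteq> UNIV \<times> {a<..<b}" using assms(2) by auto
 show "continuous_on (UNIV \<times> A) (%(x, t). f x t)"
  "continuous_on (UNIV \<times> A) (%(x, t). G x t)"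
  "continuous_on (UNIV \<times> A) (%(x, t). ft x t)"
  using assms(1) continuous_on_subset[OF _ sub] by (auto simp: C21_def)
 have D: "continuous_on (UNIV \<times> A) (%(x, t). D x t v)" for v
  by (rule continuous_on_subset[OF _ sub]) (use assms(1) in \<open>auto simp: C21_def\<close>)
 then show "continuous_on (UNIV \<times> A) (%(x, t). D x t v)" .
 show "continuous_on (UNIV \<times> A) (%(x, t). lap (D x t))"
  using D unfolding lap_def split_beta by (intro continuous_intros) auto
qed

lemma resid_continuous:
 assumes "C21 a b f G D ft" "A \<subseteq> {a<..<b}" "q > 0"
 shows "continuous_on (UNIV \<times> A) (%(x, t). resid q G D ft x t)"
 using C21_continuous[OF assms(1,2)] assms(3) unfolding resid_def split_beta
 by (intro continuous_intros continuous_on_powr') auto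

section \<open>Polynomial cutoffs\<close>

lemma pos_power_derivative:
 "((%x::real. max 0 x ^ (n + 2)) has_real_derivative real (n + 2) * max 0 x ^ (n + 1)) (at x)"
proof -
 consider "x > 0" | "x < 0" | "x = 0" by linarith
 then show ?thesis
 proof cases
  case 1
  have "((%x. x ^ (n + 2)) has_real_derivative real (n + 2) * x ^ (n + 1)) (at x)"
   using DERIV_pow[of "n + 2" x] by simp
  then have "((%x. max 0 x ^ (n + 2)) has_real_derivative real (n + 2) * x ^ (n + 1)) (at x)"
   by (rule has_field_derivative_transform_within_open[of _ _ _ "{0<..}"]) (use 1 in auto)
  with 1 show ?thesis by simp
 next
  case 2
  have "((%x. 0) has_real_derivative 0) (at x)" by simp
  then have "((%x. max 0 x ^ (n + 2)) has_real_derivative 0) (at x)"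
   by (rule has_field_derivative_transform_within_open[of _ _ _ "{..<0}"]) (use 2 in auto)
  with 2 show ?thesis by simp
 next
  case 3
  have "((%h::real. max 0 h ^ (n + 2) / h) \<longlongrightarrow> 0) (at 0)"
  proof (rule Lim_null_comparison)
   show "\<forall>\<^sub>F h in at 0. norm (max 0 h ^ (n + 2) / h) \<le> \<bar>h\<bar> ^ (n + 1)"
    by (intro always_eventually) (auto simp: max_def power_abs field_simps power_add intro!: mult_nonpos_nonneg)
   show "((%h. \<bar>h\<bar> ^ (n + 1)) \<longlongrightarrow> 0) (at (0::real))"
    by (auto intro!: tendsto_eq_intros)
  qed
  with 3 show ?thesis
   by (simp add: DERIV_def)
 qed
qed

text \<open>The power \<open>m\<close> makes the gradient of the cutoff small compared with the cutoff itself.\<close>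

definition cutb :: "real => real => real" where
 "cutb c r = 1 - max 0 (c * r - 1/4) ^ 3"

text \<open>The profile is 1 for \<open>c * r \<le> 1/4\<close> and 0 for
  \<open>c * r \<ge> 5/4\<close>, where the inner cube reaches 1. Cubes of positive parts are C2:
  the inner cube joins smoothly at the first threshold, the outer power, at least 3, at the
  second.\<close>

definition cut :: "nat => real => real => real" where
 "cut m c r = max 0 (cutb c r) ^ (m + 3)"

definition cut1 :: "nat => real => real => real" where
 "cut1 m c r = real (m + 3) * max 0 (cutb c r) ^ (m + 2) * (- 3 * c * max 0 (c * r - 1/4) ^ 2)"

definition cut2 :: "nat => real => real => real" where
 "cut2 m c r = real (m + 3) * (real (m + 2) * max 0 (cutb c r) ^ (m + 1)) * (- 3 * c * max 0 (c * r - 1/4) ^ 2) ^ 2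
  + real (m + 3) * max 0 (cutb c r) ^ (m + 2) * (- 6 * c ^ 2 * max 0 (c * r - 1/4))"

lemma cutb_derivative: "(cutb c has_real_derivative - 3 * c * max 0 (c * r - 1/4) ^ 2) (at r)"
proof -
 have g: "((%r. c * r - 1/4) has_real_derivative c) (at r)"
  by (auto intro!: derivative_eq_intros)
 have "((%r. max 0 (c * r - 1/4) ^ 3) has_real_derivative (3 * max 0 (c * r - 1/4) ^ 2) * c) (at r)"
  using DERIV_chain'[OF g pos_power_derivative[of 1]] by (simp add: numeral_eq_Suc mult_ac)
 from DERIV_diff[OF DERIV_const[of 1] this] show ?thesis
  unfolding cutb_def[abs_def] by (simp add: mult_ac)
qed

lemma cut_derivative: "(cut m c has_real_derivative cut1 m c r) (at r)"
 unfolding cut_def[abs_def] cut1_def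
 using DERIV_chain'[OF cutb_derivative pos_power_derivative[of "m + 1"], of c r]
 by (simp add: numeral_eq_Suc mult_ac)

lemma cut1_derivative: "(cut1 m c has_real_derivative cut2 m c r) (at r)"
proof -
 have g: "((%r. c * r - 1/4) has_real_derivative c) (at r)"
  by (auto intro!: derivative_eq_intros)
 have 1: "((%r. max 0 (c * r - 1/4) ^ 2) has_real_derivative (2 * max 0 (c * r - 1/4)) * c) (at r)"
  using DERIV_chain'[OF g pos_power_derivative[of 0]] by (simp add: numeral_eq_Suc mult_ac)
 have 2: "((%r. max 0 (cutb c r) ^ (m + 2)) has_real_derivative
   (real (m + 2) * max 0 (cutb c r) ^ (m + 1)) * (- 3 * c * max 0 (c * r - 1/4) ^ 2)) (at r)"
  using DERIV_chain'[OF cutb_derivative pos_power_derivative[of m], of c r]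
  by (simp add: numeral_eq_Suc mult_ac)
 show ?thesis
  unfolding cut1_def[abs_def] cut2_def
  apply (rule DERIV_cong)
  apply (rule DERIV_mult)
   apply (rule DERIV_cmult)
   apply (rule 2)
  apply (rule DERIV_cmult)
  apply (rule 1)
  apply (simp add: algebra_simps power2_eq_square)
  done
qed

lemma cut2_continuous: "continuous_on UNIV (cut2 m c)"
 unfolding cut2_def[abs_def] cutb_def[abs_def] by (intro continuous_intros)

lemma cut_bounds: "0 \<le> cut m c r" "cut m c r \<le> 1"
 by (auto simp: cut_def cutb_def intro!: power_le_one)

lemma cut_eq_1: "c * r \<le> 1/4 ==> cut m c r = 1 \<and> cut1 m c r = 0 \<and> cut2 m c r = 0"
 by (simp add: cut_def cut1_def cut2_def cutb_def)

lemma cut_eq_0: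
 assumes "c * r \<ge> 5/4"
 shows "cut m c r = 0" "cut1 m c r = 0" "cut2 m c r = 0"
proof -
 have "1 \<le> (c * r - 1/4) ^ 3" using assms by (intro one_le_power) simp
 then show "cut m c r = 0" "cut1 m c r = 0" "cut2 m c r = 0"
  using assms by (simp_all add: cut_def cut1_def cut2_def cutb_def max_absorb2)
qed

lemma cut_pos: "c * r < 5/4 ==> cut m c r > 0"
proof -
 assume "c * r < 5/4"
 then have "max 0 (c * r - 1/4) ^ 3 < 1 ^ 3"
  by (intro power_strict_mono) auto
 then show "cut m c r > 0" by (simp add: cut_def cutb_def)
qed

text \<open>In terms of the norm, the bump is 1 up to radius \<open>1 / (2 * sqrt c)\<close> and
  vanishes from radius \<open>sqrt (5 / (4 * c))\<close> on.\<close>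

definition bump :: "nat => real => 'a::euclidean_space => real" where
 "bump m c x = cut m c (x \<bullet> x)"
definition bumpG :: "nat => real => 'a::euclidean_space => 'a" where
 "bumpG m c x = (2 * cut1 m c (x \<bullet> x)) *\<^sub>R x"
definition bumpD :: "nat => real => 'a::euclidean_space => 'a => 'a" where
 "bumpD m c x v = (4 * cut2 m c (x \<bullet> x) * (x \<bullet> v)) *\<^sub>R x + (2 * cut1 m c (x \<bullet> x)) *\<^sub>R v"

lemma C2_bump: "C2 (bump m c) (bumpG m c) (bumpD m c)"
 unfolding bump_def[abs_def] bumpG_def[abs_def] bumpD_def[abs_def]
 by (rule C2_radial[OF cut_derivative cut1_derivative continuous_on_subset[OF cut2_continuous]]) auto

lemma bump_bounds: "0 \<le> bump m c x" "bump m c x \<le> 1"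
 by (auto simp: bump_def cut_bounds)

lemma bump_eq_0:
 assumes "c > 0" "norm x \<ge> sqrt (5 / (4 * c))"
 shows "bump m c x = 0 \<and> bumpG m c x = 0 \<and> bumpD m c x = (%v. 0)"
proof -
 have "norm x ^ 2 \<ge> sqrt (5 / (4 * c)) ^ 2" using assms by (intro power_mono) auto
 then have "c * (x \<bullet> x) \<ge> 5/4"
  using assms(1) by (simp add: power2_norm_eq_inner field_simps)
 then show ?thesis
  by (simp add: bump_def bumpG_def bumpD_def[abs_def] cut_eq_0)
qed

lemma bump_eq_1:
 assumes "c * (x \<bullet> x) \<le> 1/4"
 shows "bump m c x = 1"
 using cut_eq_1[OF assms] by (simp add: bump_def)

text \<open>The gradient keeps the power \<open>m + 2\<close> of a base that is at most 1, while
  \<open>bump powr (1 / q)\<close> has the power \<open>(m + 3) / q\<close>. The condition on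
  \<open>m\<close> says exactly that the first exponent is not smaller than the second.\<close>

lemma bump_gradient_le:
 fixes x :: "'a::euclidean_space"
 assumes q: "q > 1" and m: "q / (q - 1) \<le> real (m + 3)" and c: "c > 0"
 shows "norm (bumpG m c x) \<le> (6 * c * real (m + 3) * sqrt (5 / (4 * c))) * bump m c x powr (1 / q)"
proof (cases "norm x \<ge> sqrt (5 / (4 * c))")
 case True
 then show ?thesis using bump_eq_0[OF c True] by simp
next
 case False
 let ?B = "max 0 (cutb c (x \<bullet> x))"
 have "norm x ^ 2 < sqrt (5 / (4 * c)) ^ 2" using False c by (intro power_strict_mono) auto
 then have lt: "c * (x \<bullet> x) < 5/4"
  using c by (simp add: power2_norm_eq_inner field_simps)
 then have B: "?B > 0" "?B \<le> 1"
  using cut_pos[OF lt, of 0] by (auto simp: cut_def cutb_def max_def split: if_splits)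
 have "real (m + 3) * (q - 1) \<ge> q" using m q by (simp add: field_simps)
 then have "real (m + 2) \<ge> real (m + 3) / q" using q by (simp add: field_simps)
 then have "?B powr real (m + 2) \<le> ?B powr (real (m + 3) / q)"
  using B by (intro powr_mono') auto
 also have "\<dots> = (?B powr real (m + 3)) powr (1 / q)" by (simp add: powr_powr)
 finally have *: "?B ^ (m + 2) \<le> bump m c x powr (1 / q)"
  unfolding powr_realpow[OF B(1)] by (simp only: bump_def cut_def)
 have p: "max 0 (c * (x \<bullet> x) - 1/4) ^ 2 \<le> 1" using lt by (intro power_le_one) auto
 have "norm (bumpG m c x) = 2 * (real (m + 3) * ?B ^ (m + 2) * (3 * c * max 0 (c * (x \<bullet> x) - 1/4) ^ 2)) * norm x"
  using c by (simp add: bumpG_def cut1_def abs_mult)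
 also have "\<dots> \<le> 2 * (real (m + 3) * ?B ^ (m + 2) * (3 * c * 1)) * sqrt (5 / (4 * c))"
  using False p c by (intro mult_mono mult_nonneg_nonneg) auto
 also have "\<dots> = (6 * c * real (m + 3) * sqrt (5 / (4 * c))) * ?B ^ (m + 2)" by simp
 also have "\<dots> \<le> (6 * c * real (m + 3) * sqrt (5 / (4 * c))) * bump m c x powr (1 / q)"
  using * c by (intro mult_left_mono) auto
 finally show ?thesis .
qed

section \<open>Transport of mass paid for by the absorption\<close>

text \<open>Young's inequality with constant 1, which is not sharp: either
  \<open>k \<le> m powr (q - 1)\<close> and the left side is not positive, or
  \<open>m \<le> k powr (1 / (q - 1))\<close> and the product alone is small enough.\<close>

lemma young_powr:
 fixes m k q :: real
 assumes q: "q > 1" and "m \<ge> 0" "k \<ge> 0"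
 shows "m * k - m powr q \<le> k powr (q / (q - 1))"
proof (cases "k \<le> m powr (q - 1)")
 case True
 have "m * k \<le> m * m powr (q - 1)" using True assms by (intro mult_left_mono) auto
 also have "\<dots> = m powr q"
  using assms by (cases "m = 0") (auto simp: powr_diff)
 finally show ?thesis by (simp add: add_increasing2 algebra_simps)
next
 case False
 then have k: "k > 0" by (meson linorder_not_le order_less_le_trans powr_ge_zero)
 have "m = (m powr (q - 1)) powr (1 / (q - 1))" using assms by (simp add: powr_powr)
 also have "\<dots> \<le> k powr (1 / (q - 1))" using False q by (intro powr_mono2) auto
 finally have "m * k \<le> k powr (1 / (q - 1)) * k powr 1" using k by (intro mult_mono) auto
 also have "\<dots> = k powr (1 / (q - 1) + 1)"
  by (rule powr_add[symmetric])
 also have "1 / (q - 1) + 1 = q / (q - 1)"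
  using q by (simp add: field_simps)
 finally show ?thesis by (smt (verit) powr_ge_zero)
qed

lemma measure_cball_translate: "measure lborel (cball (c::'a::euclidean_space) r) = measure lborel (cball (0::'a) r)"
proof (cases "r \<ge> 0")
 case True
 then show ?thesis by (simp add: content_cball)
qed simp

lemma integral_le_const_on_cball:
 fixes F :: "'a::euclidean_space => real"
 assumes F: "integrable lborel F" and le: "\<And>x. F x \<le> (if dist c x \<le> R then K else 0)"
 shows "(LBINT x. F x) \<le> K * measure lborel (cball (0::'a) R)"
proof -
 have "(LBINT x. F x) \<le> (LBINT x. K * indicator (cball c R) x)"
 proof (rule integral_mono[OF F])
  show "integrable lborel (%x. K * indicator (cball c R) x)"
   by (intro integrable_mult_right integrable_real_indicator)
    (use emeasure_bounded_finite[OF bounded_cball] in \<open>auto simp: top.not_eq_extremum\<close>)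
  show "F x \<le> K * indicator (cball c R) x" for x
   using le[of x] by (auto simp: indicator_def split: if_splits)
 qed
 also have "\<dots> = K * measure lborel (cball c R)" by simp
 finally show ?thesis by (simp only: measure_cball_translate[of c])
qed

text \<open>The average of a subsolution against a bump that moves from \<open>x0\<close> to \<open>x1\<close>: the
 absorption \<open>norm G powr q\<close> pays for the transport and for the diffusion.\<close>

lemma subsol_moving_average:
 fixes f :: "'a::euclidean_space => real => real"
 assumes sub: "subsol q a b f G D ft" and q: "q > 1"
  and m: "q / (q - 1) \<le> real (m + 3)" and c: "c > 0"
  and st: "a < s" "s < t" "t < b"
 defines "R \<equiv> sqrt (5 / (4 * c))"
 shows "(LBINT x. f x t * bump m c (x - x1)) \<le> (LBINT x. f x s * bump m c (x - x0))
  + (6 * c * real (m + 3) * R + norm (x1 - x0) / (t - s)) powr (q / (q - 1))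
    * measure lborel (cball (0::'a) R) * (t - s)"
proof -
 let ?\<chi> = "bump m c :: 'a => real" and ?X = "bumpG m c :: 'a => 'a"
 \<comment> \<open>The centre of the bump runs along a straight line, from \<open>x0\<close> at time
   \<open>s\<close> to \<open>x1\<close> at time \<open>t\<close>.\<close>
 define v where "v = (1 / (t - s)) *\<^sub>R (x1 - x0)"
 define p where "p r = x0 + (r - s) *\<^sub>R v" for r
 define C where "C = 6 * c * real (m + 3) * R"
 define I where "I r = (LBINT x. f x r * ?\<chi> (x - p r))" for r
 define I' where "I' r = (LBINT x. ft x r * ?\<chi> (x - p r) - f x r * (?X (x - p r) \<bullet> v))" for r
 define R' where "R' = R + norm x0 + (t - s) * norm v"
 have C21: "C21 a b f G D ft" using sub by (simp add: subsol_def)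
 have C0: "C \<ge> 0" using c by (simp add: C_def R_def)
 have sub_st: "{s..t} \<subseteq> {a<..<b}" using st by auto
 note cf = C21_continuous[OF C21 sub_st]
 have chi: "(?\<chi> has_derivative (%h. ?X x \<bullet> h)) (at x)" for x
  using C2_bump[of m c] by (auto simp: C2_def)
 note cb = C2_continuous[OF C2_bump[of m c]]
 have far: "?\<chi> (x - p r) = 0 \<and> ?X (x - p r) = 0" if "r \<in> {s..t}" "norm x > R'" for x r
 proof -
  have "norm (p r) \<le> norm x0 + (t - s) * norm v"
   unfolding p_def using that(1)
   by (intro norm_triangle_le add_mono) (auto intro!: mult_right_mono)
  then have "norm (x - p r) \<ge> R"
   using that(2) norm_triangle_ineq2[of x "p r"] unfolding R'_def by linarith
  then show ?thesis using bump_eq_0[OF c, of "x - p r" m] by (simp add: R_def)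
 qed
 have der: "(I has_real_derivative I' r) (at r within {s..t})" if r: "r \<in> {s..t}" for r
  unfolding I_def I'_def
 proof (rule leibniz_compact_support[where R = R'])
  fix x r assume r: "r \<in> {s..t}"
  show "norm x > R' ==> f x r * ?\<chi> (x - p r) = 0" using far[OF r] by simp
  have 1: "((%r. x - p r) has_derivative (%h. - h *\<^sub>R v)) (at r)"
   unfolding p_def by (auto intro!: derivative_eq_intros)
  have "((%r. ?\<chi> (x - p r)) has_real_derivative - (?X (x - p r) \<bullet> v)) (at r)"
   unfolding has_field_derivative_def
   by (rule has_derivative_eq_rhs[OF has_derivative_compose[OF 1 chi]]) (simp add: mult_ac fun_eq_iff)
  moreover have "(f x has_real_derivative ft x r) (at r)"
   by (rule subsolD[OF sub]) (use r sub_st in auto)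
  ultimately have "((%r. f x r * ?\<chi> (x - p r)) has_real_derivative
   ft x r * ?\<chi> (x - p r) - f x r * (?X (x - p r) \<bullet> v)) (at r)"
   by (auto intro!: derivative_eq_intros)
  then show "((%r. f x r * ?\<chi> (x - p r)) has_real_derivative
   ft x r * ?\<chi> (x - p r) - f x r * (?X (x - p r) \<bullet> v)) (at r within {s..t})"
   by (rule has_field_derivative_at_within)
 next
  fix r assume "r \<in> {s..t}"
  show "continuous_on UNIV (%x. f x r * ?\<chi> (x - p r))"
   using continuous_on_slice[OF cf(1) \<open>r \<in> {s..t}\<close>]
   by (intro continuous_intros continuous_on_compose2[OF cb(1)]) auto
 next
  show "continuous_on (UNIV \<times> {s..t})
   (%(x, r). ft x r * ?\<chi> (x - p r) - f x r * (?X (x - p r) \<bullet> v))"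
   using cf(1,4) unfolding split_beta p_def
   by (intro continuous_intros continuous_on_compose2[OF cb(1)] continuous_on_compose2[OF cb(2)]) auto
 qed (use st r in auto)
 have le: "I' r \<le> (C + norm v) powr (q / (q - 1)) * measure lborel (cball (0::'a) R)" if r: "r \<in> {s..t}" for r
 proof -
  have r': "r \<in> {a<..<b}" using r sub_st by auto
  note C2f = subsolD(1)[OF sub r']
  note cfr = C2_continuous[OF C2f] C2_lap_continuous[OF C2f] continuous_on_slice[OF cf(4) r]
  have C2chi: "C2 (%x. ?\<chi> (x - p r)) (%x. ?X (x - p r)) (%x. bumpD m c (x - p r))"
   by (rule C2_translate[OF C2_bump])
  note cchi = C2_continuous[OF C2chi]
  have dchi: "((%x. ?\<chi> (x - p r)) has_derivative (%h. ?X (x - p r) \<bullet> h)) (at x)" for x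
   using C2chi by (auto simp: C2_def)
  have df: "((%x. f x r) has_derivative (%h. G x r \<bullet> h)) (at x)" for x
   using C2f by (auto simp: C2_def)
  have powr_cont: "continuous_on UNIV (%x. norm (G x r) powr q)"
   using q by (intro continuous_intros continuous_on_powr' cfr) auto
  have int: "integrable lborel (%x. g x * ?\<chi> (x - p r))" if "continuous_on UNIV g" for g :: "'a => real"
   by (rule integrable_compact_support[where R = R'])
    (use far[OF r] in \<open>auto intro!: continuous_intros that cchi\<close>)
  have int2: "integrable lborel (%x. g x * (?X (x - p r) \<bullet> v))" if "continuous_on UNIV g" for g :: "'a => real"
   by (rule integrable_compact_support[where R = R'])
    (use far[OF r] in \<open>auto intro!: continuous_intros that cchi\<close>)
  have int3: "integrable lborel (%x. G x r \<bullet> ?X (x - p r))"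
   by (rule integrable_compact_support[where R = R'])
    (use far[OF r] in \<open>auto intro!: continuous_intros cchi cfr\<close>)
  note ints = int[OF cfr(4)] int[OF cfr(3)] int[OF powr_cont] int2[OF cfr(1)]
  have green: "(LBINT x. lap (D x r) * ?\<chi> (x - p r)) = - (LBINT x. G x r \<bullet> ?X (x - p r))"
   by (rule C2_green[OF C2f dchi cchi(2), where R = R']) (use far[OF r] in auto)
  \<comment> \<open>Integrating the transport term by parts turns it into a multiple of the gradient
    of \<open>f\<close>, the only quantity that the absorption can dominate.\<close>
  have parts: "(LBINT x. (G x r \<bullet> v) * ?\<chi> (x - p r)) = - (LBINT x. f x r * (?X (x - p r) \<bullet> v))"
   by (rule integration_by_parts_direction[OF df cfr(2) dchi cchi(2), where R = R']) (use far[OF r] in auto)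
  have int4: "integrable lborel (%x. (G x r \<bullet> v) * ?\<chi> (x - p r))"
   by (rule int) (intro continuous_intros cfr)
  have "I' r \<le> (LBINT x. lap (D x r) * ?\<chi> (x - p r) - norm (G x r) powr q * ?\<chi> (x - p r)
    - f x r * (?X (x - p r) \<bullet> v))"
   unfolding I'_def
  proof (intro integral_mono Bochner_Integration.integrable_diff ints)
   fix x
   have "ft x r \<le> lap (D x r) - norm (G x r) powr q"
    using subsolD(4)[OF sub r', of x] by (simp add: resid_def)
   then have "ft x r * ?\<chi> (x - p r) \<le> (lap (D x r) - norm (G x r) powr q) * ?\<chi> (x - p r)"
    by (intro mult_right_mono bump_bounds)
   then show "ft x r * ?\<chi> (x - p r) - f x r * (?X (x - p r) \<bullet> v)
    \<le> lap (D x r) * ?\<chi> (x - p r) - norm (G x r) powr q * ?\<chi> (x - p r) - f x r * (?X (x - p r) \<bullet> v)"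
    by (simp add: algebra_simps)
  qed
  also have "\<dots> = (LBINT x. - (G x r \<bullet> ?X (x - p r)) - norm (G x r) powr q * ?\<chi> (x - p r)
    + (G x r \<bullet> v) * ?\<chi> (x - p r))"
   using ints int3 int4 green parts by simp
  also have "\<dots> \<le> (C + norm v) powr (q / (q - 1)) * measure lborel (cball (0::'a) R)"
  proof (rule integral_le_const_on_cball[where c = "p r"])
   show "integrable lborel (%x. - (G x r \<bullet> ?X (x - p r)) - norm (G x r) powr q * ?\<chi> (x - p r)
    + (G x r \<bullet> v) * ?\<chi> (x - p r))"
    using ints int3 int4 by (intro Bochner_Integration.integrable_add Bochner_Integration.integrable_diff integrable_minus)
   fix x
   show "- (G x r \<bullet> ?X (x - p r)) - norm (G x r) powr q * ?\<chi> (x - p r) + (G x r \<bullet> v) * ?\<chi> (x - p r)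
    \<le> (if dist (p r) x \<le> R then (C + norm v) powr (q / (q - 1)) else 0)"
   proof (cases "dist (p r) x \<le> R")
    case False
    then show ?thesis using bump_eq_0[OF c, of "x - p r" m]
     by (simp add: R_def dist_norm norm_minus_commute)
   next
    case True
    define X where "X = ?\<chi> (x - p r)"
    define n where "n = norm (G x r)"
    have X: "0 \<le> X" "X \<le> 1" "n \<ge> 0" by (auto simp: X_def n_def bump_bounds)
    \<comment> \<open>Because \<open>X\<close> lies between 0 and 1, the transport factor may be
      weakened to \<open>X powr (1 / q)\<close>. Transport and diffusion are then both linear in
      \<open>n * X powr (1 / q)\<close>, whose power \<open>q\<close> is the absorption weighted by
      the bump.\<close>
    have X1: "X \<le> X powr (1 / q)"
     using X q powr_mono'[of "1/q" 1 X] by (cases "X = 0") auto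
    have "- (G x r \<bullet> ?X (x - p r)) \<le> n * norm (?X (x - p r))"
     unfolding n_def using Cauchy_Schwarz_ineq2[of "G x r" "?X (x - p r)"] by linarith
    also have "\<dots> \<le> n * (C * X powr (1 / q))"
     unfolding X_def C_def R_def by (intro mult_left_mono bump_gradient_le q m c) (simp add: n_def)
    finally have 1: "- (G x r \<bullet> ?X (x - p r)) \<le> n * (C * X powr (1 / q))" .
    have "(G x r \<bullet> v) * X \<le> (n * norm v) * X"
     unfolding n_def by (intro mult_right_mono norm_cauchy_schwarz X)
    also have "\<dots> \<le> (n * norm v) * X powr (1 / q)"
     using X by (intro mult_left_mono X1) auto
    finally have 2: "(G x r \<bullet> v) * X \<le> (n * norm v) * X powr (1 / q)" .
    have 3: "n powr q * X = (n * X powr (1 / q)) powr q"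
     using X q by (simp add: powr_mult powr_powr)
    have "- (G x r \<bullet> ?X (x - p r)) - n powr q * X + (G x r \<bullet> v) * X
     \<le> (n * X powr (1 / q)) * (C + norm v) - (n * X powr (1 / q)) powr q"
     using 1 2 3 by (simp add: algebra_simps)
    also have "\<dots> \<le> (C + norm v) powr (q / (q - 1))"
     by (rule young_powr) (use q X C0 in auto)
    finally show ?thesis using True by (simp add: X_def n_def)
   qed
  qed
  finally show ?thesis .
 qed
 have "I t - I s \<le> ((C + norm v) powr (q / (q - 1)) * measure lborel (cball (0::'a) R)) * (t - s)"
  by (rule increment_le_of_derivative_le[OF _ der le]) (use st in auto)
 moreover have "p s = x0" "p t = x1" "norm v = norm (x1 - x0) / (t - s)"
  using st by (auto simp: p_def v_def)
 ultimately show ?thesis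
  by (simp add: I_def C_def)
qed

section \<open>Backward heat kernel and local boundedness\<close>

text \<open>The heat kernel at time \<open>\<sigma>\<close> and squared distance \<open>r\<close>,
  without the constant power of \<open>4 * pi\<close>. The power of \<open>sqrt \<sigma>\<close>
  covers odd dimensions.\<close>

definition gk :: "nat => real => real => real" where
 "gk N \<sigma> r = exp (- r / (4 * \<sigma>)) / sqrt \<sigma> ^ N"

lemma gk_derivative_space:
 "(gk N \<sigma> has_real_derivative - gk N \<sigma> r / (4 * \<sigma>)) (at r)"
proof -
 have "((%r. - r / (4 * \<sigma>)) has_real_derivative - 1 / (4 * \<sigma>)) (at r)"
  by (rule DERIV_cdivide) (auto intro!: derivative_eq_intros)
 from DERIV_cdivide[OF DERIV_chain'[OF this DERIV_exp], of "sqrt \<sigma> ^ N"] show ?thesis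
  unfolding gk_def[abs_def] by (simp add: mult_ac)
qed

lemma gk_derivative_time:
 assumes "\<sigma> > 0"
 shows "((%\<sigma>. gk N \<sigma> r) has_real_derivative gk N \<sigma> r * (r / (4 * \<sigma> ^ 2) - N / (2 * \<sigma>))) (at \<sigma>)"
proof -
 have s: "sqrt \<sigma> > 0" using assms by simp
 have "((%\<sigma>. sqrt \<sigma> ^ N) has_real_derivative (N * sqrt \<sigma> ^ (N - 1)) * (inverse (sqrt \<sigma>) / 2)) (at \<sigma>)"
  using DERIV_power[OF DERIV_real_sqrt[OF assms], of N] by (simp add: mult_ac)
 moreover have "(N * sqrt \<sigma> ^ (N - 1)) * (inverse (sqrt \<sigma>) / 2) = N * sqrt \<sigma> ^ N / (2 * \<sigma>)"
 proof -
  have "w * (inverse w / 2) = w ^ 2 / (2 * w ^ 2) \<and> (N * w ^ (N - 1)) * (inverse w / 2) = N * w ^ N / (2 * w ^ 2)"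
   if "w > 0" for w :: real
   using that by (cases N) (auto simp: field_simps power2_eq_square)
  from this[OF s] show ?thesis using assms by simp
 qed
 ultimately have 1: "((%\<sigma>. sqrt \<sigma> ^ N) has_real_derivative N * sqrt \<sigma> ^ N / (2 * \<sigma>)) (at \<sigma>)"
  by (rule DERIV_cong)
 have 2: "((%\<sigma>. exp (- r / (4 * \<sigma>))) has_real_derivative exp (- r / (4 * \<sigma>)) * (r / (4 * \<sigma> ^ 2))) (at \<sigma>)"
  using assms by (auto intro!: derivative_eq_intros simp: power2_eq_square)
 show ?thesis
  unfolding gk_def
 proof (rule DERIV_cong[OF DERIV_divide[OF 2 1]])
  have "(e * X * w - e * (N * w / Y)) / (w * w) = e / w * (X - N / Y)" if "w \<noteq> 0" for e X w Y :: real
   using that by (simp add: diff_divide_distrib right_diff_distrib)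
  note eq = this
  show "(exp (- r / (4 * \<sigma>)) * (r / (4 * \<sigma>\<^sup>2)) * sqrt \<sigma> ^ N - exp (- r / (4 * \<sigma>)) * (N * sqrt \<sigma> ^ N / (2 * \<sigma>)))
    / (sqrt \<sigma> ^ N * sqrt \<sigma> ^ N)
   = exp (- r / (4 * \<sigma>)) / sqrt \<sigma> ^ N * (r / (4 * \<sigma>\<^sup>2) - N / (2 * \<sigma>))"
   by (rule eq) (use s in simp)
 qed (use s in simp)
qed

lemma gk_nonneg: "0 \<le> \<sigma> ==> 0 \<le> gk N \<sigma> r"
 by (simp add: gk_def)

lemma gk_le:
 assumes "0 < \<theta>" "\<theta> \<le> \<sigma>" "0 \<le> r"
 shows "gk N \<sigma> r \<le> 1 / sqrt \<theta> ^ N"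
proof -
 have "exp (- r / (4 * \<sigma>)) \<le> 1" using assms by simp
 moreover have "sqrt \<theta> ^ N \<le> sqrt \<sigma> ^ N" using assms by (intro power_mono) auto
 ultimately show ?thesis
  unfolding gk_def using assms by (intro frac_le) auto
qed

text \<open>At squared distance at least 1/4 the exponential beats every power of
  \<open>1 / \<sigma>\<close>. With \<open>z = 1 + 1 / \<sigma>\<close> the left side is at most a
  constant times \<open>z ^ (N + 1) * exp (- z / 16)\<close>, and one term of the exponential series
  bounds this.\<close>

lemma gk_away:
 assumes "0 < \<sigma>" "1/4 \<le> r"
 shows "gk N \<sigma> r * (1 + 1 / \<sigma>) \<le> fact (N + 1) * 16 ^ (N + 1) * exp (1/16)"
proof -
 define y where "y = 1 / sqrt \<sigma>"
 have y: "y > 0" "1 / \<sigma> = y ^ 2" using assms by (auto simp: y_def power_divide)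
 define z where "z = 1 + y ^ 2"
 have z: "z \<ge> 1" by (simp add: z_def)
 have "y \<le> z" unfolding z_def using y(1)
  by (metis add_increasing add_increasing2 linorder_linear pos2
    self_le_power zero_le_one zero_le_power2 less_imp_le)
 then have yN: "y ^ N \<le> z ^ N" using y by (intro power_mono) auto
 have "exp (- r / (4 * \<sigma>)) = exp (- r / 4 * y ^ 2)" using y by (simp flip: y(2))
 also have "\<dots> \<le> exp (1/16 - z / 16)"
  using mult_right_mono[OF assms(2), of "y ^ 2"] by (simp add: z_def field_simps)
 finally have e: "exp (- r / (4 * \<sigma>)) \<le> exp (1/16) * exp (- (z / 16))" by (simp flip: exp_add)
 define k where "k = N + 1"
 define F :: real where "F = fact k"
 have F: "F > 0" by (simp add: F_def)
 define g :: "nat => real" where "g n = (z / 16) ^ n /\<^sub>R fact n" for n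
 have "g n \<ge> 0" for n using z by (simp add: g_def)
 moreover have "summable g" unfolding g_def[abs_def] by (rule summable_exp_generic)
 ultimately have "sum g {k} \<le> suminf g"
  by (intro sum_le_suminf) auto
 then have "g k \<le> exp (z / 16)"
  by (simp add: exp_def g_def[abs_def])
 moreover have "g k = (z / 16) ^ k / F"
  unfolding g_def F_def real_scaleR_def by (simp only: divide_inverse mult.commute)
 ultimately have "(z / 16) ^ k / F \<le> exp (z / 16)"
  by (simp only:)
 then have "(z / 16) ^ k \<le> exp (z / 16) * F"
  by (simp only: pos_divide_le_eq[OF F])
 then have "16 ^ k * (z / 16) ^ k * exp (- (z / 16)) \<le> 16 ^ k * (exp (z / 16) * F) * exp (- (z / 16))"
  by (intro mult_right_mono mult_left_mono) auto
 moreover have "16 ^ k * (z / 16) ^ k = z ^ k"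
  by (simp add: power_divide)
 moreover have "exp (z / 16) * exp (- (z / 16)) = 1"
  by (simp flip: exp_add)
 ultimately have z2: "z ^ k * exp (- (z / 16)) \<le> F * 16 ^ k"
  by (simp add: mult_ac)
 have "gk N \<sigma> r * (1 + 1 / \<sigma>) = exp (- r / (4 * \<sigma>)) * (y ^ N * z)"
 proof -
  have "1 / sqrt \<sigma> ^ N = y ^ N" by (simp add: y_def power_one_over)
  then have "gk N \<sigma> r = exp (- r / (4 * \<sigma>)) * y ^ N"
   by (metis gk_def mult.right_neutral times_divide_eq_right)
  then show ?thesis by (simp add: z_def y(2))
 qed
 also have "\<dots> \<le> (exp (1/16) * exp (- (z / 16))) * (z ^ N * z)"
  using e yN z y by (intro mult_mono) auto
 also have "\<dots> = exp (1/16) * (z ^ k * exp (- (z / 16)))" by (simp add: k_def)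
 also have "\<dots> \<le> exp (1/16) * (F * 16 ^ k)"
  by (intro mult_left_mono z2) simp
 finally show ?thesis by (simp only: F_def k_def mult_ac)
qed

text \<open>\<open>heat1\<close> and \<open>heat2\<close> are the first two derivatives, in the
  squared radius, of the kernel multiplied by the cutoff.\<close>

definition heat1 :: "nat => nat => real => real => real" where
 "heat1 N m \<sigma> r = gk N \<sigma> r * (cut1 m 1 r - cut m 1 r / (4 * \<sigma>))"

definition heat2 :: "nat => nat => real => real => real" where
 "heat2 N m \<sigma> r = gk N \<sigma> r * (cut2 m 1 r - cut1 m 1 r / (2 * \<sigma>) + cut m 1 r / (16 * \<sigma> ^ 2))"

lemma C2_heat_cut:
 fixes \<sigma> :: real and m N :: nat
 assumes "\<sigma> > 0"
 shows "C2 (%x::'a::euclidean_space. gk N \<sigma> (x \<bullet> x) * cut m 1 (x \<bullet> x))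
  (%x. (2 * heat1 N m \<sigma> (x \<bullet> x)) *\<^sub>R x)
  (%x v. (4 * heat2 N m \<sigma> (x \<bullet> x) * (x \<bullet> v)) *\<^sub>R x + (2 * heat1 N m \<sigma> (x \<bullet> x)) *\<^sub>R v)"
proof (rule C2_radial[where th = "%r. gk N \<sigma> r * cut m 1 r"])
 note g = gk_derivative_space
 fix r
 show "((%r. gk N \<sigma> r * cut m 1 r) has_real_derivative heat1 N m \<sigma> r) (at r)"
  by (rule DERIV_cong[OF DERIV_mult[OF g cut_derivative]]) (simp add: heat1_def algebra_simps)
 have "((%r. gk N \<sigma> r * (cut1 m 1 r - cut m 1 r / (4 * \<sigma>))) has_real_derivative heat2 N m \<sigma> r) (at r)"
  by (rule DERIV_cong[OF DERIV_mult[OF g DERIV_diff[OF cut1_derivative DERIV_cdivide[OF cut_derivative]]]])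
   (use assms in \<open>simp add: heat2_def field_simps power2_eq_square\<close>)
 then show "(heat1 N m \<sigma> has_real_derivative heat2 N m \<sigma> r) (at r)"
  by (simp add: heat1_def[abs_def])
next
 have "continuous_on UNIV (cut m 1)" "continuous_on UNIV (cut1 m 1)" "continuous_on UNIV (gk N \<sigma>)"
  using cut_derivative cut1_derivative gk_derivative_space
  by (meson DERIV_isCont continuous_at_imp_continuous_on)+
 then have "continuous_on UNIV (heat2 N m \<sigma>)"
  unfolding heat2_def[abs_def] by (intro continuous_intros cut2_continuous) (use assms in auto)
 then show "continuous_on {0..} (heat2 N m \<sigma>)"
  by (rule continuous_on_subset) auto
qed

lemma cut12_bounded: "\<exists>M\<ge>0. \<forall>r\<ge>0. \<bar>cut1 m 1 r\<bar> \<le> M \<and> \<bar>cut2 m 1 r\<bar> \<le> M"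
proof -
 have "continuous_on {0..5/4} (cut1 m 1)"
  using cut1_derivative by (meson DERIV_isCont continuous_at_imp_continuous_on)
 then have "bounded (cut1 m 1 ` {0..5/4})"
  by (intro compact_imp_bounded compact_continuous_image) auto
 then obtain M1 where M1: "\<And>r. r \<in> {0..5/4} ==> \<bar>cut1 m 1 r\<bar> \<le> M1"
  unfolding bounded_iff by (metis image_eqI real_norm_def)
 have "continuous_on {0..5/4} (cut2 m 1)"
  by (rule continuous_on_subset[OF cut2_continuous]) auto
 then have "bounded (cut2 m 1 ` {0..5/4})"
  by (intro compact_imp_bounded compact_continuous_image) auto
 then obtain M2 where M2: "\<And>r. r \<in> {0..5/4} ==> \<bar>cut2 m 1 r\<bar> \<le> M2"
  unfolding bounded_iff by (metis image_eqI real_norm_def)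
 have "\<bar>cut1 m 1 r\<bar> \<le> max 0 (max M1 M2) \<and> \<bar>cut2 m 1 r\<bar> \<le> max 0 (max M1 M2)" if "r \<ge> 0" for r
  using M1[of r] M2[of r] cut_eq_0[of 1 r m] that by (cases "r \<le> 5/4") auto
 then show ?thesis
  by (intro exI[of _ "max 0 (max M1 M2)"]) auto
qed

lemma cut_le_bump: "cut m 1 (x \<bullet> x) \<le> bump m (1/16) x"
proof (cases "x \<bullet> x \<le> 4")
 case True
 then show ?thesis using cut_bounds[of m 1 "x \<bullet> x"] bump_eq_1[of "1/16" x m] by simp
next
 case False
 then show ?thesis using cut_eq_0[of 1 "x \<bullet> x" m] bump_bounds[of m "1/16" x] by simp
qed

text \<open>The test function is a backward heat kernel times a cutoff: both are exchanged for the mass at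
 positive distance from the pole, where the kernel is bounded.\<close>

lemma subsol_sup_le_mass:
 fixes m :: nat and \<theta> :: real
 assumes \<theta>: "\<theta> > 0"
 shows "\<exists>C\<ge>0. \<forall>q a b f G D ft (x::'a::euclidean_space) t B.
  q > 1 --> subsol q a b f G D ft --> a < t - \<theta> --> t < b -->
  (\<forall>s\<in>{t-\<theta>..t}. (LBINT y. f y s * bump m (1/16) (y - x)) \<le> B) --> f x t \<le> C * B"
proof -
 let ?N = "DIM('a)"
 obtain M where M: "M \<ge> 0" "\<And>r. r \<ge> 0 ==> \<bar>cut1 m 1 r\<bar> \<le> M" "\<And>r. r \<ge> 0 ==> \<bar>cut2 m 1 r\<bar> \<le> M"
  using cut12_bounded by blast
 \<comment> \<open>\<open>K0\<close> bounds the kernel at the initial time. \<open>K1\<close> bounds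
   what remains after the heat equation of the kernel has been used, namely the terms with
   derivatives of the cutoff. \<open>V\<close> is the integral over a ball of radius
   \<open>h\<close> of the lower bound \<open>exp (-1/4) / h ^ N\<close> of the kernel at time
   \<open>h ^ 2\<close>; it does not depend on \<open>h\<close>.\<close>
 define K0 where "K0 = 1 / sqrt \<theta> ^ ?N"
 define K1 where "K1 = (fact (?N + 1) * 16 ^ (?N + 1) * exp (1/16)) * ((5 / 2 + 5 + 2 * ?N) * M)"
 define V where "V = unit_ball_vol ?N * exp (-1/4)"
 have V: "V > 0" by (simp add: V_def)
 have K1: "K1 \<ge> 0" using M by (simp add: K1_def)
 have K0: "K0 \<ge> 0" using \<theta> by (simp add: K0_def)
 have "f x t \<le> ((K0 + K1 * \<theta>) / V) * B"
  if q: "q > 1" and sub: "subsol q a b f G D ft" and at: "a < t - \<theta>" and tb: "t < b"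
   and mass: "\<And>s. s \<in> {t-\<theta>..t} ==> (LBINT y. f y s * bump m (1/16) (y - x)) \<le> B"
  for q a b f G D ft t B and x :: 'a
 proof -
  have C21: "C21 a b f G D ft" using sub by (simp add: subsol_def)
  have sub_st: "{t-\<theta>..t} \<subseteq> {a<..<b}" using at tb by auto
  note cf = C21_continuous[OF C21 sub_st]
  have cbump: "continuous_on UNIV (bump m (1/16) :: 'a => real)"
   by (rule C2_continuous(1)[OF C2_bump])
  have R20: "sqrt (5 / (4 * (1 / 16))) \<le> (5::real)" by (simp add: real_le_lsqrt)
  have bump0: "bump m (1/16) (y - x) = 0" if "norm y > 5 + norm x" for y
  proof -
   have "norm (y - x) \<ge> sqrt (5 / (4 * (1 / 16)))"
    using that norm_triangle_ineq2[of y x] R20 by linarith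
   then show ?thesis using bump_eq_0[of "1/16" "y - x" m] by simp
  qed
  have int_bump: "integrable lborel (%y. f y s * bump m (1/16) (y - x))" if "s \<in> {t-\<theta>..t}" for s
   by (rule integrable_compact_support[where R = "5 + norm x"])
    (use bump0 in \<open>auto intro!: continuous_intros continuous_on_slice[OF cf(1) that] continuous_on_compose2[OF cbump]\<close>)
  have fnn: "f y s \<ge> 0" if "s \<in> {t-\<theta>..t}" for y s
   using subsolD(3)[OF sub] that sub_st by auto
  have B0: "B \<ge> 0"
  proof -
   have "0 \<le> (LBINT y. f y t * bump m (1/16) (y - x))"
    using fnn[of t] \<theta> by (intro Bochner_Integration.integral_nonneg mult_nonneg_nonneg bump_bounds) auto
   then show ?thesis using mass[of t] \<theta> by auto
  qed
  \<comment> \<open>The pole sits at time \<open>t + \<eta>\<close>, so the kernel is smooth up to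
    time \<open>t\<close>. The bound is uniform in \<open>\<eta>\<close>, which allows
    \<open>\<eta> = h ^ 2\<close> with \<open>h\<close> small afterwards.\<close>
  have main: "(LBINT y. f y t * (gk ?N \<eta> ((y - x) \<bullet> (y - x)) * cut m 1 ((y - x) \<bullet> (y - x)))) \<le> (K0 + K1 * \<theta>) * B"
   if \<eta>: "\<eta> > 0" for \<eta>
  proof -
   define \<sigma> where "\<sigma> s = t + \<eta> - s" for s
   define \<rho> where "\<rho> y = (y - x) \<bullet> (y - x)" for y
   define P where "P y s = f y s * (gk ?N (\<sigma> s) (\<rho> y) * cut m 1 (\<rho> y))" for y s
   define gt where "gt y s = - (gk ?N (\<sigma> s) (\<rho> y) * (\<rho> y / (4 * \<sigma> s ^ 2) - ?N / (2 * \<sigma> s)))" for y s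
   define P' where "P' y s = ft y s * (gk ?N (\<sigma> s) (\<rho> y) * cut m 1 (\<rho> y)) + f y s * (gt y s * cut m 1 (\<rho> y))" for y s
   have \<sigma>: "\<sigma> s > 0" if "s \<in> {t-\<theta>..t}" for s using that \<eta> by (auto simp: \<sigma>_def)
   have \<rho>0: "\<rho> y \<ge> 0" for y by (simp add: \<rho>_def)
   have c\<rho>: "continuous_on A \<rho>" for A unfolding \<rho>_def by (intro continuous_intros)
   have ccut: "continuous_on A (%y. cut m 1 (\<rho> y))" for A
    by (rule continuous_on_compose2[OF _ c\<rho>, of UNIV])
     (use cut_derivative in \<open>auto intro!: continuous_at_imp_continuous_on DERIV_isCont\<close>)
   have cutfar: "cut m 1 (\<rho> y) = 0 \<and> cut1 m 1 (\<rho> y) = 0 \<and> cut2 m 1 (\<rho> y) = 0" if "norm y > 5 + norm x" for y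
   proof -
    have "norm (y - x) \<ge> 5" using that norm_triangle_ineq2[of y x] by linarith
    then have "norm (y - x) ^ 2 \<ge> 5 ^ 2" by (intro power_mono) auto
    then show ?thesis
     unfolding \<rho>_def using cut_eq_0[of 1 "(y - x) \<bullet> (y - x)" m] by (simp add: power2_norm_eq_inner)
   qed
   have cgk: "continuous_on (UNIV \<times> {t-\<theta>..t}) (%(y, s). gk ?N (\<sigma> s) (\<rho> y))"
    unfolding gk_def split_beta \<rho>_def \<sigma>_def using \<eta> by (intro continuous_intros) auto
   have cgt: "continuous_on (UNIV \<times> {t-\<theta>..t}) (%(y, s). gt y s)"
    using cgk unfolding gt_def split_beta \<rho>_def \<sigma>_def using \<eta> by (intro continuous_intros) auto
   have ccut2: "continuous_on (UNIV \<times> {t-\<theta>..t}) (%z. cut m 1 (\<rho> (fst z)))"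
    by (rule continuous_on_compose2[OF ccut[of UNIV]]) (auto intro!: continuous_intros)
   have der: "((%s. LBINT y. P y s) has_real_derivative (LBINT y. P' y s)) (at s within {t-\<theta>..t})"
    if s: "s \<in> {t-\<theta>..t}" for s
   proof (rule leibniz_compact_support[where R = "5 + norm x"])
    fix y r assume r: "r \<in> {t-\<theta>..t}"
    show "norm y > 5 + norm x ==> P y r = 0" using cutfar[of y] by (simp add: P_def)
    have "(\<sigma> has_real_derivative -1) (at r)"
     unfolding \<sigma>_def by (auto intro!: derivative_eq_intros)
    from DERIV_chain'[OF this gk_derivative_time[OF \<sigma>[OF r]]]
    have "((%r. gk ?N (\<sigma> r) (\<rho> y)) has_real_derivative gt y r) (at r)"
     by (simp add: gt_def)
    moreover have "(f y has_real_derivative ft y r) (at r)"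
     by (rule subsolD[OF sub]) (use r sub_st in auto)
    ultimately have "(P y has_real_derivative P' y r) (at r)"
     unfolding P_def[abs_def] P'_def by (auto intro!: derivative_eq_intros simp: algebra_simps)
    then show "(P y has_real_derivative P' y r) (at r within {t-\<theta>..t})"
     by (rule has_field_derivative_at_within)
   next
    fix r assume r: "r \<in> {t-\<theta>..t}"
    show "continuous_on UNIV (%y. P y r)"
     unfolding P_def by (intro continuous_intros ccut continuous_on_slice[OF cgk r] continuous_on_slice[OF cf(1) r])
   next
    show "continuous_on (UNIV \<times> {t-\<theta>..t}) (%(y, s). P' y s)"
     using cgk cgt cf(1,4) ccut2 unfolding P'_def split_beta by (intro continuous_intros)
   qed (use \<theta> s in auto)
   have le: "(LBINT y. P' y s) \<le> K1 * B" if s: "s \<in> {t-\<theta>..t}" for s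
   proof -
    have s': "s \<in> {a<..<b}" using s sub_st by auto
    note C2f = subsolD(1)[OF sub s']
    note cfs = C2_continuous[OF C2f] C2_lap_continuous[OF C2f] continuous_on_slice[OF cf(4) s]
    define \<mu> where "\<mu> y = gk ?N (\<sigma> s) (\<rho> y) * cut m 1 (\<rho> y)" for y
    define DD where "DD y v = (4 * heat2 ?N m (\<sigma> s) (\<rho> y) * ((y - x) \<bullet> v)) *\<^sub>R (y - x) + (2 * heat1 ?N m (\<sigma> s) (\<rho> y)) *\<^sub>R v" for y v
    have C2\<mu>: "C2 \<mu> (%y. (2 * heat1 ?N m (\<sigma> s) (\<rho> y)) *\<^sub>R (y - x)) DD"
     using C2_translate[OF C2_heat_cut[OF \<sigma>[OF s], of ?N m], of x]
     by (simp add: \<mu>_def[abs_def] DD_def[abs_def] \<rho>_def)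
    have lapDD: "lap (DD y) = 4 * heat2 ?N m (\<sigma> s) (\<rho> y) * \<rho> y + 2 * heat1 ?N m (\<sigma> s) (\<rho> y) * ?N" for y
     using lap_radial[of "4 * heat2 ?N m (\<sigma> s) (\<rho> y)" "y - x"] by (simp add: DD_def[abs_def] \<rho>_def)
    have far: "\<mu> y = 0 \<and> (2 * heat1 ?N m (\<sigma> s) (\<rho> y)) *\<^sub>R (y - x) = 0 \<and> DD y = (%v. 0)"
     if "norm y > 5 + norm x" for y
     using cutfar[OF that] by (simp add: \<mu>_def DD_def[abs_def] heat1_def heat2_def)
    have c\<mu>: "continuous_on UNIV \<mu>" using C2_continuous[OF C2\<mu>] by simp
    have cgts: "continuous_on UNIV (%y. gt y s * cut m 1 (\<rho> y))"
     by (intro continuous_intros ccut continuous_on_slice[OF cgt s])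
    have int1: "integrable lborel (%y. g y * \<mu> y)" if "continuous_on UNIV g" for g :: "'a => real"
     by (rule integrable_compact_support[where R = "5 + norm x"])
      (use far in \<open>auto intro!: continuous_intros that c\<mu>\<close>)
    have int2: "integrable lborel (%y. f y s * (gt y s * cut m 1 (\<rho> y)))"
     by (rule integrable_compact_support[where R = "5 + norm x"])
      (use cutfar in \<open>auto intro!: continuous_intros cfs cgts\<close>)
    have int3: "integrable lborel (%y. f y s * lap (DD y))"
    proof (rule integrable_compact_support[where R = "5 + norm x"])
     show "f y s * lap (DD y) = 0" if "norm y > 5 + norm x" for y
      using far[OF that] by (simp add: lap_def)
    qed (intro continuous_intros cfs C2_lap_continuous[OF C2\<mu>])
    have "(LBINT y. P' y s) \<le> (LBINT y. lap (D y s) * \<mu> y + f y s * (gt y s * cut m 1 (\<rho> y)))"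
    proof (rule integral_mono)
     show "integrable lborel (%y. P' y s)"
      unfolding P'_def using int1[OF cfs(4)] int2 by (simp add: \<mu>_def)
     show "integrable lborel (%y. lap (D y s) * \<mu> y + f y s * (gt y s * cut m 1 (\<rho> y)))"
      using int1[OF cfs(3)] int2 by simp
     fix y
     \<comment> \<open>Here the absorption is dropped: for local boundedness it is enough to be a
       subsolution of the heat equation.\<close>
     have "ft y s \<le> lap (D y s)"
      using subsolD(4)[OF sub s', of y] powr_ge_zero[of "norm (G y s)" q] unfolding resid_def by linarith
     then have "ft y s * \<mu> y \<le> lap (D y s) * \<mu> y"
      using gk_nonneg[OF less_imp_le[OF \<sigma>[OF s]]] cut_bounds by (intro mult_right_mono) (auto simp: \<mu>_def)
     then show "P' y s \<le> lap (D y s) * \<mu> y + f y s * (gt y s * cut m 1 (\<rho> y))"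
      by (simp add: P'_def \<mu>_def)
    qed
    also have "\<dots> = (LBINT y. f y s * lap (DD y) + f y s * (gt y s * cut m 1 (\<rho> y)))"
     using int1[OF cfs(3)] int2 int3 C2_lap_symmetric[OF C2f C2\<mu>, of "5 + norm x"] far by simp
    also have "\<dots> \<le> (LBINT y. K1 * (f y s * bump m (1/16) (y - x)))"
    proof (rule integral_mono)
     show "integrable lborel (%y. f y s * lap (DD y) + f y s * (gt y s * cut m 1 (\<rho> y)))"
      using int2 int3 by simp
     show "integrable lborel (%y. K1 * (f y s * bump m (1/16) (y - x)))"
      using int_bump[OF s] by simp
     fix y
     define r where "r = \<rho> y"
     define g where "g = gk ?N (\<sigma> s) r"
     have g0: "g \<ge> 0" using gk_nonneg[OF less_imp_le[OF \<sigma>[OF s]]] by (simp add: g_def)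
     \<comment> \<open>The terms in which the cutoff is not differentiated cancel, since the kernel
       solves the backward heat equation. The others live in the shell
       \<open>1/4 \<le> r \<le> 5/4\<close>, where \<open>gk_away\<close> applies.\<close>
     have eq: "lap (DD y) + gt y s * cut m 1 r = g * (- 2 * r * cut1 m 1 r / \<sigma> s + 4 * r * cut2 m 1 r + 2 * ?N * cut1 m 1 r)"
      unfolding lapDD gt_def heat1_def heat2_def r_def[symmetric] g_def[symmetric]
      using \<sigma>[OF s] by (simp add: field_simps power2_eq_square)
     have "lap (DD y) + gt y s * cut m 1 r \<le> K1 * bump m (1/16) (y - x)"
     proof (cases "r \<in> {1/4..5/4}")
      case True
      have b1: "bump m (1/16) (y - x) = 1"
       using True by (intro bump_eq_1) (auto simp: r_def \<rho>_def)
      have M': "\<bar>cut1 m 1 r\<bar> \<le> M" "\<bar>cut2 m 1 r\<bar> \<le> M" using M True by auto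
      have s0: "1 / \<sigma> s \<ge> 0" using \<sigma>[OF s] by simp
      have e1: "- 2 * r * cut1 m 1 r / \<sigma> s \<le> (5/2 * M) * (1 + 1 / \<sigma> s)"
      proof -
       have "- 2 * r * cut1 m 1 r \<le> 2 * r * \<bar>cut1 m 1 r\<bar>"
        using True mult_left_mono[of "- cut1 m 1 r" "\<bar>cut1 m 1 r\<bar>" "2*r"] by auto
       also have "\<dots> \<le> (5/2) * M" using M' M(1) True by (intro mult_mono) auto
       finally have "(- 2 * r * cut1 m 1 r) * (1 / \<sigma> s) \<le> (5/2 * M) * (1 / \<sigma> s)"
        using s0 by (intro mult_right_mono) auto
       also have "\<dots> \<le> (5/2 * M) * (1 + 1 / \<sigma> s)"
        using M(1) by (intro mult_left_mono) auto
       finally show ?thesis by (simp only: times_divide_eq_right mult_1_right)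
      qed
      have e2: "4 * r * cut2 m 1 r \<le> (5 * M) * (1 + 1 / \<sigma> s)"
      proof -
       have "4 * r * cut2 m 1 r \<le> 4 * r * M"
        using True M' by (intro mult_left_mono) auto
       also have "\<dots> \<le> 5 * M" using M(1) True by (intro mult_right_mono) auto
       also have "\<dots> \<le> (5 * M) * (1 + 1 / \<sigma> s)" using s0 M(1) by (simp add: algebra_simps)
       finally show ?thesis .
      qed
      have e3: "2 * ?N * cut1 m 1 r \<le> (2 * ?N * M) * (1 + 1 / \<sigma> s)"
      proof -
       have "2 * ?N * cut1 m 1 r \<le> 2 * ?N * M"
        using M' by (intro mult_left_mono) auto
       also have "\<dots> \<le> (2 * ?N * M) * (1 + 1 / \<sigma> s)" using s0 M(1) by (simp add: algebra_simps)
       finally show ?thesis .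
      qed
      have "g * (- 2 * r * cut1 m 1 r / \<sigma> s + 4 * r * cut2 m 1 r + 2 * ?N * cut1 m 1 r)
        \<le> g * (((5/2 + 5 + 2 * ?N) * M) * (1 + 1 / \<sigma> s))"
      proof (rule mult_left_mono[OF _ g0])
       define w where "w = 1 + 1 / \<sigma> s"
       have "((5/2 + 5 + 2 * ?N) * M) * w = (5/2 * M) * w + (5 * M) * w + (2 * ?N * M) * w"
        by (simp only: distrib_right)
       then show "- 2 * r * cut1 m 1 r / \<sigma> s + 4 * r * cut2 m 1 r + 2 * ?N * cut1 m 1 r
         \<le> ((5/2 + 5 + 2 * ?N) * M) * (1 + 1 / \<sigma> s)"
        using e1 e2 e3 unfolding w_def by linarith
      qed
      also have "\<dots> = (g * (1 + 1 / \<sigma> s)) * ((5/2 + 5 + 2 * ?N) * M)" by simp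
      also have "\<dots> \<le> K1"
       unfolding K1_def g_def using True M(1) by (intro mult_right_mono gk_away \<sigma>[OF s]) auto
      finally show ?thesis using eq b1 by simp
     next
      case False
      then have "cut1 m 1 r = 0 \<and> cut2 m 1 r = 0"
       using cut_eq_1[of 1 r m] cut_eq_0[of 1 r m] by auto
      then show ?thesis using eq K1 bump_bounds[of m "1/16" "y - x"] by simp
     qed
     from mult_left_mono[OF this fnn[OF s, of y]]
     show "f y s * lap (DD y) + f y s * (gt y s * cut m 1 (\<rho> y)) \<le> K1 * (f y s * bump m (1/16) (y - x))"
      by (simp add: algebra_simps r_def)
    qed
    also have "\<dots> \<le> K1 * B" using mass[OF s] K1 by (simp add: mult_left_mono)
    finally show ?thesis .
   qed
   have "(LBINT y. P y t) - (LBINT y. P y (t - \<theta>)) \<le> (K1 * B) * (t - (t - \<theta>))"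
    by (rule increment_le_of_derivative_le[OF _ der le]) (use \<theta> in auto)
   moreover have "(LBINT y. P y (t - \<theta>)) \<le> (LBINT y. K0 * (f y (t-\<theta>) * bump m (1/16) (y - x)))"
   proof (rule integral_mono)
    have in_st: "t - \<theta> \<in> {t-\<theta>..t}" using \<theta> by auto
    show "integrable lborel (%y. P y (t - \<theta>))"
     by (rule integrable_compact_support[where R = "5 + norm x"])
      (use cutfar in \<open>auto simp: P_def intro!: continuous_intros ccut continuous_on_slice[OF cgk in_st] continuous_on_slice[OF cf(1) in_st]\<close>)
    show "integrable lborel (%y. K0 * (f y (t-\<theta>) * bump m (1/16) (y - x)))"
     using int_bump[OF in_st] by simp
    fix y
    have "gk ?N (\<sigma> (t - \<theta>)) (\<rho> y) * cut m 1 (\<rho> y) \<le> K0 * bump m (1/16) (y - x)"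
     unfolding K0_def using \<theta> \<eta> \<rho>0 cut_le_bump[of m "y - x"]
     by (intro mult_mono gk_le) (auto simp: \<sigma>_def \<rho>_def cut_bounds)
    from mult_left_mono[OF this fnn[OF in_st, of y]]
    show "P y (t - \<theta>) \<le> K0 * (f y (t-\<theta>) * bump m (1/16) (y - x))"
     by (simp add: P_def mult_ac)
   qed
   moreover have "(LBINT y. K0 * (f y (t-\<theta>) * bump m (1/16) (y - x))) \<le> K0 * B"
    using mass[of "t - \<theta>"] K0 \<theta> by (simp add: mult_left_mono)
   ultimately show ?thesis
    by (simp add: P_def \<rho>_def \<sigma>_def algebra_simps)
  qed
  \<comment> \<open>Recovers the point value: near \<open>x\<close> the function exceeds
    \<open>f x t - \<delta>\<close>, and the kernel at time \<open>h ^ 2\<close> carries at least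
    mass \<open>V\<close> on the ball of radius \<open>h\<close>.\<close>
  have "V * f x t \<le> (K0 + K1 * \<theta>) * B"
  proof (rule field_le_epsilon)
   fix e :: real assume e: "e > 0"
   define \<delta> where "\<delta> = e / V"
   have \<delta>: "\<delta> > 0" using e V by (simp add: \<delta>_def)
   have in_t: "t \<in> {t-\<theta>..t}" using \<theta> by auto
   have cft: "continuous_on UNIV (%y. f y t)" by (rule continuous_on_slice[OF cf(1) in_t])
   then have "isCont (%y. f y t) x" by (simp add: continuous_on_eq_continuous_at)
   then obtain r where r: "r > 0" "\<And>y. dist y x < r ==> dist (f y t) (f x t) < \<delta>"
    using \<delta> unfolding continuous_at_eps_delta by blast
   define h where "h = min (r / 2) (1/2)"
   have h: "h > 0" "h < r" "h \<le> 1/2" using r by (auto simp: h_def)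
   let ?w = "%y. gk ?N (h ^ 2) ((y - x) \<bullet> (y - x)) * cut m 1 ((y - x) \<bullet> (y - x))"
   have ccut: "continuous_on UNIV (%y. cut m 1 ((y - x) \<bullet> (y - x)))"
    by (rule continuous_on_compose2[where g = "cut m 1" and t = UNIV])
     (use cut_derivative in \<open>auto intro!: continuous_at_imp_continuous_on DERIV_isCont continuous_intros\<close>)
   have "(f x t - \<delta>) * V = (LBINT y. ((f x t - \<delta>) * exp (-1/4) / h ^ ?N) * indicator (cball x h) y)"
    using h by (simp add: content_cball V_def)
   also have "\<dots> \<le> (LBINT y. f y t * ?w y)"
   proof (rule integral_mono)
    show "integrable lborel (%y. ((f x t - \<delta>) * exp (-1/4) / h ^ ?N) * indicator (cball x h) y)"
     by (intro integrable_mult_right integrable_real_indicator)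
      (use emeasure_bounded_finite[OF bounded_cball] in \<open>auto simp: top.not_eq_extremum\<close>)
    show "integrable lborel (%y. f y t * ?w y)"
    proof (rule integrable_compact_support[where R = "5 + norm x"])
     show "continuous_on UNIV (%y. f y t * ?w y)"
      unfolding gk_def using h by (intro continuous_intros cft ccut) auto
     fix y :: 'a assume "norm y > 5 + norm x"
     then have "norm (y - x) \<ge> 5" using norm_triangle_ineq2[of y x] by linarith
     then have "norm (y - x) ^ 2 \<ge> 5 ^ 2" by (intro power_mono) auto
     then show "f y t * ?w y = 0"
      using cut_eq_0[of 1 "(y - x) \<bullet> (y - x)" m] by (simp add: power2_norm_eq_inner)
    qed
    fix y
    show "((f x t - \<delta>) * exp (-1/4) / h ^ ?N) * indicator (cball x h) y \<le> f y t * ?w y"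
    proof (cases "y \<in> cball x h")
     case True
     then have d: "norm (y - x) \<le> h" by (simp add: dist_norm norm_minus_commute)
     then have "norm (y - x) ^ 2 \<le> h ^ 2" by (intro power_mono) auto
     then have sq: "(y - x) \<bullet> (y - x) \<le> h ^ 2" by (simp add: power2_norm_eq_inner)
     have "h ^ 2 \<le> (1/2) ^ 2" using h by (intro power_mono) auto
     then have "cut m 1 ((y - x) \<bullet> (y - x)) = 1"
      using cut_eq_1[of 1 "(y - x) \<bullet> (y - x)" m] sq by (simp add: power2_eq_square)
     moreover have "gk ?N (h ^ 2) ((y - x) \<bullet> (y - x)) \<ge> exp (-1/4) / h ^ ?N"
      unfolding gk_def using h sq by (simp add: divide_right_mono field_simps)
     moreover have "f x t - \<delta> \<le> f y t"
      using r(2)[of y] d h by (auto simp: dist_norm)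
     moreover have "f y t \<ge> 0" by (rule fnn[OF in_t])
     ultimately have "(f x t - \<delta>) * (exp (-1/4) / h ^ ?N) \<le> f y t * ?w y"
      using h by (intro mult_mono) auto
     then show ?thesis using True by simp
    next
     case False
     then show ?thesis
      using fnn[OF in_t, of y] gk_nonneg[of "h ^ 2"] cut_bounds by simp
    qed
   qed
   also have "\<dots> \<le> (K0 + K1 * \<theta>) * B" by (rule main) (use h in simp)
   finally show "V * f x t \<le> (K0 + K1 * \<theta>) * B + e"
    using V by (simp add: \<delta>_def algebra_simps)
  qed
  then show ?thesis using V by (simp add: field_simps)
 qed
 moreover have "(K0 + K1 * \<theta>) / V \<ge> 0" using V K0 K1 \<theta> by simp
 ultimately show ?thesis by blast
qed

text \<open>A bump at \<open>x\<close> is fed from the bump at the origin, at a time between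
  \<open>d\<close> and \<open>2 * d\<close> earlier. The delay is bounded below, so the velocity is
  at most \<open>norm x / d\<close>, and the cost of transport has the growth of
  \<open>norm x powr (q / (q - 1))\<close>. Only one suitable earlier time is required, because
  masses of approximants are controlled only at almost every time.\<close>

lemma subsol_growth:
 fixes m :: nat and d M0 :: real
 assumes q: "q > 1" and m: "q / (q - 1) \<le> real (m + 3)" and d: "d > 0" and M0: "M0 \<ge> 0"
 shows "\<exists>C\<ge>0. \<forall>a b f G D ft (x::'a::euclidean_space) t.
  subsol q a b f G D ft --> a + 3 * d < t --> t < b -->
  (\<forall>r. a + 2 * d < r --> r < b --> (\<exists>s. a < s \<and> r - 2 * d \<le> s \<and> s \<le> r - d \<and>
    (LBINT y. f y s * bump m (1/16) y) \<le> M0)) -->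
  f x t \<le> C * (1 + norm x) powr (q / (q - 1))"
proof -
 let ?p = "q / (q - 1)"
 obtain C where C: "C \<ge> 0" and C': "\<forall>q a b f G D ft (x::'a) t B.
   q > 1 --> subsol q a b f G D ft --> a < t - d --> t < b -->
   (\<forall>s\<in>{t-d..t}. (LBINT y. f y s * bump m (1/16) (y - x)) \<le> B) --> f x t \<le> C * B"
  using subsol_sup_le_mass[OF d, of m] by (elim exE conjE) (rule that)
 define R where "R = sqrt (5 / (4 * (1/16)))"
 define C1 where "C1 = 6 * (1/16) * real (m + 3) * R"
 define vol where "vol = measure lborel (cball (0::'a) R)"
 define K where "K = M0 + (C1 + 1 / d) powr ?p * vol * (2 * d)"
 have C1: "C1 \<ge> 0" by (simp add: C1_def R_def)
 have p: "?p > 0" using q by simp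
 have K: "K \<ge> 0" using M0 d by (simp add: K_def vol_def)
 have "f x t \<le> C * K * (1 + norm x) powr ?p"
  if sub: "subsol q a b f G D ft" and t: "a + 3 * d < t" "t < b"
   and mass: "\<And>r. a + 2 * d < r ==> r < b ==> (\<exists>s. a < s \<and> r - 2 * d \<le> s \<and> s \<le> r - d \<and>
    (LBINT y. f y s * bump m (1/16) y) \<le> M0)"
  for a b f G D ft t and x :: 'a
 proof -
  have "f x t \<le> C * (K * (1 + norm x) powr ?p)"
  proof (rule C'[rule_format, OF q sub])
   fix r
   show "(LBINT y. f y r * bump m (1/16) (y - x)) \<le> K * (1 + norm x) powr ?p"
    if r: "r \<in> {t-d..t}"
   proof -
    obtain s where s: "a < s" "r - 2 * d \<le> s" "s \<le> r - d"
     "(LBINT y. f y s * bump m (1/16) y) \<le> M0"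
     using mass[of r] t r by auto
    have "(LBINT y. f y r * bump m (1/16) (y - x)) \<le>
      (LBINT y. f y s * bump m (1/16) (y - 0)) + (C1 + norm (x - 0) / (r - s)) powr ?p * vol * (r - s)"
     unfolding C1_def vol_def R_def
     by (rule subsol_moving_average[OF sub q m]) (use s r t d in auto)
    also have "\<dots> \<le> M0 + (C1 + norm (x - 0) / (r - s)) powr ?p * vol * (r - s)"
     using s(4) by simp
    also have "\<dots> \<le> M0 + ((C1 + 1 / d) * (1 + norm x)) powr ?p * vol * (2 * d)"
    proof -
     have "norm x / (r - s) \<le> norm x / d" using s d by (intro divide_left_mono) auto
     also have "C1 + norm x / d \<le> (C1 + 1 / d) * (1 + norm x)"
      using C1 d by (simp add: algebra_simps)
     finally have "C1 + norm x / (r - s) \<le> (C1 + 1 / d) * (1 + norm x)" by simp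
     then have "(C1 + norm (x - 0) / (r - s)) powr ?p \<le> ((C1 + 1 / d) * (1 + norm x)) powr ?p"
      using p C1 s d by (intro powr_mono2) auto
     then show ?thesis
      using s d by (intro add_left_mono mult_mono) (auto simp: vol_def)
    qed
    also have "\<dots> = M0 + (C1 + 1 / d) powr ?p * (1 + norm x) powr ?p * vol * (2 * d)"
     using C1 d by (simp add: powr_mult)
    also have "\<dots> \<le> M0 * (1 + norm x) powr ?p + (C1 + 1 / d) powr ?p * (1 + norm x) powr ?p * vol * (2 * d)"
    proof -
     have "1 powr ?p \<le> (1 + norm x) powr ?p" using p by (intro powr_mono2) auto
     then show ?thesis using M0 by (simp add: mult_left_mono mult_le_cancel_left1)
    qed
    also have "\<dots> = K * (1 + norm x) powr ?p" by (simp add: K_def algebra_simps)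
    finally show "(LBINT y. f y r * bump m (1/16) (y - x)) \<le> K * (1 + norm x) powr ?p" .
   qed
  qed (use t d in auto)
  then show ?thesis by (simp add: mult_ac)
 qed
 moreover have "C * K \<ge> 0" using C K by simp
 ultimately show ?thesis by blast
qed

section \<open>Tools for the comparison argument: convexity, penalty function, barrier
  weight\<close>

text \<open>Convexity with weights \<open>1 - k\<close> and \<open>k\<close>. For small
  \<open>k\<close> the factor of \<open>A powr q\<close> is as close to 1 as desired, at the price
  of a large factor on \<open>B powr q\<close>.\<close>

lemma powr_add_le_weighted:
 fixes A B q :: real
 assumes q: "q > 1" and k: "0 < k" "k < 1" and AB: "A \<ge> 0" "B \<ge> 0"
 shows "(A + B) powr q \<le> (1 - k) powr (1 - q) * A powr q + k powr (1 - q) * B powr q"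
proof -
 have one: "c powr (1 - q) \<ge> 1" if "0 < c" "c < 1" for c
  using powr_mono'[of "1 - q" 0 c] that q by simp
 consider "A = 0" | "B = 0" | "A > 0" "B > 0" using AB by linarith
 then show ?thesis
 proof cases
  case 1
  then show ?thesis using one[OF k] q by (simp add: mult_le_cancel_right1)
 next
  case 2
  then show ?thesis using one[of "1 - k"] k q by (simp add: mult_le_cancel_right1)
 next
  case 3
  have "((1 - k) *\<^sub>R (A / (1 - k)) + k *\<^sub>R (B / k)) powr q
    \<le> (1 - k) * (A / (1 - k)) powr q + k * (B / k) powr q"
   using convex_onD[OF powr_convex[of q], of k "A / (1 - k)" "B / k"] 3 k q by simp
  also have "\<dots> = (1 - k) powr (1 - q) * A powr q + k powr (1 - q) * B powr q"
  proof -
   have "c * (X / c) powr q = c powr (1 - q) * X powr q" if "c > 0" "X > 0" for c X :: real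
    using that by (simp add: powr_divide powr_diff)
   then show ?thesis using 3 k by simp
  qed
  finally show ?thesis using k by simp
 qed
qed

lemma powr_add_le_two:
 fixes A B q :: real
 assumes q: "q \<ge> 0" and AB: "A \<ge> 0" "B \<ge> 0"
 shows "(A + B) powr q \<le> 2 powr q * (A powr q + B powr q)"
proof -
 have "(A + B) powr q \<le> (2 * max A B) powr q" using assms by (intro powr_mono2) auto
 also have "\<dots> = 2 powr q * max A B powr q" using AB by (simp add: powr_mult)
 also have "\<dots> \<le> 2 powr q * (A powr q + B powr q)" by (intro mult_left_mono) (auto simp: max_def)
 finally show ?thesis .
qed

text \<open>Only partial derivatives are given. Continuity of the time derivative yields joint
  differentiability, to which the chain rule along the moving point applies.\<close>

lemma C21_translate_derivative:
 fixes f :: "'a::euclidean_space => real => real"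
 assumes C21: "C21 a b f G D ft" and r: "r \<in> {a<..<b}"
 shows "((%r. f (x + (r - \<tau>) *\<^sub>R k) r) has_real_derivative
  ft (x + (r - \<tau>) *\<^sub>R k) r + G (x + (r - \<tau>) *\<^sub>R k) r \<bullet> k) (at r)"
proof -
 let ?x = "x + (r - \<tau>) *\<^sub>R k"
 have *: "((%(x, y). f x y) has_derivative (%(tx, ty). G ?x r \<bullet> tx + blinfun_apply (blinfun_mult_right (ft ?x r)) ty))
   (at (?x, r) within UNIV \<times> {a<..<b})"
 proof (rule has_derivative_partialsI)
  show "((%x. f x r) has_derivative (%tx. G ?x r \<bullet> tx)) (at ?x within UNIV)"
   using C21 r by (auto simp: C21_def C2_def)
  show "((%y. f x y) has_derivative blinfun_apply (blinfun_mult_right (ft x y))) (at y within {a<..<b})"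
   if "y \<in> {a<..<b}" for x y
   using C21 that by (auto simp: C21_def has_field_derivative_def intro: has_derivative_at_withinI)
  have "continuous_on (UNIV \<times> {a<..<b}) (%z. blinfun_mult_right (case z of (x, y) => ft x y))"
   using C21 by (intro bounded_linear.continuous_on[OF bounded_linear_blinfun_mult_right]) (auto simp: C21_def)
  then show "continuous (at (?x, r) within UNIV \<times> {a<..<b}) (%(x, y). blinfun_mult_right (ft x y))"
   using r by (simp add: continuous_on_eq_continuous_within split_beta')
 qed (use r in auto)
 have op: "at (?x, r) within UNIV \<times> {a<..<b} = at (?x, r)"
  by (rule at_within_open) (use r in \<open>auto intro!: open_Times\<close>)
 have d: "((%(x, y). f x y) has_derivative (%(tx, ty). G ?x r \<bullet> tx + ft ?x r * ty)) (at (?x, r))"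
  using * unfolding op blinfun_mult_right.rep_eq .
 have g: "((%r. (x + (r - \<tau>) *\<^sub>R k, r)) has_derivative (%h. (h *\<^sub>R k, h))) (at r)"
  by (auto intro!: derivative_eq_intros)
 show ?thesis
  unfolding has_field_derivative_def
  by (rule has_derivative_eq_rhs[OF has_derivative_compose[OF g d, unfolded split_beta fst_conv snd_conv]])
   (simp add: fun_eq_iff algebra_simps)
qed

text \<open>A penalty for negative \<open>y\<close>. The exponential gives
  \<open>Jp2 \<ge> K * (- Jp1)\<close>, as in a Hopf-Cole transformation; the cube of the positive
  part makes the function C2 and zero for \<open>y \<ge> 0\<close>.\<close>

definition Jp :: "real => real => real" where
 "Jp K y = max 0 (exp (- K * y) - 1) ^ 3"
definition Jp1 :: "real => real => real" where
 "Jp1 K y = - 3 * K * exp (- K * y) * max 0 (exp (- K * y) - 1) ^ 2"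
definition Jp2 :: "real => real => real" where
 "Jp2 K y = 3 * K ^ 2 * exp (- K * y) * max 0 (exp (- K * y) - 1) ^ 2
  + 6 * K ^ 2 * exp (- K * y) ^ 2 * max 0 (exp (- K * y) - 1)"

lemma Jp_derivative: "(Jp K has_real_derivative Jp1 K y) (at y)"
 and Jp1_derivative: "(Jp1 K has_real_derivative Jp2 K y) (at y)"
proof -
 have e: "((%y. exp (- K * y)) has_real_derivative - K * exp (- K * y)) (at y)"
  by (auto intro!: derivative_eq_intros)
 then have e1: "((%y. exp (- K * y) - 1) has_real_derivative - K * exp (- K * y)) (at y)"
  by (auto intro!: derivative_eq_intros)
 have p3: "((%x::real. max 0 x ^ 3) has_real_derivative 3 * max 0 x ^ 2) (at x)" for x
  using pos_power_derivative[of 1 x] by (simp add: numeral_eq_Suc)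
 have p2: "((%x::real. max 0 x ^ 2) has_real_derivative 2 * max 0 x) (at x)" for x
  using pos_power_derivative[of 0 x] by (simp add: numeral_eq_Suc)
 show "(Jp K has_real_derivative Jp1 K y) (at y)"
  unfolding Jp_def[abs_def] Jp1_def
  by (rule DERIV_cong[OF DERIV_chain'[OF e1 p3]]) (simp add: mult_ac)
 have "((%y. (- 3 * K * exp (- K * y)) * max 0 (exp (- K * y) - 1) ^ 2) has_real_derivative Jp2 K y) (at y)"
  by (rule DERIV_cong[OF DERIV_mult[OF DERIV_cmult[OF e] DERIV_chain'[OF e1 p2]]])
   (simp add: Jp2_def algebra_simps power2_eq_square)
 then show "(Jp1 K has_real_derivative Jp2 K y) (at y)"
  by (simp add: Jp1_def[abs_def] mult_ac)
qed

lemma Jp_continuous: "continuous_on A (Jp K)" "continuous_on A (Jp1 K)" "continuous_on A (Jp2 K)"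
 unfolding Jp_def[abs_def] Jp1_def[abs_def] Jp2_def[abs_def] by (intro continuous_intros)+

lemma Jp_nonneg_eq_0:
 assumes "K \<ge> 0" "y \<ge> 0"
 shows "Jp K y = 0" "Jp1 K y = 0" "Jp2 K y = 0"
proof -
 have "exp (- K * y) \<le> 1" using assms by simp
 then have "max 0 (exp (- K * y) - 1) = 0" by simp
 then show "Jp K y = 0" "Jp1 K y = 0" "Jp2 K y = 0"
  by (simp_all only: Jp_def Jp1_def Jp2_def) simp_all
qed

lemma Jp_ge_0: "Jp K y \<ge> 0"
 by (simp add: Jp_def)

lemma Jp1_le_0: "K \<ge> 0 ==> Jp1 K y \<le> 0"
 by (simp add: Jp1_def)

lemma Jp2_ge: "K \<ge> 0 ==> Jp2 K y \<ge> K * (- Jp1 K y)"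
 by (simp add: Jp1_def Jp2_def power2_eq_square mult_ac)

lemma Jp1_bound:
 assumes "K \<ge> 0" "y \<ge> - Y" "Y \<ge> 0"
 shows "- Jp1 K y \<le> 3 * K * exp (K * Y) ^ 3"
proof -
 have e: "exp (- K * y) \<le> exp (K * Y)" using mult_left_mono[OF assms(2,1)] by simp
 have "max 0 (exp (- K * y) - 1) \<le> exp (K * Y)"
  using order_trans[OF _ e, of "exp (- K * y) - 1"] by (simp del: exp_le_cancel_iff)
 then have "max 0 (exp (- K * y) - 1) ^ 2 \<le> exp (K * Y) ^ 2" by (intro power_mono) auto
 then have "(3 * K * exp (- K * y)) * max 0 (exp (- K * y) - 1) ^ 2 \<le> (3 * K * exp (K * Y)) * exp (K * Y) ^ 2"
  using e assms by (intro mult_mono) auto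
 then show ?thesis by (simp add: Jp1_def power3_eq_cube power2_eq_square mult_ac)
qed

lemma Jp_eq_0_imp: "K > 0 ==> Jp K y = 0 ==> y \<ge> 0"
proof -
 assume K: "K > 0" and 0: "Jp K y = 0"
 from 0 have "exp (- K * y) \<le> exp 0" by (simp add: Jp_def max_def split: if_splits)
 then show "y \<ge> 0" using K by (simp add: zero_le_mult_iff)
qed

text \<open>Evaluated at \<open>x \<bullet> x\<close> this is a smooth weight with the growth of
  \<open>norm x powr (2 * e)\<close>.\<close>

definition wt :: "real => real => real" where "wt e r = (1 + r) powr e"

lemma C2_wt:
 "C2 (%x::'a::euclidean_space. wt e (x \<bullet> x))
  (%x. (2 * (e * wt (e - 1) (x \<bullet> x))) *\<^sub>R x)
  (%x v. (4 * (e * (e - 1) * wt (e - 2) (x \<bullet> x)) * (x \<bullet> v)) *\<^sub>R x + (2 * (e * wt (e - 1) (x \<bullet> x))) *\<^sub>R v)"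
proof (rule C2_radial[where th = "wt e"])
 have d: "(wt e has_real_derivative e * wt (e - 1) r) (at r)" if "r \<ge> 0" for e r
  unfolding wt_def[abs_def] using that
  by (auto intro!: derivative_eq_intros simp: powr_diff)
 fix r :: real assume r: "r \<ge> 0"
 show "(wt e has_real_derivative e * wt (e - 1) r) (at r)" by (rule d[OF r])
 show "((%r. e * wt (e - 1) r) has_real_derivative e * (e - 1) * wt (e - 2) r) (at r)"
  using DERIV_cmult[OF d[OF r, of "e - 1"], of e] by (simp add: mult_ac)
next
 show "continuous_on {0..} (%r. e * (e - 1) * wt (e - 2) r)"
  unfolding wt_def by (intro continuous_intros) auto
qed

lemma wt_gradient_norm_le:
 assumes "e \<ge> 0"
 shows "norm ((2 * (e * wt (e - 1) (x \<bullet> x))) *\<^sub>R x) \<le> 2 * e * wt (e - 1/2) (x \<bullet> x)"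
proof -
 have "norm x = sqrt (x \<bullet> x)" by (rule norm_eq_sqrt_inner)
 also have "\<dots> \<le> sqrt (1 + x \<bullet> x)" by simp
 also have "\<dots> = wt (1/2) (x \<bullet> x)" by (simp add: wt_def powr_half_sqrt)
 finally have "wt (e - 1) (x \<bullet> x) * norm x \<le> wt (e - 1) (x \<bullet> x) * wt (1/2) (x \<bullet> x)"
  by (intro mult_left_mono) (auto simp: wt_def)
 also have "\<dots> = wt (e - 1/2) (x \<bullet> x)" by (simp add: wt_def flip: powr_add)
 finally have "(2 * e) * (wt (e - 1) (x \<bullet> x) * norm x) \<le> (2 * e) * wt (e - 1/2) (x \<bullet> x)"
  using assms by (intro mult_left_mono) auto
 moreover have "\<bar>2 * (e * wt (e - 1) (x \<bullet> x))\<bar> = 2 * (e * wt (e - 1) (x \<bullet> x))"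
  using assms by (intro abs_of_nonneg) (auto simp: wt_def)
 ultimately show ?thesis by simp
qed

lemma lap_wt_le:
 fixes x :: "'a::euclidean_space"
 assumes "e \<ge> 1"
 shows "lap (%v. (4 * (e * (e - 1) * wt (e - 2) (x \<bullet> x)) * (x \<bullet> v)) *\<^sub>R x + (2 * (e * wt (e - 1) (x \<bullet> x))) *\<^sub>R v)
  \<le> (4 * e ^ 2 + 2 * e * DIM('a)) * wt e (x \<bullet> x)"
proof -
 let ?r = "x \<bullet> x"
 have r: "?r \<ge> 0" by simp
 have mono: "wt (e - 1) ?r \<le> wt e ?r" unfolding wt_def by (intro powr_mono) auto
 have "wt (e - 2) ?r * ?r \<le> wt (e - 2) ?r * wt 1 ?r"
  by (intro mult_left_mono) (auto simp: wt_def)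
 also have "\<dots> = wt (e - 1) ?r" by (simp only: wt_def powr_add[symmetric]) simp
 finally have 1: "wt (e - 2) ?r * ?r \<le> wt e ?r" using mono by simp
 have "4 * (e * (e - 1) * wt (e - 2) ?r) * ?r = (4 * (e * (e - 1))) * (wt (e - 2) ?r * ?r)" by simp
 also have "\<dots> \<le> (4 * (e * e)) * wt e ?r"
  using assms 1 by (intro mult_mono) (auto simp: wt_def)
 finally have 2: "4 * (e * (e - 1) * wt (e - 2) ?r) * ?r \<le> 4 * e ^ 2 * wt e ?r"
  by (simp add: power2_eq_square)
 have 3: "(2 * (e * wt (e - 1) ?r)) * DIM('a) \<le> (2 * e * DIM('a)) * wt e ?r"
  using mult_left_mono[OF mono, of "2 * e * DIM('a)"] assms by (simp add: mult_ac)
 show ?thesis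
  unfolding lap_radial using 2 3 by (simp add: algebra_simps)
qed

lemma C2_translate_add:
 assumes "C2 f G D"
 shows "C2 (%x. f (x + c)) (%x. G (x + c)) (%x. D (x + c))"
 using C2_translate[OF assms, of "- c"] by simp

text \<open>The function \<open>y\<close> compares the solution with a multiple \<open>lam\<close> of the solution seen from a point moving
 with velocity \<open>k\<close>. By convexity of the Hamiltonian it is a supersolution of a similar equation, and
 \<open>zeta\<close> is a barrier that controls it near infinity.\<close>

lemma theta_functional_le:
 fixes f :: "'a::euclidean_space => real => real" and G :: "'a => real => 'a" and k :: 'a and \<tau> t lam kap eps R C K cst q :: real
 defines "p \<equiv> q / (q - 1)"
 defines "c3 \<equiv> kap powr (1 - q) * 2 powr q"
 defines "e \<equiv> (p + 1) / 2"
 defines "A \<equiv> 4 * e ^ 2 + 2 * e * DIM('a) + c3 * ((p + 1) * C) powr (q - 1) * (p + 1)"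
 defines "z \<equiv> %r. C / R * exp (A * (r - \<tau>))"
 defines "y \<equiv> %x r. f x r - lam * f (x + (r - \<tau>) *\<^sub>R k) r + z r * wt e (x \<bullet> x) + (lam * cst + eps) * (r - \<tau>)"
 defines "Gy \<equiv> %x r. G x r - lam *\<^sub>R G (x + (r - \<tau>) *\<^sub>R k) r + z r *\<^sub>R ((2 * (e * wt (e - 1) (x \<bullet> x))) *\<^sub>R x)"
 assumes sub: "subsol q a b f G D ft" and q: "q > 1"
  and st: "a < \<tau>" "\<tau> < t" "t < b"
  and lam: "0 < lam" "lam < 1" and kap: "0 < kap" "kap < 1 - lam"
  and eps: "eps \<ge> 0" and R: "R > 0" and C: "C > 0" and K: "K \<ge> 0"
  and cst: "\<And>m. m \<ge> 0 ==> norm k * m - (1 - (lam / (1 - kap)) powr (q - 1)) * m powr q \<le> cst"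
  and growth: "\<And>x r. r \<in> {\<tau>..t} ==> f (x + (r - \<tau>) *\<^sub>R k) r \<le> C * wt (p / 2) (x \<bullet> x)"
  and quad: "\<And>x r. r \<in> {\<tau>..t} ==> norm x \<le> R ==> c3 * norm (Gy x r) powr q \<le> eps + K * norm (Gy x r) ^ 2"
 shows "(\<integral>\<^sup>+x. ennreal (Jp K (y x t)) \<partial>lborel) \<le> ennreal (3 * K * exp (K * (C * wt (p / 2) (R ^ 2))) ^ 3 *
   integral {\<tau>..t} (%r. LBINT x. resid q G D ft x r * bump 0 (1 / (4 * R ^ 2)) x))"
proof -
 define X where "X x r = x + (r - \<tau>) *\<^sub>R k" for x r
 define M where "M = 3 * K * exp (K * (C * wt (p / 2) (R ^ 2))) ^ 3"
 define E where "E x r = resid q G D ft x r" for x r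
 define chi :: "'a => real" where "chi = bump 0 (1 / (4 * R ^ 2))"
 define DW where "DW x v = (4 * (e * (e - 1) * wt (e - 2) (x \<bullet> x)) * (x \<bullet> v)) *\<^sub>R x + (2 * (e * wt (e - 1) (x \<bullet> x))) *\<^sub>R v"
  for x v :: 'a
 define Dy where "Dy x r v = D x r v + (- lam) *\<^sub>R D (X x r) r v + z r *\<^sub>R DW x v" for x r v
 \<comment> \<open>The time derivative of \<open>y\<close>. In the constant slope,
   \<open>lam * cst\<close> pays for the transport of the shifted copy and \<open>eps\<close> for
   the part of the error that the quadratic term misses at small gradients.\<close>
 define yt where "yt x r = ft x r - lam * (ft (X x r) r + G (X x r) r \<bullet> k) + A * (z r * wt e (x \<bullet> x)) + (lam * cst + eps)" for x r
 have C21: "C21 a b f G D ft" using sub by (simp add: subsol_def)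
 have sub_st: "{\<tau>..t} \<subseteq> {a<..<b}" using st by auto
 note cf = C21_continuous[OF C21 sub_st]
 have p: "p > 1" using q by (simp add: p_def field_simps)
 have e: "e \<ge> 1" using p by (simp add: e_def)
 have pq: "(p - 1) * (q - 1) = 1" using q by (simp add: p_def field_simps)
 have c3: "c3 \<ge> 0" by (simp add: c3_def)
 have A: "A \<ge> 0" using e c3 p by (auto simp: A_def intro!: add_nonneg_nonneg mult_nonneg_nonneg)
 have z: "z r > 0" for r using C R by (simp add: z_def)
 have wt0: "wt c (x \<bullet> x) > 0" for c and x :: 'a
 proof -
  have "1 + x \<bullet> x > 0" by (simp add: add_pos_nonneg)
  then show ?thesis by (simp add: wt_def)
 qed
 have fnn: "f x r \<ge> 0" if "r \<in> {\<tau>..t}" for x r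
  using subsolD(3)[OF sub] that sub_st by auto
 have cst0: "cst \<ge> 0" using cst[of 0] q by simp
 have lower: "y x r \<ge> z r * wt e (x \<bullet> x) - C * wt (p / 2) (x \<bullet> x)" if r: "r \<in> {\<tau>..t}" for x r
 proof -
  have "lam * f (X x r) r \<le> 1 * f (X x r) r" using lam fnn[OF r] by (intro mult_right_mono) auto
  also have "\<dots> \<le> C * wt (p / 2) (x \<bullet> x)" using growth[OF r] by (simp add: X_def)
  finally have 1: "lam * f (X x r) r \<le> C * wt (p / 2) (x \<bullet> x)" .
  have "(lam * cst + eps) * (r - \<tau>) \<ge> 0"
   using lam cst0 eps r by (intro mult_nonneg_nonneg add_nonneg_nonneg) auto
  then show ?thesis using 1 fnn[OF r, of x] unfolding y_def X_def[symmetric] by linarith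
 qed
 \<comment> \<open>The barrier exponent \<open>e\<close> exceeds the growth exponent
   \<open>p / 2\<close> by 1/2, so the extra factor \<open>wt (1/2)\<close> beats the coefficient
   \<open>C / R\<close> once it reaches \<open>R\<close>. Hence \<open>y\<close> can be negative
   only where \<open>norm x < R\<close>, although \<open>f\<close> itself is unbounded.\<close>
 have outside: "y x r \<ge> 0" if r: "r \<in> {\<tau>..t}" and out: "wt (1/2) (x \<bullet> x) * exp (A * (r - \<tau>)) \<ge> R" for x r
 proof -
  have "C * wt (p / 2) (x \<bullet> x) \<le> C / R * (wt (1/2) (x \<bullet> x) * exp (A * (r - \<tau>))) * wt (p / 2) (x \<bullet> x)"
   using C R out less_imp_le[OF wt0] by (intro mult_right_mono) (auto simp: field_simps)
  also have "\<dots> = z r * (wt (1/2) (x \<bullet> x) * wt (p / 2) (x \<bullet> x))" by (simp add: z_def)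
  also have "wt (1/2) (x \<bullet> x) * wt (p / 2) (x \<bullet> x) = wt e (x \<bullet> x)"
   by (simp add: wt_def e_def add_divide_distrib add.commute flip: powr_add)
  finally show ?thesis using lower[OF r, of x] by simp
 qed
 have norm_le_wt: "norm x \<le> wt (1/2) (x \<bullet> x)" for x :: 'a
  by (simp add: wt_def powr_half_sqrt norm_eq_sqrt_inner)
 have ge_wt: "wt (1/2) (x \<bullet> x) \<le> wt (1/2) (x \<bullet> x) * exp (A * (r - \<tau>))" if "r \<in> {\<tau>..t}" for x :: 'a and r
  using wt0[of "1/2" x] A that by (simp add: mult_le_cancel_left1)
 have far: "y x r \<ge> 0" if "r \<in> {\<tau>..t}" "norm x \<ge> R" for x r
  using outside[OF that(1), of x] norm_le_wt[of x] ge_wt[OF that(1), of x] that(2) by linarith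
 have cX: "continuous_on (UNIV \<times> {\<tau>..t}) (%w. h (X (fst w) (snd w)) (snd w))"
  if "continuous_on (UNIV \<times> {\<tau>..t}) (%(x, r). h x r)" for h :: "'a => real => 'b::topological_space"
  by (rule continuous_on_compose_pair[OF that]) (auto simp: X_def intro!: continuous_intros)
 have cwt: "continuous_on B (%w. wt c (g w \<bullet> g w))" if "continuous_on B g" for c B and g :: "'b::topological_space => 'a"
  unfolding wt_def using that by (intro continuous_intros) (auto simp: add_nonneg_eq_0_iff)
 have cy: "continuous_on (UNIV \<times> {\<tau>..t}) (%(x, r). y x r)"
  using cf(1) cX[OF cf(1)] unfolding y_def X_def[symmetric] split_beta z_def
  by (intro continuous_intros cwt)
 have cGy: "continuous_on (UNIV \<times> {\<tau>..t}) (%(x, r). Gy x r)"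
  using cf(2) cX[OF cf(2)] unfolding Gy_def X_def[symmetric] split_beta z_def
  by (intro continuous_intros cwt)
 have cyt: "continuous_on (UNIV \<times> {\<tau>..t}) (%(x, r). yt x r)"
  using cf(4) cX[OF cf(4)] cX[OF cf(2)] unfolding yt_def split_beta z_def
  by (intro continuous_intros cwt)
 have cE: "continuous_on (UNIV \<times> {\<tau>..t}) (%(x, r). E x r)"
  unfolding E_def by (rule resid_continuous[OF C21 sub_st]) (use q in simp)
 have cchi: "continuous_on B chi" for B
  using C2_continuous(1)[OF C2_bump] continuous_on_subset unfolding chi_def by blast
 have chi_far: "chi x = 0" if "norm x > 3 * R" for x
 proof -
  have "sqrt (5 / (4 * (1 / (4 * R ^ 2)))) = sqrt 5 * R" using R by (simp add: real_sqrt_mult)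
  also have "\<dots> \<le> 3 * R" using R by (intro mult_right_mono real_le_lsqrt) auto
  finally have *: "sqrt (5 / (4 * (1 / (4 * R ^ 2)))) \<le> 3 * R" .
  then show ?thesis
   unfolding chi_def using R that bump_eq_0[of "1 / (4 * R ^ 2)" x 0] by auto
 qed
 define F where "F r = (LBINT x. Jp K (y x r))" for r
 have der: "(F has_real_derivative (LBINT x. Jp1 K (y x r) * yt x r)) (at r within {\<tau>..t})" if r: "r \<in> {\<tau>..t}" for r
  unfolding F_def
 proof (rule leibniz_compact_support[where R = R])
  fix x r assume r: "r \<in> {\<tau>..t}"
  show "norm x > R ==> Jp K (y x r) = 0" using far[OF r, of x] Jp_nonneg_eq_0[OF K] by auto
  have r': "r \<in> {a<..<b}" using r sub_st by auto
  have d1: "(f x has_real_derivative ft x r) (at r)" by (rule subsolD[OF sub r'])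
  have d2: "((%r. f (X x r) r) has_real_derivative ft (X x r) r + G (X x r) r \<bullet> k) (at r)"
   unfolding X_def by (rule C21_translate_derivative[OF C21 r'])
  have d3: "(z has_real_derivative A * z r) (at r)"
   unfolding z_def using R by (auto intro!: derivative_eq_intros)
  have "(y x has_real_derivative yt x r) (at r)"
   unfolding y_def X_def[symmetric] yt_def
   using d1 d2 d3 by (auto intro!: derivative_eq_intros)
  from DERIV_chain'[OF this Jp_derivative]
  have "((%r. Jp K (y x r)) has_real_derivative Jp1 K (y x r) * yt x r) (at r)"
   by simp
  then show "((%r. Jp K (y x r)) has_real_derivative Jp1 K (y x r) * yt x r) (at r within {\<tau>..t})"
   by (rule has_field_derivative_at_within)
 next
  fix r assume r: "r \<in> {\<tau>..t}"
  show "continuous_on UNIV (%x. Jp K (y x r))"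
   by (rule continuous_on_compose2[OF Jp_continuous(1)[of UNIV] continuous_on_slice[OF cy r]]) auto
 next
  show "continuous_on (UNIV \<times> {\<tau>..t}) (%(x, r). Jp1 K (y x r) * yt x r)"
   using cy cyt unfolding split_beta
   by (intro continuous_intros continuous_on_compose2[OF Jp_continuous(2)[of UNIV]]) auto
 qed (use st r in auto)
 \<comment> \<open>The supersolution inequality for \<open>y\<close>, up to the defect and a
   quadratic gradient term. It is needed only where \<open>y\<close> is negative, and there the
   barrier is under control.\<close>
 have key: "yt x r - lap (Dy x r) \<ge> - E x r - K * norm (Gy x r) ^ 2"
  if r: "r \<in> {\<tau>..t}" and neg: "y x r < 0" for x r
 proof -
  have r': "r \<in> {a<..<b}" using r sub_st by auto
  define w where "w = wt (1/2) (x \<bullet> x)"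
  have D1: "w * exp (A * (r - \<tau>)) \<le> R" using outside[OF r, of x] neg unfolding w_def by linarith
  have w: "w > 0" using wt0 by (simp add: w_def)
  have xR: "norm x \<le> R" using norm_le_wt[of x] ge_wt[OF r, of x] D1 unfolding w_def by linarith
  define p1 where "p1 = G (X x r) r"
  define p2 where "p2 = G x r"
  define gz where "gz = z r *\<^sub>R ((2 * (e * wt (e - 1) (x \<bullet> x))) *\<^sub>R x)"
  have gy: "Gy x r = p2 - lam *\<^sub>R p1 + gz" by (simp add: Gy_def p1_def p2_def gz_def X_def)
  define sg where "sg = 1 - (lam / (1 - kap)) powr (q - 1)"
  \<comment> \<open>The gradient \<open>p2\<close> is \<open>lam *\<^sub>R p1\<close> plus the
    remainder \<open>Gy x r - gz\<close>. Convexity with weight \<open>kap\<close> on the remainder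
    leaves the factor \<open>lam * (1 - sg)\<close> on \<open>norm p1 powr q\<close>. As this is
    less than \<open>lam\<close>, some absorption is saved.\<close>
  have "norm p2 powr q \<le> (norm (lam *\<^sub>R p1) + norm (Gy x r - gz)) powr q"
   using q norm_triangle_ineq[of "lam *\<^sub>R p1" "Gy x r - gz"] gy by (intro powr_mono2) auto
  also have "\<dots> \<le> (1 - kap) powr (1 - q) * norm (lam *\<^sub>R p1) powr q + kap powr (1 - q) * norm (Gy x r - gz) powr q"
   by (rule powr_add_le_weighted) (use q kap lam in auto)
  also have "(1 - kap) powr (1 - q) * norm (lam *\<^sub>R p1) powr q = lam * (1 - sg) * norm p1 powr q"
  proof -
   have "norm (lam *\<^sub>R p1) powr q = (lam * norm p1) powr q" using lam by simp
   also have "\<dots> = lam powr q * norm p1 powr q" using lam by (simp add: powr_mult)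
   also have "lam powr q = lam * lam powr (q - 1)" using lam by (simp add: powr_diff)
   also have "lam powr (q - 1) = (1 - sg) * (1 - kap) powr (q - 1)"
    using lam kap by (simp add: sg_def powr_divide)
   finally have "(1 - kap) powr (1 - q) * norm (lam *\<^sub>R p1) powr q
     = ((1 - kap) powr (1 - q) * (1 - kap) powr (q - 1)) * (lam * (1 - sg) * norm p1 powr q)" by (simp only: mult_ac)
   also have "(1 - kap) powr (1 - q) * (1 - kap) powr (q - 1) = 1" using kap lam by (simp flip: powr_add)
   finally show ?thesis by simp
  qed
  finally have 1: "norm p2 powr q \<le> lam * (1 - sg) * norm p1 powr q + kap powr (1 - q) * norm (Gy x r - gz) powr q" .
  have "norm (Gy x r - gz) powr q \<le> (norm (Gy x r) + norm gz) powr q"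
   using q norm_triangle_ineq4[of "Gy x r" gz] by (intro powr_mono2) auto
  also have "\<dots> \<le> 2 powr q * (norm (Gy x r) powr q + norm gz powr q)"
   by (rule powr_add_le_two) (use q in auto)
  finally have 2: "kap powr (1 - q) * norm (Gy x r - gz) powr q \<le> c3 * norm (Gy x r) powr q + c3 * norm gz powr q"
   using mult_left_mono[of _ _ "kap powr (1 - q)"] by (fastforce simp: c3_def algebra_simps)
  \<comment> \<open>The saved amount \<open>lam * sg * norm p1 powr q\<close> pays for the transport
    with velocity \<open>k\<close>, up to the constant \<open>cst\<close>.\<close>
  have "p1 \<bullet> k \<le> norm k * norm p1" using norm_cauchy_schwarz[of p1 k] by (simp add: mult.commute)
  then have "p1 \<bullet> k - sg * norm p1 powr q \<le> cst"
   using cst[of "norm p1"] unfolding sg_def by simp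
  then have "lam * (p1 \<bullet> k - sg * norm p1 powr q) \<le> lam * cst"
   using lam by (intro mult_left_mono) auto
  then have 3: "lam * norm p1 powr q - lam * (1 - sg) * norm p1 powr q - lam * (p1 \<bullet> k) + lam * cst \<ge> 0"
   by (simp add: algebra_simps)
  \<comment> \<open>Where \<open>y < 0\<close> one has \<open>z r * w \<le> C\<close>. This bounds
    \<open>norm gz powr (q - 1)\<close> by a multiple of \<open>w\<close>, so the superlinear
    gradient term of the barrier becomes linear in the barrier, and the exponential rate
    \<open>A\<close> absorbs it.\<close>
  have 4: "c3 * norm gz powr q + lap (%v. z r *\<^sub>R DW x v) \<le> A * (z r * wt e (x \<bullet> x))"
  proof -
   have "norm gz \<le> z r * (2 * e * wt (e - 1/2) (x \<bullet> x))"
    unfolding gz_def norm_scaleR[of "z r"] using z[of r] e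
    by (simp only: abs_of_pos) (intro mult_left_mono wt_gradient_norm_le, auto)
   also have "2 * e = p + 1" by (simp add: e_def)
   also have "e - 1/2 = p / 2" by (simp add: e_def add_divide_distrib)
   finally have g1: "norm gz \<le> z r * ((p + 1) * wt (p / 2) (x \<bullet> x))" .
   have zw: "z r * w \<le> C"
   proof -
    have "z r * w = C / R * (w * exp (A * (r - \<tau>)))" by (simp add: z_def)
    also have "\<dots> \<le> C / R * R" using D1 C R by (intro mult_left_mono) auto
    finally show ?thesis using R by simp
   qed
   have wsplit: "wt (p / 2) (x \<bullet> x) = w * wt ((p - 1) / 2) (x \<bullet> x)"
    unfolding w_def by (simp add: wt_def diff_divide_distrib flip: powr_add)
   have "z r * ((p + 1) * wt (p / 2) (x \<bullet> x)) = (p + 1) * (z r * w) * wt ((p - 1) / 2) (x \<bullet> x)"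
    by (simp add: wsplit)
   also have "\<dots> \<le> (p + 1) * C * wt ((p - 1) / 2) (x \<bullet> x)"
    using zw p less_imp_le[OF wt0] by (intro mult_right_mono mult_left_mono) auto
   finally have "norm gz powr (q - 1) \<le> ((p + 1) * C * wt ((p - 1) / 2) (x \<bullet> x)) powr (q - 1)"
    using g1 q by (intro powr_mono2) auto
   also have "\<dots> = ((p + 1) * C) powr (q - 1) * wt ((p - 1) / 2) (x \<bullet> x) powr (q - 1)"
    using p C less_imp_le[OF wt0] by (subst powr_mult) auto
   also have "wt ((p - 1) / 2) (x \<bullet> x) powr (q - 1) = w"
    using pq by (simp add: wt_def w_def powr_powr)
   finally have g2: "norm gz powr (q - 1) \<le> ((p + 1) * C) powr (q - 1) * w" .
   have "norm gz powr q = norm gz powr (q - 1) * norm gz"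
    by (cases "norm gz = 0") (use q in \<open>auto simp: powr_diff\<close>)
   also have "\<dots> \<le> (((p + 1) * C) powr (q - 1) * w) * (z r * ((p + 1) * wt (p / 2) (x \<bullet> x)))"
    using g1 g2 w by (intro mult_mono) auto
   also have "\<dots> = ((p + 1) * C) powr (q - 1) * (p + 1) * (z r * (w * wt (p / 2) (x \<bullet> x)))" by simp
   also have "w * wt (p / 2) (x \<bullet> x) = wt e (x \<bullet> x)"
    by (simp add: w_def wt_def e_def add_divide_distrib add.commute flip: powr_add)
   finally have g3: "c3 * norm gz powr q \<le> c3 * (((p + 1) * C) powr (q - 1) * (p + 1) * (z r * wt e (x \<bullet> x)))"
    using c3 by (rule mult_left_mono)
   have "lap (%v. z r *\<^sub>R DW x v) = z r * lap (DW x)" by (rule lap_cmult)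
   also have "\<dots> \<le> z r * ((4 * e ^ 2 + 2 * e * DIM('a)) * wt e (x \<bullet> x))"
    unfolding DW_def using z[of r] e by (intro mult_left_mono lap_wt_le) auto
   finally show ?thesis using g3 unfolding A_def by (simp add: algebra_simps)
  qed
  have 5: "lap (Dy x r) = lap (D x r) - lam * lap (D (X x r) r) + lap (%v. z r *\<^sub>R DW x v)"
   unfolding Dy_def lap_add lap_cmult[of "- lam"] by simp
  have 6: "ft x r = lap (D x r) - norm p2 powr q - E x r" by (simp add: E_def resid_def p2_def)
  have "ft (X x r) r \<le> lap (D (X x r) r) - norm p1 powr q"
   using subsolD(4)[OF sub r', of "X x r"] by (simp add: resid_def p1_def)
  then have 7: "lam * ft (X x r) r \<le> lam * lap (D (X x r) r) - lam * norm p1 powr q"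
   using mult_left_mono[of _ _ lam] lam by (fastforce simp: algebra_simps)
  have 8: "yt x r = ft x r - lam * ft (X x r) r - lam * (p1 \<bullet> k) + A * (z r * wt e (x \<bullet> x)) + lam * cst + eps"
   by (simp add: yt_def p1_def algebra_simps)
  show ?thesis
   using 1 2 3 4 5 6 7 8 quad[OF r xR] by linarith
 qed
 \<comment> \<open>Only the defect of \<open>f\<close> at the unshifted point appears: the shifted
   copy enters \<open>y\<close> with a negative sign, so there the subsolution property alone helps.
   The factor \<open>M\<close> bounds \<open>- Jp1\<close> on the region where \<open>y\<close> is
   negative.\<close>
 have le: "(LBINT x. Jp1 K (y x r) * yt x r) \<le> M * (LBINT x. E x r * chi x)" if r: "r \<in> {\<tau>..t}" for r
 proof -
  have r': "r \<in> {a<..<b}" using r sub_st by auto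
  note C2f = subsolD(1)[OF sub r']
  have "C2 (%x. f x r + (- lam) * f (x + (r - \<tau>) *\<^sub>R k) r + z r * wt e (x \<bullet> x) + (lam * cst + eps) * (r - \<tau>))
   (%x. G x r + (- lam) *\<^sub>R G (x + (r - \<tau>) *\<^sub>R k) r + z r *\<^sub>R ((2 * (e * wt (e - 1) (x \<bullet> x))) *\<^sub>R x) + 0)
   (%x v. D x r v + (- lam) *\<^sub>R D (x + (r - \<tau>) *\<^sub>R k) r v + z r *\<^sub>R DW x v + 0)"
   unfolding DW_def
   by (intro C2_add C2_cmult C2_const C2_wt C2f C2_translate_add[OF C2f])
  then have C2y: "C2 (%x. y x r) (%x. Gy x r) (%x. Dy x r)"
   by (simp add: y_def[abs_def] Gy_def[abs_def] Dy_def[abs_def] X_def)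
  note cyr = C2_continuous[OF C2y] C2_lap_continuous[OF C2y]
  have cJ1: "continuous_on UNIV (%x. Jp1 K (y x r))"
   by (rule continuous_on_compose2[OF Jp_continuous(2)[of UNIV] cyr(1)]) auto
  have cJ2: "continuous_on UNIV (%x. Jp2 K (y x r))"
   by (rule continuous_on_compose2[OF Jp_continuous(3)[of UNIV] cyr(1)]) auto
  have J0: "Jp1 K (y x r) = 0 \<and> Jp2 K (y x r) = 0" if "norm x > R" for x
   using far[OF r, of x] that Jp_nonneg_eq_0[OF K] by auto
  have dJ: "((%x. Jp1 K (y x r)) has_derivative (%h. (Jp2 K (y x r) *\<^sub>R Gy x r) \<bullet> h)) (at x)" for x
  proof -
   have "((%x. y x r) has_derivative (%h. Gy x r \<bullet> h)) (at x)" using C2y by (auto simp: C2_def)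
   from has_derivative_compose[OF this, of "Jp1 K" "(*) (Jp2 K (y x r))"] Jp1_derivative[of K "y x r"]
   show ?thesis by (simp add: has_field_derivative_def)
  qed
  have green: "(LBINT x. lap (Dy x r) * Jp1 K (y x r)) = - (LBINT x. Gy x r \<bullet> (Jp2 K (y x r) *\<^sub>R Gy x r))"
   by (rule C2_green[OF C2y dJ _, where R = R]) (use J0 in \<open>auto intro!: continuous_intros cJ2 cyr\<close>)
  have i1: "integrable lborel (%x. h x * Jp1 K (y x r))" if "continuous_on UNIV h" for h
   by (rule integrable_compact_support[where R = R]) (use J0 that in \<open>auto intro!: continuous_intros cJ1\<close>)
  have i2: "integrable lborel (%x. Gy x r \<bullet> (Jp2 K (y x r) *\<^sub>R Gy x r))"
   by (rule integrable_compact_support[where R = R]) (use J0 in \<open>auto intro!: continuous_intros cJ2 cyr\<close>)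
  have i3: "integrable lborel (%x. E x r * chi x)"
   by (rule integrable_compact_support[where R = "3 * R"])
    (use chi_far in \<open>auto intro!: continuous_intros cchi continuous_on_slice[OF cE r]\<close>)
  note cytr = continuous_on_slice[OF cyt r]
  have "(LBINT x. Jp1 K (y x r) * yt x r)
   = (LBINT x. (yt x r - lap (Dy x r)) * Jp1 K (y x r) - Gy x r \<bullet> (Jp2 K (y x r) *\<^sub>R Gy x r))"
   using i1[OF cytr] i1[OF cyr(3)] i2 green by (simp add: left_diff_distrib mult.commute[of "Jp1 K _"])
  also have "\<dots> \<le> (LBINT x. M * (E x r * chi x))"
  proof (rule integral_mono)
   show "integrable lborel (%x. (yt x r - lap (Dy x r)) * Jp1 K (y x r) - Gy x r \<bullet> (Jp2 K (y x r) *\<^sub>R Gy x r))"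
    using i1[OF cytr] i1[OF cyr(3)] i2 by (simp add: left_diff_distrib)
   show "integrable lborel (%x. M * (E x r * chi x))" using i3 by simp
   fix x
   have E0: "E x r \<ge> 0" unfolding E_def by (rule subsolD(4)[OF sub r'])
   have M0: "M \<ge> 0" using K by (simp add: M_def)
   have chi0: "chi x \<ge> 0" by (simp add: chi_def bump_bounds)
   show "(yt x r - lap (Dy x r)) * Jp1 K (y x r) - Gy x r \<bullet> (Jp2 K (y x r) *\<^sub>R Gy x r) \<le> M * (E x r * chi x)"
   proof (cases "y x r \<ge> 0")
    case True
    then show ?thesis using Jp_nonneg_eq_0[OF K True] E0 M0 chi0 by simp
   next
    case False
    then have neg: "y x r < 0" by simp
    have xR: "norm x < R" using far[OF r, of x] neg by linarith
    have "norm x ^ 2 \<le> R ^ 2" using xR by (intro power_mono) auto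
    then have xx: "x \<bullet> x \<le> R ^ 2" by (simp add: power2_norm_eq_inner)
    then have chi1: "chi x = 1" unfolding chi_def using R by (intro bump_eq_1) (simp add: field_simps)
    define j where "j = - Jp1 K (y x r)"
    have j0: "j \<ge> 0" using Jp1_le_0[OF K] by (simp add: j_def)
    have Y: "y x r \<ge> - (C * wt (p / 2) (R ^ 2))"
    proof -
     have "wt (p / 2) (x \<bullet> x) \<le> wt (p / 2) (R ^ 2)"
      unfolding wt_def using xx p by (intro powr_mono2) (auto simp: add_pos_nonneg)
     then have "C * wt (p / 2) (x \<bullet> x) \<le> C * wt (p / 2) (R ^ 2)" using C by simp
     then show ?thesis using lower[OF r, of x] z[of r] wt0[of e x] mult_pos_pos[OF z[of r] wt0[of e x]] by linarith
    qed
    have jM: "j \<le> M" unfolding j_def M_def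
     by (rule Jp1_bound[OF K Y]) (use C in \<open>auto simp: wt_def\<close>)
    have "(yt x r - lap (Dy x r)) * Jp1 K (y x r) = - ((yt x r - lap (Dy x r)) * j)" by (simp add: j_def)
    also have "\<dots> \<le> - ((- E x r - K * norm (Gy x r) ^ 2) * j)"
     using key[OF r neg] j0 by (simp only: neg_le_iff_le mult_right_mono)
    also have "\<dots> = E x r * j + (K * j) * norm (Gy x r) ^ 2" by (simp add: algebra_simps)
    \<comment> \<open>The quadratic gradient error is absorbed by the second derivative of the
      penalty, which Green's identity has produced.\<close>
    also have "(K * j) * norm (Gy x r) ^ 2 \<le> Jp2 K (y x r) * norm (Gy x r) ^ 2"
     using Jp2_ge[OF K, of "y x r"] unfolding j_def by (intro mult_right_mono) auto
    also have "Jp2 K (y x r) * norm (Gy x r) ^ 2 = Gy x r \<bullet> (Jp2 K (y x r) *\<^sub>R Gy x r)"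
     by (simp add: power2_norm_eq_inner)
    also have "E x r * j \<le> E x r * M" using E0 jM by (rule mult_left_mono[rotated])
    finally show ?thesis using chi1 by (simp add: mult_ac)
   qed
  qed
  finally show ?thesis by simp
 qed
 have "F t - F \<tau> \<le> integral {\<tau>..t} (%r. M * (LBINT x. E x r * chi x))"
 proof (rule increment_le_integral_of_derivative_le[OF _ der le])
  show "continuous_on {\<tau>..t} (%r. M * (LBINT x. E x r * chi x))"
  proof (intro continuous_intros continuous_on_lborel_integral[where R = "3 * R"])
   show "E x r * chi x = 0" if "norm x > 3 * R" for x r using chi_far[OF that] by simp
   show "continuous_on (UNIV \<times> {\<tau>..t}) (%(x, r). E x r * chi x)"
    using cE unfolding split_beta by (intro continuous_intros continuous_on_compose2[OF cchi[of UNIV]]) auto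
  qed
 qed (use st in auto)
 \<comment> \<open>At the initial time there is no shift yet, so \<open>y\<close> is at least
   \<open>(1 - lam) * f\<close>, which is nonnegative.\<close>
 moreover have "F \<tau> = 0"
 proof -
  have "y x \<tau> \<ge> 0" for x
  proof -
   have "lam * f x \<tau> \<le> 1 * f x \<tau>" using lam fnn[of \<tau> x] st by (intro mult_right_mono) auto
   then show ?thesis using z[of \<tau>] wt0[of e x] by (simp add: y_def)
  qed
  then show ?thesis unfolding F_def using Jp_nonneg_eq_0[OF K] by simp
 qed
 ultimately have "F t \<le> M * integral {\<tau>..t} (%r. LBINT x. E x r * chi x)"
  by simp
 moreover have "integrable lborel (%x. Jp K (y x t))"
 proof (rule integrable_compact_support[where R = R])
  have t: "t \<in> {\<tau>..t}" using st by simp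
  show "continuous_on UNIV (%x. Jp K (y x t))"
   by (rule continuous_on_compose2[OF Jp_continuous(1)[of UNIV] continuous_on_slice[OF cy t]]) auto
  show "norm x > R ==> Jp K (y x t) = 0" for x
   using far[OF t, of x] Jp_nonneg_eq_0[OF K] by auto
 qed
 then have "(\<integral>\<^sup>+x. ennreal (Jp K (y x t)) \<partial>lborel) = ennreal (F t)"
  unfolding F_def by (intro nn_integral_eq_integral) (auto simp: Jp_ge_0)
 ultimately show ?thesis
  by (simp add: M_def E_def chi_def ennreal_leI)
qed

lemma compact_continuous_abs_bound:
 fixes f :: "'b::topological_space => real"
 assumes "continuous_on S f" "compact S"
 obtains B where "\<And>x. x \<in> S ==> \<bar>f x\<bar> \<le> B"
proof -
 have "bounded (f ` S)" using assms by (intro compact_imp_bounded compact_continuous_image)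
 then have "\<exists>B. \<forall>x\<in>S. \<bar>f x\<bar> \<le> B" by (simp add: bounded_iff)
 then show thesis using that by blast
qed

text \<open>Up to the threshold \<open>m0\<close> the constant \<open>e\<close> suffices. Beyond it
  \<open>m powr (q - 2)\<close> is at most \<open>m0 powr (q - 2)\<close>, because
  \<open>q \<le> 2\<close>.\<close>

lemma powr_le_quadratic:
 fixes c e q :: real
 assumes q: "0 < q" "q \<le> 2" and c: "c \<ge> 0" and e: "e > 0"
 shows "\<exists>K>0. \<forall>m\<ge>0. c * m powr q \<le> e + K * m ^ 2"
proof -
 define m0 where "m0 = (e / (c + 1)) powr (1 / q)"
 have m0: "m0 > 0" using c e by (simp add: m0_def)
 have "c * m powr q \<le> e + (c * m0 powr (q - 2) + 1) * m ^ 2" if m: "m \<ge> 0" for m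
 proof (cases "m \<le> m0")
  case True
  then have "m powr q \<le> m0 powr q" using m q by (intro powr_mono2) auto
  also have "m0 powr q = e / (c + 1)" using c e q by (simp add: m0_def powr_powr)
  finally have "c * m powr q \<le> c * (e / (c + 1))" using c by (rule mult_left_mono)
  also have "\<dots> \<le> e" using c e by (simp add: field_simps)
  finally show ?thesis using c m0 by (simp add: add_increasing2)
 next
  case False
  then have mp: "m > 0" using m0 by linarith
  have "m powr q = m powr (q - 2) * m powr 2" by (simp only: powr_add[symmetric]) simp
  also have "\<dots> \<le> m0 powr (q - 2) * m powr 2"
   using False m0 q by (intro mult_right_mono powr_mono2') auto
  also have "m powr 2 = m ^ 2" using mp by (simp add: powr_numeral)
  finally have "c * m powr q \<le> c * (m0 powr (q - 2) * m ^ 2)" using c by (rule mult_left_mono)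
  also have "\<dots> \<le> e + (c * m0 powr (q - 2) + 1) * m ^ 2"
   using e by (simp add: algebra_simps)
  finally show ?thesis .
 qed
 then show ?thesis using c by (intro exI[of _ "c * m0 powr (q - 2) + 1"]) (auto simp: add_nonneg_pos)
qed

lemma AE_dense:
 assumes "AE t in lborel. (a::real) < t \<and> t < b --> P t" "a < b"
 shows "\<exists>t. a < t \<and> t < b \<and> P t"
proof (rule ccontr)
 assume "\<not> ?thesis"
 with assms(1) have "AE t in lborel. t \<notin> {a<..<b}"
  by (auto elim!: eventually_mono)
 then have "emeasure lborel {a<..<b} = 0"
  by (subst (asm) AE_iff_measurable[of "{a<..<b}"]) auto
 then show False using assms(2) by simp
qed

lemma AE_lborel_translate:
 fixes h :: "'b::euclidean_space"
 assumes "AE x in lborel. P x"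
 shows "AE x in lborel. P (x + h)"
proof -
 obtain N where N: "{x. \<not> P x} \<subseteq> N" "emeasure lborel N = 0" "N \<in> sets lborel"
  using assms by (auto elim!: AE_E)
 have "emeasure lborel ((+) h -` N) = emeasure (distr lborel borel ((+) h)) N"
  using N by (subst emeasure_distr) auto
 also have "\<dots> = 0" using N by (simp add: lborel_distr_plus)
 finally have "(+) h -` N \<in> null_sets lborel"
  using N measurable_sets[of "(+) h" lborel borel N] by (auto intro!: null_setsI)
 then show ?thesis
  by (rule AE_I') (use N in \<open>auto simp: add.commute\<close>)
qed

section \<open>Approximable solutions and uniform growth\<close>

text \<open>The weight of the defect is a bump that equals 1 on \<open>cball 0 R\<close>. The shift
  condition says that affine inequalities of \<open>v\<close> near time \<open>t\<close> survive the
  approximation, as they do under averaging. The last clause fixes the gradient for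
  \<open>q > 2\<close>, so that its bounds on compact sets are uniform in \<open>n\<close>.\<close>

definition approximants :: "real => real => real => real => ('a::euclidean_space => real => real) =>
  (nat => 'a => real => real) => (nat => 'a => real => 'a) =>
  (nat => 'a => real => 'a => 'a) => (nat => 'a => real => real) => bool" where
 "approximants q a b R v f G D ft \<longleftrightarrow>
  (\<forall>n. subsol q a b (f n) (G n) (D n) (ft n)) \<and>
  (\<forall>s t. a < s \<and> s < t \<and> t < b -->
   (%n. integral {s..t} (%r. LBINT x. resid q (G n) (D n) (ft n) x r * bump 0 (1 / (4 * R ^ 2)) x)) \<longlonglongrightarrow> 0) \<and>
  (AE t in lborel. a < t \<and> t < b --> (%n. \<integral>\<^sup>+x\<in>cball 0 R. ennreal \<bar>f n x t - v x t\<bar> \<partial>lborel) \<longlonglongrightarrow> 0) \<and>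
  (\<forall>\<delta>>0. \<exists>n0. \<forall>n\<ge>n0. \<forall>t A B h. a + \<delta> < t \<and> t < b - \<delta> \<and> A \<ge> 0 \<and>
   (AE r in lborel. \<bar>r - t\<bar> < \<delta> --> (AE x in lborel. v (x + h) r \<le> A * v x r + B)) -->
   (\<forall>x. f n (x + h) t \<le> A * f n x t + B)) \<and>
  (q \<le> 2 \<or> (\<forall>n. G n = G 0))"

text \<open>A common setting for classical and weak solutions. The time slices of \<open>v\<close>
  are Borel and nonnegative at every real time, and continuity in time is in local L1 inside
  \<open>(0, T0)\<close>, with \<open>T0\<close> finite.\<close>

locale approximable =
 fixes q T0 :: real and v :: "'a::euclidean_space => real => real"
 assumes q: "q > 1" and T0: "T0 > 0"
  and v_measurable [measurable]: "\<And>t. (%x. v x t) \<in> borel_measurable borel"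
  and v_nonneg: "\<And>x t. v x t \<ge> 0"
  and v_integrable: "\<And>t R. 0 < t ==> t < T0 ==> set_integrable lborel (cball 0 R) (%x. v x t)"
  and v_continuous: "\<And>t R. 0 < t ==> t < T0 ==>
   ((%s. \<integral>\<^sup>+x\<in>cball 0 R. ennreal \<bar>v x s - v x t\<bar> \<partial>lborel) \<longlongrightarrow> 0) (at t)"
  and approx: "\<And>a b R. 0 < a ==> a < b ==> b < T0 ==> R > 0 ==> \<exists>f G D ft. approximants q a b R v f G D ft"
begin

lemma integrable_v_mult:
 assumes t: "0 < t" "t < T0" and c: "continuous_on UNIV \<psi>" and supp: "\<And>x. norm x > R ==> \<psi> x = 0"
 shows "integrable lborel (%x. v x t * \<psi> x)"
proof -
 have [measurable]: "\<psi> \<in> borel_measurable borel" using c by (rule borel_measurable_continuous_onI)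
 obtain B where B: "\<And>x. x \<in> cball 0 R ==> \<bar>\<psi> x\<bar> \<le> B"
  using compact_continuous_abs_bound[OF continuous_on_subset[OF c] compact_cball] by blast
 have "integrable lborel (%x. B * (indicator (cball 0 R) x *\<^sub>R v x t))"
  using v_integrable[OF t] by (simp add: set_integrable_def)
 then show ?thesis
 proof (rule Bochner_Integration.integrable_bound)
  show "AE x in lborel. norm (v x t * \<psi> x) \<le> norm (B * (indicator (cball 0 R) x *\<^sub>R v x t))"
  proof (intro AE_I2)
   fix x
   show "norm (v x t * \<psi> x) \<le> norm (B * (indicator (cball 0 R) x *\<^sub>R v x t))"
   proof (cases "norm x \<le> R")
    case True
    then have "\<bar>\<psi> x\<bar> \<le> B" using B[of x] by simp
    then have "v x t * \<bar>\<psi> x\<bar> \<le> v x t * B" using v_nonneg by (intro mult_left_mono) auto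
    also have "\<dots> \<le> \<bar>B * v x t\<bar>" by (simp add: mult.commute)
    finally show ?thesis using True v_nonneg[of x t] by (simp add: abs_mult)
   qed (use supp[of x] in auto)
  qed
 qed simp
qed

lemma integral_diff_bound:
 fixes f :: "'a => real"
 assumes fv: "integrable lborel (%x. f x * \<psi> x)" "integrable lborel (%x. g x * \<psi> x)"
  and [measurable]: "f \<in> borel_measurable borel" "g \<in> borel_measurable borel"
  and B: "B \<ge> 0" "\<And>x. \<bar>\<psi> x\<bar> \<le> B" and supp: "\<And>x. norm x > R ==> \<psi> x = 0"
 shows "ennreal \<bar>(LBINT x. f x * \<psi> x) - (LBINT x. g x * \<psi> x)\<bar>
  \<le> ennreal B * (\<integral>\<^sup>+x\<in>cball 0 R. ennreal \<bar>f x - g x\<bar> \<partial>lborel)"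
proof -
 have [measurable]: "cball (0::'a) R \<in> sets borel" by simp
 have "ennreal \<bar>(LBINT x. f x * \<psi> x) - (LBINT x. g x * \<psi> x)\<bar>
  = ennreal (norm (LBINT x. f x * \<psi> x - g x * \<psi> x))" using fv by simp
 also have "\<dots> \<le> (\<integral>\<^sup>+x. norm (f x * \<psi> x - g x * \<psi> x) \<partial>lborel)"
  using fv by (intro integral_norm_bound_ennreal) auto
 also have "\<dots> \<le> (\<integral>\<^sup>+x. ennreal B * (ennreal \<bar>f x - g x\<bar> * indicator (cball 0 R) x) \<partial>lborel)"
 proof (rule nn_integral_mono)
  fix x
  have "norm (f x * \<psi> x - g x * \<psi> x) = \<bar>\<psi> x\<bar> * \<bar>f x - g x\<bar>"
   by (simp add: left_diff_distrib[symmetric] abs_mult)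
  also have "\<dots> \<le> B * \<bar>f x - g x\<bar>" by (intro mult_right_mono B) auto
  finally have "ennreal (norm (f x * \<psi> x - g x * \<psi> x)) \<le> ennreal (B * \<bar>f x - g x\<bar>)"
   by (rule ennreal_leI)
  also have "\<dots> = ennreal B * ennreal \<bar>f x - g x\<bar>" using B by (simp add: ennreal_mult')
  finally have "ennreal (norm (f x * \<psi> x - g x * \<psi> x)) \<le> ennreal B * ennreal \<bar>f x - g x\<bar>" .
  then show "ennreal (norm (f x * \<psi> x - g x * \<psi> x)) \<le> ennreal B * (ennreal \<bar>f x - g x\<bar> * indicator (cball 0 R) x)"
   using supp[of x] by (auto simp: indicator_def)
 qed
 also have "\<dots> = ennreal B * (\<integral>\<^sup>+x\<in>cball 0 R. ennreal \<bar>f x - g x\<bar> \<partial>lborel)"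
  by (rule nn_integral_cmult) measurable
 finally show ?thesis .
qed

lemma tendsto_ennreal_0_imp:
 fixes g :: "'b => real"
 assumes "((%x. ennreal \<bar>g x\<bar>) \<longlongrightarrow> 0) F"
 shows "(g \<longlongrightarrow> 0) F"
proof -
 have "((%x. enn2real (ennreal \<bar>g x\<bar>)) \<longlongrightarrow> 0) F"
  by (rule tendsto_enn2real) (use assms in auto)
 then show ?thesis by (simp add: tendsto_rabs_zero_iff)
qed

lemma continuous_bounded_support:
 fixes \<psi> :: "'a => real"
 assumes c: "continuous_on UNIV \<psi>" and supp: "\<And>x. norm x > R ==> \<psi> x = 0"
 obtains B where "B \<ge> 0" "\<And>x. \<bar>\<psi> x\<bar> \<le> B"
proof -
 obtain B where B: "\<And>x. x \<in> cball 0 R ==> \<bar>\<psi> x\<bar> \<le> B"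
  using compact_continuous_abs_bound[OF continuous_on_subset[OF c] compact_cball] by blast
 have "\<bar>\<psi> x\<bar> \<le> max 0 B" for x
  using B[of x] supp[of x] by (cases "norm x \<le> R") auto
 then show thesis by (intro that[of "max 0 B"]) auto
qed

lemma tendsto_integral_of_L1:
 assumes conv: "((%s. \<integral>\<^sup>+x\<in>cball 0 R. ennreal \<bar>f s x - g x\<bar> \<partial>lborel) \<longlongrightarrow> 0) F"
  and ev: "\<forall>\<^sub>F s in F. integrable lborel (%x. f s x * \<psi> x) \<and> f s \<in> borel_measurable borel"
  and g: "integrable lborel (%x. g x * \<psi> x)" "g \<in> borel_measurable borel"
  and c: "continuous_on UNIV \<psi>" and supp: "\<And>x::'a. norm x > R ==> \<psi> x = 0"
 shows "((%s. LBINT x. f s x * \<psi> x) \<longlongrightarrow> (LBINT x. g x * \<psi> x)) F"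
proof -
 obtain B where B: "B \<ge> 0" "\<And>x. \<bar>\<psi> x\<bar> \<le> B" using continuous_bounded_support[OF c supp] by blast
 have "((%s. ennreal \<bar>(LBINT x. f s x * \<psi> x) - (LBINT x. g x * \<psi> x)\<bar>) \<longlongrightarrow> 0) F"
 proof (rule tendsto_sandwich[where f = "%_. 0"])
  show "\<forall>\<^sub>F s in F. ennreal \<bar>(LBINT x. f s x * \<psi> x) - (LBINT x. g x * \<psi> x)\<bar>
    \<le> ennreal B * (\<integral>\<^sup>+x\<in>cball 0 R. ennreal \<bar>f s x - g x\<bar> \<partial>lborel)"
   using ev by eventually_elim (rule integral_diff_bound, use g B supp in auto)
  show "((%s. ennreal B * (\<integral>\<^sup>+x\<in>cball 0 R. ennreal \<bar>f s x - g x\<bar> \<partial>lborel)) \<longlongrightarrow> 0) F"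
   using ennreal_tendsto_cmult[OF _ conv, of "ennreal B"] by simp
 qed auto
 then have "((%s. (LBINT x. f s x * \<psi> x) - (LBINT x. g x * \<psi> x)) \<longlongrightarrow> 0) F"
  by (rule tendsto_ennreal_0_imp)
 then show ?thesis by (simp add: LIM_zero_iff)
qed

lemma eventually_at_Ioo:
 fixes t :: real assumes "0 < t" "t < T0"
 shows "\<forall>\<^sub>F s in at t. 0 < s \<and> s < T0"
 using assms by (auto simp: eventually_at_topological intro!: exI[of _ "{0<..<T0}"])

lemma continuous_integral_v:
 assumes c: "continuous_on UNIV \<psi>" and supp: "\<And>x. norm x > R ==> \<psi> x = 0"
 shows "continuous_on {0<..<T0} (%t. LBINT x. v x t * \<psi> x)"
proof (intro continuous_at_imp_continuous_on ballI)
 fix t assume t: "t \<in> {0<..<T0}"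
 show "isCont (%t. LBINT x. v x t * \<psi> x) t"
  unfolding isCont_def
 proof (rule tendsto_integral_of_L1[OF v_continuous[of t R] _ _ _ c supp])
  show "\<forall>\<^sub>F s in at t. integrable lborel (%x. v x s * \<psi> x) \<and> (%x. v x s) \<in> borel_measurable borel"
   using eventually_at_Ioo[of t] t
   by (auto elim!: eventually_mono intro!: integrable_v_mult[OF _ _ c supp])
 qed (use t in \<open>auto intro!: integrable_v_mult[OF _ _ c supp]\<close>)
qed

lemma approximants_mass_converges:
 assumes ap: "approximants q a b R v f G D ft" and ab: "0 < a" "b < T0"
  and c: "continuous_on UNIV \<psi>" and supp: "\<And>x. norm x > R ==> \<psi> x = 0"
 shows "AE t in lborel. a < t \<and> t < b -->
  (%n. LBINT x. f n x t * \<psi> x) \<longlonglongrightarrow> (LBINT x. v x t * \<psi> x)"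
proof -
 have "AE t in lborel. a < t \<and> t < b --> (%n. \<integral>\<^sup>+x\<in>cball 0 R. ennreal \<bar>f n x t - v x t\<bar> \<partial>lborel) \<longlonglongrightarrow> 0"
  using ap by (simp add: approximants_def)
 then show ?thesis
 proof (rule AE_mp, intro AE_I2 impI, elim impE)
  fix t assume t: "a < t \<and> t < b" "(%n. \<integral>\<^sup>+x\<in>cball 0 R. ennreal \<bar>f n x t - v x t\<bar> \<partial>lborel) \<longlonglongrightarrow> 0"
  have cf: "continuous_on UNIV (%x. f n x t)" for n
  proof -
   have "subsol q a b (f n) (G n) (D n) (ft n)" using ap by (simp add: approximants_def)
   from C2_continuous(1)[OF subsolD(1)[OF this, of t]] show ?thesis using t by auto
  qed
  show "(%n. LBINT x. f n x t * \<psi> x) \<longlonglongrightarrow> (LBINT x. v x t * \<psi> x)"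
  proof (rule tendsto_integral_of_L1[OF t(2) _ _ _ c supp])
   show "\<forall>\<^sub>F n in sequentially. integrable lborel (%x. f n x t * \<psi> x) \<and> (%x. f n x t) \<in> borel_measurable borel"
    using supp by (intro always_eventually allI conjI integrable_compact_support[where R = R]
      continuous_intros c cf borel_measurable_continuous_onI) auto
   show "integrable lborel (%x. v x t * \<psi> x)"
    by (rule integrable_v_mult[OF _ _ c supp]) (use t ab in auto)
  qed auto
 qed auto
qed

definition mexp :: nat where "mexp = nat \<lceil>q / (q - 1)\<rceil>"

lemma mexp: "q / (q - 1) \<le> real (mexp + 3)"
 unfolding mexp_def by linarith

text \<open>The constant comes from the masses of \<open>v\<close> near the origin on
  \<open>[a, b]\<close>, so it depends neither on \<open>R\<close> nor on the approximants. This
  independence later allows \<open>R\<close> to tend to infinity. Only the index \<open>n0\<close>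
  depends on the sequence.\<close>

lemma growth_uniform:
 assumes ab: "0 < a" "a < b" "b < T0" and d: "d > 0"
 shows "\<exists>C>0. \<forall>R f G D ft. R \<ge> 5 --> approximants q a b R v f G D ft -->
  (\<exists>n0. \<forall>n\<ge>n0. \<forall>x t. a + 3 * d < t \<and> t < b --> f n x t \<le> C * (1 + norm x) powr (q / (q - 1)))"
proof -
 let ?\<eta> = "bump mexp (1/16) :: 'a => real"
 have c: "continuous_on UNIV ?\<eta>" by (rule C2_continuous(1)[OF C2_bump])
 have supp: "?\<eta> x = 0" if "norm x > 5" for x
 proof -
  have "sqrt (5 / (4 * (1 / 16))) \<le> (5::real)" by (simp add: real_le_lsqrt)
  then show ?thesis using bump_eq_0[of "1/16" x mexp] that by simp
 qed
 have "continuous_on {a..b} (%t. LBINT x. v x t * ?\<eta> x)"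
  by (rule continuous_on_subset[OF continuous_integral_v[OF c supp]]) (use ab in auto)
 from compact_continuous_abs_bound[OF this compact_Icc]
 obtain M where M: "\<And>t. t \<in> {a..b} ==> \<bar>\<integral>x. v x t * ?\<eta> x \<partial>lborel\<bar> \<le> M" by blast
 have M0: "M + 1 \<ge> 0" using M[of a] ab by auto
 obtain C where C0: "C \<ge> 0" and C: "\<forall>a b f G D ft (x::'a) t.
  subsol q a b f G D ft --> a + 3 * d < t --> t < b -->
  (\<forall>r. a + 2 * d < r --> r < b --> (\<exists>s. a < s \<and> r - 2 * d \<le> s \<and> s \<le> r - d \<and>
    (LBINT y. f y s * bump mexp (1/16) y) \<le> M + 1)) -->
  f x t \<le> C * (1 + norm x) powr (q / (q - 1))"
  using subsol_growth[OF q mexp d M0] by (elim exE conjE) (rule that)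
 have "\<exists>n0. \<forall>n\<ge>n0. \<forall>x t. a + 3 * d < t \<and> t < b --> f n x t \<le> (C + 1) * (1 + norm x) powr (q / (q - 1))"
  if R: "R \<ge> 5" and ap: "approximants q a b R v f G D ft" for R f G D ft
 proof -
  have good: "AE t in lborel. a < t \<and> t < b -->
  (%n. LBINT x. f n x t * ?\<eta> x) \<longlonglongrightarrow> (LBINT x. v x t * ?\<eta> x)"
   by (rule approximants_mass_converges[OF ap ab(1,3) c]) (use supp R in auto)
  \<comment> \<open>The interval is cut into cells of length \<open>d / 2\<close>, and each cell
    gets one time of convergence. Only finitely many times occur, so a single \<open>n0\<close>
    serves all of them.\<close>
  define J where "J = nat \<lceil>(b - a) / (d / 2)\<rceil>"
  define Q where "Q s \<longleftrightarrow> (s < b -->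
   (%n. LBINT x. f n x s * ?\<eta> x) \<longlonglongrightarrow> (LBINT x. v x s * ?\<eta> x))" for s
  have "\<exists>s. a + real j * (d / 2) < s \<and> s < a + real (Suc j) * (d / 2) \<and> Q s" for j
  proof (rule AE_dense)
   show "a + real j * (d / 2) < a + real (Suc j) * (d / 2)" using d by (simp add: algebra_simps)
   show "AE s in lborel. a + real j * (d / 2) < s \<and> s < a + real (Suc j) * (d / 2) --> Q s"
    using good
   proof (rule AE_mp, intro AE_I2 impI)
    fix s assume h: "a < s \<and> s < b --> (%n. LBINT x. f n x s * ?\<eta> x) \<longlonglongrightarrow> (LBINT x. v x s * ?\<eta> x)"
     and s: "a + real j * (d / 2) < s \<and> s < a + real (Suc j) * (d / 2)"
    have "a \<le> a + real j * (d / 2)" using d by simp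
    then show "Q s" unfolding Q_def using h s by auto
   qed
  qed
  then have "\<forall>j. \<exists>s. a + real j * (d / 2) < s \<and> s < a + real (Suc j) * (d / 2) \<and> Q s" by blast
  from choice[OF this] obtain s where s: "\<And>j. a + real j * (d / 2) < s j" "\<And>j. s j < a + real (Suc j) * (d / 2)"
   "\<And>j. Q (s j)" by blast
  have as: "a < s j" for j
  proof -
   have "a \<le> a + j * (d / 2)" using d by simp
   with s(1)[of j] show ?thesis by linarith
  qed
  have ev: "\<forall>\<^sub>F n in sequentially. s j < b --> (LBINT x. f n x (s j) * ?\<eta> x) \<le> M + 1" for j
  proof (cases "s j < b")
   case True
   have "(LBINT x. v x (s j) * ?\<eta> x) < M + 1" using M[of "s j"] as[of j] True by auto
   from order_tendstoD(2)[OF s(3)[unfolded Q_def, rule_format, OF True] this] show ?thesis by (auto elim: eventually_mono)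
  qed auto
  have "\<forall>\<^sub>F n in sequentially. \<forall>j\<in>{..J}. s j < b --> (LBINT x. f n x (s j) * ?\<eta> x) \<le> M + 1"
   using ev by (intro eventually_ball_finite) auto
  then obtain n0 where n0: "\<And>n j. n \<ge> n0 ==> j \<le> J ==> s j < b ==> (LBINT x. f n x (s j) * ?\<eta> x) \<le> M + 1"
   unfolding eventually_sequentially by auto
  have "f n x t \<le> (C + 1) * (1 + norm x) powr (q / (q - 1))"
   if n: "n \<ge> n0" and t: "a + 3 * d < t" "t < b" for n x t
  proof -
   have "f n x t \<le> C * (1 + norm x) powr (q / (q - 1))"
   proof (rule C[rule_format, where a = a and b = b and f = "f n" and G = "G n" and D = "D n" and ft = "ft n"])
    show "subsol q a b (f n) (G n) (D n) (ft n)" using ap by (simp add: approximants_def)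
    fix r assume r: "a + 2 * d < r" "r < b"
    \<comment> \<open>The cell is chosen so that its point is at least \<open>r - 2 * d\<close>. It
      is at most two cell lengths later, hence at most \<open>r - d\<close>.\<close>
    define j where "j = nat \<lceil>(r - 2 * d - a) / (d / 2)\<rceil>"
    have pos: "(r - 2 * d - a) / (d / 2) > 0" using r d by simp
    have jr: "real j \<ge> (r - 2 * d - a) / (d / 2)" "real j < (r - 2 * d - a) / (d / 2) + 1"
     unfolding j_def using pos by linarith+
    have j1: "j * (d / 2) \<ge> r - 2 * d - a" using jr(1) d by (simp add: field_simps)
    have j2: "j * (d / 2) < r - 2 * d - a + d / 2" using jr(2) d by (simp add: field_simps)
    have "(r - 2 * d - a) / (d / 2) \<le> (b - a) / (d / 2)" using r d by (intro divide_right_mono) auto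
    then have jJ: "j \<le> J" unfolding j_def J_def by (intro nat_mono ceiling_mono)
    have "real (Suc j) * (d / 2) = real j * (d / 2) + d / 2" by (simp add: algebra_simps)
    then have sj: "r - 2 * d \<le> s j" "s j \<le> r - d"
     using s(1)[of j] s(2)[of j] j1 j2 by linarith+
    then show "\<exists>s. a < s \<and> r - 2 * d \<le> s \<and> s \<le> r - d \<and> (LBINT y. f n y s * bump mexp (1/16) y) \<le> M + 1"
     using as[of j] n0[OF n jJ] r d by (intro exI[of _ "s j"]) auto
   qed (use t in auto)
   also have "\<dots> \<le> (C + 1) * (1 + norm x) powr (q / (q - 1))" by (intro mult_right_mono) auto
   finally show ?thesis .
  qed
  then show ?thesis by blast
 qed
 then show ?thesis using C0 by (intro exI[of _ "C + 1"]) auto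
qed

lemma L1_cball_AE_subseq:
 fixes g :: "'a => real"
 assumes conv: "(%n. \<integral>\<^sup>+x\<in>cball 0 R. ennreal \<bar>f n x - g x\<bar> \<partial>lborel) \<longlonglongrightarrow> 0"
  and f: "\<And>n. set_integrable lborel (cball 0 R) (f n)" and g: "set_integrable lborel (cball 0 R) g"
 obtains r :: "nat => nat" where "strict_mono r"
  "AE x in lborel. norm x \<le> R --> (%n. f (r n) x) \<longlonglongrightarrow> g x"
proof -
 define u where "u n x = indicator (cball 0 R) x *\<^sub>R f n x - indicator (cball 0 R) x *\<^sub>R g x" for n x
 have int: "integrable lborel (u n)" for n
  unfolding u_def using f g by (auto simp: set_integrable_def)
 have "(\<integral>\<^sup>+x\<in>cball 0 R. ennreal \<bar>f n x - g x\<bar> \<partial>lborel) = (\<integral>\<^sup>+x. ennreal (norm (u n x)) \<partial>lborel)" for n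
  by (intro nn_integral_cong) (auto simp: u_def indicator_def)
 also have "\<dots> n = ennreal (LBINT x. norm (u n x))" for n
  using int by (intro nn_integral_eq_integral) auto
 finally have eq: "(\<integral>\<^sup>+x\<in>cball 0 R. ennreal \<bar>f n x - g x\<bar> \<partial>lborel) = ennreal \<bar>\<integral>x. norm (u n x) \<partial>lborel\<bar>" for n
  by simp
 have "(%n. LBINT x. norm (u n x)) \<longlonglongrightarrow> 0"
  by (rule tendsto_ennreal_0_imp) (use conv in \<open>simp only: eq\<close>)
 from tendsto_L1_AE_subseq[OF int this] obtain r where r: "strict_mono r" "AE x in lborel. (%n. u (r n) x) \<longlonglongrightarrow> 0"
  by blast
 have "AE x in lborel. norm x \<le> R --> (%n. f (r n) x) \<longlonglongrightarrow> g x"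
  using r(2)
 proof (rule AE_mp, intro AE_I2 impI)
  fix x assume "(%n. u (r n) x) \<longlonglongrightarrow> 0" "norm x \<le> R"
  then show "(%n. f (r n) x) \<longlonglongrightarrow> g x" by (simp add: u_def LIM_zero_iff)
 qed
 with r(1) show thesis by (rule that)
qed

section \<open>Passage to the limit and the affine Harnack inequalities\<close>

text \<open>The comparison at fixed \<open>R\<close> and \<open>eps\<close>, with the limit taken in
  the approximation. The velocity \<open>k\<close> is chosen so that the shift equals
  \<open>h\<close> at time \<open>t\<close>; \<open>C'\<close> enlarges \<open>C\<close> to make the
  growth bound hold along all intermediate shifts.\<close>

lemma theta_limit_fixed:
 fixes h :: 'a and f G D ft
 defines "p \<equiv> q / (q - 1)"
 defines "e \<equiv> (p + 1) / 2"
 assumes ap: "approximants q a b R v f G D ft"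
  and ab: "0 < a" "a < \<tau>" "\<tau> < t" "t < b" "b < T0" and R: "R > 0"
  and good: "(%n. \<integral>\<^sup>+x\<in>cball 0 R. ennreal \<bar>f n x t - v x t\<bar> \<partial>lborel) \<longlonglongrightarrow> 0"
  and C: "C > 0" and gr: "\<And>n x r. n \<ge> n0 ==> \<tau> \<le> r ==> r \<le> t ==> f n x r \<le> C * (1 + norm x) powr p"
  and lam: "0 < lam" "lam < 1" and kap: "0 < kap" "kap < 1 - lam" and eps: "eps > 0"
  and c: "\<And>m. m \<ge> 0 ==> norm h * m - (t - \<tau>) * (1 - (lam / (1 - kap)) powr (q - 1)) * m powr q \<le> c"
  and R0: "R0 + norm h \<le> R"
 defines "C' \<equiv> C * (2 * (1 + norm h)) powr p"
 defines "A \<equiv> 4 * e ^ 2 + 2 * e * DIM('a) + kap powr (1 - q) * 2 powr q * ((p + 1) * C') powr (q - 1) * (p + 1)"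
 shows "AE x in lborel. norm x \<le> R0 -->
  0 \<le> v x t - lam * v (x + h) t + (C' / R * exp (A * (t - \<tau>))) * wt e (x \<bullet> x) + (lam * c + eps * (t - \<tau>))"
proof -
 define c3 where "c3 = kap powr (1 - q) * 2 powr q"
 have c3: "c3 \<ge> 0" by (simp add: c3_def)
 have p: "p > 1" using q by (simp add: p_def field_simps)
 have sub: "subsol q a b (f n) (G n) (D n) (ft n)" for n using ap by (simp add: approximants_def)
 have "2 * (1 + norm h) > 0" by (simp add: add_pos_nonneg)
 then have "(2 * (1 + norm h)) powr p > 0" by (simp only: powr_gt_zero)
 then have C': "C' > 0" using C by (simp only: C'_def mult_pos_pos)
 define k where "k = (1 / (t - \<tau>)) *\<^sub>R h"
 define cst where "cst = c / (t - \<tau>)"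
 have kh: "(t - \<tau>) *\<^sub>R k = h" using ab by (simp add: k_def)
 have cst: "norm k * m - (1 - (lam / (1 - kap)) powr (q - 1)) * m powr q \<le> cst" if "m \<ge> 0" for m
 proof -
  have eq: "n / w * m - S * X = (n * m - w * S * X) / w" if "w > 0" for w n S X :: real
   using that by (simp add: field_simps)
  have nk: "norm k = norm h / (t - \<tau>)" using ab by (simp add: k_def)
  show ?thesis
   unfolding nk cst_def by (subst eq) (use c[OF that] ab in \<open>auto intro!: divide_right_mono\<close>)
 qed
 define z where "z r = C' / R * exp (A * (r - \<tau>))" for r
 define Gy where "Gy n x r = G n x r - lam *\<^sub>R G n (x + (r - \<tau>) *\<^sub>R k) r + z r *\<^sub>R ((2 * (e * wt (e - 1) (x \<bullet> x))) *\<^sub>R x)" for n x r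
 have "\<exists>K>0. \<forall>n x r. r \<in> {\<tau>..t} --> norm x \<le> R --> c3 * norm (Gy n x r) powr q \<le> eps + K * norm (Gy n x r) ^ 2"
 proof (cases "q \<le> 2")
  case True
  from powr_le_quadratic[OF _ True c3 eps] q
  obtain K where "K > 0" "\<forall>m\<ge>0. c3 * m powr q \<le> eps + K * m ^ 2" by auto
  then show ?thesis by (intro exI[of _ K]) auto
 next
  case False
  \<comment> \<open>For \<open>q > 2\<close> the gradients do not depend on \<open>n\<close>. A
    bound on a compact set then turns the power \<open>q\<close> into a square.\<close>
  then have G0: "G n = G 0" for n using ap by (auto simp: approximants_def)
  have Gy0: "Gy n = Gy 0" for n unfolding Gy_def[abs_def] G0[of n] ..
  have sub_st: "{\<tau>..t} \<subseteq> {a<..<b}" using ab by auto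
  have C21: "C21 a b (f 0) (G 0) (D 0) (ft 0)" using sub by (simp add: subsol_def)
  note cG = C21_continuous(2)[OF C21 sub_st]
  have c1: "continuous_on (UNIV \<times> {\<tau>..t}) (%w. G 0 (fst w + (snd w - \<tau>) *\<^sub>R k) (snd w))"
   by (rule continuous_on_compose_pair[OF cG]) (auto intro!: continuous_intros)
  have c2: "continuous_on B (%w. wt c (fst w \<bullet> fst w))" for B :: "('a \<times> real) set" and c
   unfolding wt_def by (intro continuous_intros) (auto simp: add_nonneg_eq_0_iff)
  have "continuous_on (UNIV \<times> {\<tau>..t}) (%w. Gy 0 (fst w) (snd w))"
   using cG c1 R unfolding Gy_def z_def split_beta by (intro continuous_intros c2) auto
  then have "continuous_on (cball 0 R \<times> {\<tau>..t}) (%w. norm (Gy 0 (fst w) (snd w)))"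
   by (intro continuous_intros) (auto elim: continuous_on_subset)
  from compact_continuous_abs_bound[OF this compact_Times[OF compact_cball compact_Icc]] obtain B where B: "\<And>w. w \<in> cball 0 R \<times> {\<tau>..t} ==> \<bar>norm (Gy 0 (fst w) (snd w))\<bar> \<le> B"
   by blast
  have "c3 * norm (Gy n x r) powr q \<le> eps + (c3 * B powr (q - 2) + 1) * norm (Gy n x r) ^ 2"
   if "r \<in> {\<tau>..t}" "norm x \<le> R" for n x r
  proof -
   define m where "m = norm (Gy n x r)"
   have m: "0 \<le> m" "m \<le> B" using B[of "(x, r)"] that Gy0[of n] by (auto simp: m_def)
   have "m powr q = m powr (q - 2) * m powr 2" by (simp only: powr_add[symmetric]) simp
   also have "\<dots> \<le> B powr (q - 2) * m powr 2" using m False by (intro mult_right_mono powr_mono2) auto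
   also have "m powr 2 = m ^ 2" using m by (cases "m = 0") (auto simp: powr_numeral)
   finally have "c3 * m powr q \<le> c3 * (B powr (q - 2) * m ^ 2)" using c3 by (rule mult_left_mono)
   also have "\<dots> \<le> eps + (c3 * B powr (q - 2) + 1) * m ^ 2" using eps by (simp add: algebra_simps)
   finally show ?thesis by (simp add: m_def)
  qed
  then show ?thesis using c3 by (intro exI[of _ "c3 * B powr (q - 2) + 1"]) (auto simp: add_nonneg_pos)
 qed
 then obtain K where K: "K > 0" and quad: "\<And>n x r. r \<in> {\<tau>..t} ==> norm x \<le> R ==>
   c3 * norm (Gy n x r) powr q \<le> eps + K * norm (Gy n x r) ^ 2" by blast
 define y where "y n x = f n x t - lam * f n (x + h) t + z t * wt e (x \<bullet> x) + (lam * cst + eps) * (t - \<tau>)" for n x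
 define M where "M = 3 * K * exp (K * (C' * wt (p / 2) (R ^ 2))) ^ 3"
 define I where "I n = integral {\<tau>..t} (%r. LBINT x. resid q (G n) (D n) (ft n) x r * bump 0 (1 / (4 * R ^ 2)) x)" for n
 have bound: "(\<integral>\<^sup>+x. ennreal (Jp K (y n x)) \<partial>lborel) \<le> ennreal (M * I n)" if n: "n \<ge> n0" for n
 proof -
  have gr': "f n (x + (r - \<tau>) *\<^sub>R k) r \<le> C' * wt (p / 2) (x \<bullet> x)" if r: "r \<in> {\<tau>..t}" for x r
  proof -
   have nk: "norm ((r - \<tau>) *\<^sub>R k) \<le> norm h"
   proof -
    have "norm ((r - \<tau>) *\<^sub>R k) = (r - \<tau>) / (t - \<tau>) * norm h" using r ab by (simp add: k_def)
    also have "\<dots> \<le> 1 * norm h" using r ab by (intro mult_right_mono) auto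
    finally show ?thesis by simp
   qed
   have w1: "1 \<le> wt (1/2) (x \<bullet> x)" "norm x \<le> wt (1/2) (x \<bullet> x)"
    by (auto simp: wt_def powr_half_sqrt norm_eq_sqrt_inner)
   have "1 + norm (x + (r - \<tau>) *\<^sub>R k) \<le> 1 + norm x + norm h"
    using norm_triangle_ineq[of x "(r - \<tau>) *\<^sub>R k"] nk by linarith
   also have "\<dots> \<le> (1 + norm h) * (1 + norm x)" by (simp add: algebra_simps)
   also have "\<dots> \<le> (1 + norm h) * (2 * wt (1/2) (x \<bullet> x))" using w1 by (intro mult_left_mono) auto
   also have "\<dots> = 2 * (1 + norm h) * wt (1/2) (x \<bullet> x)" by simp
   finally have "(1 + norm (x + (r - \<tau>) *\<^sub>R k)) powr p \<le> (2 * (1 + norm h) * wt (1/2) (x \<bullet> x)) powr p"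
    using p by (intro powr_mono2) simp_all
   also have "\<dots> = (2 * (1 + norm h)) powr p * wt (p / 2) (x \<bullet> x)"
   proof -
    have "(2 * (1 + norm h) * wt (1/2) (x \<bullet> x)) powr p = (2 * (1 + norm h)) powr p * wt (1/2) (x \<bullet> x) powr p"
     by (rule powr_mult)
    then show ?thesis by (simp add: wt_def powr_powr)
   qed
   finally have "C * (1 + norm (x + (r - \<tau>) *\<^sub>R k)) powr p \<le> C' * wt (p / 2) (x \<bullet> x)"
    using C by (simp add: C'_def)
   then show ?thesis using gr[OF n, of r "x + (r - \<tau>) *\<^sub>R k"] r by simp
  qed
  show ?thesis
   using theta_functional_le[where f = "f n" and G = "G n" and D = "D n" and ft = "ft n" and a = a and b = b and k = k and \<tau> = \<tau> and t = t
     and lam = lam and kap = kap and eps = eps and R = R and C = C' and K = K and cst = cst and q = q,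
     folded p_def, folded e_def, folded A_def, folded z_def, folded c3_def, folded Gy_def, OF sub q ab(2-4) lam kap less_imp_le[OF eps] R C' less_imp_le[OF K] cst gr' quad]
   unfolding y_def M_def I_def by (simp add: kh)
 qed
 have I0: "I \<longlonglongrightarrow> 0" unfolding I_def using ap ab by (auto simp: approximants_def)
 have cf: "continuous_on UNIV (%x. f n x t)" for n
  using C2_continuous(1)[OF subsolD(1)[OF sub, of t n]] ab by auto
 have [measurable]: "(%x. f n x t) \<in> borel_measurable borel" for n
  by (rule borel_measurable_continuous_onI[OF cf])
 have [measurable]: "(%x. f n (x + h) t) \<in> borel_measurable borel" for n
  by (rule borel_measurable_continuous_onI, rule continuous_on_compose2[OF cf]) (auto intro!: continuous_intros)
 have [measurable]: "(%x::'a. wt e (x \<bullet> x)) \<in> borel_measurable borel"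
  unfolding wt_def by measurable
 have [measurable]: "Jp K \<in> borel_measurable borel"
  by (rule borel_measurable_continuous_onI) (rule Jp_continuous)
 have [measurable]: "y n \<in> borel_measurable borel" for n unfolding y_def[abs_def] by measurable
 have "set_integrable lborel (cball 0 R) (%x. f n x t)" for n
  unfolding set_integrable_def by (intro borel_integrable_compact continuous_on_subset[OF cf]) auto
 then obtain r where r: "strict_mono r" and conv: "AE x in lborel. norm x \<le> R --> (%n. f (r n) x t) \<longlonglongrightarrow> v x t"
  using L1_cball_AE_subseq[OF good _ v_integrable[of t R]] ab by auto
 have conv': "AE x in lborel. norm (x + h) \<le> R --> (%n. f (r n) (x + h) t) \<longlonglongrightarrow> v (x + h) t"
  by (rule AE_lborel_translate[OF conv])
 \<comment> \<open>The defect tends to 0 and drags the integral of the penalty along. Fatou's lemma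
   then forces the penalty of the limit to vanish almost everywhere, so the limit of
   \<open>y\<close> is nonnegative.\<close>
 have lim0: "(%n. \<integral>\<^sup>+x. ennreal (Jp K (y (r n) x)) \<partial>lborel) \<longlonglongrightarrow> 0"
 proof (rule tendsto_sandwich[where f = "%_. 0"])
  show "\<forall>\<^sub>F n in sequentially. (\<integral>\<^sup>+x. ennreal (Jp K (y (r n) x)) \<partial>lborel) \<le> ennreal (M * I (r n))"
   using eventually_ge_at_top[of n0]
  proof eventually_elim
   case (elim n)
   then have "r n \<ge> n0" using seq_suble[OF r, of n] by linarith
   then show ?case by (rule bound)
  qed
  have "(%n. M * I (r n)) \<longlonglongrightarrow> M * 0"
   by (intro tendsto_intros LIMSEQ_subseq_LIMSEQ[OF I0 r, unfolded comp_def])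
  then show "(%n. ennreal (M * I (r n))) \<longlonglongrightarrow> 0"
   using tendsto_ennrealI[of _ "M * 0"] by fastforce
 qed auto
 have "(\<integral>\<^sup>+x. liminf (%n. ennreal (Jp K (y (r n) x))) \<partial>lborel) \<le> liminf (%n. \<integral>\<^sup>+x. ennreal (Jp K (y (r n) x)) \<partial>lborel)"
  by (rule nn_integral_liminf) measurable
 also have "\<dots> = 0" using lim_imp_Liminf[OF _ lim0] by simp
 finally have "(\<integral>\<^sup>+x. liminf (%n. ennreal (Jp K (y (r n) x))) \<partial>lborel) = 0" by simp
 then have liminf0: "AE x in lborel. liminf (%n. ennreal (Jp K (y (r n) x))) = 0"
  by (subst (asm) nn_integral_0_iff_AE) measurable
 show ?thesis
  using conv conv' liminf0
 proof eventually_elim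
  case (elim x)
  show ?case
  proof
   assume x: "norm x \<le> R0"
   have nx: "norm x \<le> R" "norm (x + h) \<le> R"
    using x R0 norm_triangle_ineq[of x h] norm_ge_zero[of h] by linarith+
   define Y where "Y = v x t - lam * v (x + h) t + z t * wt e (x \<bullet> x) + (lam * cst + eps) * (t - \<tau>)"
   have "(%n. y (r n) x) \<longlonglongrightarrow> Y"
    unfolding y_def Y_def using elim nx by (intro tendsto_intros) auto
   then have "(%n. Jp K (y (r n) x)) \<longlonglongrightarrow> Jp K Y"
    using Jp_continuous(1)[of UNIV K] by (auto intro: continuous_on_tendsto_compose)
   then have "(%n. ennreal (Jp K (y (r n) x))) \<longlonglongrightarrow> ennreal (Jp K Y)" by (rule tendsto_ennrealI)
   from lim_imp_Liminf[OF _ this] elim(3) have "ennreal (Jp K Y) = 0" by simp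
   then have "Jp K Y = 0" using Jp_ge_0[of K Y] by (simp add: ennreal_eq_0_iff)
   then have "Y \<ge> 0" by (rule Jp_eq_0_imp[OF K])
   moreover have "(lam * cst + eps) * (t - \<tau>) = lam * c + eps * (t - \<tau>)"
    using ab by (simp add: cst_def field_simps)
   ultimately show "0 \<le> v x t - lam * v (x + h) t + C' / R * exp (A * (t - \<tau>)) * wt e (x \<bullet> x) + (lam * c + eps * (t - \<tau>))"
    by (simp add: Y_def z_def)
  qed
 qed
qed

text \<open>The choices \<open>R = n + 5\<close> and \<open>eps = 1 / (n + 1)\<close> remove barrier
  and slope, since \<open>A\<close> and \<open>C'\<close> do not depend on \<open>R\<close>. The
  exceptional times come from the approximating sequences alone, so one null set serves all
  \<open>h\<close>, \<open>lam\<close>, \<open>kap\<close> and \<open>c\<close>.\<close>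

lemma theta_limit:
 assumes ab: "0 < \<tau>" "\<tau> < b" "b < T0"
 shows "AE t in lborel. \<tau> < t \<and> t < b --> (\<forall>h lam kap c. 0 < lam \<and> lam < 1 \<and> 0 < kap \<and> kap < 1 - lam \<and>
  (\<forall>m\<ge>0. norm h * m - (t - \<tau>) * (1 - (lam / (1 - kap)) powr (q - 1)) * m powr q \<le> c) -->
  (AE x in lborel. lam * v (x + h) t \<le> v x t + lam * c))"
proof -
 define p where "p = q / (q - 1)"
 define e where "e = (p + 1) / 2"
 have "\<exists>C>0. \<forall>R f G D ft. R \<ge> 5 --> approximants q (\<tau>/2) b R v f G D ft -->
  (\<exists>n0. \<forall>n\<ge>n0. \<forall>x t. \<tau>/2 + 3 * (\<tau>/8) < t \<and> t < b --> f n x t \<le> C * (1 + norm x) powr p)"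
  unfolding p_def by (rule growth_uniform) (use ab in auto)
 then obtain C where C: "C > 0" and
  gr: "\<forall>R f G D ft. R \<ge> 5 --> approximants q (\<tau>/2) b R v f G D ft -->
   (\<exists>n0. \<forall>n\<ge>n0. \<forall>x t. \<tau>/2 + 3 * (\<tau>/8) < t \<and> t < b --> f n x t \<le> C * (1 + norm x) powr p)"
  by (elim exE conjE) (rule that)
 define C' where "C' h = C * (2 * (1 + norm h)) powr p" for h :: 'a
 define A where "A h kap = 4 * e ^ 2 + 2 * e * DIM('a) + kap powr (1 - q) * 2 powr q * ((p + 1) * C' h) powr (q - 1) * (p + 1)" for h kap
 define X where "X R t h lam kap c eps x = v x t - lam * v (x + h) t + (C' h / R * exp (A h kap * (t - \<tau>))) * wt e (x \<bullet> x) + (lam * c + eps * (t - \<tau>))"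
  for R t h lam kap c eps x
 define cond where "cond t h lam kap c \<longleftrightarrow> 0 < lam \<and> lam < 1 \<and> 0 < kap \<and> kap < 1 - lam \<and>
  (\<forall>m\<ge>0. norm h * m - (t - \<tau>) * (1 - (lam / (1 - kap)) powr (q - 1)) * m powr q \<le> c)" for t and h :: 'a and lam kap c
 have "AE t in lborel. \<tau> < t \<and> t < b --> (\<forall>h lam kap c eps R0. cond t h lam kap c --> eps > 0 --> R0 + norm h \<le> real n + 5 -->
  (AE x in lborel. norm x \<le> R0 --> 0 \<le> X (real n + 5) t h lam kap c eps x))" for n
 proof -
  define R where "R = real n + 5"
  have R: "R \<ge> 5" "R > 0" by (auto simp: R_def)
  obtain f G D ft where ap: "approximants q (\<tau>/2) b R v f G D ft"
   using approx[of "\<tau>/2" b R] ab R by auto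
  obtain n0 where n0: "\<And>n x t. n \<ge> n0 ==> \<tau>/2 + 3 * (\<tau>/8) < t ==> t < b ==> f n x t \<le> C * (1 + norm x) powr p"
   using gr[rule_format, OF R(1) ap] by blast
  have "AE t in lborel. \<tau>/2 < t \<and> t < b --> (%n. \<integral>\<^sup>+x\<in>cball 0 R. ennreal \<bar>f n x t - v x t\<bar> \<partial>lborel) \<longlonglongrightarrow> 0"
   using ap by (simp add: approximants_def)
  then show ?thesis
   unfolding R_def[symmetric]
  proof (rule eventually_mono, intro impI allI)
   fix t :: real and h :: 'a and lam kap c eps R0 :: real
   assume good: "\<tau>/2 < t \<and> t < b --> (%n. \<integral>\<^sup>+x\<in>cball 0 R. ennreal \<bar>f n x t - v x t\<bar> \<partial>lborel) \<longlonglongrightarrow> 0"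
    and t: "\<tau> < t \<and> t < b" and cond: "cond t h lam kap c" and eps: "eps > 0" and R0: "R0 + norm h \<le> R"
   have g: "(%n. \<integral>\<^sup>+x\<in>cball 0 R. ennreal \<bar>f n x t - v x t\<bar> \<partial>lborel) \<longlonglongrightarrow> 0" using good t ab by auto
   show "AE x in lborel. norm x \<le> R0 --> 0 \<le> X R t h lam kap c eps x"
    unfolding X_def C'_def A_def e_def p_def
    by (rule theta_limit_fixed[OF ap _ _ _ _ _ R(2) g C, where ?n0.0 = n0])
     (use n0 ab t cond eps R0 in \<open>auto simp: cond_def p_def\<close>)
  qed
 qed
 then have "AE t in lborel. \<forall>n. \<tau> < t \<and> t < b --> (\<forall>h lam kap c eps R0. cond t h lam kap c --> eps > 0 --> R0 + norm h \<le> real n + 5 -->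
  (AE x in lborel. norm x \<le> R0 --> 0 \<le> X (real n + 5) t h lam kap c eps x))"
  unfolding AE_all_countable by blast
 then show ?thesis
  unfolding cond_def[symmetric]
 proof (rule eventually_mono, intro impI allI)
  fix t :: real and h :: 'a and lam kap c :: real
  assume *: "\<forall>n. \<tau> < t \<and> t < b --> (\<forall>h lam kap c eps R0. cond t h lam kap c --> eps > 0 --> R0 + norm h \<le> real n + 5 -->
  (AE x in lborel. norm x \<le> R0 --> 0 \<le> X (real n + 5) t h lam kap c eps x))"
   and t: "\<tau> < t \<and> t < b" and cond: "cond t h lam kap c"
  have "AE x in lborel. norm x \<le> real n + 5 - norm h --> 0 \<le> X (real n + 5) t h lam kap c (1 / real (Suc n)) x" for n
   using *[rule_format, OF t cond, of "1 / real (Suc n)" "real n + 5 - norm h" n] by simp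
  then have "AE x in lborel. \<forall>n. norm x \<le> real n + 5 - norm h --> 0 \<le> X (real n + 5) t h lam kap c (1 / real (Suc n)) x"
   unfolding AE_all_countable by blast
  then show "AE x in lborel. lam * v (x + h) t \<le> v x t + lam * c"
  proof (rule AE_mp, intro AE_I2 impI)
   fix x assume x: "\<forall>n. norm x \<le> real n + 5 - norm h --> 0 \<le> X (real n + 5) t h lam kap c (1 / real (Suc n)) x"
   have "(%n. inverse (real n + 5)) \<longlonglongrightarrow> 0"
    using LIMSEQ_ignore_initial_segment[OF LIMSEQ_inverse_real_of_nat, of 4] by (simp add: add_ac)
   moreover have "(%n. 1 / real (Suc n)) \<longlonglongrightarrow> 0"
    using LIMSEQ_inverse_real_of_nat by (simp add: inverse_eq_divide)
   ultimately have "(%n. v x t - lam * v (x + h) t + (C' h * exp (A h kap * (t - \<tau>)) * wt e (x \<bullet> x)) * inverse (real n + 5) + (lam * c + 1 / real (Suc n) * (t - \<tau>)))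
    \<longlonglongrightarrow> v x t - lam * v (x + h) t + (C' h * exp (A h kap * (t - \<tau>)) * wt e (x \<bullet> x)) * 0 + (lam * c + 0 * (t - \<tau>))"
    by (intro tendsto_intros)
   then have "(%n. X (real n + 5) t h lam kap c (1 / real (Suc n)) x) \<longlonglongrightarrow> v x t - lam * v (x + h) t + lam * c"
    by (simp add: X_def field_simps)
   moreover have "\<forall>\<^sub>F n in sequentially. 0 \<le> X (real n + 5) t h lam kap c (1 / real (Suc n)) x"
   proof -
    have "\<forall>\<^sub>F n in sequentially. real n \<ge> norm x + norm h"
     by (rule eventually_sequentiallyI[of "nat \<lceil>norm x + norm h\<rceil>"]) linarith
    then show ?thesis using x by (auto elim!: eventually_mono)
   qed
   ultimately have "0 \<le> v x t - lam * v (x + h) t + lam * c"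
    by (intro tendsto_lowerbound) auto
   then show "lam * v (x + h) t \<le> v x t + lam * c" by simp
  qed
 qed
qed

text \<open>Optimising the affine inequalities over \<open>lam\<close> and \<open>h\<close> gives
 \<open>norm (grad u) powr q \<le> u / ((q - 1) * t)\<close>; in this form they are stable under averaging.\<close>

theorem harnack:
 "AE t in lborel. 0 < t \<and> t < T0 --> (\<forall>h lam c. 0 < lam \<and> lam < 1 \<and>
  (\<forall>m\<ge>0. norm h * m - t * (1 - lam powr (q - 1)) * m powr q \<le> c) -->
  (AE x in lborel. lam * v (x + h) t \<le> v x t + lam * c))"
proof -
 define P where "P \<tau> t \<longleftrightarrow> (\<forall>h lam kap c. 0 < lam \<and> lam < 1 \<and> 0 < kap \<and> kap < 1 - lam \<and>
  (\<forall>m\<ge>0. norm h * m - (t - \<tau>) * (1 - (lam / (1 - kap)) powr (q - 1)) * m powr q \<le> c) -->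
  (AE x in lborel. lam * v (x + h) t \<le> v x t + lam * c))" for \<tau> t
 have "AE t in lborel. 1 / real (Suc i) < t \<and> t < T0 - 1 / real (Suc j) --> P (1 / real (Suc i)) t" for i j
 proof (cases "1 / real (Suc i) < T0 - 1 / real (Suc j)")
  case True
  then show ?thesis unfolding P_def by (intro theta_limit) auto
 qed auto
 then have "AE t in lborel. \<forall>i j. 1 / real (Suc i) < t \<and> t < T0 - 1 / real (Suc j) --> P (1 / real (Suc i)) t"
  unfolding AE_all_countable by blast
 then show ?thesis
 proof (rule eventually_mono, intro impI allI)
  fix t :: real and h :: 'a and lam c :: real
  assume *: "\<forall>i j. 1 / real (Suc i) < t \<and> t < T0 - 1 / real (Suc j) --> P (1 / real (Suc i)) t"
   and t: "0 < t \<and> t < T0" and cond: "0 < lam \<and> lam < 1 \<and>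
  (\<forall>m\<ge>0. norm h * m - t * (1 - lam powr (q - 1)) * m powr q \<le> c)"
  have lim1: "(%n. 1 / real (Suc n)) \<longlonglongrightarrow> 0"
   using LIMSEQ_inverse_real_of_nat by (simp add: inverse_eq_divide)
  have "\<forall>\<^sub>F j in sequentially. 1 / real (Suc j) < T0 - t"
   using order_tendstoD(2)[OF lim1, of "T0 - t"] t by simp
  then obtain j where j: "1 / real (Suc j) < T0 - t" by (auto dest: eventually_happens)
  define \<tau> where "\<tau> i = 1 / real (Suc i)" for i
  define kap where "kap i = (1 - lam) * (1 / real (Suc (Suc i)))" for i
  define \<sigma> where "\<sigma> = t * (1 - lam powr (q - 1))"
  \<comment> \<open>The ratio of the available coefficient, with positive \<open>\<tau> i\<close>
    and \<open>kap i\<close>, to the limiting coefficient \<open>\<sigma>\<close>. It tends to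
    1.\<close>
  define \<theta> where "\<theta> i = ((t - \<tau> i) * (1 - (lam / (1 - kap i)) powr (q - 1))) / \<sigma>" for i
  have kap: "0 < kap i" "kap i < 1 - lam" for i
  proof -
   show "0 < kap i" using cond by (simp add: kap_def)
   have "(1 - lam) * (1 / real (Suc (Suc i))) < (1 - lam) * 1"
    using cond by (intro mult_strict_left_mono) auto
   then show "kap i < 1 - lam" by (simp add: kap_def)
  qed
  have lamq: "lam powr (q - 1) < 1" using cond q powr_less_mono2[of "q - 1" lam 1] by simp
  then have \<sigma>: "\<sigma> > 0" using t by (simp add: \<sigma>_def)
  have kaplim: "kap \<longlonglongrightarrow> (1 - lam) * 0"
   unfolding kap_def[abs_def] using LIMSEQ_Suc[OF lim1] by (intro tendsto_intros)
  have "(%i. ((t - \<tau> i) * (1 - (lam / (1 - kap i)) powr (q - 1))) / \<sigma>) \<longlonglongrightarrow> ((t - 0) * (1 - (lam / (1 - (1 - lam) * 0)) powr (q - 1))) / \<sigma>"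
   using kaplim lim1 cond \<sigma> unfolding \<tau>_def by (intro tendsto_intros) auto
  moreover have "((t - 0) * (1 - (lam / (1 - (1 - lam) * 0)) powr (q - 1))) / \<sigma> = 1"
   using t lamq by (simp add: \<sigma>_def)
  ultimately have \<theta>lim: "\<theta> \<longlonglongrightarrow> 1" by (simp only: \<theta>_def[abs_def])
  have clim: "(%i. \<theta> i powr (- 1 / (q - 1)) * c) \<longlonglongrightarrow> 1 powr (- 1 / (q - 1)) * c"
   by (intro tendsto_intros \<theta>lim) auto
  have ae: "\<tau> i < t --> \<theta> i > 0 --> (AE x in lborel. lam * v (x + h) t \<le> v x t + lam * (\<theta> i powr (- 1 / (q - 1)) * c))" for i
  proof (intro impI)
   assume i: "\<tau> i < t" "\<theta> i > 0"
   have Pi: "P (\<tau> i) t" using * i(1) j unfolding \<tau>_def by (metis less_diff_eq add.commute)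
   have "norm h * m - (t - \<tau> i) * (1 - (lam / (1 - kap i)) powr (q - 1)) * m powr q \<le> \<theta> i powr (- 1 / (q - 1)) * c"
    if m: "m \<ge> 0" for m
   proof -
    \<comment> \<open>A rescaling of \<open>m\<close>: since
      \<open>k powr q = k * \<theta> i\<close>, the hypothesis at \<open>k * m\<close>, divided by
      \<open>k\<close>, is the inequality with coefficient \<open>\<sigma> * \<theta> i\<close> and
      constant \<open>c / k\<close>.\<close>
    define k where "k = \<theta> i powr (1 / (q - 1))"
    have k: "k > 0" using i by (simp add: k_def)
    have "norm h * (k * m) - \<sigma> * (k * m) powr q \<le> c"
     using cond m k unfolding \<sigma>_def by (simp add: mult_nonneg_nonneg)
    moreover have "(k * m) powr q = k * (\<theta> i * m powr q)"
    proof -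
     have "k powr q = \<theta> i powr (1 / (q - 1) + 1)"
      unfolding k_def powr_powr using q by (simp add: field_simps)
     also have "\<dots> = k * \<theta> i" using i by (simp add: powr_add k_def)
     finally show ?thesis using k m by (simp add: powr_mult)
    qed
    ultimately have "k * (norm h * m - \<sigma> * \<theta> i * m powr q) \<le> c" by (simp add: algebra_simps)
    then have "norm h * m - \<sigma> * \<theta> i * m powr q \<le> c / k" using k by (simp add: pos_le_divide_eq mult.commute)
    also have "c / k = \<theta> i powr (- 1 / (q - 1)) * c" by (simp add: k_def powr_minus_divide)
    also have "\<sigma> * \<theta> i = (t - \<tau> i) * (1 - (lam / (1 - kap i)) powr (q - 1))"
     using \<sigma> by (simp add: \<theta>_def)
    finally show ?thesis .
   qed
   then show "AE x in lborel. lam * v (x + h) t \<le> v x t + lam * (\<theta> i powr (- 1 / (q - 1)) * c)"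
    using Pi[unfolded P_def, rule_format, of lam "kap i" h] cond kap by blast
  qed
  have "AE x in lborel. \<forall>i. \<tau> i < t --> \<theta> i > 0 --> lam * v (x + h) t \<le> v x t + lam * (\<theta> i powr (- 1 / (q - 1)) * c)"
   unfolding AE_all_countable using ae by (auto simp: AE_conj_iff)
  then show "AE x in lborel. lam * v (x + h) t \<le> v x t + lam * c"
  proof (rule AE_mp, intro AE_I2 impI)
   fix x assume x: "\<forall>i. \<tau> i < t --> \<theta> i > 0 --> lam * v (x + h) t \<le> v x t + lam * (\<theta> i powr (- 1 / (q - 1)) * c)"
   have ev: "\<forall>\<^sub>F i in sequentially. lam * v (x + h) t \<le> v x t + lam * (\<theta> i powr (- 1 / (q - 1)) * c)"
   proof -
    have 1: "\<forall>\<^sub>F i in sequentially. \<tau> i < t"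
     using order_tendstoD(2)[OF lim1, of t] t by (simp add: \<tau>_def)
    have 2: "\<forall>\<^sub>F i in sequentially. \<theta> i > 0"
     using order_tendstoD(1)[OF \<theta>lim, of 0] by simp
    show ?thesis using 1 2 by eventually_elim (use x in blast)
   qed
   have "(%i. v x t + lam * (\<theta> i powr (- 1 / (q - 1)) * c)) \<longlonglongrightarrow> v x t + lam * (1 powr (- 1 / (q - 1)) * c)"
    by (intro tendsto_intros clim)
   from tendsto_lowerbound[OF this ev] show "lam * v (x + h) t \<le> v x t + lam * c" by simp
  qed
 qed
qed

end

section \<open>From affine inequalities to a gradient bound\<close>

lemma powr_tangent:
 fixes m n q :: real
 assumes q: "q > 1" and m: "m \<ge> 0" and n: "n > 0"
 shows "m powr q \<ge> n powr q + q * n powr (q - 1) * (m - n)"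
proof (cases "m = 0")
 case True
 have "n powr q = n powr (q - 1) * n" using n by (simp add: powr_diff)
 then have "n powr q + q * n powr (q - 1) * (0 - n) = (1 - q) * n powr q" by (simp add: algebra_simps)
 also have "\<dots> \<le> 0" using q by (intro mult_nonpos_nonneg) auto
 finally show ?thesis using True q by simp
next
 case False
 then have m: "m > 0" using m by simp
 have "q * n powr (q - 1) * (m - n) \<le> m powr q - n powr q"
 proof (rule convex_on_imp_above_tangent[OF powr_convex[of q]])
  show "((%x. x powr q) has_real_derivative q * n powr (q - 1)) (at n within {0<..})"
   by (rule has_field_derivative_at_within[OF has_real_derivative_powr[OF n]])
  show "n \<in> interior {0<..}" using n by (subst interior_open) auto
 qed (use q m in auto)
 then show ?thesis by simp
qed

text \<open>First-order expansion of the affine inequalities at \<open>h = 0\<close>,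
  \<open>lam = 1\<close>, along the direction that is optimal for the Legendre transform. The
  function \<open>\<phi>\<close> vanishes at 0 and is nonnegative to the right, so its derivative
  there is nonnegative, which is the claim.\<close>

lemma gradient_le_of_affine:
 fixes g :: "'a::euclidean_space => real"
 assumes q: "q > 1" and \<sigma>: "\<sigma> > 0" and g: "(g has_derivative (%h. Gx \<bullet> h)) (at x)" and g0: "g x \<ge> 0"
  and aff: "\<And>h lam c. 0 < lam ==> lam < 1 ==>
   (\<And>m. m \<ge> 0 ==> norm h * m - \<sigma> * (1 - lam powr (q - 1)) * m powr q \<le> c) ==> g (x + h) \<le> (1 / lam) * g x + c"
 shows "\<sigma> * norm Gx powr q \<le> g x / (q - 1)"
proof (cases "Gx = 0")
 case True
 then show ?thesis using q g0 by simp
next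
 case False
 define n where "n = norm Gx"
 have n: "n > 0" using False by (simp add: n_def)
 \<comment> \<open>\<open>s\<close> is the derivative of
   \<open>m \<mapsto> \<sigma> * m powr q\<close> at \<open>n\<close>, and \<open>c0\<close> is its
   Legendre transform at \<open>s\<close>. Therefore
   \<open>s * n - c0 = \<sigma> * n powr q\<close>.\<close>
 define s where "s = \<sigma> * q * n powr (q - 1)"
 have s: "s > 0" using \<sigma> q n by (simp add: s_def)
 define c0 where "c0 = \<sigma> * (q - 1) * n powr q"
 define u where "u = (s / n) *\<^sub>R Gx"
 have nu: "norm u = s" using n s by (simp add: u_def n_def)
 \<comment> \<open>With \<open>lam = (1 - d) powr (1 / (q - 1))\<close> the coefficient
   \<open>1 - lam powr (q - 1)\<close> is just \<open>d\<close>, so the constant needed for the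
   shift \<open>d *\<^sub>R u\<close> is \<open>d * c0\<close>.\<close>
 define \<phi> where "\<phi> d = g x * (1 - d) powr (- 1 / (q - 1)) + d * c0 - g (x + d *\<^sub>R u)" for d
 have sm: "s * m - \<sigma> * m powr q \<le> c0" if "m \<ge> 0" for m
 proof -
  have nn: "n powr q = n powr (q - 1) * n" using n by (simp add: powr_diff)
  have "\<sigma> * (n powr q + q * n powr (q - 1) * (m - n)) \<le> \<sigma> * m powr q"
   using powr_tangent[OF q that n] \<sigma> by (intro mult_left_mono) auto
  moreover have "\<sigma> * (n powr q + q * n powr (q - 1) * (m - n)) = s * m - c0"
   unfolding s_def c0_def nn by (simp add: algebra_simps)
  ultimately show ?thesis by simp
 qed
 have pos: "\<phi> d \<ge> 0" if d: "0 < d" "d < 1" for d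
 proof -
  define lam where "lam = (1 - d) powr (1 / (q - 1))"
  have lam: "0 < lam" "lam < 1" using d q powr_less_mono2[of "1 / (q - 1)" "1 - d" 1] by (auto simp: lam_def)
  have lq: "lam powr (q - 1) = 1 - d" using d q by (simp add: lam_def powr_powr)
  have "norm (d *\<^sub>R u) * m - \<sigma> * (1 - lam powr (q - 1)) * m powr q \<le> d * c0" if "m \<ge> 0" for m
   using mult_left_mono[OF sm[OF that], of d] d by (simp add: lq nu algebra_simps)
  from aff[OF lam this] have "g (x + d *\<^sub>R u) \<le> (1 / lam) * g x + d * c0" .
  moreover have "1 / lam = (1 - d) powr (- 1 / (q - 1))" by (simp add: lam_def powr_minus_divide)
  ultimately show ?thesis by (simp add: \<phi>_def mult.commute)
 qed
 have "((%r. g (x + r *\<^sub>R u)) has_real_derivative Gx \<bullet> u) (at 0)"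
  using has_derivative_imp_directional[OF g, of u] by (simp add: has_real_derivative_iff_has_vector_derivative)
 moreover have "((%d. (1 - d) powr (- 1 / (q - 1))) has_real_derivative 1 / (q - 1)) (at 0)"
  by (auto intro!: derivative_eq_intros)
 ultimately have der: "(\<phi> has_real_derivative g x * (1 / (q - 1)) + c0 - Gx \<bullet> u) (at 0)"
  unfolding \<phi>_def[abs_def] by (auto intro!: derivative_eq_intros)
 have "g x * (1 / (q - 1)) + c0 - Gx \<bullet> u \<ge> 0"
 proof (rule ccontr)
  assume "\<not> ?thesis"
  then obtain e where e: "e > 0" "\<And>h. 0 < h ==> h < e ==> \<phi> (0 + h) < \<phi> 0"
   using DERIV_neg_dec_right[OF der] by auto
  define h where "h = min (e / 2) (1 / 2)"
  have "0 < h" "h < e" "h < 1" using e by (auto simp: h_def)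
  moreover have "\<phi> 0 = 0" by (simp add: \<phi>_def)
  ultimately show False using pos[of h] e(2)[of h] by simp
 qed
 moreover have "Gx \<bullet> u = s * n"
  using n by (simp add: u_def n_def power2_norm_eq_inner[symmetric] power2_eq_square)
 moreover have "s * n - c0 = \<sigma> * n powr q"
 proof -
  have nn: "n powr q = n powr (q - 1) * n" using n by (simp add: powr_diff)
  show ?thesis unfolding s_def c0_def nn by (simp add: algebra_simps)
 qed
 ultimately show ?thesis by (simp add: n_def)
qed

lemma (in approximable) mono_of_dense:
 fixes g :: "real => real"
 assumes g: "continuous_on {c<..<d} g" and P: "AE t in lborel. c < t \<and> t < d --> P t"
  and mono: "\<And>s t. c < s ==> s < t ==> t < d ==> P s ==> P t ==> g s \<le> g t"
  and st: "c < s" "s < t" "t < d"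
 shows "g s \<le> g t"
proof (rule ccontr)
 assume neg: "\<not> ?thesis"
 define e where "e = (g s - g t) / 2"
 have e: "e > 0" using neg by (simp add: e_def)
 have cont: "isCont g r" if "c < r" "r < d" for r
  using g that by (simp add: continuous_on_eq_continuous_at)
 obtain d1 where d1: "d1 > 0" "\<And>r. \<bar>r - s\<bar> < d1 ==> \<bar>g r - g s\<bar> < e"
  using cont[of s] st e unfolding continuous_at_eps_delta dist_real_def by auto
 obtain d2 where d2: "d2 > 0" "\<And>r. \<bar>r - t\<bar> < d2 ==> \<bar>g r - g t\<bar> < e"
  using cont[of t] st e unfolding continuous_at_eps_delta dist_real_def by auto
 define dd where "dd = min (min d1 d2) ((t - s) / 2)"
 have dd: "dd > 0" "dd \<le> d1" "dd \<le> d2" using d1 d2 st by (auto simp: dd_def)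
 have dd2: "dd \<le> (t - s) / 2" unfolding dd_def by (rule min.cobounded2)
 have "AE r in lborel. s < r \<and> r < s + dd --> P r"
  using P by (rule eventually_mono) (use st dd2 in auto)
 from AE_dense[OF this] dd obtain s' where s': "s < s'" "s' < s + dd" "P s'" by auto
 have "AE r in lborel. t - dd < r \<and> r < t --> P r"
  using P by (rule eventually_mono) (use st dd2 in auto)
 from AE_dense[OF this] dd obtain t' where t': "t - dd < t'" "t' < t" "P t'" by auto
 have "s' < t'" using s'(2) t'(1) dd2 by (simp add: field_simps)
 then have "g s' \<le> g t'" using mono[of s' t'] s' t' st by auto
 moreover have "\<bar>g s' - g s\<bar> < e" using d1(2)[of s'] s' dd by linarith
 moreover have "\<bar>g t' - g t\<bar> < e" using d2(2)[of t'] t' dd by linarith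
 moreover have "g s - g t = 2 * e" by (simp add: e_def)
 ultimately show False by (simp add: abs_less_iff)
qed

lemma mono_at_right_limit:
 fixes g :: "real => real"
 assumes "b > 0" and mono: "\<And>s t. 0 < s ==> s < t ==> t < b ==> g s \<le> g t"
  and bdd: "\<And>t. 0 < t ==> t < b ==> L \<le> g t"
 shows "\<exists>l. (g \<longlongrightarrow> l) (at_right 0)"
proof -
 define l where "l = Inf (g ` {0<..<b})"
 have ne: "{0<..<b} \<noteq> {}" using assms(1) by simp
 have bb: "bdd_below (g ` {0<..<b})" using bdd by (auto intro!: bdd_belowI[of _ L])
 have "(g \<longlongrightarrow> l) (at_right 0)"
 proof (rule order_tendstoI)
  fix a assume "a < l"
  have "a < g t" if "t \<in> {0<..<b}" for t
   using cInf_lower[OF imageI[OF that] bb, of ] \<open>a < l\<close> unfolding l_def by linarith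
  then show "\<forall>\<^sub>F t in at_right 0. a < g t"
   using assms(1) by (auto simp: eventually_at_right_field intro!: exI[of _ b])
 next
  fix a assume "l < a"
  then obtain t where t: "t \<in> {0<..<b}" "g t < a"
   unfolding l_def using cInf_lessD[of "g ` {0<..<b}" a] ne by auto
  then show "\<forall>\<^sub>F s in at_right 0. g s < a"
   using mono[of _ t] by (auto simp: eventually_at_right_field intro!: exI[of _ t] elim!: le_less_trans[rotated])
 qed
 then show ?thesis by blast
qed

section \<open>Weighted masses and their limits at time zero\<close>

context approximable
begin

text \<open>The Harnack inequalities of \<open>v\<close> are transferred to the approximants and
  differentiated there. An approximant at time \<open>t\<close> sees \<open>v\<close> at times
  within \<open>ep\<close>, so the factor \<open>t\<close> drops to \<open>t - ep\<close>.\<close>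

lemma approximants_gradient:
 assumes ap: "approximants q a b R v f G D ft" and ab: "0 < a" "b < T0" and ep: "ep > 0"
 shows "\<exists>n0. \<forall>n\<ge>n0. \<forall>t x. a + ep < t \<and> t < b - ep --> (t - ep) * norm (G n x t) powr q \<le> f n x t / (q - 1)"
proof -
 obtain n0 where n0: "\<forall>n\<ge>n0. \<forall>t A B h. a + ep < t \<and> t < b - ep \<and> A \<ge> 0 \<and>
   (AE r in lborel. \<bar>r - t\<bar> < ep --> (AE x in lborel. v (x + h) r \<le> A * v x r + B)) -->
   (\<forall>x. f n (x + h) t \<le> A * f n x t + B)"
  using ap ep unfolding approximants_def by blast
 have "(t - ep) * norm (G n x t) powr q \<le> f n x t / (q - 1)" if n: "n \<ge> n0" and t: "a + ep < t" "t < b - ep" for n t x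
 proof (rule gradient_le_of_affine[OF q])
  have t': "t \<in> {a<..<b}" using t ep by auto
  have sub: "subsol q a b (f n) (G n) (D n) (ft n)" using ap by (simp add: approximants_def)
  show "t - ep > 0" using t ab by simp
  show "((%x. f n x t) has_derivative (%h. G n x t \<bullet> h)) (at x)"
   using subsolD(1)[OF sub t'] by (auto simp: C2_def)
  show "f n x t \<ge> 0" by (rule subsolD(3)[OF sub t'])
  fix h :: 'a and lam c :: real
  assume lam: "0 < lam" "lam < 1" and c: "\<And>m. m \<ge> 0 ==> norm h * m - (t - ep) * (1 - lam powr (q - 1)) * m powr q \<le> c"
  have lq: "lam powr (q - 1) < 1" using lam q powr_less_mono2[of "q - 1" lam 1] by simp
  have "AE r in lborel. \<bar>r - t\<bar> < ep --> (AE x in lborel. v (x + h) r \<le> (1 / lam) * v x r + c)"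
   using harnack
  proof (rule eventually_mono, intro impI)
   fix r
   assume *: "0 < r \<and> r < T0 --> (\<forall>h lam c. 0 < lam \<and> lam < 1 \<and>
    (\<forall>m\<ge>0. norm h * m - r * (1 - lam powr (q - 1)) * m powr q \<le> c) -->
    (AE x in lborel. lam * v (x + h) r \<le> v x r + lam * c))" and r: "\<bar>r - t\<bar> < ep"
   have r': "0 < r" "r < T0" "t - ep \<le> r" using r t ab by auto
   have "norm h * m - r * (1 - lam powr (q - 1)) * m powr q \<le> c" if "m \<ge> 0" for m
   proof -
    have "(t - ep) * ((1 - lam powr (q - 1)) * m powr q) \<le> r * ((1 - lam powr (q - 1)) * m powr q)"
     using r' lq by (intro mult_right_mono) auto
    then show ?thesis using c[OF that] by (simp add: mult.assoc)
   qed
   then have "AE x in lborel. lam * v (x + h) r \<le> v x r + lam * c"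
    using * r' lam by blast
   then show "AE x in lborel. v (x + h) r \<le> (1 / lam) * v x r + c"
    by (rule eventually_mono) (use lam in \<open>simp add: field_simps\<close>)
  qed
  then show "f n (x + h) t \<le> (1 / lam) * f n x t + c"
   using n0[rule_format, OF n, of t "1 / lam" h c x] t lam by auto
 qed
 then show ?thesis by blast
qed

definition alpha :: real where "alpha = 1 / (q - 1)"

lemma alpha_pos: "alpha > 0" using q by (simp add: alpha_def)

text \<open>When \<open>(r - ep) powr alpha\<close> times the mass is differentiated, the growth of
  the weight contributes \<open>alpha / (r - ep)\<close> times the weighted mass, and the gradient
  bound shows that the absorption takes away no more. What is left is the defect, which disappears
  in the limit, and the Laplacian of \<open>\<psi>\<close>, bounded by \<open>M\<close>.\<close>

lemma weighted_mass_almost_mono_eps: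
 assumes ab: "0 < a" "a < b" "b < T0" and ep: "ep > 0"
  and psi: "C2 \<psi> G\<psi> D\<psi>" "\<And>x. \<psi> x \<ge> 0" "\<And>x. norm x > Rp ==> \<psi> x = 0 \<and> G\<psi> x = 0 \<and> D\<psi> x = (%v. 0)"
  and Mb: "\<And>t. a < t ==> t < b ==> t powr alpha * (LBINT x. v x t * \<bar>lap (D\<psi> x)\<bar>) \<le> M"
  and st: "a + ep < s" "s < t" "t < b - ep"
 shows "(s - ep) powr alpha * (LBINT x. v x s * \<psi> x) + M * s \<le> (t - ep) powr alpha * (LBINT x. v x t * \<psi> x) + M * t"
proof -
 define d where "d = ep / 3"
 have d: "d > 0" using ep by (simp add: d_def)
 define R where "R = max 5 (max Rp 1)"
 have R: "R \<ge> 5" "R \<ge> Rp" "R > 0" by (auto simp: R_def)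
 obtain f G D ft where ap: "approximants q a b R v f G D ft" using approx[OF ab R(3)] by blast
 have sub: "subsol q a b (f n) (G n) (D n) (ft n)" for n using ap by (simp add: approximants_def)
 obtain C where C: "C > 0" and grC: "\<forall>R f G D ft. R \<ge> 5 --> approximants q a b R v f G D ft -->
  (\<exists>n0. \<forall>n\<ge>n0. \<forall>x t. a + 3 * d < t \<and> t < b --> f n x t \<le> C * (1 + norm x) powr (q / (q - 1)))"
  using growth_uniform[OF ab d] by (elim exE conjE) (rule that)
 obtain n1 where n1: "\<And>n x t. n \<ge> n1 ==> a + ep < t ==> t < b ==> f n x t \<le> C * (1 + norm x) powr (q / (q - 1))"
  using grC[rule_format, OF R(1) ap] by (auto simp: d_def)
 obtain n2 where n2: "\<And>n t x. n \<ge> n2 ==> a + ep < t ==> t < b - ep ==> (t - ep) * norm (G n x t) powr q \<le> f n x t / (q - 1)"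
  using approximants_gradient[OF ap ab(1,3) ep] by blast
 define L where "L x = \<bar>lap (D\<psi> x)\<bar>" for x
 have cL: "continuous_on UNIV L" unfolding L_def by (intro continuous_intros C2_lap_continuous[OF psi(1)])
 have L0: "L x = 0" if "norm x > Rp" for x using psi(3)[OF that] by (simp add: L_def lap_def)
 note cpsi = C2_continuous[OF psi(1)]
 have psi0: "\<psi> x = 0" if "norm x > R" for x using psi(3)[of x] that R by simp
 have L0': "L x = 0" if "norm x > R" for x using L0[of x] that R by simp
 obtain B where B: "B \<ge> 0" "\<And>x. \<bar>\<psi> x\<bar> \<le> B" using continuous_bounded_support[OF cpsi(1) psi0] by blast
 define chi :: "'a => real" where "chi = bump 0 (1 / (4 * R ^ 2))"
 have psi_le: "\<psi> x \<le> B * chi x" for x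
 proof (cases "norm x \<le> R")
  case True
  then have "norm x ^ 2 \<le> R ^ 2" by (intro power_mono) auto
  then have "chi x = 1" unfolding chi_def using R by (intro bump_eq_1) (simp add: power2_norm_eq_inner field_simps)
  then show ?thesis using B(2)[of x] by simp
 next
  case False
  then show ?thesis using psi0[of x] B bump_bounds[of 0 "1 / (4 * R ^ 2)" x] by (simp add: chi_def)
 qed
 have cchi: "continuous_on UNIV chi" unfolding chi_def by (rule C2_continuous(1)[OF C2_bump])
 have chi_far: "chi x = 0" if "norm x > 3 * R" for x
 proof -
  have "sqrt (5 / (4 * (1 / (4 * R ^ 2)))) = sqrt 5 * R" using R by (simp add: real_sqrt_mult)
  also have "\<dots> \<le> 3 * R" using R by (intro mult_right_mono real_le_lsqrt) auto
  finally show ?thesis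
   unfolding chi_def using R that bump_eq_0[of "1 / (4 * R ^ 2)" x 0] by auto
 qed
 define In where "In n r = (LBINT x. f n x r * \<psi> x)" for n r
 define Ln where "Ln n r = (LBINT x. f n x r * L x)" for n r
 define En where "En n r = (LBINT x. resid q (G n) (D n) (ft n) x r * chi x)" for n r
 define I where "I r = (LBINT x. v x r * \<psi> x)" for r
 have C21: "C21 a b (f n) (G n) (D n) (ft n)" for n using sub by (simp add: subsol_def)
 have step: "(s - ep) powr alpha * In n s - (t - ep) powr alpha * In n t
  \<le> integral {s..t} (%r. (r - ep) powr alpha * Ln n r) + t powr alpha * B * integral {s..t} (En n)"
  if st: "a + ep < s" "s < t" "t < b - ep" and n: "n \<ge> n2" for n s t
 proof -
  have sub_st: "{s..t} \<subseteq> {a<..<b}" using st ep by auto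
  note cf = C21_continuous[OF C21[of n] sub_st]
  have cE: "continuous_on (UNIV \<times> {s..t}) (%(x, r). resid q (G n) (D n) (ft n) x r)"
   by (rule resid_continuous[OF C21 sub_st]) (use q in simp)
  have cEn: "continuous_on {s..t} (En n)"
   unfolding En_def
  proof (rule continuous_on_lborel_integral[where R = "3 * R"])
   show "continuous_on (UNIV \<times> {s..t}) (%(x, r). resid q (G n) (D n) (ft n) x r * chi x)"
    using cE unfolding split_beta by (intro continuous_intros continuous_on_compose2[OF cchi]) auto
  qed (use chi_far in auto)
  have cLn: "continuous_on {s..t} (Ln n)"
   unfolding Ln_def
  proof (rule continuous_on_lborel_integral[where R = R])
   show "continuous_on (UNIV \<times> {s..t}) (%(x, r). f n x r * L x)"
    using cf(1) unfolding split_beta by (intro continuous_intros continuous_on_compose2[OF cL]) auto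
  qed (use L0' in auto)
  have cr: "continuous_on {s..t} (%r. (r - ep) powr alpha)"
   using st ab by (intro continuous_intros) auto
  have "- ((t - ep) powr alpha * In n t) - - ((s - ep) powr alpha * In n s)
   \<le> integral {s..t} (%r. (r - ep) powr alpha * Ln n r + t powr alpha * B * En n r)"
  proof (rule increment_le_integral_of_derivative_le)
   fix r assume r: "r \<in> {s..t}"
   have r': "r \<in> {a<..<b}" using r sub_st by auto
   have re: "r - ep > 0" using r st ab by auto
   have dI: "(In n has_real_derivative (LBINT x. ft n x r * \<psi> x)) (at r within {s..t})"
    unfolding In_def
   proof (rule leibniz_compact_support[where R = R])
    show "((%r. f n x r * \<psi> x) has_real_derivative ft n x r * \<psi> x) (at r within {s..t})" if "r \<in> {s..t}" for x r
     by (rule has_field_derivative_at_within[OF DERIV_cmult_right[OF subsolD(2)[OF sub]]])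
      (use that sub_st in auto)
    show "continuous_on (UNIV \<times> {s..t}) (%(x, r). ft n x r * \<psi> x)"
     using cf(4) unfolding split_beta by (intro continuous_intros continuous_on_compose2[OF cpsi(1)]) auto
    show "continuous_on UNIV (%x. f n x r * \<psi> x)" if "r \<in> {s..t}" for r
     by (intro continuous_intros cpsi continuous_on_slice[OF cf(1) that])
   qed (use psi0 r st in auto)
   have dr: "((%r. (r - ep) powr alpha) has_real_derivative alpha * (r - ep) powr (alpha - 1)) (at r within {s..t})"
   proof -
    have "((%r. r - ep) has_real_derivative 1) (at r)" by (auto intro!: derivative_eq_intros)
    from has_field_derivative_at_within[OF DERIV_chain'[OF this has_real_derivative_powr[OF re]]] show ?thesis
     by simp
   qed
   show "((%r. - ((r - ep) powr alpha * In n r)) has_real_derivative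
    - (alpha * (r - ep) powr (alpha - 1) * In n r + (LBINT x. ft n x r * \<psi> x) * (r - ep) powr alpha)) (at r within {s..t})"
    by (intro DERIV_minus DERIV_mult dI dr)
   note C2f = subsolD(1)[OF sub[of n] r']
   note cfr = C2_continuous[OF C2f] C2_lap_continuous[OF C2f] continuous_on_slice[OF cf(4) r]
   have powr_cont: "continuous_on UNIV (%x. norm (G n x r) powr q)"
    using q by (intro continuous_intros continuous_on_powr' cfr) auto
   have int: "integrable lborel (%x. g x * \<psi> x)" if "continuous_on UNIV g" for g :: "'a => real"
    by (rule integrable_compact_support[where R = R]) (use psi0 in \<open>auto intro!: continuous_intros that cpsi\<close>)
   have intL: "integrable lborel (%x. f n x r * L x)"
    by (rule integrable_compact_support[where R = R]) (use L0' in \<open>auto intro!: continuous_intros cfr cL\<close>)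
   have intl: "integrable lborel (%x. f n x r * lap (D\<psi> x))"
    by (rule integrable_compact_support[where R = R])
     (use L0' in \<open>auto simp: L_def intro!: continuous_intros cfr C2_lap_continuous[OF psi(1)]\<close>)
   have cEr: "continuous_on UNIV (%x. resid q (G n) (D n) (ft n) x r)" by (rule continuous_on_slice[OF cE r])
   have intE: "integrable lborel (%x. resid q (G n) (D n) (ft n) x r * chi x)"
    by (rule integrable_compact_support[where R = "3 * R"]) (use chi_far in \<open>auto intro!: continuous_intros cEr cchi\<close>)
   have "(LBINT x. ft n x r * \<psi> x) = (LBINT x. lap (D n x r) * \<psi> x - norm (G n x r) powr q * \<psi> x
     - resid q (G n) (D n) (ft n) x r * \<psi> x)"
    by (intro Bochner_Integration.integral_cong) (auto simp: resid_def algebra_simps)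
   also have "\<dots> = (LBINT x. f n x r * lap (D\<psi> x)) - (LBINT x. norm (G n x r) powr q * \<psi> x)
     - (LBINT x. resid q (G n) (D n) (ft n) x r * \<psi> x)"
    using int[OF cfr(3)] int[OF powr_cont] int[OF cEr] C2_lap_symmetric[OF C2f psi(1), of Rp] psi(3) by simp
   finally have eq: "(LBINT x. ft n x r * \<psi> x) = \<dots>" .
   have b1: "- (LBINT x. f n x r * lap (D\<psi> x)) \<le> Ln n r"
   proof -
    have "(LBINT x. - (f n x r * lap (D\<psi> x))) \<le> Ln n r"
     unfolding Ln_def
    proof (rule integral_mono)
     fix x
     have "f n x r * (- lap (D\<psi> x)) \<le> f n x r * L x"
      using subsolD(3)[OF sub r'] by (intro mult_left_mono) (auto simp: L_def)
     then show "- (f n x r * lap (D\<psi> x)) \<le> f n x r * L x" by simp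
    qed (use intl intL in auto)
    then show ?thesis by simp
   qed
   have b2: "(LBINT x. resid q (G n) (D n) (ft n) x r * \<psi> x) \<le> B * En n r"
   proof -
    have "(LBINT x. resid q (G n) (D n) (ft n) x r * \<psi> x) \<le> (LBINT x. B * (resid q (G n) (D n) (ft n) x r * chi x))"
    proof (rule integral_mono)
     fix x
     show "resid q (G n) (D n) (ft n) x r * \<psi> x \<le> B * (resid q (G n) (D n) (ft n) x r * chi x)"
      using mult_left_mono[OF psi_le[of x] subsolD(4)[OF sub r', of n x]] by (simp add: mult_ac)
    qed (use int[OF cEr] intE in auto)
    then show ?thesis by (simp add: En_def)
   qed
   have b3: "(r - ep) * (LBINT x. norm (G n x r) powr q * \<psi> x) \<le> alpha * In n r"
   proof -
    have "(LBINT x. (r - ep) * (norm (G n x r) powr q * \<psi> x)) \<le> (LBINT x. alpha * (f n x r * \<psi> x))"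
    proof (rule integral_mono)
     fix x
     have "(r - ep) * norm (G n x r) powr q \<le> alpha * f n x r"
      using n2[OF n, of r x] r st by (simp add: alpha_def)
     from mult_right_mono[OF this psi(2)[of x]]
     show "(r - ep) * (norm (G n x r) powr q * \<psi> x) \<le> alpha * (f n x r * \<psi> x)" by (simp add: mult_ac)
    qed (use int[OF powr_cont] int[OF cfr(1)] in auto)
    then show ?thesis by (simp add: In_def)
   qed
   have En0: "En n r \<ge> 0"
    unfolding En_def using subsolD(4)[OF sub r', of n] bump_bounds
    by (intro Bochner_Integration.integral_nonneg mult_nonneg_nonneg) (auto simp: chi_def)
   \<comment> \<open>Splits off the factor \<open>r - ep\<close> that the gradient bound consumes;
     the remaining power is exactly that of the derivative of the weight.\<close>
   have pw: "(r - ep) powr alpha = (r - ep) powr (alpha - 1) * (r - ep)" using re by (simp add: powr_diff)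
   have "(r - ep) powr alpha * (LBINT x. norm (G n x r) powr q * \<psi> x) \<le> (r - ep) powr (alpha - 1) * (alpha * In n r)"
    unfolding pw mult.assoc using b3 by (intro mult_left_mono) auto
   moreover have "(r - ep) powr alpha * (- (LBINT x. f n x r * lap (D\<psi> x))) \<le> (r - ep) powr alpha * Ln n r"
    using b1 by (intro mult_left_mono) auto
   moreover have "(r - ep) powr alpha * (LBINT x. resid q (G n) (D n) (ft n) x r * \<psi> x) \<le> t powr alpha * B * En n r"
   proof -
    have "(r - ep) powr alpha * (LBINT x. resid q (G n) (D n) (ft n) x r * \<psi> x) \<le> (r - ep) powr alpha * (B * En n r)"
     using b2 by (intro mult_left_mono) auto
    also have "\<dots> \<le> t powr alpha * (B * En n r)"
     using re r ep alpha_pos En0 B by (intro mult_right_mono powr_mono2) auto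
    finally show ?thesis by simp
   qed
   ultimately show "- (alpha * (r - ep) powr (alpha - 1) * In n r + (LBINT x. ft n x r * \<psi> x) * (r - ep) powr alpha)
     \<le> (r - ep) powr alpha * Ln n r + t powr alpha * B * En n r"
    unfolding eq by (simp add: algebra_simps)
  qed (use st cLn cEn cr in \<open>auto intro!: continuous_intros\<close>)
  also have "\<dots> = integral {s..t} (%r. (r - ep) powr alpha * Ln n r) + t powr alpha * B * integral {s..t} (En n)"
   using cLn cEn cr
   by (subst integral_add) (auto intro!: integrable_continuous_interval continuous_intros)
  finally show ?thesis by simp
 qed
 have Lconv: "AE r in lborel. a < r \<and> r < b --> (%n. Ln n r) \<longlonglongrightarrow> (LBINT x. v x r * L x)"
  unfolding Ln_def by (rule approximants_mass_converges[OF ap ab(1,3) cL L0'])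
 have Iconv: "AE r in lborel. a + ep < r \<and> r < b - ep --> (%n. In n r) \<longlonglongrightarrow> I r"
  using approximants_mass_converges[OF ap ab(1,3) cpsi(1) psi0] unfolding In_def I_def
  by (rule eventually_mono) (use ep in auto)
 define W where "W = (LBINT x. C * (1 + norm x) powr (q / (q - 1)) * L x)"
 have intW: "integrable lborel (%x. C * (1 + norm x) powr (q / (q - 1)) * L x)"
  by (rule integrable_compact_support[where R = R])
   (use L0' in \<open>auto intro!: continuous_intros cL simp: add_nonneg_eq_0_iff\<close>)
 have cI: "continuous_on {0<..<T0} I" unfolding I_def by (rule continuous_integral_v[OF cpsi(1) psi0])
 have cLv: "continuous_on {0<..<T0} (%r. LBINT x. v x r * L x)" by (rule continuous_integral_v[OF cL L0'])
 show ?thesis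
  unfolding I_def[symmetric]
 proof (rule mono_of_dense[OF _ Iconv _ st])
  show "continuous_on {a + ep<..<b - ep} (%t. (t - ep) powr alpha * I t + M * t)"
   using ab ep by (intro continuous_intros continuous_on_subset[OF cI]) auto
  fix s t assume st: "a + ep < s" "s < t" "t < b - ep"
   and Is: "(%n. In n s) \<longlonglongrightarrow> I s" and It: "(%n. In n t) \<longlonglongrightarrow> I t"
  \<comment> \<open>The diffusion term converges only at almost every time. Dominated convergence in
    time is possible because the uniform growth bound gives the majorant \<open>W\<close>.\<close>
  define h where "h n r = indicator {s..t} r *\<^sub>R ((r - ep) powr alpha * Ln n r)" for n r
  define h0 where "h0 r = indicator {s..t} r *\<^sub>R ((r - ep) powr alpha * (LBINT x. v x r * L x))" for r
  have cr: "continuous_on {s..t} (%r. (r - ep) powr alpha)" using st ab by (intro continuous_intros) auto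
  have cLn: "continuous_on {s..t} (Ln n)" for n
   unfolding Ln_def
  proof (rule continuous_on_lborel_integral[where R = R])
   have "{s..t} \<subseteq> {a<..<b}" using st ep by auto
   from C21_continuous(1)[OF C21 this]
   show "continuous_on (UNIV \<times> {s..t}) (%(x, r). f n x r * L x)"
    unfolding split_beta by (intro continuous_intros continuous_on_compose2[OF cL]) auto
  qed (use L0' in auto)
  have ih: "set_integrable lborel {s..t} (%r. (r - ep) powr alpha * Ln n r)" for n
   by (rule borel_integrable_atLeastAtMost') (intro continuous_intros cr cLn)
  have ih0: "set_integrable lborel {s..t} (%r. (r - ep) powr alpha * (LBINT x. v x r * L x))"
   by (rule borel_integrable_atLeastAtMost', intro continuous_intros cr continuous_on_subset[OF cLv]) (use st ab ep in auto)
  have "(%n. LBINT r. h (n + n1) r) \<longlonglongrightarrow> (LBINT r. h0 r)"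
  proof (rule integral_dominated_convergence[where w = "%r. indicator {s..t} r *\<^sub>R (t powr alpha * W)"])
   show "h0 \<in> borel_measurable lborel" "h (n + n1) \<in> borel_measurable lborel" for n
    using ih ih0 unfolding set_integrable_def h_def h0_def by (auto dest: borel_measurable_integrable)
   show "integrable lborel (%r. indicator {s..t} r *\<^sub>R (t powr alpha * W))"
    using borel_integrable_atLeastAtMost'[of s t "%_. t powr alpha * W"] by (simp add: set_integrable_def)
   show "AE r in lborel. (%n. h (n + n1) r) \<longlonglongrightarrow> h0 r"
    using Lconv
   proof (rule eventually_mono)
    fix r assume *: "a < r \<and> r < b --> (%n. Ln n r) \<longlonglongrightarrow> (LBINT x. v x r * L x)"
    show "(%n. h (n + n1) r) \<longlonglongrightarrow> h0 r"
    proof (cases "r \<in> {s..t}")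
     case True
     then have "(%n. Ln n r) \<longlonglongrightarrow> (LBINT x. v x r * L x)" using * st ep by auto
     from LIMSEQ_ignore_initial_segment[OF this, of n1] show ?thesis
      unfolding h_def h0_def by (intro tendsto_intros)
    qed (simp add: h_def h0_def)
   qed
   show "AE r in lborel. norm (h (n + n1) r) \<le> indicator {s..t} r *\<^sub>R (t powr alpha * W)" for n
   proof (intro AE_I2)
    fix r
    show "norm (h (n + n1) r) \<le> indicator {s..t} r *\<^sub>R (t powr alpha * W)"
    proof (cases "r \<in> {s..t}")
     case True
     have r': "r \<in> {a<..<b}" using True st ep by auto
     have Ln0: "0 \<le> Ln (n + n1) r" unfolding Ln_def
      using subsolD(3)[OF sub r'] by (intro Bochner_Integration.integral_nonneg mult_nonneg_nonneg) (auto simp: L_def)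
     have "Ln (n + n1) r \<le> W" unfolding Ln_def W_def
     proof (rule integral_mono[OF _ intW])
      show "integrable lborel (%x. f (n + n1) x r * L x)"
       by (rule integrable_compact_support[where R = R])
        (use L0' C2_continuous(1)[OF subsolD(1)[OF sub r']] in \<open>auto intro!: continuous_intros cL\<close>)
      show "f (n + n1) x r * L x \<le> C * (1 + norm x) powr (q / (q - 1)) * L x" for x
       using n1[of "n + n1" r x] True st ep by (intro mult_right_mono) (auto simp: L_def)
     qed
     then have "(r - ep) powr alpha * Ln (n + n1) r \<le> t powr alpha * W"
      using True st ab ep alpha_pos Ln0 by (intro mult_mono powr_mono2) auto
     then show ?thesis using True Ln0 by (simp add: h_def)
    qed (simp add: h_def)
   qed
  qed
  then have c1: "(%n. integral {s..t} (%r. (r - ep) powr alpha * Ln (n + n1) r)) \<longlonglongrightarrow>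
    integral {s..t} (%r. (r - ep) powr alpha * (LBINT x. v x r * L x))"
   using set_borel_integral_eq_integral(2)[OF ih] set_borel_integral_eq_integral(2)[OF ih0]
   by (simp add: set_lebesgue_integral_def h_def h0_def)
  have c2: "(%n. integral {s..t} (En n)) \<longlonglongrightarrow> 0"
   using ap st ep unfolding approximants_def En_def chi_def by auto
  have ev: "\<forall>\<^sub>F n in sequentially. (s - ep) powr alpha * In (n + n1) s - (t - ep) powr alpha * In (n + n1) t
  \<le> integral {s..t} (%r. (r - ep) powr alpha * Ln (n + n1) r) + t powr alpha * B * integral {s..t} (En (n + n1))"
   by (rule eventually_sequentiallyI[of n2]) (intro step st, simp)
  have l1: "(%n. (s - ep) powr alpha * In (n + n1) s - (t - ep) powr alpha * In (n + n1) t) \<longlonglongrightarrow>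
    (s - ep) powr alpha * I s - (t - ep) powr alpha * I t"
   using LIMSEQ_ignore_initial_segment[OF Is, of n1] LIMSEQ_ignore_initial_segment[OF It, of n1] by (intro tendsto_intros)
  have l2: "(%n. integral {s..t} (%r. (r - ep) powr alpha * Ln (n + n1) r) + t powr alpha * B * integral {s..t} (En (n + n1))) \<longlonglongrightarrow>
    integral {s..t} (%r. (r - ep) powr alpha * (LBINT x. v x r * L x)) + t powr alpha * B * 0"
   using c1 LIMSEQ_ignore_initial_segment[OF c2, of n1] by (intro tendsto_intros)
  have "(s - ep) powr alpha * I s - (t - ep) powr alpha * I t
    \<le> integral {s..t} (%r. (r - ep) powr alpha * (LBINT x. v x r * L x)) + t powr alpha * B * 0"
   by (rule tendsto_le[OF _ l2 l1 ev]) simp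
  also have "\<dots> \<le> integral {s..t} (%r. M)"
  proof -
   have "(r - ep) powr alpha * (LBINT x. v x r * L x) \<le> M" if "r \<in> {s..t}" for r
   proof -
    have "(r - ep) powr alpha * (LBINT x. v x r * L x) \<le> r powr alpha * (LBINT x. v x r * L x)"
     using that st ab ep alpha_pos v_nonneg
     by (intro mult_right_mono powr_mono2 Bochner_Integration.integral_nonneg mult_nonneg_nonneg) (auto simp: L_def)
    also have "\<dots> \<le> M" unfolding L_def by (rule Mb) (use that st ep in auto)
    finally show ?thesis .
   qed
   then have "integral {s..t} (%r. (r - ep) powr alpha * (LBINT x. v x r * L x)) \<le> integral {s..t} (%r. M)"
    by (intro integral_le set_borel_integral_eq_integral(1)[OF ih0]) auto
   then show ?thesis by (simp only: mult_zero_right add_0_right)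
  qed
  also have "\<dots> = M * (t - s)" using st by simp
  finally show "(s - ep) powr alpha * I s + M * s \<le> (t - ep) powr alpha * I t + M * t"
   by (simp add: algebra_simps)
 qed
qed

lemma weighted_mass_almost_mono:
 assumes t1: "t1 \<le> T0"
  and psi: "C2 \<psi> G\<psi> D\<psi>" "\<And>x. \<psi> x \<ge> 0" "\<And>x. norm x > Rp ==> \<psi> x = 0 \<and> G\<psi> x = 0 \<and> D\<psi> x = (%v. 0)"
  and Mb: "\<And>t. 0 < t ==> t < t1 ==> t powr alpha * (LBINT x. v x t * \<bar>lap (D\<psi> x)\<bar>) \<le> M"
  and st: "0 < s" "s < t" "t < t1"
 shows "s powr alpha * (LBINT x. v x s * \<psi> x) + M * s \<le> t powr alpha * (LBINT x. v x t * \<psi> x) + M * t"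
proof -
 let ?I = "%r. LBINT x. v x r * \<psi> x"
 define a where "a = s / 2"
 define b where "b = (t + t1) / 2"
 define e0 where "e0 = min (s / 2) ((t1 - t) / 2)"
 have e0: "e0 > 0" using st by (simp add: e0_def)
 have ev: "\<forall>\<^sub>F ep in at_right 0. (s - ep) powr alpha * ?I s + M * s \<le> (t - ep) powr alpha * ?I t + M * t"
  unfolding eventually_at_right_field
 proof (intro exI[of _ e0] conjI e0 allI impI)
  fix ep :: real assume e: "0 < ep" "ep < e0"
  have e1: "ep < s / 2" "ep < (t1 - t) / 2" using e by (simp_all only: e0_def min_less_iff_conj)
  show "(s - ep) powr alpha * ?I s + M * s \<le> (t - ep) powr alpha * ?I t + M * t"
  proof (rule weighted_mass_almost_mono_eps[where a = a and b = b])
   show "0 < a" "a < b" "b < T0" "0 < ep" "a + ep < s" "s < t" "t < b - ep"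
    using e e1 st t1 by (auto simp: a_def b_def field_simps)
   show "t powr alpha * (LBINT x. v x t * \<bar>lap (D\<psi> x)\<bar>) \<le> M" if "a < t" "t < b" for t
    by (rule Mb) (use that st in \<open>auto simp: a_def b_def field_simps\<close>)
  qed (use psi in auto)
 qed
 have lim: "((%ep. (r - ep) powr alpha * ?I r + M * r) \<longlongrightarrow> (r - 0) powr alpha * ?I r + M * r) (at_right 0)" if "r > 0" for r
  using that by (intro tendsto_intros) auto
 from tendsto_le[OF _ lim[of t] lim[of s] ev] st show ?thesis by simp
qed

text \<open>The Harnack inequality with \<open>lam = 1/2\<close> compares any two points at the same
  time, and the mass bound supplies a point near \<open>x0\<close> where \<open>v\<close> is not
  large. The cost of the comparison is \<open>norm h powr (q / (q - 1))\<close> times a power of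
  \<open>t\<close> that the weight cancels.\<close>

lemma weighted_sup_bound:
 assumes t1: "0 < t1" "t1 \<le> T0" "t1 \<le> 1" and c: "c > 0"
  and B: "\<And>t. 0 < t ==> t < t1 ==> (LBINT x. v x t * bump m c (x - x0)) \<le> B"
 shows "\<exists>M>0. \<forall>t. 0 < t \<and> t < t1 --> (AE x in lborel. t powr alpha * v x t \<le> M * (1 + norm x) powr (q / (q - 1)))"
proof -
 let ?p = "q / (q - 1)"
 have p: "?p > 1" using q by (simp add: field_simps)
 define r1 where "r1 = 1 / (2 * sqrt c)"
 have r1: "r1 > 0" "c * r1 ^ 2 = 1/4" using c by (auto simp: r1_def power_divide power_mult_distrib)
 define V1 where "V1 = measure lborel (ball x0 r1)"
 have V1: "V1 > 0" using r1 by (simp add: V1_def content_ball_pos)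
 define K where "K = (\<bar>B\<bar> + 1) / V1"
 have K: "K > 0" using V1 by (simp add: K_def)
 define \<sigma> where "\<sigma> = 1 - (1/2::real) powr (q - 1)"
 have \<sigma>: "\<sigma> > 0" using q powr_less_mono2[of "q - 1" "1/2" 1] by (simp add: \<sigma>_def)
 define M where "M = 2 * K + (1 + norm x0 + r1) powr ?p * \<sigma> powr (- alpha)"
 have M: "M > 0" using K by (simp add: M_def add_pos_nonneg)
 define V where "V x = M * (1 + norm x) powr ?p" for x :: 'a
 have ae: "AE t in lborel. 0 < t \<and> t < t1 --> (AE x in lborel. t powr alpha * v x t \<le> V x)"
  using harnack
 proof (rule eventually_mono, intro impI)
  fix t
  assume *: "0 < t \<and> t < T0 --> (\<forall>h lam c. 0 < lam \<and> lam < 1 \<and>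
    (\<forall>m\<ge>0. norm h * m - t * (1 - lam powr (q - 1)) * m powr q \<le> c) -->
    (AE x in lborel. lam * v (x + h) t \<le> v x t + lam * c))" and t: "0 < t \<and> t < t1"
  \<comment> \<open>A bound for the Legendre transform of
    \<open>m \<mapsto> t * \<sigma> * m powr q\<close> at \<open>norm h\<close>, from Young's
    inequality after scaling \<open>m\<close> by \<open>w = (t * \<sigma>) powr (1 / q)\<close>.
    Times \<open>t powr alpha\<close> it is independent of \<open>t\<close>.\<close>
  define cc where "cc h = norm h powr ?p * (t * \<sigma>) powr (- alpha)" for h :: 'a
  have h1: "AE x in lborel. v (x + h) t \<le> 2 * v x t + cc h" for h
  proof -
   have "norm h * m - t * (1 - (1/2) powr (q - 1)) * m powr q \<le> cc h" if m: "m \<ge> 0" for m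
   proof -
    define w where "w = (t * \<sigma>) powr (1 / q)"
    have w: "w > 0" using t \<sigma> by (simp add: w_def)
    have "(w * m) * (norm h / w) - (w * m) powr q \<le> (norm h / w) powr ?p"
     by (rule young_powr[OF q]) (use w m in auto)
    moreover have "(w * m) * (norm h / w) = norm h * m" using w by simp
    moreover have "(w * m) powr q = t * \<sigma> * m powr q"
     using w m t \<sigma> q by (simp add: powr_mult w_def powr_powr)
    moreover have "(norm h / w) powr ?p = cc h"
    proof -
     have "(norm h / w) powr ?p = norm h powr ?p * w powr (- ?p)"
      using w by (simp add: powr_divide powr_minus_divide)
     also have "w powr (- ?p) = (t * \<sigma>) powr (- alpha)"
      using q unfolding w_def powr_powr alpha_def by (simp add: field_simps)
     finally show ?thesis by (simp add: cc_def)
    qed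
    ultimately show ?thesis by (simp add: \<sigma>_def)
   qed
   then have "AE x in lborel. (1/2) * v (x + h) t \<le> v x t + (1/2) * cc h"
    using *[rule_format, of "1/2" h "cc h"] t t1 by auto
   then show ?thesis by (rule eventually_mono) simp
  qed
  define w where "w x = v x t" for x
  have mw: "w \<in> borel_measurable lborel" unfolding w_def[abs_def] measurable_lborel2 by (rule v_measurable)
  have mcc: "cc \<in> borel_measurable lborel" unfolding cc_def[abs_def] measurable_lborel2
   by (intro borel_measurable_times borel_measurable_const powr_real_measurable borel_measurable_norm measurable_ident)
  let ?P = "lborel \<Otimes>\<^sub>M (lborel :: 'a measure)"
  have m1: "(%z. fst z + snd z) \<in> ?P \<rightarrow>\<^sub>M lborel"
   unfolding measurable_lborel1 measurable_lborel2
   using borel_measurable_add[of fst ?P snd] measurable_fst[of lborel lborel] measurable_snd[of lborel lborel]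
   by simp
  have "{z \<in> space ?P. w (fst z + snd z) \<le> 2 * w (fst z) + cc (snd z)} \<in> sets ?P"
   by (intro borel_measurable_le borel_measurable_add borel_measurable_times borel_measurable_const
     measurable_compose[OF m1 mw] measurable_compose[OF measurable_fst mw] measurable_compose[OF measurable_snd mcc])
  then have meas: "{z \<in> space (lborel \<Otimes>\<^sub>M lborel). v (fst z + snd z) t \<le> 2 * v (fst z) t + cc (snd z)} \<in> sets (lborel \<Otimes>\<^sub>M (lborel :: 'a measure))"
   by (simp only: w_def)
  \<comment> \<open>So far the exceptional set of \<open>x\<close> depends on \<open>h\<close>.
    Fubini exchanges the quantifiers, so that one fixed \<open>x\<close> can be compared with almost
    every other point.\<close>
  have "AE h in lborel. AE x in lborel. v (x + h) t \<le> 2 * v x t + cc h" using h1 by simp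
  then have "AE x in lborel. AE h in lborel. v (x + h) t \<le> 2 * v x t + cc h"
   using lborel_pair.AE_commute[of "%x h. v (x + h) t \<le> 2 * v x t + cc h"] meas by blast
  then have AEx: "AE x in lborel. AE y in lborel. v y t \<le> 2 * v x t + cc (y - x)"
  proof (rule eventually_mono)
   fix x assume "AE h in lborel. v (x + h) t \<le> 2 * v x t + cc h"
   from AE_lborel_translate[OF this, of "- x"] show "AE y in lborel. v y t \<le> 2 * v x t + cc (y - x)"
    by simp
  qed
  \<comment> \<open>Otherwise \<open>v\<close> would exceed \<open>K\<close> almost everywhere on
    the ball, where the bump equals 1, and the mass would be at least
    \<open>K * V1 = \<bar>B\<bar> + 1\<close>.\<close>
  have "\<exists>x\<in>ball x0 r1. v x t \<le> K \<and> (AE y in lborel. v y t \<le> 2 * v x t + cc (y - x))"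
  proof (rule ccontr)
   assume "\<not> ?thesis"
   then have big: "AE x in lborel. x \<in> ball x0 r1 --> K < v x t"
    using AEx by (auto elim!: eventually_mono simp: not_le)
   have cb: "continuous_on UNIV (%x. bump m c (x - x0) :: real)"
    by (rule continuous_on_compose2[OF C2_continuous(1)[OF C2_bump]]) (auto intro!: continuous_intros)
   have "K * V1 = (LBINT x. K * indicator (ball x0 r1) x)" by (simp add: V1_def)
   also have "\<dots> \<le> (LBINT x. v x t * bump m c (x - x0))"
   proof (rule integral_mono_AE)
    show "integrable lborel (%x. K * indicator (ball x0 r1) x)"
     using emeasure_bounded_finite[OF bounded_ball, of x0 r1]
     by (intro integrable_mult_right integrable_real_indicator) (auto simp: top.not_eq_extremum)
    show "integrable lborel (%x. v x t * bump m c (x - x0))"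
    proof (rule integrable_v_mult[OF _ _ cb])
     show "bump m c (x - x0) = 0" if "norm x > sqrt (5 / (4 * c)) + norm x0" for x
      using bump_eq_0[OF c, of "x - x0" m] that norm_triangle_ineq2[of x x0] by auto
    qed (use t t1 in auto)
    show "AE x in lborel. K * indicator (ball x0 r1) x \<le> v x t * bump m c (x - x0)"
     using big
    proof (rule eventually_mono)
     fix x assume x: "x \<in> ball x0 r1 --> K < v x t"
     show "K * indicator (ball x0 r1) x \<le> v x t * bump m c (x - x0)"
     proof (cases "x \<in> ball x0 r1")
      case True
      then have "norm (x - x0) \<le> r1" by (simp add: dist_norm norm_minus_commute)
      then have "norm (x - x0) ^ 2 \<le> r1 ^ 2" by (intro power_mono) auto
      then have "c * ((x - x0) \<bullet> (x - x0)) \<le> c * r1 ^ 2" using c by (simp add: power2_norm_eq_inner)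
      then have "bump m c (x - x0) = 1" using r1 by (intro bump_eq_1) simp
      then show ?thesis using x True by simp
     next
      case False
      then show ?thesis using v_nonneg[of x t] bump_bounds[of m c "x - x0"] by simp
     qed
    qed
   qed
   also have "\<dots> \<le> B" using B[of t] t by simp
   finally show False using V1 by (simp add: K_def)
  qed
  then obtain x where x: "x \<in> ball x0 r1" "v x t \<le> K" "AE y in lborel. v y t \<le> 2 * v x t + cc (y - x)" by blast
  show "AE x in lborel. t powr alpha * v x t \<le> V x"
   using x(3)
  proof (rule eventually_mono)
   fix y assume y: "v y t \<le> 2 * v x t + cc (y - x)"
   have one: "1 \<le> (1 + norm y) powr ?p" using powr_mono2[of ?p 1 "1 + norm y"] p by simp
   have ta: "t powr alpha \<le> 1" using powr_mono2[of alpha t 1] t t1 alpha_pos by simp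
   have "norm (y - x) \<le> norm y + norm x" by (rule norm_triangle_ineq4)
   also have "norm x \<le> norm x0 + r1" using x(1) norm_triangle_ineq2[of x x0] by (simp add: dist_norm norm_minus_commute)
   also have "norm y + (norm x0 + r1) \<le> (1 + norm x0 + r1) * (1 + norm y)" using r1 by (simp add: algebra_simps)
   finally have "norm (y - x) powr ?p \<le> ((1 + norm x0 + r1) * (1 + norm y)) powr ?p"
    using p by (intro powr_mono2) auto
   also have "\<dots> = (1 + norm x0 + r1) powr ?p * (1 + norm y) powr ?p" using r1 by (simp add: powr_mult)
   finally have n1: "norm (y - x) powr ?p \<le> (1 + norm x0 + r1) powr ?p * (1 + norm y) powr ?p" .
   have "t powr alpha * v y t \<le> t powr alpha * (2 * K + cc (y - x))"
    using y x(2) by (intro mult_left_mono) auto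
   also have "\<dots> = t powr alpha * (2 * K) + norm (y - x) powr ?p * (t powr alpha * (t * \<sigma>) powr (- alpha))"
    by (simp add: cc_def algebra_simps)
   also have "t powr alpha * (t * \<sigma>) powr (- alpha) = \<sigma> powr (- alpha)"
   proof -
    have "(t * \<sigma>) powr (- alpha) = t powr (- alpha) * \<sigma> powr (- alpha)" by (rule powr_mult)
    moreover have "t powr alpha * t powr (- alpha) = 1" using t by (simp flip: powr_add)
    ultimately show ?thesis by (metis mult.assoc mult_1)
   qed
   also have "t powr alpha * (2 * K) \<le> 1 * (2 * K)" using ta K by (intro mult_right_mono) auto
   also have "1 * (2 * K) \<le> 2 * K * (1 + norm y) powr ?p" using one K by simp
   also have "norm (y - x) powr ?p * \<sigma> powr (- alpha) \<le> ((1 + norm x0 + r1) powr ?p * (1 + norm y) powr ?p) * \<sigma> powr (- alpha)"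
    using n1 by (intro mult_right_mono) auto
   finally show "t powr alpha * v y t \<le> V y" by (simp add: V_def M_def algebra_simps)
  qed
 qed
 \<comment> \<open>The bound is known at almost every time. Good times decreasing to
   \<open>t\<close>, L1 continuity and an almost everywhere convergent subsequence give it at every
   time.\<close>
 have "AE x in lborel. t powr alpha * v x t \<le> V x" if t: "0 < t" "t < t1" for t
 proof -
  have "\<exists>s. t < s \<and> s < t + (t1 - t) / real (Suc k) \<and> (AE x in lborel. s powr alpha * v x s \<le> V x)" for k
  proof (rule AE_dense)
   show "t < t + (t1 - t) / real (Suc k)" using t by simp
   have le: "(t1 - t) / real (Suc k) \<le> t1 - t" using t by (simp add: divide_le_eq mult_le_cancel_left1)
   show "AE s in lborel. t < s \<and> s < t + (t1 - t) / real (Suc k) --> (AE x in lborel. s powr alpha * v x s \<le> V x)"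
    using ae
   proof (rule eventually_mono, intro impI)
    fix s assume h: "0 < s \<and> s < t1 --> (AE x in lborel. s powr alpha * v x s \<le> V x)"
     and s: "t < s \<and> s < t + (t1 - t) / real (Suc k)"
    have "s < t1" using s le by linarith
    then show "AE x in lborel. s powr alpha * v x s \<le> V x" using h s t by auto
   qed
  qed
  then have "\<forall>k. \<exists>s. t < s \<and> s < t + (t1 - t) / real (Suc k) \<and> (AE x in lborel. s powr alpha * v x s \<le> V x)" by blast
  from choice[OF this] obtain s where s: "\<And>k. t < s k" "\<And>k. s k < t + (t1 - t) / real (Suc k)"
   "\<And>k. AE x in lborel. s k powr alpha * v x (s k) \<le> V x" by blast
  have sT: "0 < s k" "s k < T0" for k
  proof -
   have "(t1 - t) / real (Suc k) \<le> t1 - t" using t by (simp add: divide_le_eq mult_le_cancel_left1)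
   then show "0 < s k" "s k < T0" using s(1)[of k] s(2)[of k] t t1 by linarith+
  qed
  have slim: "s \<longlonglongrightarrow> t"
  proof (rule tendsto_sandwich[where f = "%_. t"])
   have "(%k. t + (t1 - t) * inverse (real (Suc k))) \<longlonglongrightarrow> t + (t1 - t) * 0"
    by (intro tendsto_intros LIMSEQ_inverse_real_of_nat)
   then show "(%k. t + (t1 - t) / real (Suc k)) \<longlonglongrightarrow> t" by (simp add: divide_inverse)
  qed (use s in \<open>auto intro!: always_eventually less_imp_le\<close>)
  have sfl: "filterlim s (at t) sequentially"
   unfolding filterlim_at using slim s(1) by (auto intro!: always_eventually simp: less_imp_neq[symmetric])
  have "AE x in lborel. norm x \<le> real R --> t powr alpha * v x t \<le> V x" for R :: nat
  proof -
   have conv: "(%k. \<integral>\<^sup>+x\<in>cball 0 (real R). ennreal \<bar>v x (s k) - v x t\<bar> \<partial>lborel) \<longlonglongrightarrow> 0"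
    by (rule filterlim_compose[OF v_continuous sfl]) (use t t1 in auto)
   obtain r where r: "strict_mono r" "AE x in lborel. norm x \<le> real R --> (%k. v x (s (r k))) \<longlonglongrightarrow> v x t"
    by (rule L1_cball_AE_subseq[OF conv]) (use v_integrable sT t t1 in auto)
   have all: "AE x in lborel. \<forall>k. s k powr alpha * v x (s k) \<le> V x"
    unfolding AE_all_countable using s(3) by blast
   show ?thesis
    using r(2) all
   proof eventually_elim
    case (elim x)
    show ?case
    proof
     assume "norm x \<le> real R"
     then have "(%k. v x (s (r k))) \<longlonglongrightarrow> v x t" using elim by blast
     moreover have "(%k. s (r k)) \<longlonglongrightarrow> t" using LIMSEQ_subseq_LIMSEQ[OF slim r(1)] by (simp add: comp_def)
     ultimately have "(%k. s (r k) powr alpha * v x (s (r k))) \<longlonglongrightarrow> t powr alpha * v x t"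
      using t by (intro tendsto_intros) auto
     then show "t powr alpha * v x t \<le> V x"
      by (rule tendsto_upperbound) (use elim in auto)
    qed
   qed
  qed
  then have "AE x in lborel. \<forall>R::nat. norm x \<le> real R --> t powr alpha * v x t \<le> V x"
   unfolding AE_all_countable by blast
  then show ?thesis
   by (rule eventually_mono) (use real_arch_simple in blast)
 qed
 then show ?thesis using M unfolding V_def by blast
qed

text \<open>The sup bound provides the constant \<open>M1\<close> for the Laplacian term. Adding
  \<open>M1 * t\<close> makes the weighted mass nondecreasing in \<open>t\<close> and bounded below,
  so it has a limit at 0, and the correction tends to 0.\<close>

lemma bump_limit_exists:
 assumes t1: "0 < t1" "t1 \<le> T0"
  and V: "\<And>t. 0 < t ==> t < t1 ==> AE x in lborel. t powr alpha * v x t \<le> M * (1 + norm x) powr (q / (q - 1))"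
  and psi: "C2 \<psi> G\<psi> D\<psi>" "\<And>x. \<psi> x \<ge> 0" "\<And>x. norm x > Rp ==> \<psi> x = 0 \<and> G\<psi> x = 0 \<and> D\<psi> x = (%v. 0)"
 shows "\<exists>l. ((%t. t powr alpha * (LBINT x. v x t * \<psi> x)) \<longlongrightarrow> l) (at_right 0)"
proof -
 define L where "L x = \<bar>lap (D\<psi> x)\<bar>" for x
 have cL: "continuous_on UNIV L" unfolding L_def by (intro continuous_intros C2_lap_continuous[OF psi(1)])
 have L0: "L x = 0" if "norm x > Rp" for x using psi(3)[OF that] by (simp add: L_def lap_def)
 define M1 where "M1 = (LBINT x. M * (1 + norm x) powr (q / (q - 1)) * L x)"
 have int: "integrable lborel (%x. M * (1 + norm x) powr (q / (q - 1)) * L x)"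
  by (rule integrable_compact_support[where R = Rp])
   (use L0 in \<open>auto intro!: continuous_intros cL simp: add_nonneg_eq_0_iff\<close>)
 have Mb: "t powr alpha * (LBINT x. v x t * L x) \<le> M1" if t: "0 < t" "t < t1" for t
 proof -
  have "(LBINT x. t powr alpha * (v x t * L x)) \<le> M1"
   unfolding M1_def
  proof (rule integral_mono_AE[OF _ int])
   show "integrable lborel (%x. t powr alpha * (v x t * L x))"
    by (intro integrable_mult_right integrable_v_mult[OF _ _ cL L0]) (use t t1 in auto)
   show "AE x in lborel. t powr alpha * (v x t * L x) \<le> M * (1 + norm x) powr (q / (q - 1)) * L x"
    using V[OF t]
   proof (rule eventually_mono)
    fix x assume "t powr alpha * v x t \<le> M * (1 + norm x) powr (q / (q - 1))"
    from mult_right_mono[OF this, of "L x"]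
    show "t powr alpha * (v x t * L x) \<le> M * (1 + norm x) powr (q / (q - 1)) * L x"
     by (simp add: L_def mult.assoc)
   qed
  qed
  then show ?thesis by simp
 qed
 have "\<exists>l. ((%t. t powr alpha * (LBINT x. v x t * \<psi> x) + M1 * t) \<longlongrightarrow> l) (at_right 0)"
 proof (rule mono_at_right_limit[OF t1(1), where L = "- \<bar>M1 * t1\<bar>"])
  fix s t assume st: "0 < s" "s < t" "t < t1"
  show "s powr alpha * (LBINT x. v x s * \<psi> x) + M1 * s \<le> t powr alpha * (LBINT x. v x t * \<psi> x) + M1 * t"
   by (rule weighted_mass_almost_mono[OF t1(2) psi _ st]) (use Mb in \<open>auto simp: L_def\<close>)
 next
  fix t assume t: "0 < t" "t < t1"
  have 1: "t powr alpha * (LBINT x. v x t * \<psi> x) \<ge> 0"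
   using v_nonneg psi(2) by (intro mult_nonneg_nonneg Bochner_Integration.integral_nonneg) auto
  have "\<bar>M1 * t\<bar> \<le> \<bar>M1 * t1\<bar>" using t by (simp add: abs_mult mult_left_mono)
  then show "- \<bar>M1 * t1\<bar> \<le> t powr alpha * (LBINT x. v x t * \<psi> x) + M1 * t" using 1 by linarith
 qed
 then obtain l where l: "((%t. t powr alpha * (LBINT x. v x t * \<psi> x) + M1 * t) \<longlongrightarrow> l) (at_right 0)" by blast
 have "((%t. (t powr alpha * (LBINT x. v x t * \<psi> x) + M1 * t) - M1 * t) \<longlongrightarrow> l - M1 * 0) (at_right 0)"
  by (intro tendsto_intros l)
 then show ?thesis by auto
qed

end

section \<open>Weak limits of densities under a common bound\<close>

text \<open>As \<open>n\<close> grows, these functions increase to the indicator of the open ball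
  where the bump is positive, while remaining C2 with the same support.\<close>

lemma C2_bump_power:
 "C2 (%x::'a::euclidean_space. 1 - (1 - bump 0 c x) ^ (n + 2))
  (%x. (2 * (real (n + 2) * (1 - cut 0 c (x \<bullet> x)) ^ (n + 1) * cut1 0 c (x \<bullet> x))) *\<^sub>R x)
  (%x v. (4 * (real (n + 2) * ((1 - cut 0 c (x \<bullet> x)) ^ (n + 1) * cut2 0 c (x \<bullet> x)
     - real (n + 1) * (1 - cut 0 c (x \<bullet> x)) ^ n * cut1 0 c (x \<bullet> x) ^ 2)) * (x \<bullet> v)) *\<^sub>R x
    + (2 * (real (n + 2) * (1 - cut 0 c (x \<bullet> x)) ^ (n + 1) * cut1 0 c (x \<bullet> x))) *\<^sub>R v)"
 unfolding bump_def
proof (rule C2_radial[where th = "%r. 1 - (1 - cut 0 c r) ^ (n + 2)"])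
 fix r :: real
 have d: "((%r. (1 - cut 0 c r) ^ k) has_real_derivative - (real k * (1 - cut 0 c r) ^ (k - 1) * cut1 0 c r)) (at r)" for k
  using DERIV_power[OF DERIV_diff[OF DERIV_const[of 1] cut_derivative[of 0 c r]], of k] by (simp add: mult_ac)
 show "((%r. 1 - (1 - cut 0 c r) ^ (n + 2)) has_real_derivative
   real (n + 2) * (1 - cut 0 c r) ^ (n + 1) * cut1 0 c r) (at r)"
  by (rule DERIV_cong[OF DERIV_diff[OF DERIV_const[of 1] d]]) simp
 show "((%r. real (n + 2) * (1 - cut 0 c r) ^ (n + 1) * cut1 0 c r) has_real_derivative
   real (n + 2) * ((1 - cut 0 c r) ^ (n + 1) * cut2 0 c r
     - real (n + 1) * (1 - cut 0 c r) ^ n * cut1 0 c r ^ 2)) (at r)"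
  by (rule DERIV_cong[OF DERIV_mult[OF DERIV_cmult[OF d] cut1_derivative]]) (simp add: algebra_simps power2_eq_square)
next
 have "continuous_on UNIV (cut 0 c)" "continuous_on UNIV (cut1 0 c)"
  using cut_derivative cut1_derivative by (meson DERIV_isCont continuous_at_imp_continuous_on)+
 then have "continuous_on UNIV (%r. real (n + 2) * ((1 - cut 0 c r) ^ (n + 1) * cut2 0 c r
     - real (n + 1) * (1 - cut 0 c r) ^ n * cut1 0 c r ^ 2))"
  by (intro continuous_intros cut2_continuous)
 then show "continuous_on {0..} (%r. real (n + 2) * ((1 - cut 0 c r) ^ (n + 1) * cut2 0 c r
     - real (n + 1) * (1 - cut 0 c r) ^ n * cut1 0 c r ^ 2))"
  by (rule continuous_on_subset) auto
qed

text \<open>An abstract setting in which convergence against nonnegative C2 functions of compact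
  support is upgraded to convergence against everything integrable with respect to
  \<open>V dx\<close>, and the limit gets a density below \<open>V\<close>.\<close>

locale bounded_densities =
 fixes w :: "real => 'a::euclidean_space => real" and V :: "'a => real" and t1 :: real
 assumes V_cont: "continuous_on UNIV V" and V_pos: "\<And>x. V x > 0" and t1: "t1 > 0"
  and w_meas: "\<And>t. w t \<in> borel_measurable borel"
  and w_nn: "\<And>t x. 0 \<le> w t x"
  and w_le: "\<And>t. 0 < t ==> t < t1 ==> AE x in lborel. w t x \<le> V x"
  and radial: "\<And>\<psi> G D R. C2 \<psi> G D ==> (\<And>x. \<psi> x \<ge> 0) ==>
   (\<And>x. norm x > R ==> \<psi> x = 0 \<and> G x = 0 \<and> D x = (%v. 0)) ==>
   \<exists>l. ((%t. LBINT x. w t x * \<psi> x) \<longlongrightarrow> l) (at_right 0)"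
begin

definition W :: "'a measure" where "W = density lborel (%x. ennreal (V x))"

definition Lam :: "real => ('a => real) => real" where "Lam t \<phi> = (LBINT x. w t x * \<phi> x)"

definition limex :: "('a => real) => bool" where
 "limex \<phi> \<longleftrightarrow> (\<exists>l. ((%t. Lam t \<phi>) \<longlongrightarrow> l) (at_right 0))"

lemma V_meas [measurable]: "V \<in> borel_measurable borel"
 by (rule borel_measurable_continuous_onI[OF V_cont])

lemma sets_W [simp, measurable_cong]: "sets W = sets borel" by (simp add: W_def)

lemma W_integrable:
 assumes "\<phi> \<in> borel_measurable borel"
 shows "integrable W \<phi> \<longleftrightarrow> integrable lborel (%x. V x * \<phi> x)"
 unfolding W_def using assms V_pos by (subst integrable_density) (auto simp: less_imp_le)

lemma W_integral:
 assumes "\<phi> \<in> borel_measurable borel"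
 shows "integral\<^sup>L W \<phi> = (LBINT x. V x * \<phi> x)"
 unfolding W_def using assms V_pos by (subst integral_density) (auto simp: less_imp_le)

lemma meas_W: "integrable W \<phi> ==> \<phi> \<in> borel_measurable borel"
 using borel_measurable_integrable[of W \<phi>] by (simp add: W_def)

lemma Lam_integrable:
 assumes t: "0 < t" "t < t1" and \<phi>: "integrable W \<phi>"
 shows "integrable lborel (%x. w t x * \<phi> x)"
proof (rule Bochner_Integration.integrable_bound)
 show "integrable lborel (%x. V x * \<phi> x)" using \<phi> W_integrable[OF meas_W[OF \<phi>]] by simp
 show "(%x. w t x * \<phi> x) \<in> borel_measurable lborel"
  using w_meas[of t] meas_W[OF \<phi>] by simp
 show "AE x in lborel. norm (w t x * \<phi> x) \<le> norm (V x * \<phi> x)"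
  using w_le[OF t] by (rule eventually_mono)
   (use w_nn[of t] V_pos in \<open>auto simp: abs_mult less_imp_le intro!: mult_right_mono\<close>)
qed

lemma Lam_bound:
 assumes t: "0 < t" "t < t1" and \<phi>: "integrable W \<phi>"
 shows "\<bar>Lam t \<phi>\<bar> \<le> (\<integral>x. \<bar>\<phi> x\<bar> \<partial>W)"
proof -
 have m: "(%x. \<bar>\<phi> x\<bar>) \<in> borel_measurable borel" using meas_W[OF \<phi>] by simp
 have "\<bar>Lam t \<phi>\<bar> \<le> (LBINT x. \<bar>w t x * \<phi> x\<bar>)"
  unfolding Lam_def using integral_norm_bound[of lborel "%x. w t x * \<phi> x"] by simp
 also have "\<dots> \<le> (LBINT x. V x * \<bar>\<phi> x\<bar>)"
 proof (rule integral_mono_AE)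
  show "integrable lborel (%x. \<bar>w t x * \<phi> x\<bar>)" using Lam_integrable[OF assms] by simp
  show "integrable lborel (%x. V x * \<bar>\<phi> x\<bar>)"
   using integrable_abs[OF \<phi>] W_integrable[OF m] by simp
  show "AE x in lborel. \<bar>w t x * \<phi> x\<bar> \<le> V x * \<bar>\<phi> x\<bar>"
   using w_le[OF t] by (rule eventually_mono)
    (use w_nn[of t] in \<open>auto simp: abs_mult intro!: mult_right_mono\<close>)
 qed
 finally show ?thesis by (simp add: W_integral[OF m])
qed

lemma ev_t: "\<forall>\<^sub>F t in at_right 0. 0 < t \<and> t < t1"
 using t1 by (auto simp: eventually_at_right_field intro!: exI[of _ t1])

lemma Lam_diff:
 assumes "0 < t" "t < t1" "integrable W \<phi>" "integrable W \<psi>"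
 shows "Lam t \<phi> - Lam t \<psi> = Lam t (%x. \<phi> x - \<psi> x)"
 using Lam_integrable[OF assms(1,2,3)] Lam_integrable[OF assms(1,2,4)]
 unfolding Lam_def by (simp add: right_diff_distrib)

lemma Lam_add:
 assumes "0 < t" "t < t1" "integrable W \<phi>" "integrable W \<psi>"
 shows "Lam t \<phi> + Lam t \<psi> = Lam t (%x. \<phi> x + \<psi> x)"
 using Lam_integrable[OF assms(1,2,3)] Lam_integrable[OF assms(1,2,4)]
 unfolding Lam_def by (simp add: distrib_left)

lemma limex_add:
 assumes "limex \<phi>" "limex \<psi>" "integrable W \<phi>" "integrable W \<psi>"
 shows "limex (%x. \<phi> x + \<psi> x)"
proof -
 obtain l k where lk: "((%t. Lam t \<phi>) \<longlongrightarrow> l) (at_right 0)" "((%t. Lam t \<psi>) \<longlongrightarrow> k) (at_right 0)"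
  using assms by (auto simp: limex_def)
 have "((%t. Lam t (%x. \<phi> x + \<psi> x)) \<longlongrightarrow> l + k) (at_right 0)"
  by (rule Lim_transform_eventually[OF tendsto_add[OF lk]], rule eventually_mono[OF ev_t])
   (use Lam_add assms in auto)
 then show ?thesis by (auto simp: limex_def)
qed

lemma limex_cmult:
 assumes "limex \<phi>" shows "limex (%x. c * \<phi> x)"
proof -
 obtain l where l: "((%t. Lam t \<phi>) \<longlongrightarrow> l) (at_right 0)"
  using assms by (auto simp: limex_def)
 have "Lam t (%x. c * \<phi> x) = c * Lam t \<phi>" for t
  unfolding Lam_def by (simp add: mult.left_commute)
 then have "((%t. Lam t (%x. c * \<phi> x)) \<longlongrightarrow> c * l) (at_right 0)"
  by (simp only:) (intro tendsto_intros l)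
 then show ?thesis by (auto simp: limex_def)
qed

text \<open>By \<open>Lam_bound\<close> the functionals \<open>Lam t\<close> have a common Lipschitz
  constant in L1 of \<open>W\<close>. Hence the limits \<open>l n\<close> form a Cauchy sequence,
  and its limit is attained by \<open>\<psi>\<close>.\<close>

lemma limex_closed:
 assumes lim: "\<And>n. limex (\<phi> n)" and int: "\<And>n. integrable W (\<phi> n)" "integrable W \<psi>"
  and conv: "(%n. \<integral>x. \<bar>\<phi> n x - \<psi> x\<bar> \<partial>W) \<longlonglongrightarrow> 0"
 shows "limex \<psi>"
proof -
 define d where "d n = (\<integral>x. \<bar>\<phi> n x - \<psi> x\<bar> \<partial>W)" for n
 obtain l where l: "\<And>n. ((%t. Lam t (\<phi> n)) \<longlongrightarrow> l n) (at_right 0)"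
  using lim unfolding limex_def by metis
 have close: "\<bar>Lam t (\<phi> n) - Lam t \<psi>\<bar> \<le> d n" if "0 < t" "t < t1" for t n
  using Lam_bound[OF that, of "%x. \<phi> n x - \<psi> x"] Lam_diff[OF that int(1)[of n] int(2)] int
  by (simp add: d_def)
 have ll: "\<bar>l n - l m\<bar> \<le> d n + d m" for n m
 proof (rule tendsto_upperbound)
  show "((%t. \<bar>Lam t (\<phi> n) - Lam t (\<phi> m)\<bar>) \<longlongrightarrow> \<bar>l n - l m\<bar>) (at_right 0)"
   by (intro tendsto_intros l)
  show "\<forall>\<^sub>F t in at_right 0. \<bar>Lam t (\<phi> n) - Lam t (\<phi> m)\<bar> \<le> d n + d m"
   using ev_t
  proof eventually_elim
   case (elim t)
   then show ?case using close[of t n] close[of t m] by linarith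
  qed
 qed simp
 have "Cauchy l"
 proof (rule CauchyI)
  fix e :: real assume e: "e > 0"
  then have "\<forall>\<^sub>F n in sequentially. d n < e / 2"
   using order_tendstoD(2)[OF conv, of "e / 2"] by (simp add: d_def)
  then obtain N where "\<And>n. n \<ge> N ==> d n < e / 2" by (auto simp: eventually_sequentially)
  then show "\<exists>N. \<forall>m\<ge>N. \<forall>n\<ge>N. norm (l m - l n) < e"
   using ll by (intro exI[of _ N]) (smt (verit, best) field_sum_of_halves real_norm_def)
 qed
 then obtain l0 where l0: "l \<longlonglongrightarrow> l0" using Cauchy_convergent_iff convergent_def by blast
 have "((%t. Lam t \<psi>) \<longlongrightarrow> l0) (at_right 0)"
 proof (rule tendstoI)
  fix e :: real assume e: "e > 0"
  have "\<forall>\<^sub>F n in sequentially. d n < e / 3" using order_tendstoD(2)[OF conv, of "e / 3"] e by (simp add: d_def)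
  moreover have "\<forall>\<^sub>F n in sequentially. dist (l n) l0 < e / 3" using tendstoD[OF l0, of "e / 3"] e by simp
  ultimately have "\<forall>\<^sub>F n in sequentially. d n < e / 3 \<and> dist (l n) l0 < e / 3" by eventually_elim simp
  then obtain n where n: "d n < e / 3" "dist (l n) l0 < e / 3" using eventually_happens by force
  have "\<forall>\<^sub>F t in at_right 0. dist (Lam t (\<phi> n)) (l n) < e / 3" using tendstoD[OF l, of "e / 3"] e by simp
  then show "\<forall>\<^sub>F t in at_right 0. dist (Lam t \<psi>) l0 < e"
   using ev_t
  proof eventually_elim
   case (elim t)
   then show ?case using close[of t n] n unfolding dist_real_def by linarith
  qed
 qed
 then show ?thesis by (auto simp: limex_def)
qed

lemma finite_emeasure_W: "emeasure W (A \<inter> ball 0 r) < \<infinity>" if "A \<in> sets borel"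
proof -
 have "emeasure W (A \<inter> ball 0 r) \<le> emeasure W (cball 0 r)"
  by (intro emeasure_mono) auto
 also have "\<dots> < \<infinity>"
 proof -
  have i: "integrable lborel (%x. indicator (cball 0 r) x *\<^sub>R V x)"
   by (rule borel_integrable_compact) (auto intro: continuous_on_subset[OF V_cont])
  have "emeasure W (cball 0 r) = (\<integral>\<^sup>+x. ennreal (indicator (cball 0 r) x *\<^sub>R V x) \<partial>lborel)"
   unfolding W_def by (subst emeasure_density) (auto intro!: nn_integral_cong simp: indicator_def)
  also have "\<dots> < \<infinity>" using i V_pos
   by (subst nn_integral_eq_integral) (auto simp: less_imp_le)
  finally show ?thesis .
 qed
 finally show ?thesis .
qed

lemma integrable_indicator_W: "A \<in> sets borel ==> emeasure W A < \<infinity> ==> integrable W (indicator A :: 'a => real)"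
 by (intro integrable_real_indicator) auto

lemma limex_incseq:
 assumes A: "\<And>n. A n \<in> sets borel" "incseq A" and fin: "emeasure W (\<Union>n. A n) < \<infinity>"
  and lim: "\<And>n. limex (indicator (A n))"
 shows "limex (indicator (\<Union>n. A n))"
proof (rule limex_closed[OF lim])
 have U: "(\<Union>n. A n) \<in> sets borel" using A by auto
 show int: "integrable W (indicator (\<Union>n. A n) :: 'a => real)" by (rule integrable_indicator_W[OF U fin])
 show intn: "integrable W (indicator (A n) :: 'a => real)" for n
 proof (rule integrable_indicator_W[OF A(1)])
  have "emeasure W (A n) \<le> emeasure W (\<Union>n. A n)" using U by (intro emeasure_mono) auto
  then show "emeasure W (A n) < \<infinity>" using fin by (rule le_less_trans)
 qed
 have "(%n. \<integral>x. \<bar>indicator (A n) x - indicator (\<Union>n. A n) x :: real\<bar> \<partial>W) \<longlonglongrightarrow> (\<integral>x. 0 \<partial>W)"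
 proof (rule integral_dominated_convergence[where w = "indicator (\<Union>n. A n)"])
  show "AE x in W. (%n. \<bar>indicator (A n) x - indicator (\<Union>n. A n) x :: real\<bar>) \<longlonglongrightarrow> 0"
  proof (intro AE_I2)
   fix x
   have "(%n. indicator (A n) x :: real) \<longlonglongrightarrow> indicator (\<Union>n. A n) x"
    by (rule LIMSEQ_indicator_incseq[OF A(2)])
   then have "(%n. \<bar>indicator (A n) x - indicator (\<Union>n. A n) x :: real\<bar>) \<longlonglongrightarrow> \<bar>indicator (\<Union>n. A n) x - indicator (\<Union>n. A n) x\<bar>"
    by (intro tendsto_intros)
   then show "(%n. \<bar>indicator (A n) x - indicator (\<Union>n. A n) x :: real\<bar>) \<longlonglongrightarrow> 0" by simp
  qed
  show "AE x in W. norm \<bar>indicator (A n) x - indicator (\<Union>n. A n) x :: real\<bar> \<le> indicator (\<Union>n. A n) x" for n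
   by (intro AE_I2) (auto simp: indicator_def)
 qed (use int intn in auto)
 then show "(%n. \<integral>x. \<bar>indicator (A n) x - indicator (\<Union>n. A n) x :: real\<bar> \<partial>W) \<longlonglongrightarrow> 0" by simp
qed

lemma limex_AE_cong:
 assumes "limex \<phi>" "integrable W \<phi>" "\<psi> \<in> borel_measurable borel" "AE x in lborel. \<phi> x = \<psi> x"
 shows "limex \<psi>"
proof -
 have "Lam t \<phi> = Lam t \<psi>" for t
  unfolding Lam_def using assms(4) w_meas[of t] meas_W[OF assms(2)] assms(3)
  by (intro integral_cong_AE) (auto elim!: eventually_mono)
 then show ?thesis using assms(1) by (simp add: limex_def)
qed

lemma limex_empty: "limex (indicator {})"
 by (auto simp: limex_def Lam_def intro!: exI[of _ 0])

lemma limex_ball: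
 assumes r: "r > 0"
 shows "limex (indicator (ball x0 r))"
proof -
 define c where "c = 5 / (4 * r ^ 2)"
 have c: "c > 0" using r by (simp add: c_def)
 have sq: "sqrt (5 / (4 * c)) = r" using r by (simp add: c_def real_sqrt_unique)
 define \<phi> where "\<phi> n x = 1 - (1 - bump 0 c (x - x0)) ^ (n + 2)" for n and x :: 'a
 have b: "0 \<le> 1 - bump 0 c y" "1 - bump 0 c y \<le> 1" for y :: 'a using bump_bounds[of 0 c y] by auto
 have far: "bump 0 c (x - x0) = 0" if "norm (x - x0) \<ge> r" for x
  using bump_eq_0[OF c, of "x - x0" 0] that sq by simp
 have cont: "continuous_on UNIV (\<phi> n)" for n
  unfolding \<phi>_def by (intro continuous_intros continuous_on_compose2[OF C2_continuous(1)[OF C2_bump]]) auto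
 have phi_ind: "0 \<le> \<phi> n x \<and> \<phi> n x \<le> indicator (ball x0 r) x" for n x
 proof (cases "x \<in> ball x0 r")
  case True
  then show ?thesis using power_le_one[OF b(1)[of "x - x0"] b(2)[of "x - x0"], of "n + 2"] zero_le_power[OF b(1)[of "x - x0"], of "n + 2"] by (simp add: \<phi>_def)
 next
  case False
  then show ?thesis using far[of x] by (simp add: \<phi>_def dist_norm norm_minus_commute)
 qed
 have fin: "emeasure W (ball x0 r) < \<infinity>"
 proof -
  have "ball x0 r \<subseteq> UNIV \<inter> ball 0 (norm x0 + r)"
  proof
   fix x :: 'a assume "x \<in> ball x0 r"
   then have "norm (x - x0) < r" by (simp add: dist_norm norm_minus_commute)
   then show "x \<in> UNIV \<inter> ball 0 (norm x0 + r)" using norm_triangle_sub[of x x0] by simp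
  qed
  then have "emeasure W (ball x0 r) \<le> emeasure W (UNIV \<inter> ball 0 (norm x0 + r))" by (intro emeasure_mono) auto
  also have "\<dots> < \<infinity>" by (rule finite_emeasure_W) simp
  finally show ?thesis .
 qed
 have int: "integrable W (indicator (ball x0 r) :: 'a => real)" by (rule integrable_indicator_W) (use fin in auto)
 have mphi: "\<phi> n \<in> borel_measurable borel" for n by (rule borel_measurable_continuous_onI[OF cont])
 have intn: "integrable W (\<phi> n)" for n
  by (rule Bochner_Integration.integrable_bound[OF int]) (use phi_ind[of n] mphi in \<open>auto intro!: AE_I2\<close>)
 show ?thesis
 proof (rule limex_closed[of \<phi>])
  show "limex (\<phi> n)" for n
   unfolding limex_def Lam_def
  proof (rule radial)
   show "C2 (\<phi> n) (%x. (2 * (real (n + 2) * (1 - cut 0 c ((x - x0) \<bullet> (x - x0))) ^ (n + 1) * cut1 0 c ((x - x0) \<bullet> (x - x0)))) *\<^sub>R (x - x0))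
    (%x v. (4 * (real (n + 2) * ((1 - cut 0 c ((x - x0) \<bullet> (x - x0))) ^ (n + 1) * cut2 0 c ((x - x0) \<bullet> (x - x0))
     - real (n + 1) * (1 - cut 0 c ((x - x0) \<bullet> (x - x0))) ^ n * cut1 0 c ((x - x0) \<bullet> (x - x0)) ^ 2)) * ((x - x0) \<bullet> v)) *\<^sub>R (x - x0)
    + (2 * (real (n + 2) * (1 - cut 0 c ((x - x0) \<bullet> (x - x0))) ^ (n + 1) * cut1 0 c ((x - x0) \<bullet> (x - x0)))) *\<^sub>R v)"
    unfolding \<phi>_def by (rule C2_translate[OF C2_bump_power])
   show "\<phi> n x \<ge> 0" for x using phi_ind by blast
   fix x :: 'a assume "norm x > norm x0 + r"
   then have "norm (x - x0) \<ge> r" using norm_triangle_ineq2[of x x0] by linarith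
   then have "norm (x - x0) ^ 2 \<ge> r ^ 2" using r by (intro power_mono) auto
   then have "c * ((x - x0) \<bullet> (x - x0)) \<ge> c * r ^ 2" using c by (simp add: power2_norm_eq_inner)
   also have "c * r ^ 2 = 5/4" using r by (simp add: c_def)
   finally have z: "cut 0 c ((x - x0) \<bullet> (x - x0)) = 0" "cut1 0 c ((x - x0) \<bullet> (x - x0)) = 0" "cut2 0 c ((x - x0) \<bullet> (x - x0)) = 0"
    by (auto intro!: cut_eq_0)
   show "\<phi> n x = 0 \<and> (2 * (real (n + 2) * (1 - cut 0 c ((x - x0) \<bullet> (x - x0))) ^ (n + 1) * cut1 0 c ((x - x0) \<bullet> (x - x0)))) *\<^sub>R (x - x0) = 0 \<and>
    (%v. (4 * (real (n + 2) * ((1 - cut 0 c ((x - x0) \<bullet> (x - x0))) ^ (n + 1) * cut2 0 c ((x - x0) \<bullet> (x - x0))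
     - real (n + 1) * (1 - cut 0 c ((x - x0) \<bullet> (x - x0))) ^ n * cut1 0 c ((x - x0) \<bullet> (x - x0)) ^ 2)) * ((x - x0) \<bullet> v)) *\<^sub>R (x - x0)
    + (2 * (real (n + 2) * (1 - cut 0 c ((x - x0) \<bullet> (x - x0))) ^ (n + 1) * cut1 0 c ((x - x0) \<bullet> (x - x0)))) *\<^sub>R v) = (%v. 0)"
    unfolding z \<phi>_def bump_def by simp
  qed
  have "(%n. \<integral>x. \<bar>\<phi> n x - indicator (ball x0 r) x\<bar> \<partial>W) \<longlonglongrightarrow> (\<integral>x. 0 \<partial>W)"
  proof (rule integral_dominated_convergence[where w = "indicator (ball x0 r)"])
   show "AE x in W. (%n. \<bar>\<phi> n x - indicator (ball x0 r) x\<bar>) \<longlonglongrightarrow> 0"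
   proof (intro AE_I2)
    fix x
    show "(%n. \<bar>\<phi> n x - indicator (ball x0 r) x\<bar>) \<longlonglongrightarrow> 0"
    proof (cases "x \<in> ball x0 r")
     case True
     then have "norm (x - x0) < r" by (simp add: dist_norm norm_minus_commute)
     then have "norm (x - x0) ^ 2 < r ^ 2" using r by (intro power_strict_mono) auto
     then have "c * ((x - x0) \<bullet> (x - x0)) < c * r ^ 2" using c by (simp add: power2_norm_eq_inner)
     also have "c * r ^ 2 = 5/4" using r by (simp add: c_def)
     finally have "bump 0 c (x - x0) > 0" unfolding bump_def by (rule cut_pos)
     then have "(%n. (1 - bump 0 c (x - x0)) ^ n) \<longlonglongrightarrow> 0" using b[of "x - x0"] by (intro LIMSEQ_power_zero) auto
     from LIMSEQ_ignore_initial_segment[OF this, of 2]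
     have "(%n. \<bar>(1 - (1 - bump 0 c (x - x0)) ^ (n + 2)) - 1\<bar>) \<longlonglongrightarrow> \<bar>(1 - 0) - 1\<bar>" by (intro tendsto_intros)
     then show ?thesis using True by (simp add: \<phi>_def)
    next
     case False
     have "\<phi> n x = 0" for n using phi_ind[of n x] False by auto
     then show ?thesis using False by simp
    qed
   qed
   show "AE x in W. norm \<bar>\<phi> n x - indicator (ball x0 r) x\<bar> \<le> indicator (ball x0 r) x" for n
    by (intro AE_I2) (use phi_ind[of n] in \<open>auto simp: abs_le_iff add_increasing2\<close>)
  qed (use int intn in auto)
  then show "(%n. \<integral>x. \<bar>\<phi> n x - indicator (ball x0 r) x\<bar> \<partial>W) \<longlonglongrightarrow> 0" by simp
 qed (use intn int in auto)
qed

lemma limex_disjoint_Un: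
 assumes "limex (indicator A)" "limex (indicator B)" "A \<inter> B = {}" "A \<in> sets borel" "B \<in> sets borel"
  and "emeasure W A < \<infinity>" "emeasure W B < \<infinity>"
 shows "limex (indicator (A \<union> B))"
proof -
 have "limex (%x. indicator A x + indicator B x)"
  using assms by (intro limex_add integrable_indicator_W) auto
 moreover have "(%x. indicator A x + indicator B x) = (indicator (A \<union> B) :: 'a => real)"
  using assms(3) by (auto simp: indicator_def fun_eq_iff)
 ultimately show ?thesis by simp
qed

lemma limex_finite_UN:
 assumes "finite F" "\<And>i. i \<in> F ==> limex (indicator (B i))" "\<And>i. i \<in> F ==> B i \<in> sets borel"
  "disjoint_family_on B F" "\<And>i. i \<in> F ==> emeasure W (B i) < \<infinity>"
 shows "limex (indicator (\<Union>i\<in>F. B i)) \<and> emeasure W (\<Union>i\<in>F. B i) < \<infinity>"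
 using assms
proof (induction F rule: finite_induct)
 case empty
 show ?case unfolding image_empty Union_empty by (intro conjI limex_empty) simp
next
 case (insert i F)
 have IH: "limex (indicator (\<Union>i\<in>F. B i))" "emeasure W (\<Union>i\<in>F. B i) < \<infinity>"
  using insert by (auto simp: disjoint_family_on_def)
 have disj: "B i \<inter> (\<Union>i\<in>F. B i) = {}" using insert(2,6) by (force simp: disjoint_family_on_def)
 have m: "(\<Union>i\<in>F. B i) \<in> sets borel" using insert by auto
 have "limex (indicator (B i \<union> (\<Union>i\<in>F. B i)))"
  by (rule limex_disjoint_Un[OF _ IH(1) disj]) (use insert IH m in auto)
 moreover have "emeasure W (B i \<union> (\<Union>i\<in>F. B i)) \<le> emeasure W (B i) + emeasure W (\<Union>i\<in>F. B i)"
  using insert m by (intro emeasure_subadditive) auto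
 then have "emeasure W (B i \<union> (\<Union>i\<in>F. B i)) < \<infinity>"
  by (rule le_less_trans) (use insert IH in \<open>auto simp: less_top[symmetric]\<close>)
 ultimately show ?case by simp
qed

text \<open>By Vitali's covering theorem a bounded open set is, up to a null set, a countable
  disjoint union of balls; finite unions are handled by additivity and the countable one by monotone
  limits.\<close>

lemma limex_open_bounded:
 assumes U: "open U" "U \<subseteq> ball 0 k"
 shows "limex (indicator U)"
proof -
 define K where "K = {i::'a \<times> real. 0 < snd i \<and> cball (fst i) (snd i) \<subseteq> U}"
 obtain C where C: "countable C" "C \<subseteq> K" "pairwise (%i j. disjnt (cball (fst i) (snd i)) (cball (fst j) (snd j))) C"
  "negligible (U - (\<Union>i\<in>C. cball (fst i) (snd i)))"
 proof (rule Vitali_covering_theorem_cballs[of K snd U fst])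
  show "0 < snd i" if "i \<in> K" for i using that by (simp add: K_def)
  fix x d assume x: "x \<in> U" and d: "(0::real) < d"
  obtain e where e: "e > 0" "cball x e \<subseteq> U" using U(1) x open_contains_cball by blast
  define r where "r = min e (d / 2)"
  have "(x, r) \<in> K" using e d by (auto simp: K_def r_def)
  moreover have "x \<in> cball x r" "r < d" using e d by (auto simp: r_def min_less_iff_disj)
  ultimately show "\<exists>i. i \<in> K \<and> x \<in> cball (fst i) (snd i) \<and> snd i < d" by (intro exI[of _ "(x, r)"]) auto
 qed blast
 define B where "B i = ball (fst i) (snd i)" for i :: "'a \<times> real"
 have BU: "B i \<subseteq> U" if "i \<in> C" for i using C(2) that by (force simp: B_def K_def)
 have disj: "disjoint_family_on B C"
  unfolding disjoint_family_on_def
 proof (intro ballI impI)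
  fix i j assume "i \<in> C" "j \<in> C" "i \<noteq> j"
  then have "disjnt (cball (fst i) (snd i)) (cball (fst j) (snd j))" using C(3) by (auto simp: pairwise_def)
  then show "B i \<inter> B j = {}" unfolding disjnt_def B_def using ball_subset_cball by blast
 qed
 have finU: "emeasure W A < \<infinity>" if "A \<subseteq> U" "A \<in> sets borel" for A
 proof -
  have "A = A \<inter> ball 0 k" using that U by auto
  then show ?thesis using finite_emeasure_W[OF that(2), of k] by simp
 qed
 define F where "F n = to_nat_on C -` {..<n} \<inter> C" for n
 have finF: "finite (F n)" for n unfolding F_def by (rule finite_vimage_IntI[OF finite_lessThan inj_on_to_nat_on[OF C(1)]])
 have UF: "(\<Union>n. \<Union>i\<in>F n. B i) = (\<Union>i\<in>C. B i)" by (auto simp: F_def)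
 have sub: "(\<Union>i\<in>C. B i) \<subseteq> U" using BU by blast
 have meas: "(\<Union>i\<in>C. B i) \<in> sets borel" unfolding B_def by (intro borel_open open_UN) auto
 have lim: "limex (indicator (\<Union>n. \<Union>i\<in>F n. B i))"
 proof (rule limex_incseq)
  show "(\<Union>i\<in>F n. B i) \<in> sets borel" for n unfolding B_def by (intro borel_open open_UN) auto
  show "incseq (%n. \<Union>i\<in>F n. B i)" by (force simp: incseq_def F_def)
  show "emeasure W (\<Union>n. \<Union>i\<in>F n. B i) < \<infinity>" unfolding UF by (rule finU[OF sub meas])
  show "limex (indicator (\<Union>i\<in>F n. B i))" for n
  proof (rule limex_finite_UN[OF finF, THEN conjunct1])
   fix i assume i: "i \<in> F n"
   then have "i \<in> C" by (simp add: F_def)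
   then show "emeasure W (B i) < \<infinity>" by (intro finU BU) (auto simp: B_def)
   have "snd i > 0" using C(2) \<open>i \<in> C\<close> by (auto simp: K_def)
   then show "limex (indicator (B i))" unfolding B_def by (rule limex_ball)
   show "B i \<in> sets borel" by (simp add: B_def)
  next
   show "disjoint_family_on B (F n)" using disj by (auto simp: disjoint_family_on_def F_def)
  qed
 qed
 \<comment> \<open>The covering theorem gives closed balls, but limits were obtained for open ones.
   The spheres are therefore added to the null set.\<close>
 define N where "N = (U - (\<Union>i\<in>C. cball (fst i) (snd i))) \<union> (\<Union>i\<in>C. sphere (fst i) (snd i))"
 have "negligible (\<Union>i\<in>C. sphere (fst i) (snd i))"
  by (rule negligible_countable_Union) (use C(1) negligible_sphere in auto)
 then have "negligible N" unfolding N_def using C(4) by (rule negligible_Un[rotated])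
 then have "AE x in lebesgue. x \<notin> N" by (intro AE_not_in) (simp add: negligible_iff_null_sets)
 then have "AE x in lborel. x \<notin> N" by (simp add: AE_completion_iff)
 then have "AE x in lborel. indicator (\<Union>i\<in>C. B i) x = (indicator U x :: real)"
 proof (rule eventually_mono)
  fix x assume "x \<notin> N"
  have "x \<in> (\<Union>i\<in>C. B i)" if xU: "x \<in> U"
  proof -
   obtain i where i: "i \<in> C" "dist (fst i) x \<le> snd i" using xU \<open>x \<notin> N\<close> by (auto simp: N_def)
   moreover have "dist (fst i) x \<noteq> snd i" using i(1) \<open>x \<notin> N\<close> by (auto simp: N_def)
   ultimately show ?thesis by (auto simp: B_def intro!: bexI[of _ i])
  qed
  then show "indicator (\<Union>i\<in>C. B i) x = (indicator U x :: real)" using sub by (auto simp: indicator_def)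
 qed
 then show ?thesis
  using limex_AE_cong[of "indicator (\<Union>i\<in>C. B i)" "indicator U"] lim U integrable_indicator_W[OF meas finU[OF sub meas]]
  unfolding UF by simp
qed

text \<open>Dynkin's argument, starting from the open sets as an intersection-stable generator.
  Intersecting with a ball keeps all \<open>W\<close> measures finite, so complements can be handled
  by subtraction.\<close>

lemma limex_borel_bounded:
 assumes "A \<in> sets borel"
 shows "limex (indicator (A \<inter> ball 0 k))"
proof -
 have *: "sets borel = sigma_sets UNIV {S::'a set. open S}" by (simp add: borel_def)
 show ?thesis
 proof (rule sigma_sets_induct_disjoint[of "{S::'a set. open S}" UNIV A])
  show "Int_stable {S::'a set. open S}" by (auto simp: Int_stable_def)
  show "A \<in> sigma_sets UNIV {S. open S}" using assms * by simp
  show "limex (indicator (A \<inter> ball 0 k))" if "A \<in> {S. open S}" for A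
   by (rule limex_open_bounded[of _ k]) (use that in auto)
  show "limex (indicator ({} \<inter> ball 0 k))" unfolding Int_empty_left by (rule limex_empty)
  fix A :: "'a set" assume A: "A \<in> sigma_sets UNIV {S. open S}" and lim: "limex (indicator (A \<inter> ball 0 k))"
  have mA: "A \<in> sets borel" using A * by simp
  have "limex (%x. indicator (ball 0 k) x + (- 1) * indicator (A \<inter> ball 0 k) x)"
   using lim limex_open_bounded[of "ball 0 k" k] mA finite_emeasure_W[of UNIV k] finite_emeasure_W[OF mA, of k]
   by (intro limex_add limex_cmult integrable_mult_right integrable_indicator_W) auto
  moreover have "(%x. indicator (ball 0 k) x + (- 1) * indicator (A \<inter> ball 0 k) x) = (indicator ((UNIV - A) \<inter> ball 0 k) :: 'a => real)"
   by (auto simp: indicator_def fun_eq_iff)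
  ultimately show "limex (indicator ((UNIV - A) \<inter> ball 0 k))" by simp
 next
  fix A :: "nat => 'a set"
  assume d: "disjoint_family A" and A: "range A \<subseteq> sigma_sets UNIV {S. open S}"
   and lim: "\<And>i. limex (indicator (A i \<inter> ball 0 k))"
  have mA: "A i \<in> sets borel" for i using A * by auto
  have U: "(\<Union>n. \<Union>i<n. A i \<inter> ball 0 k) = (\<Union>i. A i) \<inter> ball 0 k" by auto
  have "limex (indicator (\<Union>n. \<Union>i<n. A i \<inter> ball 0 k))"
  proof (rule limex_incseq)
   show "(\<Union>i<n. A i \<inter> ball 0 k) \<in> sets borel" for n using mA by auto
   show "incseq (%n. \<Union>i<n. A i \<inter> ball 0 k)" by (force simp: incseq_def)
   show "emeasure W (\<Union>n. \<Union>i<n. A i \<inter> ball 0 k) < \<infinity>" unfolding U by (rule finite_emeasure_W) (use mA in auto)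
   show "limex (indicator (\<Union>i<n. A i \<inter> ball 0 k))" for n
   proof (rule limex_finite_UN[THEN conjunct1])
    show "disjoint_family_on (%i. A i \<inter> ball 0 k) {..<n}"
     unfolding disjoint_family_on_def
    proof (intro ballI impI)
     fix i j :: nat assume "i \<noteq> j"
     then have "A i \<inter> A j = {}" using d by (auto simp: disjoint_family_on_def)
     then show "(A i \<inter> ball 0 k) \<inter> (A j \<inter> ball 0 k) = {}" by blast
    qed
   qed (use lim mA finite_emeasure_W in auto)
  qed
  then show "limex (indicator ((\<Union>i. A i) \<inter> ball 0 k))" unfolding U .
 qed auto
qed

lemma L1_dominated:
 assumes "\<And>i. integrable W (s i)" "integrable W \<phi>" "\<And>x. (%i. s i x) \<longlonglongrightarrow> \<phi> x" "\<And>i x. \<bar>s i x\<bar> \<le> 2 * \<bar>\<phi> x\<bar>"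
 shows "(%n. \<integral>x. \<bar>s n x - \<phi> x :: real\<bar> \<partial>W) \<longlonglongrightarrow> 0"
proof -
 have "(%n. \<integral>x. \<bar>s n x - \<phi> x\<bar> \<partial>W) \<longlonglongrightarrow> (\<integral>x. 0 \<partial>W)"
 proof (rule integral_dominated_convergence[where w = "%x. 3 * \<bar>\<phi> x\<bar>"])
  show "AE x in W. (%n. \<bar>s n x - \<phi> x\<bar>) \<longlonglongrightarrow> 0"
  proof (intro AE_I2)
   fix x
   have "(%n. \<bar>s n x - \<phi> x\<bar>) \<longlonglongrightarrow> \<bar>\<phi> x - \<phi> x\<bar>" by (intro tendsto_intros assms(3))
   then show "(%n. \<bar>s n x - \<phi> x\<bar>) \<longlonglongrightarrow> 0" by simp
  qed
  show "AE x in W. norm \<bar>s n x - \<phi> x\<bar> \<le> 3 * \<bar>\<phi> x\<bar>" for n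
  proof (intro AE_I2)
   fix x show "norm \<bar>s n x - \<phi> x\<bar> \<le> 3 * \<bar>\<phi> x\<bar>" using assms(4)[of n x] unfolding real_norm_def by linarith
  qed
 qed (use assms(1,2) in auto)
 then show ?thesis by simp
qed

lemma limex_integrable:
 assumes "integrable W \<phi>"
 shows "limex \<phi>"
 using assms
proof (induction rule: integrable_induct)
 case (base A c)
 have mA: "A \<in> sets borel" using base by simp
 have "limex (indicator (\<Union>n. A \<inter> ball 0 (real n)))"
 proof (rule limex_incseq)
  show "incseq (%n. A \<inter> ball 0 (real n))" by (force simp: incseq_def)
  have "emeasure W (\<Union>n. A \<inter> ball 0 (real n)) \<le> emeasure W A" using mA by (intro emeasure_mono) auto
  then show "emeasure W (\<Union>n. A \<inter> ball 0 (real n)) < \<infinity>" using base by (auto simp: less_top[symmetric] top_unique)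
 qed (use mA limex_borel_bounded in auto)
 moreover have "(\<Union>n. A \<inter> ball 0 (real n)) = A" using reals_Archimedean2 by force
 ultimately show ?case using limex_cmult[of "indicator A" c] by (simp add: mult.commute)
next
 case (add f g)
 then show ?case by (intro limex_add)
next
 case (lim f s)
 have sp: "space W = UNIV" by (simp add: W_def)
 show ?case
  by (rule limex_closed[OF _ lim.hyps(1,4) L1_dominated[OF lim.hyps(1,4)]]) (use lim.IH lim.hyps sp in auto)
qed

definition limL :: "('a => real) => real" where
 "limL \<phi> = (THE l. ((%t. Lam t \<phi>) \<longlongrightarrow> l) (at_right 0))"

lemma limL_tendsto:
 assumes "integrable W \<phi>"
 shows "((%t. Lam t \<phi>) \<longlongrightarrow> limL \<phi>) (at_right 0)"
proof -
 obtain l where l: "((%t. Lam t \<phi>) \<longlongrightarrow> l) (at_right 0)" using limex_integrable[OF assms] by (auto simp: limex_def)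
 then have "limL \<phi> = l" unfolding limL_def by (intro the_equality) (auto intro: tendsto_unique[rotated])
 then show ?thesis using l by simp
qed

lemma limL_eqI: "((%t. Lam t \<phi>) \<longlongrightarrow> l) (at_right 0) ==> limL \<phi> = l"
 unfolding limL_def by (intro the_equality) (auto intro: tendsto_unique[rotated])

lemma limL_bound:
 assumes "integrable W \<phi>"
 shows "\<bar>limL \<phi>\<bar> \<le> (\<integral>x. \<bar>\<phi> x\<bar> \<partial>W)"
proof (rule tendsto_upperbound[OF tendsto_rabs[OF limL_tendsto[OF assms]]])
 show "\<forall>\<^sub>F t in at_right 0. \<bar>Lam t \<phi>\<bar> \<le> (\<integral>x. \<bar>\<phi> x\<bar> \<partial>W)"
  using ev_t by (rule eventually_mono) (use Lam_bound assms in auto)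
qed simp

lemma limL_add:
 assumes "integrable W \<phi>" "integrable W \<psi>"
 shows "limL (%x. \<phi> x + \<psi> x) = limL \<phi> + limL \<psi>"
 by (rule limL_eqI, rule Lim_transform_eventually[OF tendsto_add[OF limL_tendsto limL_tendsto]], (rule assms)+, rule eventually_mono[OF ev_t])
  (use Lam_add assms in auto)

lemma limL_nonneg:
 assumes "integrable W \<phi>" "\<And>x. \<phi> x \<ge> 0"
 shows "limL \<phi> \<ge> 0"
 by (rule tendsto_lowerbound[OF limL_tendsto[OF assms(1)]])
  (use assms(2) w_nn in \<open>auto simp: Lam_def intro!: always_eventually Bochner_Integration.integral_nonneg\<close>)

lemma limL_cmult:
 assumes "integrable W \<phi>"
 shows "limL (%x. c * \<phi> x) = c * limL \<phi>"
proof (rule limL_eqI)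
 have "Lam t (%x. c * \<phi> x) = c * Lam t \<phi>" for t
  unfolding Lam_def by (simp add: mult.left_commute)
 then show "((%t. Lam t (%x. c * \<phi> x)) \<longlongrightarrow> c * limL \<phi>) (at_right 0)"
  by (simp only:) (intro tendsto_intros limL_tendsto assms)
qed

text \<open>The limit functional on indicators is a set function dominated by an absolutely
  continuous measure. Domination supplies countable additivity and absolute continuity, and then the
  density and its bound.\<close>

theorem weak_limit_density:
 "\<exists>h. h \<in> borel_measurable borel \<and> (\<forall>x. 0 \<le> h x \<and> h x \<le> V x) \<and>
  (\<forall>\<phi>. integrable W \<phi> --> ((%t. Lam t \<phi>) \<longlongrightarrow> (LBINT x. h x * \<phi> x)) (at_right 0))"
proof -
 obtain k0 where k0: "k0 \<in> borel_measurable (lborel :: 'a measure)" "integral\<^sup>N lborel k0 \<noteq> \<infinity>" "\<And>x. 0 < k0 x \<and> k0 x < \<infinity>"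
  using sigma_finite_measure.Ex_finite_integrable_function[OF sigma_finite_lborel] by auto
 define k where "k x = enn2real (k0 x)" for x :: 'a
 have kpos: "k x > 0" for x using k0(3)[of x] by (simp add: k_def enn2real_positive_iff)
 have kk0: "ennreal (k x) = k0 x" for x using k0(3)[of x] by (simp add: k_def)
 have km [measurable]: "k \<in> borel_measurable borel" unfolding k_def using k0(1) by simp
 have kint: "integrable lborel k"
  by (rule integrableI_nonneg) (use k0(2) kpos kk0 in \<open>auto simp: less_imp_le less_top\<close>)
 \<comment> \<open>\<open>W\<close> may have infinite mass. Multiplication by \<open>\<rho>\<close>
   turns it into the finite measure \<open>N\<close> with density \<open>k\<close>, on which
   arguments for finite measures work.\<close>
 define \<rho> where "\<rho> x = k x / V x" for x
 have \<rho>m [measurable]: "\<rho> \<in> borel_measurable borel" unfolding \<rho>_def by measurable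
 have \<rho>V: "V x * \<rho> x = k x" for x using V_pos[of x] by (simp add: \<rho>_def)
 have \<rho>0: "\<rho> x > 0" for x using V_pos[of x] kpos[of x] by (simp add: \<rho>_def)
 define N where "N = density lborel (%x. ennreal (k x))"
 have setsN [simp, measurable_cong]: "sets N = sets borel" by (simp add: N_def)
 have N_int: "integrable W (%x. \<phi> x * \<rho> x) \<longleftrightarrow> integrable N \<phi>" if [measurable]: "\<phi> \<in> borel_measurable borel" for \<phi>
 proof -
  have "integrable W (%x. \<phi> x * \<rho> x) \<longleftrightarrow> integrable lborel (%x. V x * (\<phi> x * \<rho> x))" by (rule W_integrable) measurable
  also have "(%x. V x * (\<phi> x * \<rho> x)) = (%x. k x * \<phi> x)" using \<rho>V by (auto simp: mult_ac)
  also have "integrable lborel (%x. k x * \<phi> x) \<longleftrightarrow> integrable N \<phi>"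
   unfolding N_def using kpos by (subst integrable_density) (auto simp: less_imp_le)
  finally show ?thesis .
 qed
 have N_integral: "(\<integral>x. \<bar>\<phi> x * \<rho> x\<bar> \<partial>W) = (\<integral>x. \<bar>\<phi> x\<bar> \<partial>N)" if [measurable]: "\<phi> \<in> borel_measurable borel" for \<phi>
 proof -
  have "(\<integral>x. \<bar>\<phi> x * \<rho> x\<bar> \<partial>W) = (LBINT x. V x * \<bar>\<phi> x * \<rho> x\<bar>)" by (rule W_integral) measurable
  also have "\<dots> = (LBINT x. k x * \<bar>\<phi> x\<bar>)"
   using \<rho>V \<rho>0 by (intro Bochner_Integration.integral_cong) (auto simp: abs_mult less_imp_le mult_ac)
  also have "\<dots> = (\<integral>x. \<bar>\<phi> x\<bar> \<partial>N)"
   unfolding N_def using kpos by (subst integral_density) (auto simp: less_imp_le)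
  finally show ?thesis .
 qed
 have finN: "emeasure N UNIV < \<infinity>"
  unfolding N_def using kint kpos by (subst emeasure_density) (auto simp: nn_integral_eq_integral less_imp_le)
 interpret N: finite_measure N by standard (use finN in \<open>simp add: N_def\<close>)
 define \<mu> where "\<mu> A = limL (%x. indicator A x * \<rho> x)" for A
 have intA: "integrable W (%x. indicator A x * \<rho> x)" if "A \<in> sets borel" for A
  using that by (subst N_int) (auto intro!: N.integrable_const_bound[where B = 1] simp: indicator_def)
 have \<mu>0: "\<mu> A \<ge> 0" if "A \<in> sets borel" for A
  unfolding \<mu>_def using intA[OF that] \<rho>0 by (intro limL_nonneg) (auto simp: less_imp_le)
 have \<mu>le: "\<mu> A \<le> measure N A" if "A \<in> sets borel" for A
 proof -
  have "\<mu> A \<le> (\<integral>x. \<bar>indicator A x * \<rho> x\<bar> \<partial>W)" unfolding \<mu>_def using limL_bound[OF intA[OF that]] by linarith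
  also have "\<dots> = (\<integral>x. \<bar>indicator A x\<bar> \<partial>N)" using that by (intro N_integral) auto
  also have "\<dots> = measure N A" using that by simp
  finally show ?thesis .
 qed
 have \<mu>Un: "\<mu> (A \<union> B) = \<mu> A + \<mu> B" if "A \<in> sets borel" "B \<in> sets borel" "A \<inter> B = {}" for A B
 proof -
  have "(%x. indicator (A \<union> B) x * \<rho> x) = (%x. indicator A x * \<rho> x + indicator B x * \<rho> x)"
   using that(3) by (auto simp: indicator_def fun_eq_iff)
  then show ?thesis unfolding \<mu>_def using limL_add[OF intA[OF that(1)] intA[OF that(2)]] by simp
 qed
 have \<mu>sums: "(%i. \<mu> (A i)) sums \<mu> (\<Union>i. A i)" if A: "range A \<subseteq> sets borel" "disjoint_family A" for A :: "nat => 'a set"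
 proof -
  have mA: "A i \<in> sets borel" for i using A by auto
  have fin: "\<mu> (\<Union>i<n. A i) = (\<Sum>i<n. \<mu> (A i))" for n
  proof (induction n)
   case 0
   show ?case using \<mu>le[of "{}"] \<mu>0[of "{}"] by simp
  next
   case (Suc n)
   have "A i \<inter> A n = {}" if "i < n" for i
    using disjoint_family_onD[OF A(2), of i n] that by simp
   then have "(\<Union>i<n. A i) \<inter> A n = {}" by blast
   then have "\<mu> ((\<Union>i<n. A i) \<union> A n) = \<mu> (\<Union>i<n. A i) + \<mu> (A n)" using mA by (intro \<mu>Un) auto
   then show ?case using Suc by (simp add: lessThan_Suc Un_commute)
  qed
  have mU: "(\<Union>i. A i) \<in> sets borel" "(\<Union>i<n. A i) \<in> sets borel" for n using mA by auto
  \<comment> \<open>The error of a partial sum is the \<open>\<mu>\<close> measure of the tail,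
    which lies below its \<open>N\<close> measure. Continuity of the finite measure \<open>N\<close>
    therefore yields countable additivity of \<open>\<mu>\<close>.\<close>
  have diff: "\<bar>(\<Sum>i<n. \<mu> (A i)) - \<mu> (\<Union>i. A i)\<bar> \<le> measure N (\<Union>i. A i) - measure N (\<Union>i<n. A i)" for n
  proof -
   have "(\<Union>i<n. A i) \<union> ((\<Union>i. A i) - (\<Union>i<n. A i)) = (\<Union>i. A i)" by auto
   then have "\<mu> (\<Union>i. A i) = \<mu> (\<Union>i<n. A i) + \<mu> ((\<Union>i. A i) - (\<Union>i<n. A i))"
    using \<mu>Un[of "\<Union>i<n. A i" "(\<Union>i. A i) - (\<Union>i<n. A i)"] mU by auto
   moreover have "0 \<le> \<mu> ((\<Union>i. A i) - (\<Union>i<n. A i))" "\<mu> ((\<Union>i. A i) - (\<Union>i<n. A i)) \<le> measure N ((\<Union>i. A i) - (\<Union>i<n. A i))"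
    using mU by (auto intro!: \<mu>0 \<mu>le)
   moreover have "measure N ((\<Union>i. A i) - (\<Union>i<n. A i)) = measure N (\<Union>i. A i) - measure N (\<Union>i<n. A i)"
    using mU by (intro N.finite_measure_Diff) auto
   ultimately show ?thesis using fin[of n] by linarith
  qed
  have "(%n. measure N (\<Union>i<n. A i)) \<longlonglongrightarrow> measure N (\<Union>n. \<Union>i<n. A i)"
   by (rule N.finite_Lim_measure_incseq) (use mU in \<open>auto simp: incseq_def\<close>, force)
  also have "(\<Union>n. \<Union>i<n. A i) = (\<Union>i. A i)" by auto
  finally have "(%n. measure N (\<Union>i. A i) - measure N (\<Union>i<n. A i)) \<longlonglongrightarrow> measure N (\<Union>i. A i) - measure N (\<Union>i. A i)"
   by (intro tendsto_intros)
  then have lim0: "(%n. measure N (\<Union>i. A i) - measure N (\<Union>i<n. A i)) \<longlonglongrightarrow> 0" by simp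
  have "(%n. (\<Sum>i<n. \<mu> (A i)) - \<mu> (\<Union>i. A i)) \<longlonglongrightarrow> 0"
   by (rule Lim_null_comparison[OF always_eventually lim0]) (use diff in simp)
  then show ?thesis unfolding sums_def by (simp add: LIM_zero_iff)
 qed
 define m where "m = measure_of UNIV (sets borel) (%A. ennreal (\<mu> A))"
 have emm: "emeasure m A = ennreal (\<mu> A)" if "A \<in> sets borel" for A
  unfolding m_def
 proof (rule emeasure_measure_of_sigma)
  show "sigma_algebra UNIV (sets borel :: 'a set set)" using sets.sigma_algebra_axioms[of borel] by simp
  show "positive (sets borel) (%A. ennreal (\<mu> A))"
   using \<mu>le[of "{}"] by (simp add: positive_def ennreal_neg)
  show "countably_additive (sets borel) (%A. ennreal (\<mu> A))"
  proof (rule countably_additiveI)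
   fix A :: "nat => 'a set" assume A: "range A \<subseteq> sets borel" "disjoint_family A"
   have "A i \<in> sets borel" for i using A by auto
   then show "(\<Sum>i. ennreal (\<mu> (A i))) = ennreal (\<mu> (\<Union>i. A i))"
    by (intro suminf_ennreal_eq \<mu>sums[OF A] \<mu>0)
  qed
 qed fact
 have setsm: "sets m = sets borel" unfolding m_def using sets.sigma_sets_eq[of borel] by simp
 have "absolutely_continuous lborel m"
  unfolding absolutely_continuous_def
 proof
  fix A :: "'a set" assume A: "A \<in> null_sets lborel"
  then have mA: "A \<in> sets borel" by auto
  have "emeasure N A = 0" unfolding N_def using A by (subst emeasure_density) (auto simp: nn_integral_null_set mult.commute)
  then have "\<mu> A \<le> 0" using \<mu>le[OF mA] by (simp add: measure_def)
  then show "A \<in> null_sets m" using emm[OF mA] setsm mA by (auto simp: null_sets_def ennreal_neg)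
 qed
 from sigma_finite_measure.Radon_Nikodym[OF sigma_finite_lborel this] setsm obtain f where fm: "f \<in> borel_measurable lborel" and f: "density lborel f = m" by auto
 have fm' [measurable]: "f \<in> borel_measurable borel" using fm by simp
 \<comment> \<open>The set where the density would exceed \<open>k\<close>. Domination makes the
   integral of the excess vanish; the subtraction is legitimate because \<open>k\<close> has a
   finite integral.\<close>
 define A where "A = {x. ennreal (k x) < f x}"
 have mA [measurable]: "A \<in> sets borel" unfolding A_def by measurable
 have "(\<integral>\<^sup>+x. f x * indicator A x \<partial>lborel) \<le> (\<integral>\<^sup>+x. ennreal (k x) * indicator A x \<partial>lborel)"
 proof -
  have "(\<integral>\<^sup>+x. f x * indicator A x \<partial>lborel) = ennreal (\<mu> A)"
   using emm[OF mA] f emeasure_density[OF fm, of A] by simp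
  also have "\<dots> \<le> emeasure N A" using \<mu>le[OF mA] by (simp add: N.emeasure_eq_measure ennreal_leI)
  also have "\<dots> = (\<integral>\<^sup>+x. ennreal (k x) * indicator A x \<partial>lborel)" unfolding N_def by (subst emeasure_density) auto
  finally show ?thesis .
 qed
 moreover have finA: "(\<integral>\<^sup>+x. ennreal (k x) * indicator A x \<partial>lborel) \<noteq> \<infinity>"
  using N.emeasure_finite[of A] unfolding N_def by (subst (asm) emeasure_density) auto
 moreover have "(\<integral>\<^sup>+x. f x * indicator A x - ennreal (k x) * indicator A x \<partial>lborel)
  = (\<integral>\<^sup>+x. f x * indicator A x \<partial>lborel) - (\<integral>\<^sup>+x. ennreal (k x) * indicator A x \<partial>lborel)"
  by (rule nn_integral_diff) (use finA in \<open>auto simp: A_def indicator_def intro!: AE_I2 less_imp_le\<close>)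
 ultimately have "(\<integral>\<^sup>+x. f x * indicator A x - ennreal (k x) * indicator A x \<partial>lborel) = 0"
  by (auto simp: diff_eq_0_iff_ennreal less_top intro: le_less_trans)
 then have "AE x in lborel. f x * indicator A x - ennreal (k x) * indicator A x = 0"
  by (subst (asm) nn_integral_0_iff_AE) auto
 then have fle: "AE x in lborel. f x \<le> ennreal (k x)"
 proof (rule eventually_mono)
  fix x assume a: "f x * indicator A x - ennreal (k x) * indicator A x = 0"
  show "f x \<le> ennreal (k x)"
  proof (rule ccontr)
   assume "\<not> f x \<le> ennreal (k x)"
   then have "x \<in> A" and n: "ennreal (k x) < f x" by (auto simp: A_def)
   then have "f x - ennreal (k x) = 0" using a by simp
   then show False using n by (auto simp: diff_eq_0_iff_ennreal dest: leD)
  qed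
 qed
 \<comment> \<open>Taking the minimum upgrades the bound from almost everywhere to
   everywhere.\<close>
 define g where "g x = min (enn2real (f x)) (k x)" for x
 have gm [measurable]: "g \<in> borel_measurable borel" unfolding g_def by measurable
 have g0: "0 \<le> g x" "g x \<le> k x" for x using kpos[of x] by (auto simp: g_def less_imp_le)
 have gf: "AE x in lborel. ennreal (g x) = f x"
  using fle
 proof (rule eventually_mono)
  fix x assume "f x \<le> ennreal (k x)"
  then have fin: "f x < \<infinity>" and "enn2real (f x) \<le> k x" using kpos[of x]
   by (auto simp: enn2real_leI less_imp_le le_less_trans)
  then show "ennreal (g x) = f x" by (simp add: g_def min_absorb1)
 qed
 have mg: "m = density lborel (%x. ennreal (g x))"
  unfolding f[symmetric] by (rule density_cong) (use gf in \<open>auto elim!: eventually_mono\<close>)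
 have key: "((%t. Lam t (%x. \<phi> x * \<rho> x)) \<longlongrightarrow> (LBINT x. g x * \<phi> x)) (at_right 0)" if "integrable N \<phi>" for \<phi>
 proof -
  have gk: "integrable lborel (%x. g x * \<phi> x) \<and> \<bar>\<integral>x. g x * \<phi> x \<partial>lborel\<bar> \<le> (\<integral>x. \<bar>\<phi> x\<bar> \<partial>N)" if i: "integrable N \<phi>" for \<phi>
  proof -
   have m\<phi>: "\<phi> \<in> borel_measurable borel" using borel_measurable_integrable[OF i] by (simp add: N_def)
   have ik: "integrable lborel (%x. k x * \<phi> x)"
    using i kpos m\<phi> unfolding N_def by (subst (asm) integrable_density) (auto simp: less_imp_le)
   have ig: "integrable lborel (%x. g x * \<phi> x)"
    by (rule Bochner_Integration.integrable_bound[OF ik]) (use m\<phi> g0 in \<open>auto simp: abs_mult intro!: AE_I2 mult_right_mono order_trans[OF g0(2)]\<close>)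
   have "\<bar>\<integral>x. g x * \<phi> x \<partial>lborel\<bar> \<le> (LBINT x. \<bar>g x * \<phi> x\<bar>)"
    using integral_norm_bound[of lborel "%x. g x * \<phi> x"] by simp
   also have "\<dots> \<le> (LBINT x. k x * \<bar>\<phi> x\<bar>)"
   proof (rule integral_mono)
    show "integrable lborel (%x. k x * \<bar>\<phi> x\<bar>)"
     using integrable_abs[OF ik] kpos by (simp add: abs_mult less_imp_le)
    show "integrable lborel (%x. \<bar>g x * \<phi> x\<bar>)" using ig by (rule integrable_abs)
   qed (use g0 in \<open>auto simp: abs_mult intro!: mult_right_mono\<close>)
   also have "\<dots> = (\<integral>x. \<bar>\<phi> x\<bar> \<partial>N)" unfolding N_def using kpos m\<phi> by (subst integral_density) (auto simp: less_imp_le)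
   finally show ?thesis using ig by simp
  qed
  have iW: "integrable W (%x. \<phi> x * \<rho> x)" if "integrable N \<phi>" for \<phi>
   using that borel_measurable_integrable[OF that] N_int[of \<phi>] by (simp add: N_def)
  have "limL (%x. \<phi> x * \<rho> x) = (LBINT x. g x * \<phi> x)"
   using that
  proof (induction rule: integrable_induct)
   case (base A c)
   have mA: "A \<in> sets borel" using base by simp
   have "limL (%x. indicator A x * \<rho> x) = (LBINT x. g x * indicator A x)"
   proof -
    have "ennreal (\<mu> A) = (\<integral>\<^sup>+x. ennreal (g x) * indicator A x \<partial>lborel)"
     using emm[OF mA] mA by (simp add: mg emeasure_density)
    also have "\<dots> = (\<integral>\<^sup>+x. ennreal (g x * indicator A x) \<partial>lborel)"
     by (intro nn_integral_cong) (auto simp: indicator_def)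
    also have "\<dots> = ennreal (LBINT x. g x * indicator A x)"
     using gk[of "indicator A"] g0 mA N.emeasure_finite[of A] by (intro nn_integral_eq_integral) (auto simp: less_top[symmetric])
    finally show ?thesis
     using \<mu>0[OF mA] g0 by (subst (asm) ennreal_inj) (auto simp: \<mu>_def intro!: Bochner_Integration.integral_nonneg)
   qed
   then have "limL (%x. c * (indicator A x * \<rho> x)) = (LBINT x. c * (g x * indicator A x))"
    by (simp add: limL_cmult[OF intA[OF mA]])
   then show ?case by (simp add: mult_ac)
  next
   case (add f g')
   then show ?case using limL_add[OF iW[OF add.hyps(1)] iW[OF add.hyps(2)]] gk[OF add.hyps(1)] gk[OF add.hyps(2)]
    by (simp add: distrib_left distrib_right)
  next
   case (lim f s)
   have sp: "space N = UNIV" by (simp add: N_def)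
   have d0: "(%n. \<integral>x. \<bar>s n x - f x\<bar> \<partial>N) \<longlonglongrightarrow> 0"
   proof -
    have "(%n. \<integral>x. \<bar>s n x - f x\<bar> \<partial>N) \<longlonglongrightarrow> (\<integral>x. 0 \<partial>N)"
    proof (rule integral_dominated_convergence[where w = "%x. 3 * \<bar>f x\<bar>"])
     show "AE x in N. (%n. \<bar>s n x - f x\<bar>) \<longlonglongrightarrow> 0"
     proof (intro AE_I2)
      fix x assume "x \<in> space N"
      then have "(%n. \<bar>s n x - f x\<bar>) \<longlonglongrightarrow> \<bar>f x - f x\<bar>" by (intro tendsto_intros lim.hyps(2))
      then show "(%n. \<bar>s n x - f x\<bar>) \<longlonglongrightarrow> 0" by simp
     qed
     show "AE x in N. norm \<bar>s n x - f x\<bar> \<le> 3 * \<bar>f x\<bar>" for n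
     proof (intro AE_I2)
      fix x assume "x \<in> space N"
      then show "norm \<bar>s n x - f x\<bar> \<le> 3 * \<bar>f x\<bar>" using lim.hyps(3)[of x n] unfolding real_norm_def by linarith
     qed
    qed (use lim in auto)
    then show ?thesis by simp
   qed
   have diffi: "integrable N (%x. s n x - f x)" for n using lim by simp
   have l1: "(%n. limL (%x. s n x * \<rho> x)) \<longlonglongrightarrow> limL (%x. f x * \<rho> x)"
   proof (rule LIM_zero_cancel, rule Lim_null_comparison[OF _ d0], rule always_eventually, rule allI)
    fix n
    have "limL (%x. (s n x - f x) * \<rho> x) + limL (%x. f x * \<rho> x) = limL (%x. s n x * \<rho> x)"
     using limL_add[OF iW[OF diffi[of n]] iW[OF lim.hyps(4)]] by (simp add: algebra_simps)
    moreover have "\<bar>limL (%x. (s n x - f x) * \<rho> x)\<bar> \<le> (\<integral>x. \<bar>s n x - f x\<bar> \<partial>N)"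
     using limL_bound[OF iW[OF diffi[of n]]] N_integral[of "%x. s n x - f x"] borel_measurable_integrable[OF diffi[of n]] by (simp add: N_def)
    ultimately show "norm (limL (%x. s n x * \<rho> x) - limL (%x. f x * \<rho> x)) \<le> (\<integral>x. \<bar>s n x - f x\<bar> \<partial>N)"
     unfolding real_norm_def by linarith
   qed
   have l2: "(%n. LBINT x. g x * s n x) \<longlonglongrightarrow> (LBINT x. g x * f x)"
   proof (rule LIM_zero_cancel, rule Lim_null_comparison[OF _ d0], rule always_eventually, rule allI)
    fix n
    show "norm ((LBINT x. g x * s n x) - (LBINT x. g x * f x)) \<le> (\<integral>x. \<bar>s n x - f x\<bar> \<partial>N)"
     using gk[OF diffi[of n]] gk[OF lim.hyps(1)[of n]] gk[OF lim.hyps(4)] by (simp add: right_diff_distrib)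
   qed
   show ?case using LIMSEQ_unique[OF l1] l2 lim.IH by simp
  qed
  then show ?thesis using limL_tendsto[OF iW[OF that]] by simp
 qed
 \<comment> \<open>Undoes the passage from \<open>W\<close> to \<open>N\<close>: a test function
   \<open>\<phi>\<close> is \<open>\<omega> * \<rho>\<close> with
   \<open>\<omega> = \<phi> * V / k\<close>.\<close>
 define h where "h x = g x * (V x / k x)" for x
 show ?thesis
 proof (intro exI[of _ h] conjI allI impI)
  show "h \<in> borel_measurable borel" unfolding h_def by measurable
  fix x
  show "0 \<le> h x" using g0 kpos[of x] V_pos[of x] by (simp add: h_def less_imp_le)
  have "g x / k x \<le> 1" using g0 kpos[of x] by simp
  then have "(g x / k x) * V x \<le> 1 * V x" using V_pos[of x] by (intro mult_right_mono) (auto simp: less_imp_le)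
  then show "h x \<le> V x" by (simp add: h_def)
 next
  fix \<phi> :: "'a => real" assume i: "integrable W \<phi>"
  have m\<phi> [measurable]: "\<phi> \<in> borel_measurable borel" by (rule meas_W[OF i])
  define \<omega> where "\<omega> x = \<phi> x * (V x / k x)" for x
  have [measurable]: "\<omega> \<in> borel_measurable borel" unfolding \<omega>_def by measurable
  have eq: "\<omega> x * \<rho> x = \<phi> x" for x using V_pos[of x] kpos[of x] by (simp add: \<omega>_def \<rho>_def)
  have "integrable N \<omega>" using N_int[of \<omega>] i by (simp add: eq)
  from key[OF this] show "((%t. Lam t \<phi>) \<longlongrightarrow> (LBINT x. h x * \<phi> x)) (at_right 0)"
   by (simp add: eq) (simp add: h_def \<omega>_def mult_ac)
 qed
qed

end

section \<open>The limit density and its vanishing off the singular set\<close>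

lemma CcI:
 fixes f :: "'a::euclidean_space => real"
 assumes "continuous_on UNIV f" "\<And>x. f x \<noteq> 0 ==> x \<in> K" "compact K" "K \<subseteq> A"
 shows "f \<in> Cc A"
proof -
 have "supp_cl f \<subseteq> K"
  unfolding supp_cl_def using assms by (intro closure_minimal compact_imp_closed) auto
 moreover have "compact (supp_cl f)"
  using compact_Int_closed[OF assms(3), of "supp_cl f"] calculation by (simp add: supp_cl_def Int_absorb1)
 ultimately show ?thesis using assms by (auto simp: Cc_def)
qed

lemma CcD:
 fixes f :: "'a::euclidean_space => real"
 assumes "f \<in> Cc A"
 shows "continuous_on UNIV f" "\<exists>R. \<forall>x. norm x > R --> f x = 0"
proof -
 show "continuous_on UNIV f" using assms by (simp add: Cc_def)
 obtain R where R: "\<And>x. x \<in> supp_cl f ==> norm x \<le> R"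
  using assms compact_imp_bounded[of "supp_cl f"] by (auto simp: Cc_def bounded_iff)
 have "f x = 0" if "norm x > R" for x
  using R[of x] that closure_subset[of "{z. f z \<noteq> 0}"] by (force simp: supp_cl_def)
 then show "\<exists>R. \<forall>x. norm x > R --> f x = 0" by blast
qed

text \<open>The complement of \<open>S\<close> contains a ball, on which the convergent trace bounds
  the mass near time zero. This single local bound starts all global estimates.\<close>

theorem (in approximable) trace_limit:
 assumes S: "closed S" "S \<noteq> UNIV"
  and tr: "\<And>\<psi>. \<psi> \<in> Cc (- S) ==> \<exists>l. ((%t. LBINT x. v x t * \<psi> x) \<longlongrightarrow> l) (at_right 0)"
 shows "\<exists>h M. h \<in> borel_measurable borel \<and> (\<forall>x. 0 \<le> h x \<and> h x \<le> M * (1 + norm x) powr (q / (q - 1))) \<and>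
  (\<forall>x. x \<notin> S --> h x = 0) \<and>
  (\<forall>\<psi>\<in>Cc UNIV. ((%t. t powr (1 / (q - 1)) * (LBINT x. v x t * \<psi> x)) \<longlongrightarrow> (LBINT x. h x * \<psi> x)) (at_right 0))"
proof -
 obtain x0 where "x0 \<in> - S" using S by auto
 then obtain \<rho> where \<rho>: "\<rho> > 0" "cball x0 \<rho> \<subseteq> - S"
  using S(1) open_contains_cball[of "- S"] by auto
 \<comment> \<open>Chosen so that the bump around \<open>x0\<close> vanishes outside the ball of
   radius \<open>\<rho>\<close>.\<close>
 define c where "c = 5 / (4 * \<rho> ^ 2)"
 have c: "c > 0" using \<rho> by (simp add: c_def)
 have sq: "sqrt (5 / (4 * c)) = \<rho>" using \<rho> by (simp add: c_def real_sqrt_unique)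
 have "(%x. bump 0 c (x - x0)) \<in> Cc (- S)"
 proof (rule CcI[OF _ _ compact_cball \<rho>(2)])
  show "continuous_on UNIV (%x. bump 0 c (x - x0))"
   by (rule continuous_on_compose2[OF C2_continuous(1)[OF C2_bump]]) (auto intro!: continuous_intros)
  show "x \<in> cball x0 \<rho>" if "bump 0 c (x - x0) \<noteq> 0" for x
  proof (rule ccontr)
   assume "x \<notin> cball x0 \<rho>"
   then show False using bump_eq_0[OF c, of "x - x0" 0] that sq by (simp add: dist_norm norm_minus_commute)
  qed
 qed
 from tr[OF this] obtain l where l: "((%t. LBINT x. v x t * bump 0 c (x - x0)) \<longlongrightarrow> l) (at_right 0)" by blast
 have "\<forall>\<^sub>F t in at_right 0. (LBINT x. v x t * bump 0 c (x - x0)) < l + 1"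
  using order_tendstoD(2)[OF l, of "l + 1"] by simp
 then obtain t2 where t2: "t2 > 0" "\<And>t. 0 < t ==> t < t2 ==> (LBINT x. v x t * bump 0 c (x - x0)) < l + 1"
  unfolding eventually_at_right_field by auto
 define t1 where "t1 = min (min t2 T0) 1"
 have t1: "0 < t1" "t1 \<le> T0" "t1 \<le> 1" "t1 \<le> t2" using t2 T0 by (auto simp: t1_def)
 obtain M where M: "M > 0" "\<And>t. 0 < t ==> t < t1 ==> AE x in lborel. t powr alpha * v x t \<le> M * (1 + norm x) powr (q / (q - 1))"
  using weighted_sup_bound[OF t1(1-3) c, of 0 x0 "l + 1"] t2 t1 by (meson less_imp_le less_le_trans)
 define V where "V x = M * (1 + norm x) powr (q / (q - 1))" for x :: 'a
 define w where "w t x = t powr alpha * v x t" for t x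
 interpret B: bounded_densities w V t1
 proof
  show "continuous_on UNIV V" unfolding V_def by (intro continuous_intros) (auto simp: add_nonneg_eq_0_iff)
  show "V x > 0" for x
  proof -
   have "1 + norm x > 0" by (simp add: add_pos_nonneg)
   then show ?thesis using M by (simp add: V_def)
  qed
  show "w t \<in> borel_measurable borel" for t unfolding w_def using v_measurable[of t] by measurable
  show "0 \<le> w t x" for t x using v_nonneg by (simp add: w_def)
  show "AE x in lborel. w t x \<le> V x" if "0 < t" "t < t1" for t
   using M(2)[OF that] by (simp add: w_def V_def)
  fix \<psi> :: "'a => real" and G D R
  assume "C2 \<psi> G D" "\<And>x. \<psi> x \<ge> 0" "\<And>x. norm x > R ==> \<psi> x = 0 \<and> G x = 0 \<and> D x = (%v. 0)"
  from bump_limit_exists[OF t1(1,2) M(2) this]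
  show "\<exists>l. ((%t. LBINT x. w t x * \<psi> x) \<longlongrightarrow> l) (at_right 0)"
   by (simp add: w_def mult.assoc)
 qed (rule t1(1))
 obtain h0 where h0: "h0 \<in> borel_measurable borel" "\<And>x. 0 \<le> h0 x" "\<And>x. h0 x \<le> V x"
  "\<And>\<phi>. integrable B.W \<phi> ==> ((%t. B.Lam t \<phi>) \<longlongrightarrow> (LBINT x. h0 x * \<phi> x)) (at_right 0)"
  using B.weak_limit_density by blast
 have lim: "((%t. t powr alpha * (LBINT x. v x t * \<psi> x)) \<longlongrightarrow> (LBINT x. h0 x * \<psi> x)) (at_right 0)"
  and intV: "integrable lborel (%x. V x * \<psi> x)" if \<psi>: "\<psi> \<in> Cc A" for \<psi> A
 proof -
  obtain R where R: "\<And>x. norm x > R ==> \<psi> x = 0" using CcD[OF \<psi>] by blast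
  show i: "integrable lborel (%x. V x * \<psi> x)"
   by (rule integrable_compact_support[where R = R])
    (use R B.V_cont CcD(1)[OF \<psi>] in \<open>auto intro!: continuous_intros\<close>)
  then have "integrable B.W \<psi>"
   using B.W_integrable[of \<psi>] borel_measurable_continuous_onI[OF CcD(1)[OF \<psi>]] by simp
  from h0(4)[OF this]
  show "((%t. t powr alpha * (LBINT x. v x t * \<psi> x)) \<longlongrightarrow> (LBINT x. h0 x * \<psi> x)) (at_right 0)"
   by (simp add: B.Lam_def w_def mult.assoc)
 qed
 \<comment> \<open>Against a test function supported off \<open>S\<close> the masses converge to a
   finite limit, and the weight tends to 0.\<close>
 have zero: "(LBINT x. h0 x * \<psi> x) = 0" if \<psi>: "\<psi> \<in> Cc (- S)" for \<psi>
 proof -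
  obtain l where l: "((%t. LBINT x. v x t * \<psi> x) \<longlongrightarrow> l) (at_right 0)" using tr[OF \<psi>] by blast
  have ev: "\<forall>\<^sub>F t::real in at_right 0. 0 \<le> t"
   using eventually_at_right_less[of "0::real"] by (rule eventually_mono) simp
  have "((%t::real. t powr alpha) \<longlongrightarrow> 0 powr alpha) (at_right 0)"
   by (rule tendsto_powr') (use ev alpha_pos in auto)
  then have "((%t::real. t powr alpha) \<longlongrightarrow> 0) (at_right 0)" by simp
  from tendsto_mult[OF this l]
  have "((%t. t powr alpha * (LBINT x. v x t * \<psi> x)) \<longlongrightarrow> 0) (at_right 0)" by simp
  from tendsto_unique[OF _ lim[OF \<psi>] this] show ?thesis by simp
 qed
 \<comment> \<open>The distance to \<open>S\<close>. The case of empty \<open>S\<close> is separate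
   because \<open>infdist x {}\<close> is 0 by convention, while a positive value is wanted off
   \<open>S\<close>.\<close>
 define d where "d x = (if S = {} then 1 else infdist x S)" for x
 have cd: "continuous_on UNIV d"
  unfolding d_def by (cases "S = {}") (auto intro!: continuous_intros)
 have dpos: "d x > 0" if "x \<notin> S" for x
  using that S(1) in_closed_iff_infdist_zero[of S x] infdist_nonneg[of x S] by (auto simp: d_def less_le)
 have dS: "d x = 0" if "x \<in> S" for x using that by (auto simp: d_def)
 \<comment> \<open>Nonnegative functions with compact support off \<open>S\<close>; each point off
   \<open>S\<close> is charged by all sufficiently late ones. Testing the density with them shows
   that it vanishes there almost everywhere.\<close>
 define \<psi> where "\<psi> n x = max 0 (d x - 1 / real (Suc n)) * max 0 (real n - norm x)" for n x
 have \<psi>Cc: "\<psi> n \<in> Cc (- S)" for n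
 proof (rule CcI)
  show "continuous_on UNIV (\<psi> n)" unfolding \<psi>_def by (intro continuous_intros cd)
  show "compact ({x. d x \<ge> 1 / real (Suc n)} \<inter> cball 0 (real n))"
   by (intro closed_Int_compact closed_Collect_le compact_cball cd continuous_intros)
  show "{x. d x \<ge> 1 / real (Suc n)} \<inter> cball 0 (real n) \<subseteq> - S"
   using dS by (force simp: field_simps)
  show "x \<in> {x. d x \<ge> 1 / real (Suc n)} \<inter> cball 0 (real n)" if "\<psi> n x \<noteq> 0" for x
   using that by (auto simp: \<psi>_def max_def split: if_splits)
 qed
 have "AE x in lborel. h0 x * \<psi> n x = 0" for n
 proof -
  have nn: "\<psi> n x \<ge> 0" for x by (simp add: \<psi>_def)
  have mp: "\<psi> n \<in> borel_measurable borel" by (rule borel_measurable_continuous_onI[OF CcD(1)[OF \<psi>Cc]])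
  have "integrable lborel (%x. h0 x * \<psi> n x)"
   by (rule Bochner_Integration.integrable_bound[OF intV[OF \<psi>Cc[of n]]])
    (use h0 nn mp in \<open>auto simp: abs_mult intro!: AE_I2 mult_right_mono order_trans[OF h0(3)]\<close>)
  from integral_nonneg_eq_0_iff_AE[OF this] zero[OF \<psi>Cc[of n]] h0(2) nn show ?thesis by auto
 qed
 then have "AE x in lborel. \<forall>n. h0 x * \<psi> n x = 0" unfolding AE_all_countable by blast
 then have off: "AE x in lborel. x \<notin> S --> h0 x = 0"
 proof (rule eventually_mono, intro impI)
  fix x assume x: "\<forall>n. h0 x * \<psi> n x = 0" "x \<notin> S"
  obtain n1 :: nat where n1: "inverse (real (Suc n1)) < d x" using reals_Archimedean[OF dpos[OF x(2)]] by auto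
  obtain n2 :: nat where n2: "norm x < real n2" using reals_Archimedean2 by blast
  define n where "n = max n1 n2"
  have "1 / real (Suc n) \<le> inverse (real (Suc n1))" unfolding n_def by (simp add: field_simps)
  then have "\<psi> n x > 0" using n1 n2 unfolding \<psi>_def n_def by (intro mult_pos_pos) auto
  then show "h0 x = 0" using x(1) by (metis less_irrefl mult_eq_0_iff)
 qed
 define h where "h x = (if x \<in> S then h0 x else 0)" for x
 have hm: "h \<in> borel_measurable borel" unfolding h_def using h0(1) S(1) by (intro measurable_If_set) auto
 show ?thesis
 proof (intro exI[of _ h] exI[of _ M] conjI allI ballI impI hm)
  show "0 \<le> h x" for x using h0(2) by (simp add: h_def)
  show "h x \<le> M * (1 + norm x) powr (q / (q - 1))" for x
   using h0(3)[of x] M(1) by (simp add: h_def V_def)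
  show "x \<notin> S ==> h x = 0" for x by (simp add: h_def)
  fix \<psi> :: "'a => real" assume \<psi>: "\<psi> \<in> Cc UNIV"
  have "(LBINT x. h x * \<psi> x) = (LBINT x. h0 x * \<psi> x)"
  proof (rule integral_cong_AE)
   show "AE x in lborel. h x * \<psi> x = h0 x * \<psi> x"
    using off by (rule eventually_mono) (auto simp: h_def)
  qed (use hm h0(1) borel_measurable_continuous_onI[OF CcD(1)[OF \<psi>]] in auto)
  then show "((%t. t powr (1 / (q - 1)) * (LBINT x. v x t * \<psi> x)) \<longlongrightarrow> (LBINT x. h x * \<psi> x)) (at_right 0)"
   using lim[OF \<psi>] by (simp add: alpha_def)
 qed
qed

section \<open>Classical solutions are approximable\<close>

lemma AE_continuous_le_imp_le:
 fixes f g :: "'a::euclidean_space => real"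
 assumes f: "continuous_on UNIV f" and g: "continuous_on UNIV g" and le: "AE x in lborel. f x \<le> g x"
 shows "f x \<le> g x"
proof (rule ccontr)
 assume "\<not> f x \<le> g x"
 then have x: "x \<in> {x. g x < f x}" by simp
 have "open {x. g x < f x}" using f g by (intro open_Collect_less)
 then have "\<not> negligible {x. g x < f x}" using x by (intro open_not_negligible) auto
 moreover have "AE x in lborel. x \<notin> {x. g x < f x}" using le by (rule eventually_mono) auto
 then have "{x. g x < f x} \<in> null_sets lborel"
  using \<open>open {x. g x < f x}\<close> by (subst (asm) AE_iff_null_sets[symmetric]) auto
 then have "negligible {x. g x < f x}"
  by (simp add: negligible_iff_null_sets null_sets_completionI)
 ultimately show False by blast
qed

text \<open>The constant sequence works, with residual zero. Extension by zero outside
  \<open>(0, T0)\<close> keeps the slices Borel and nonnegative at every time.\<close>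

lemma classical_approximable:
 fixes u :: "'a::euclidean_space => real => real"
 assumes q: "q > 1" and T0: "0 < T0" "ereal T0 < T"
  and nonneg: "\<forall>(x, t) \<in> Qdom T. u x t \<ge> 0" and sol: "classical_solution q T u"
 shows "approximable q T0 (%x t. if 0 < t \<and> t < T0 then u x t else 0)"
proof -
 obtain Du :: "'a => real => 'a" and D2 :: "'a => real => 'a => 'a" and ut :: "'a => real => real" where
  cu: "continuous_on (Qdom T) (%(x, t). u x t)" and
  cDu: "continuous_on (Qdom T) (%(x, t). Du x t)" and
  cD2: "\<And>v. continuous_on (Qdom T) (%(x, t). D2 x t v)" and
  cut: "continuous_on (Qdom T) (%(x, t). ut x t)" and
  eqs: "\<forall>(x, t) \<in> Qdom T.
     ((%y. u y t) has_derivative (%h. Du x t \<bullet> h)) (at x) \<and>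
     ((%y. Du y t) has_derivative D2 x t) (at x) \<and>
     ((%s. u x s) has_real_derivative ut x t) (at t) \<and>
     ut x t - (\<Sum>b\<in>Basis. D2 x t b \<bullet> b) + norm (Du x t) powr q = 0"
  using sol unfolding classical_solution_def by blast
 have Q: "(x, t) \<in> Qdom T" if "0 < t" "t < T0" for x :: 'a and t
  using that T0(2) by (auto simp: Qdom_def intro: less_trans[of "ereal t" "ereal T0"])
 have sub: "(UNIV :: 'a set) \<times> {a<..<b} \<subseteq> Qdom T" if "0 \<le> a" "b \<le> T0" for a b
  using that by (auto intro!: Q)
 have cu': "continuous_on (UNIV \<times> {0<..<T0}) (%(x, t). u x t)"
  using continuous_on_subset[OF cu sub[of 0 T0]] by simp
 have cs: "continuous_on UNIV (%x. u x t)" if "0 < t" "t < T0" for t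
  using continuous_on_slice[OF cu', of t] that by simp
 have nn: "0 \<le> u x t" and dt: "(u x has_real_derivative ut x t) (at t)" if "0 < t" "t < T0" for x t
  using nonneg eqs Q[OF that, of x] by auto
 let ?v = "%x t. if 0 < t \<and> t < T0 then u x t else 0"
 show ?thesis
 proof
  show "q > 1" "T0 > 0" by fact+
  show "(%x. ?v x t) \<in> borel_measurable borel" for t
  proof (cases "0 < t \<and> t < T0")
   case True
   then show ?thesis using borel_measurable_continuous_onI[OF cs, of t] by simp
  next
   case False
   then have "(%x. ?v x t) = (%x. 0)" by auto
   then show ?thesis by simp
  qed
  show "?v x t \<ge> 0" for x t using nonneg Q[of t x] by auto
  show "set_integrable lborel (cball 0 R) (%x. ?v x t)" if t: "0 < t" "t < T0" for t R
   using t borel_integrable_compact[OF compact_cball continuous_on_subset[OF cs[OF t]], of 0 R]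
   by (simp add: set_integrable_def)
  show "((%s. \<integral>\<^sup>+x\<in>cball 0 R. ennreal \<bar>?v x s - ?v x t\<bar> \<partial>lborel) \<longlongrightarrow> 0) (at t)" if t: "0 < t" "t < T0" for t R
  proof -
   define d where "d = min t (T0 - t) / 2"
   have d: "0 < d" "0 < t - d" "t + d < T0" using t by (auto simp: d_def min_def field_simps)
   \<comment> \<open>A continuous cutoff, 1 on \<open>cball 0 R\<close> and 0 outside radius
     \<open>R + 1\<close>. It dominates the L1 difference on the ball by an integral that depends
     continuously on the time.\<close>
   define \<omega> :: "'a => real" where "\<omega> x = max 0 (min 1 (R + 1 - norm x))" for x
   have c\<omega>: "continuous_on A \<omega>" for A unfolding \<omega>_def by (intro continuous_intros)
   define P where "P x s = \<bar>u x s - u x t\<bar> * \<omega> x" for x s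
   have cP: "continuous_on (UNIV \<times> {t-d..t+d}) (%(x, s). P x s)"
    unfolding P_def split_beta
    by (intro continuous_intros continuous_on_compose_pair[OF cu'] continuous_on_compose2[OF c\<omega>[of UNIV]])
     (use d t in auto)
   have P0: "P x s = 0" if "norm x > R + 1" for x s using that by (simp add: P_def \<omega>_def)
   have "continuous_on {t-d..t+d} (%s. LBINT x. P x s)"
    by (rule continuous_on_lborel_integral[OF P0 cP])
   then have "isCont (%s. LBINT x. P x s) t"
    by (rule continuous_on_interior) (use d in auto)
   then have "((%s. LBINT x. P x s) \<longlongrightarrow> 0) (at t)"
    by (simp add: isCont_def P_def)
   then have lim: "((%s. ennreal (LBINT x. P x s)) \<longlongrightarrow> 0) (at t)"
    using tendsto_ennrealI by fastforce
   have ev: "\<forall>\<^sub>F s in at t. s \<in> {t-d<..<t+d}"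
    by (rule eventually_at_in_open') (use d in auto)
   show ?thesis
   proof (rule tendsto_sandwich[OF _ _ tendsto_const lim])
    show "\<forall>\<^sub>F s in at t. (\<integral>\<^sup>+x\<in>cball 0 R. ennreal \<bar>?v x s - ?v x t\<bar> \<partial>lborel) \<le> ennreal (LBINT x. P x s)"
     using ev
    proof (rule eventually_mono)
     fix s assume s: "s \<in> {t-d<..<t+d}"
     then have s': "0 < s" "s < T0" using d by auto
     have "integrable lborel (%x. P x s)"
      by (rule integrable_compact_support[OF continuous_on_slice[OF cP] P0]) (use s in auto)
     then have "ennreal (LBINT x. P x s) = (\<integral>\<^sup>+x. ennreal (P x s) \<partial>lborel)"
      by (subst nn_integral_eq_integral) (auto simp: P_def \<omega>_def)
     moreover have "ennreal \<bar>?v x s - ?v x t\<bar> * indicator (cball 0 R) x \<le> ennreal (P x s)" for x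
      using s' t by (auto simp: P_def \<omega>_def indicator_def)
     ultimately show "(\<integral>\<^sup>+x\<in>cball 0 R. ennreal \<bar>?v x s - ?v x t\<bar> \<partial>lborel) \<le> ennreal (LBINT x. P x s)"
      by (simp add: nn_integral_mono)
    qed
   qed simp
  qed
  show "\<exists>f G D ft. approximants q a b R ?v f G D ft" if ab: "0 < a" "a < b" "b < T0" and R: "R > 0" for a b R
  proof (intro exI)
   have C21: "C21 a b u Du D2 ut"
    unfolding C21_def
   proof (intro conjI ballI allI)
    fix t assume t: "t \<in> {a<..<b}"
    have "continuous_on UNIV (%x. D2 x t v)" for v
     by (rule continuous_on_slice[OF continuous_on_subset[OF cD2 sub[of a b]] t]) (use ab in auto)
    then show "C2 (%x. u x t) (%x. Du x t) (%x. D2 x t)"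
     using eqs Q[of t] t ab unfolding C2_def by fastforce
    show "((%s. u x s) has_real_derivative ut x t) (at t)" for x
     by (rule dt) (use t ab in auto)
   qed (use ab in \<open>auto intro!: continuous_on_subset[OF cu sub] continuous_on_subset[OF cDu sub]
      continuous_on_subset[OF cD2 sub] continuous_on_subset[OF cut sub]\<close>)
   have res: "resid q Du D2 ut x t = 0" if "t \<in> {a<..<b}" for x t
    using eqs Q[of t x] that ab by (fastforce simp: resid_def lap_def)
   show "approximants q a b R ?v (%_. u) (%_. Du) (%_. D2) (%_. ut)"
    unfolding approximants_def
   proof (intro conjI allI impI)
    show "subsol q a b u Du D2 ut"
     unfolding subsol_def using C21 res nn ab by auto
    show "(%n::nat. integral {s..t} (%r. LBINT x. resid q Du D2 ut x r * bump 0 (1 / (4 * R\<^sup>2)) x)) \<longlonglongrightarrow> 0"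
     if "a < s \<and> s < t \<and> t < b" for s t
    proof -
     have "integral {s..t} (%r. LBINT x. resid q Du D2 ut x r * bump 0 (1 / (4 * R\<^sup>2)) x) = integral {s..t} (%r. 0)"
      by (rule integral_cong) (use that res in simp)
     then show ?thesis by simp
    qed
    show "AE t in lborel. a < t \<and> t < b --> (%n::nat. \<integral>\<^sup>+x\<in>cball 0 R. ennreal \<bar>u x t - ?v x t\<bar> \<partial>lborel) \<longlonglongrightarrow> 0"
     using ab by (intro AE_I2) auto
    fix \<delta> :: real assume \<delta>: "\<delta> > 0"
    show "\<exists>n0. \<forall>n\<ge>n0::nat. \<forall>t A B h. a + \<delta> < t \<and> t < b - \<delta> \<and> A \<ge> 0 \<and>
      (AE r in lborel. \<bar>r - t\<bar> < \<delta> --> (AE x in lborel. ?v (x + h) r \<le> A * ?v x r + B)) -->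
      (\<forall>x. u (x + h) t \<le> A * u x t + B)"
    proof (intro exI[of _ 0] allI impI, elim conjE)
     fix t A B :: real and h x :: 'a
     assume t: "a + \<delta> < t" "t < b - \<delta>"
      and ae: "AE r in lborel. \<bar>r - t\<bar> < \<delta> --> (AE x in lborel. ?v (x + h) r \<le> A * ?v x r + B)"
     have ct: "isCont (%r. u y r) t" for y
      by (rule DERIV_isCont[OF dt]) (use t ab \<delta> in auto)
     show "u (x + h) t \<le> A * u x t + B"
     \<comment> \<open>A strict violation at time \<open>t\<close> persists at nearby times. Among
       these there is one at which the inequality holds for almost every \<open>x\<close>, hence by
       continuity for every \<open>x\<close>.\<close>
     proof (rule ccontr)
      assume "\<not> ?thesis"
      then have neg: "A * u x t + B - u (x + h) t < 0" by simp
      have "((%r. A * u x r + B - u (x + h) r) \<longlongrightarrow> A * u x t + B - u (x + h) t) (at t)"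
       using ct by (intro tendsto_intros) (auto simp: isCont_def)
      from order_tendstoD(2)[OF this neg] obtain e where e: "e > 0"
       and en: "\<And>r. r \<noteq> t ==> dist r t < e ==> A * u x r + B - u (x + h) r < 0"
       unfolding eventually_at by blast
      have "AE r in lborel. t < r \<and> r < t + min e \<delta> --> (AE x in lborel. ?v (x + h) r \<le> A * ?v x r + B)"
       using ae by (rule eventually_mono) auto
      from AE_dense[OF this] e \<delta> obtain r where r: "t < r" "r < t + min e \<delta>"
       and ar: "AE x in lborel. ?v (x + h) r \<le> A * ?v x r + B" by auto
      have r0: "0 < r" "r < T0" using r t ab \<delta> by auto
      have "u (x + h) r \<le> A * u x r + B"
      proof (rule AE_continuous_le_imp_le[where f = "%x. u (x + h) r" and g = "%x. A * u x r + B"])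
       show "continuous_on UNIV (%x. u (x + h) r)"
        by (rule continuous_on_compose2[OF cs[OF r0]]) (auto intro!: continuous_intros)
       show "continuous_on UNIV (%x. A * u x r + B)" by (intro continuous_intros cs[OF r0])
       show "AE x in lborel. u (x + h) r \<le> A * u x r + B" using ar r0 by simp
      qed
      moreover have "r < t + e" using r min.cobounded1[of e \<delta>] by linarith
      ultimately show False using en[of r] r(1) by (auto simp: dist_real_def)
     qed
    qed
   qed simp
  qed
 qed
qed

section \<open>Smooth mollifiers\<close>

text \<open>The standard flat function \<open>exp (- 1 / x)\<close> together with all products by
  powers of \<open>1 / x\<close>. The family is closed under differentiation up to linear
  combinations, which makes smoothness an induction over all \<open>m\<close> at once.\<close>

definition flat :: "nat => real => real" where
 "flat m x = (if x > 0 then exp (- (1 / x)) * (1 / x) ^ m else 0)"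

lemma flat_nonneg: "0 \<le> flat m x"
 by (simp add: flat_def)

text \<open>With \<open>n = m + 2\<close>, the bound
  \<open>exp (1 / x) \<ge> (1 / (n * x)) ^ n\<close> leaves two spare powers of \<open>x\<close>
  after multiplication by \<open>(1 / x) ^ m\<close>. Quadratic smallness gives derivative 0 at the
  origin.\<close>

lemma flat_le: "flat m x \<le> real (m + 2) ^ (m + 2) * x\<^sup>2"
proof (cases "x > 0")
 case True
 define n where "n = m + 2"
 have n: "real n > 0" by (simp add: n_def)
 have "1 / x / real n \<le> exp (1 / x / real n)"
  using exp_ge_add_one_self[of "1 / x / real n"] by linarith
 then have "(1 / x / real n) ^ n \<le> exp (1 / x / real n) ^ n"
  using True n by (intro power_mono) auto
 also have "\<dots> = exp (1 / x)" using n by (simp add: exp_of_nat_mult[symmetric])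
 finally have "1 / exp (1 / x) \<le> 1 / (1 / x / real n) ^ n"
  using True n by (intro divide_left_mono) auto
 also have "\<dots> = (real n * x) ^ n" using True n by (simp add: power_divide power_mult_distrib field_simps)
 finally have "exp (- (1 / x)) * (1 / x) ^ m \<le> (real n * x) ^ n * (1 / x) ^ m"
  using True by (intro mult_right_mono) (auto simp: exp_minus inverse_eq_divide)
 also have "\<dots> = real n ^ n * x\<^sup>2"
  using True by (simp add: n_def power_mult_distrib power_divide power_add power2_eq_square)
 finally show ?thesis using True by (simp add: flat_def n_def)
qed (simp add: flat_def)

lemma flat_derivative: "(flat m has_real_derivative flat (m + 2) x - real m * flat (m + 1) x) (at x)"
proof -
 consider "x > 0" | "x < 0" | "x = 0" by linarith
 then show ?thesis
 proof cases
  case 1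
  have e: "exp (- (1 / x)) * (1 / x\<^sup>2) * (1 / x) ^ m + exp (- (1 / x)) * (real m * (1 / x) ^ (m - 1) * (- (1 / x\<^sup>2)))
    = flat (m + 2) x - real m * flat (m + 1) x"
   using 1 by (cases m) (simp_all add: flat_def power2_eq_square field_simps)
  have "((%x. exp (- (1 / x)) * (1 / x) ^ m) has_real_derivative
    exp (- (1 / x)) * (1 / x\<^sup>2) * (1 / x) ^ m + exp (- (1 / x)) * (real m * (1 / x) ^ (m - 1) * (- (1 / x\<^sup>2)))) (at x)"
   using 1 by (auto intro!: derivative_eq_intros simp: power2_eq_square)
  from has_field_derivative_transform_within_open[OF this[unfolded e], of "{0<..}" "flat m"] 1
  show ?thesis by (auto simp: flat_def)
 next
  case 2
  have "((%_. 0) has_real_derivative 0) (at x)" by simp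
  from has_field_derivative_transform_within_open[OF this, of "{..<0}" "flat m"] 2
  show ?thesis by (auto simp: flat_def)
 next
  case 3
  define C where "C = real (m + 2) ^ (m + 2)"
  have "((%h. flat m h / h) \<longlongrightarrow> 0) (at 0)"
  proof (rule Lim_null_comparison)
   have "norm (flat m h / h) \<le> C * \<bar>h\<bar>" if "h \<noteq> 0" for h
    using flat_le[of m h] flat_nonneg[of m h] that
    by (auto simp: C_def abs_divide divide_le_eq power2_eq_square abs_mult_self_eq mult.assoc)
   then show "\<forall>\<^sub>F h in at 0. norm (flat m h / h) \<le> C * \<bar>h\<bar>" by (auto simp: eventually_at_filter)
   have "((%h. C * \<bar>h\<bar>) \<longlongrightarrow> C * \<bar>0\<bar>) (at 0)" by (intro tendsto_intros)
   then show "((%h. C * \<bar>h\<bar>) \<longlongrightarrow> 0) (at 0)" by simp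
  qed
  then show ?thesis using 3 by (simp add: DERIV_def flat_def)
 qed
qed

lemma flat_continuous: "continuous_on A (flat m)"
 by (rule continuous_at_imp_continuous_on) (use flat_derivative DERIV_isCont in blast)

lemma Ck_SucD: "Ck (Suc k) f ==> Ck k f"
proof (induction k arbitrary: f)
 case (Suc k)
 then obtain Df where "continuous_on UNIV f" "\<forall>z. (f has_derivative Df z) (at z)" "\<forall>v. Ck (Suc k) (%z. Df z v)"
  by (subst (asm) Ck.simps) blast
 then show ?case using Suc.IH by (subst Ck.simps) blast
qed auto

lemma Ck_const: "Ck k (%_. c)"
proof (induction k arbitrary: c)
 case (Suc k)
 then show ?case by (auto intro!: exI[of _ "%_ _. 0"])
qed simp

lemma Ck_bounded_linear:
 assumes f: "bounded_linear f"
 shows "Ck k (%z. f z + c)"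
proof -
 have "continuous_on UNIV (%z. f z + c)"
  by (intro continuous_on_add linear_continuous_on[OF f] continuous_on_const)
 moreover have "((%z. f z + c) has_derivative f) (at z)" for z
  using has_derivative_add[OF bounded_linear_imp_has_derivative[OF f] has_derivative_const] by simp
 ultimately show ?thesis by (cases k) (auto intro!: exI[of _ "%_. f"] Ck_const)
qed

lemma Ck_add: "Ck k f ==> Ck k g ==> Ck k (%z. f z + g z)"
proof (induction k arbitrary: f g)
 case 0
 then show ?case by (auto intro: continuous_intros)
next
 case (Suc k)
 then obtain Df Dg where "\<forall>z. (f has_derivative Df z) (at z)" "\<forall>v. Ck k (%z. Df z v)"
  "\<forall>z. (g has_derivative Dg z) (at z)" "\<forall>v. Ck k (%z. Dg z v)" by auto
 with Suc show ?case
  by (auto intro!: exI[of _ "%z v. Df z v + Dg z v"] continuous_intros has_derivative_add)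
qed

lemma Ck_mult: "Ck k f ==> Ck k g ==> Ck k (%z. f z * g z)"
proof (induction k arbitrary: f g)
 case 0
 then show ?case by (auto intro: continuous_intros)
next
 case (Suc k)
 then obtain Df Dg where D: "\<forall>z. (f has_derivative Df z) (at z)" "\<forall>v. Ck k (%z. Df z v)"
  "\<forall>z. (g has_derivative Dg z) (at z)" "\<forall>v. Ck k (%z. Dg z v)" by auto
 have "Ck k (%z. f z * Dg z v + Df z v * g z)" for v
  using D Suc Ck_SucD by (intro Ck_add Suc.IH) blast+
 with Suc.prems D show ?case
  by (auto intro!: exI[of _ "%z v. f z * Dg z v + Df z v * g z"] continuous_intros has_derivative_mult)
qed

lemma Ck_inner: "Ck k (%w. (w - z) \<bullet> v)"
 using Ck_bounded_linear[OF bounded_linear_inner_left, of k v "- (z \<bullet> v)"] by (simp add: inner_diff_left)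

lemma flat_radial_derivative:
 fixes y z :: "'b::real_inner"
 shows "((%y. flat m (c - (y - z) \<bullet> (y - z))) has_derivative
  (%v. (flat (m + 2) (c - (y - z) \<bullet> (y - z)) + (- real m) * flat (m + 1) (c - (y - z) \<bullet> (y - z))) * (-2 * ((y - z) \<bullet> v)))) (at y)"
proof -
 have "((%y. c - (y - z) \<bullet> (y - z)) has_derivative (%v. -2 * ((y - z) \<bullet> v))) (at y)"
  by (auto intro!: derivative_eq_intros simp: inner_commute)
 from has_derivative_compose[OF this flat_derivative[unfolded has_field_derivative_def]]
 show ?thesis by simp
qed

text \<open>The derivative is a linear factor times a combination of two members of the same family,
  so the induction on \<open>k\<close> must generalise over \<open>m\<close>.\<close>

lemma Ck_flat_radial: "Ck k (%y. flat m (c - (y - z) \<bullet> (y - z)))"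
proof (induction k arbitrary: m)
 case 0
 show ?case by (auto intro!: continuous_on_compose2[OF flat_continuous[of UNIV]] continuous_intros)
next
 case (Suc k)
 show ?case unfolding Ck.simps
 proof (intro conjI exI allI)
  show "continuous_on UNIV (%y. flat m (c - (y - z) \<bullet> (y - z)))"
   by (auto intro!: continuous_on_compose2[OF flat_continuous[of UNIV]] continuous_intros)
  show "((%y. flat m (c - (y - z) \<bullet> (y - z))) has_derivative
   (%v. (flat (m + 2) (c - (y - z) \<bullet> (y - z)) + (- real m) * flat (m + 1) (c - (y - z) \<bullet> (y - z))) * (-2 * ((y - z) \<bullet> v)))) (at y)" for y
   by (rule flat_radial_derivative)
  show "Ck k (%y. (flat (m + 2) (c - (y - z) \<bullet> (y - z)) + (- real m) * flat (m + 1) (c - (y - z) \<bullet> (y - z))) * (-2 * ((y - z) \<bullet> v)))" for v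
   by (intro Ck_mult Ck_add Ck_const Ck_inner Suc.IH)
 qed
qed

text \<open>The argument of \<open>flat\<close> is positive exactly in the open ball of radius
  \<open>ep\<close>, and the second factor normalises the integral to 1.\<close>

definition mol :: "real => 'b::euclidean_space => real" where
 "mol ep y = flat 0 (ep\<^sup>2 - y \<bullet> y) * (1 / (LBINT w. flat 0 (ep\<^sup>2 - w \<bullet> (w::'b))))"

text \<open>The gradient of \<open>mol\<close>. In the derivative of \<open>flat 0\<close> the term
  with factor \<open>m\<close> is absent, so only \<open>flat 2\<close> occurs, times the derivative
  \<open>-2 * y\<close> of the inner function.\<close>

definition molG :: "real => 'b::euclidean_space => 'b" where
 "molG ep y = (flat 2 (ep\<^sup>2 - y \<bullet> y) * (- 2 / (LBINT w. flat 0 (ep\<^sup>2 - w \<bullet> (w::'b))))) *\<^sub>R y"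

lemma flat_outside:
 assumes "ep > 0" "norm (y::'b::euclidean_space) \<ge> ep"
 shows "flat m (ep\<^sup>2 - y \<bullet> y) = 0"
 using assms power_mono[of ep "norm y" 2] by (simp add: flat_def power2_norm_eq_inner)

lemma mol_outside: "ep > 0 ==> norm y \<ge> ep ==> mol ep y = 0" "ep > 0 ==> norm y \<ge> ep ==> molG ep y = 0"
 by (auto simp: mol_def molG_def flat_outside)

lemma mol_continuous: "continuous_on A (mol ep)" "continuous_on A (molG ep)"
 unfolding mol_def molG_def
 by (intro continuous_intros continuous_on_compose2[OF flat_continuous[of UNIV]]; simp)+

lemma mol_nonneg: "0 \<le> mol ep y"
 unfolding mol_def by (intro mult_nonneg_nonneg divide_nonneg_nonneg integral_nonneg_AE) (auto simp: flat_nonneg)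

lemma mol_integral:
 assumes "ep > 0"
 shows "(LBINT y. mol ep (y::'b::euclidean_space)) = 1"
proof -
 let ?F = "%w::'b. flat 0 (ep\<^sup>2 - w \<bullet> w)"
 have c: "continuous_on UNIV ?F"
  by (auto intro!: continuous_on_compose2[OF flat_continuous[of UNIV]] continuous_intros)
 have i: "integrable lborel ?F"
  by (rule integrable_compact_support[OF c, of ep]) (simp add: flat_outside assms less_imp_le)
 have "(LBINT w. ?F w) \<noteq> 0"
 proof
  assume "(LBINT w. ?F w) = 0"
  then have "AE w in lborel. ?F w \<le> 0"
   using i by (subst (asm) integral_nonneg_eq_0_iff_AE) (auto simp: flat_nonneg elim: eventually_mono)
  from AE_continuous_le_imp_le[OF c continuous_on_const this, of 0]
  show False using assms by (simp add: flat_def)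
 qed
 then show ?thesis by (simp add: mol_def)
qed

lemma mol_derivative: "(mol ep has_derivative (%h. molG ep y \<bullet> h)) (at y)"
proof -
 let ?c = "1 / (LBINT w. flat 0 (ep\<^sup>2 - w \<bullet> (w::'a)))"
 have "((%y. flat 0 (ep\<^sup>2 - (y - 0) \<bullet> (y - 0)) * ?c) has_derivative (%h. molG ep y \<bullet> h)) (at y)"
  by (rule has_derivative_eq_rhs[OF has_derivative_mult_left[OF flat_radial_derivative]])
   (auto simp: molG_def algebra_simps fun_eq_iff numeral_2_eq_2)
 then show ?thesis by (simp add: mol_def[abs_def])
qed

lemma mol_translate_derivative: "((%w. mol ep (w - z)) has_derivative (%h. molG ep (w - z) \<bullet> h)) (at w)"
proof -
 have "((%w. w - z) has_derivative (%h. h)) (at w)" by (auto intro!: derivative_eq_intros)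
 from has_derivative_compose[OF this mol_derivative] show ?thesis .
qed

lemma smooth_mol: "smooth (%w. mol ep (w - z))" "smooth (%w. molG ep (w - z) \<bullet> v)"
proof -
 show "smooth (%w. mol ep (w - z))"
  unfolding smooth_def mol_def by (intro allI Ck_mult Ck_flat_radial Ck_const)
 show "smooth (%w. molG ep (w - z) \<bullet> v)"
  unfolding smooth_def molG_def inner_scaleR_left by (intro allI Ck_mult Ck_flat_radial Ck_const Ck_inner)
qed

lemma test_funI:
 fixes z :: "'b::euclidean_space"
 assumes "smooth f" "\<And>w. norm (w - z) \<ge> ep ==> f w = 0" "cball z ep \<subseteq> A"
 shows "f \<in> test_fun A"
proof -
 have "{w. f w \<noteq> 0} \<subseteq> cball z ep"
  using assms(2) by (force simp: dist_norm norm_minus_commute not_le[symmetric] intro: less_imp_le)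
 then have s: "supp_cl f \<subseteq> cball z ep" unfolding supp_cl_def by (intro closure_minimal) auto
 then have "bounded (supp_cl f)" using bounded_cball bounded_subset by blast
 moreover have "closed (supp_cl f)" by (simp add: supp_cl_def)
 ultimately have "compact (supp_cl f)" by (simp add: compact_eq_bounded_closed)
 then show ?thesis using s assms unfolding test_fun_def by blast
qed

lemma test_fun_mol:
 assumes "ep > 0" "cball z ep \<subseteq> A"
 shows "(%w. mol ep (w - z)) \<in> test_fun A" "(%w. molG ep (w - z) \<bullet> v) \<in> test_fun A"
proof -
 show "(%w. mol ep (w - z)) \<in> test_fun A"
  by (rule test_funI[OF smooth_mol(1) _ assms(2)]) (simp add: mol_outside assms)
 show "(%w. molG ep (w - z) \<bullet> v) \<in> test_fun A"
  by (rule test_funI[OF smooth_mol(2) _ assms(2)]) (simp add: mol_outside assms)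
qed

section \<open>Mollification of locally integrable functions\<close>

definition locint :: "('b::euclidean_space => 'c::{banach,second_countable_topology}) => bool" where
 "locint f \<longleftrightarrow> f \<in> borel_measurable borel \<and> (\<forall>R. set_integrable lborel (cball 0 R) f)"

lemma locint_dominated:
 fixes \<kappa> :: "'b::euclidean_space => 'd::real_normed_vector"
  and h :: "'b => 'e::{banach,second_countable_topology}"
 assumes f: "locint f" and \<kappa>: "continuous_on UNIV \<kappa>" and supp: "\<And>w. norm w > R ==> \<kappa> w = 0"
  and h: "h \<in> borel_measurable borel" "\<And>w. norm (h w) \<le> norm (f w) * norm (\<kappa> w)"
 shows "integrable lborel h"
proof -
 have "continuous_on (cball 0 R) (%w. norm (\<kappa> w))" using continuous_on_subset[OF \<kappa>] by (intro continuous_intros) auto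
 from compact_continuous_abs_bound[OF this compact_cball]
 obtain B where B: "\<And>w. w \<in> cball 0 R ==> \<bar>norm (\<kappa> w)\<bar> \<le> B" by blast
 have "integrable lborel (%w. B *\<^sub>R (indicator (cball 0 R) w *\<^sub>R f w))"
  by (rule integrable_scaleR_right) (use f in \<open>simp add: locint_def set_integrable_def\<close>)
 then show ?thesis
 proof (rule Bochner_Integration.integrable_bound)
  have "norm (h w) \<le> norm (B *\<^sub>R (indicator (cball 0 R) w *\<^sub>R f w))" for w
  proof (cases "w \<in> cball 0 R")
   case True
   then have "norm (f w) * norm (\<kappa> w) \<le> norm (f w) * \<bar>B\<bar>" using B[of w] by (intro mult_left_mono) auto
   then show ?thesis using h(2)[of w] True by (simp add: mult.commute)
  next
   case False
   then show ?thesis using h(2)[of w] supp[of w] by simp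
  qed
  then show "AE w in lborel. norm (h w) \<le> norm (B *\<^sub>R (indicator (cball 0 R) w *\<^sub>R f w))" by simp
 qed (use h in simp)
qed

lemma translate_supp:
 assumes "\<And>y. norm (y::'b::real_normed_vector) > r ==> \<kappa> y = 0" "norm w > norm z + r"
 shows "\<kappa> (w - z) = 0"
 using assms(2) norm_triangle_ineq2[of w z] by (intro assms(1)) linarith

lemma locint_mollify:
 fixes f :: "'b::euclidean_space => real" and \<kappa> :: "'b => 'c::euclidean_space"
 assumes f: "locint f" and \<kappa>: "continuous_on UNIV \<kappa>" and supp: "\<And>y. norm y > r ==> \<kappa> y = 0"
 shows "integrable lborel (%w. f w *\<^sub>R \<kappa> (w - z))"
proof -
 have c: "continuous_on UNIV (%w. \<kappa> (w - z))"
  by (rule continuous_on_compose2[OF \<kappa>]) (auto intro!: continuous_intros)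
 have z: "\<kappa> (w - z) = 0" if "norm w > norm z + r" for w
  by (rule translate_supp[of r \<kappa>, OF supp that])
 show ?thesis
  by (rule locint_dominated[OF f c z])
   (use f borel_measurable_continuous_onI[OF c] in \<open>auto simp: locint_def\<close>)
qed

lemma mollify_continuous:
 fixes f :: "'b::euclidean_space => real" and \<kappa> :: "'b => 'c::euclidean_space"
 assumes f: "locint f" and \<kappa>: "continuous_on UNIV \<kappa>" and supp: "\<And>y. norm y > r ==> \<kappa> y = 0"
 shows "continuous_on UNIV (%z. LBINT w. f w *\<^sub>R \<kappa> (w - z))"
proof (rule continuous_on_sequentiallyI)
 fix s :: "nat => 'b" and a assume s: "s \<longlonglongrightarrow> a"
 then obtain C where C: "\<And>n. norm (s n) \<le> C" using convergent_imp_Bseq[of s] unfolding convergent_def Bseq_def by blast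
 have "continuous_on (cball 0 r) (%w. norm (\<kappa> w))" using continuous_on_subset[OF \<kappa>] by (intro continuous_intros) auto
 from compact_continuous_abs_bound[OF this compact_cball]
 obtain B where B0: "\<And>w. w \<in> cball 0 r ==> \<bar>norm (\<kappa> w)\<bar> \<le> B" by blast
 have B: "norm (\<kappa> y) \<le> \<bar>B\<bar>" for y
  using B0[of y] supp[of y] by (cases "norm y \<le> r") auto
 have fm: "f \<in> borel_measurable borel" using f by (simp add: locint_def)
 have \<kappa>m: "(%w. \<kappa> (w - z)) \<in> borel_measurable borel" for z
  by (intro borel_measurable_continuous_onI continuous_on_compose2[OF \<kappa>]) (auto intro!: continuous_intros)
 show "(%n. LBINT w. f w *\<^sub>R \<kappa> (w - s n)) \<longlonglongrightarrow> (LBINT w. f w *\<^sub>R \<kappa> (w - a))"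
 proof (rule integral_dominated_convergence[where w = "%w. \<bar>B\<bar> * \<bar>indicator (cball 0 (C + r)) w *\<^sub>R f w\<bar>"])
  show "integrable lborel (%w. \<bar>B\<bar> * \<bar>indicator (cball 0 (C + r)) w *\<^sub>R f w\<bar>)"
   using f by (auto simp: locint_def set_integrable_def simp del: real_scaleR_def)
  have "isCont \<kappa> y" for y using \<kappa> by (simp add: continuous_on_eq_continuous_at)
  then have "(%n. \<kappa> (w - s n)) \<longlonglongrightarrow> \<kappa> (w - a)" for w
   by (rule isCont_tendsto_compose) (intro tendsto_intros s)
  then show "AE w in lborel. (%n. f w *\<^sub>R \<kappa> (w - s n)) \<longlonglongrightarrow> f w *\<^sub>R \<kappa> (w - a)"
   by (intro AE_I2 tendsto_intros)
  have "norm (f w *\<^sub>R \<kappa> (w - s n)) \<le> \<bar>B\<bar> * \<bar>indicator (cball 0 (C + r)) w *\<^sub>R f w\<bar>" for w n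
  proof (cases "norm w \<le> C + r")
   case True
   have "\<bar>f w\<bar> * norm (\<kappa> (w - s n)) \<le> \<bar>f w\<bar> * \<bar>B\<bar>" by (intro mult_left_mono B) auto
   then show ?thesis using True by (simp add: mult.commute)
  next
   case False
   then have "\<kappa> (w - s n) = 0" using C[of n] by (intro translate_supp[OF supp]) auto
   then show ?thesis by simp
  qed
  then show "AE w in lborel. norm (f w *\<^sub>R \<kappa> (w - s n)) \<le> \<bar>B\<bar> * \<bar>indicator (cball 0 (C + r)) w *\<^sub>R f w\<bar>" for n by simp
 qed (use fm \<kappa>m in auto)
qed

lemma uniform_continuity_compact_support:
 fixes \<kappa> :: "'b::euclidean_space => 'c::real_normed_vector"
 assumes \<kappa>: "continuous_on UNIV \<kappa>" and supp: "\<And>y. norm y > r ==> \<kappa> y = 0" and e: "e > 0"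
 obtains d where "d > 0" "d \<le> 1" "\<And>x y. dist x y < d ==> norm (\<kappa> x - \<kappa> y) < e"
proof -
 have "uniformly_continuous_on (cball 0 (r + 1)) \<kappa>"
  by (rule compact_uniformly_continuous[OF continuous_on_subset[OF \<kappa>]]) auto
 then obtain d where d: "d > 0" "\<And>x y. x \<in> cball 0 (r + 1) ==> y \<in> cball 0 (r + 1) ==> dist y x < d ==> dist (\<kappa> y) (\<kappa> x) < e"
  unfolding uniformly_continuous_on_def using e by blast
 show thesis
 proof (rule that[of "min d 1"])
  fix x y :: 'b assume xy: "dist x y < min d 1"
  show "norm (\<kappa> x - \<kappa> y) < e"
  proof (cases "norm x \<le> r \<or> norm y \<le> r")
   case True
   then have "norm x \<le> r + 1" "norm y \<le> r + 1"
    using xy norm_triangle_ineq2[of x y] norm_triangle_ineq3[of x y] by (auto simp: dist_norm)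
   then show ?thesis using d(2)[of y x] xy by (simp add: dist_norm)
  next
   case False
   then show ?thesis using supp[of x] supp[of y] e by simp
  qed
 qed (use d in auto)
qed

text \<open>The linearisation error of the kernel is bounded by the modulus of continuity of
  \<open>K\<close>, uniformly in \<open>w\<close>, and can be integrated against \<open>f\<close>.
  The minus sign stems from \<open>z\<close> entering through \<open>w - z\<close>.\<close>

lemma mollify_has_derivative:
 fixes f k :: "'b::euclidean_space => real" and K :: "'b => 'b"
 assumes f: "locint f" and k: "continuous_on UNIV k" "\<And>y. norm y > r ==> k y = 0"
  and K: "continuous_on UNIV K" "\<And>y. norm y > r ==> K y = 0"
  and der: "\<And>y. (k has_derivative (%h. K y \<bullet> h)) (at y)"
 shows "((%z. LBINT w. f w * k (w - z)) has_derivative (%h. (- (LBINT w. f w *\<^sub>R K (w - z))) \<bullet> h)) (at z)"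
 unfolding has_derivative_at_alt
proof (intro conjI allI impI bounded_linear_inner_right)
 fix e :: real assume e: "e > 0"
 define I where "I = (LBINT w. \<bar>indicator (cball 0 (norm z + r + 1)) w *\<^sub>R f w\<bar>)"
 have fi: "integrable lborel (%w. \<bar>indicator (cball 0 (norm z + r + 1)) w *\<^sub>R f w\<bar>)"
  using f by (auto simp: locint_def set_integrable_def simp del: real_scaleR_def)
 have I0: "I \<ge> 0" unfolding I_def by (rule integral_nonneg_AE) auto
 define e' where "e' = e / (I + 1)"
 have e': "e' > 0" "e' * I \<le> e" using e I0 by (auto simp: e'_def field_simps add_pos_nonneg)
 obtain d where d: "d > 0" "d \<le> 1" and Kd: "\<And>x y. dist x y < d ==> norm (K x - K y) < e'"
  by (rule uniform_continuity_compact_support[OF K e'(1)]) (assumption | rule that)+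
 show "\<exists>d>0. \<forall>y. norm (y - z) < d -->
   norm ((LBINT w. f w * k (w - y)) - (LBINT w. f w * k (w - z)) - (- (LBINT w. f w *\<^sub>R K (w - z))) \<bullet> (y - z)) \<le> e * norm (y - z)"
 proof (intro exI[of _ d] conjI allI impI d(1))
  fix y assume y: "norm (y - z) < d"
  have ik: "integrable lborel (%w. f w * k (w - x))" for x using locint_mollify[of f k r x] f k by simp
  have iK: "integrable lborel (%w. f w *\<^sub>R K (w - z))" using locint_mollify[of f K r z] f K by simp
  have iKi: "integrable lborel (%w. f w * (K (w - z) \<bullet> (y - z)))"
   using integrable_inner_left[of "y - z" lborel "%w. f w *\<^sub>R K (w - z)"] iK by (simp del: integrable_inner_left)
  have pt: "\<bar>k (w - y) - k (w - z) + K (w - z) \<bullet> (y - z)\<bar> \<le> e' * norm (y - z) * indicator (cball 0 (norm z + r + 1)) w" for w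
  proof (cases "norm w \<le> norm z + r + 1")
   case True
   have "norm (k (w - y) - k (w - z) - (%h. K (w - z) \<bullet> h) ((w - y) - (w - z))) \<le> norm ((w - y) - (w - z)) * e'"
   proof (rule differentiable_bound_linearization[where S = "ball (w - z) d" and f' = "%x h. K x \<bullet> h"])
    show "w - z + t *\<^sub>R (w - y - (w - z)) \<in> ball (w - z) d" if t: "t \<in> {0..1}" for t
    proof -
     have "\<bar>t\<bar> * norm (y - z) \<le> 1 * norm (y - z)" using t by (intro mult_right_mono) auto
     then show ?thesis using y by (simp add: dist_norm norm_minus_commute)
    qed
    show "(k has_derivative (%h. K x \<bullet> h)) (at x within ball (w - z) d)" for x
     using der[of x] by (rule has_derivative_at_withinI)
    show "onorm ((%h. K x \<bullet> h) - (%h. K (w - z) \<bullet> h)) \<le> e'" if "x \<in> ball (w - z) d" for x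
    proof (rule onorm_le)
     fix h
     have "norm (K x - K (w - z)) \<le> e'" using Kd[of x "w - z"] that by (auto simp: dist_commute)
     then show "norm (((%h. K x \<bullet> h) - (%h. K (w - z) \<bullet> h)) h) \<le> e' * norm h"
      using Cauchy_Schwarz_ineq2[of "K x - K (w - z)" h] mult_right_mono[of "norm (K x - K (w - z))" e' "norm h"]
      by (simp add: inner_diff_left)
    qed
    show "w - z \<in> ball (w - z) d" using d by simp
   qed
   then show ?thesis using True by (simp add: algebra_simps inner_diff_right norm_minus_commute)
  next
   case False
   have "norm y \<le> norm z + 1" using y d norm_triangle_ineq2[of y z] by linarith
   then have "norm w > norm y + r" "norm w > norm z + r" using False by auto
   then have "k (w - y) = 0" "k (w - z) = 0" "K (w - z) = 0"
    using translate_supp[of r k y w] translate_supp[of r k z w] translate_supp[of r K z w] k(2) K(2) by auto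
   then show ?thesis using False by simp
  qed
  have "(LBINT w. f w * k (w - y)) - (LBINT w. f w * k (w - z)) - (- (LBINT w. f w *\<^sub>R K (w - z))) \<bullet> (y - z)
   = (LBINT w. f w * (k (w - y) - k (w - z) + K (w - z) \<bullet> (y - z)))"
  proof -
   have "(LBINT w. f w *\<^sub>R K (w - z)) \<bullet> (y - z) = (LBINT w. f w * (K (w - z) \<bullet> (y - z)))"
    using integral_inner_left[of "y - z" lborel "%w. f w *\<^sub>R K (w - z)"] iK by (simp del: integral_inner_left)
   then show ?thesis using ik iKi by (simp add: distrib_left right_diff_distrib)
  qed
  also have "norm \<dots> \<le> (LBINT w. e' * norm (y - z) * \<bar>indicator (cball 0 (norm z + r + 1)) w *\<^sub>R f w\<bar>)"
  proof (rule Bochner_Integration.integral_norm_bound_integral)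
   show "integrable lborel (%w. e' * norm (y - z) * \<bar>indicator (cball 0 (norm z + r + 1)) w *\<^sub>R f w\<bar>)"
    using fi by (rule integrable_mult_right)
   show "integrable lborel (%w. f w * (k (w - y) - k (w - z) + K (w - z) \<bullet> (y - z)))"
    using ik iKi by (simp add: distrib_left right_diff_distrib)
   show "norm (f w * (k (w - y) - k (w - z) + K (w - z) \<bullet> (y - z))) \<le> e' * norm (y - z) * \<bar>indicator (cball 0 (norm z + r + 1)) w *\<^sub>R f w\<bar>" for w
    using mult_left_mono[OF pt[of w], of "\<bar>f w\<bar>"] by (simp add: abs_mult mult_ac)
  qed
  also have "\<dots> = e' * I * norm (y - z)" by (simp add: I_def)
  also have "\<dots> \<le> e * norm (y - z)" using e' by (intro mult_right_mono) auto
  finally show "norm ((LBINT w. f w * k (w - y)) - (LBINT w. f w * k (w - z)) - (- (LBINT w. f w *\<^sub>R K (w - z))) \<bullet> (y - z)) \<le> e * norm (y - z)" .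
 qed
qed

text \<open>Density of compactly supported continuous functions in L1. The function is truncated in
  value and space; a measurable function is an almost everywhere limit of continuous ones, and
  clamping these provides a majorant.\<close>

lemma integrable_approx_continuous:
 fixes f :: "'b::euclidean_space => real"
 assumes f: "integrable lborel f" and e: "e > 0"
 obtains h r where "continuous_on UNIV h" "\<And>w. norm w > r ==> h w = 0" "(\<integral>\<^sup>+w. ennreal \<bar>f w - h w\<bar> \<partial>lborel) < ennreal e"
proof -
 have [measurable]: "f \<in> borel_measurable borel" using borel_measurable_integrable[OF f] by simp
 define F where "F n w = (if \<bar>f w\<bar> \<le> real n \<and> norm w \<le> real n then f w else 0)" for n :: nat and w
 have F_meas [measurable]: "F n \<in> borel_measurable borel" for n unfolding F_def by measurable
 have "(%n. LBINT w. \<bar>f w - F n w\<bar>) \<longlonglongrightarrow> (\<integral>w. 0 \<partial>(lborel :: 'b measure))"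
 proof (rule integral_dominated_convergence[where w = "%w. \<bar>f w\<bar>"])
  have "(%n. \<bar>f w - F n w\<bar>) \<longlonglongrightarrow> 0" for w
  proof (rule tendsto_eventually)
   obtain n0 where "max \<bar>f w\<bar> (norm w) \<le> real n0" using real_arch_simple by blast
   then show "\<forall>\<^sub>F n in sequentially. \<bar>f w - F n w\<bar> = 0"
    unfolding eventually_sequentially F_def by (intro exI[of _ n0]) auto
  qed
  then show "AE w in lborel. (%n. \<bar>f w - F n w\<bar>) \<longlonglongrightarrow> 0" by simp
  show "integrable lborel (%w. \<bar>f w\<bar>)" using f by (rule integrable_abs)
 qed (auto simp: F_def)
 then have "\<forall>\<^sub>F n in sequentially. (LBINT w. \<bar>f w - F n w\<bar>) < e / 2"
  using e by (intro order_tendstoD(2)) auto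
 then obtain n where n: "(LBINT w. \<bar>f w - F n w\<bar>) < e / 2"
  by (auto simp: eventually_sequentially)
 have "F n \<in> borel_measurable lborel" using F_meas by simp
 then have "F n \<in> borel_measurable lebesgue" by (rule measurable_completion)
 then have "F n measurable_on UNIV" by (intro lebesgue_measurable_imp_measurable_on) auto
 then obtain N g where N: "negligible N" and g: "\<And>k. continuous_on UNIV (g k)"
  and lim: "\<And>w. w \<notin> N ==> (%k. g k w) \<longlonglongrightarrow> F n w" unfolding measurable_on_def by auto
 define h where "h k w = max (- real n) (min (real n) (g k w)) * max 0 (min 1 (real n + 1 - norm w))" for k :: nat and w
 have hc: "continuous_on UNIV (h k)" for k unfolding h_def by (intro continuous_intros g)
 have [measurable]: "h k \<in> borel_measurable borel" for k using hc by (rule borel_measurable_continuous_onI)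
 have bd: "norm \<bar>F n w - h k w\<bar> \<le> 2 * real n * indicator (cball 0 (real n + 1)) w" for k w
 proof (cases "norm w \<le> real n + 1")
  case True
  have "\<bar>h k w\<bar> \<le> real n * 1" unfolding h_def abs_mult by (intro mult_mono) auto
  moreover have "\<bar>F n w\<bar> \<le> real n" by (auto simp: F_def)
  ultimately show ?thesis using True by simp
 qed (simp add: F_def h_def)
 have "(%k. LBINT w. \<bar>F n w - h k w\<bar>) \<longlonglongrightarrow> (\<integral>w. 0 \<partial>(lborel :: 'b measure))"
 proof (rule integral_dominated_convergence[where w = "%w. 2 * real n * indicator (cball 0 (real n + 1)) w"])
  have "AE w in lebesgue. w \<notin> N" using N by (intro AE_not_in) (simp add: negligible_iff_null_sets)
  then have "AE w in lborel. w \<notin> N" by (simp add: AE_completion_iff)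
  then show "AE w in lborel. (%k. \<bar>F n w - h k w\<bar>) \<longlonglongrightarrow> 0"
  proof (rule eventually_mono)
   fix w assume "w \<notin> N"
   then have "(%k. \<bar>F n w - h k w\<bar>) \<longlonglongrightarrow> \<bar>F n w - max (- real n) (min (real n) (F n w)) * max 0 (min 1 (real n + 1 - norm w))\<bar>"
    unfolding h_def by (intro tendsto_intros lim)
   then show "(%k. \<bar>F n w - h k w\<bar>) \<longlonglongrightarrow> 0" by (cases "norm w \<le> real n") (auto simp: F_def)
  qed
  show "integrable lborel (%w. 2 * real n * indicator (cball (0::'b) (real n + 1)) w)"
   by (intro integrable_mult_right integrable_real_indicator) (auto simp: emeasure_lborel_cball_finite[unfolded infinity_ennreal_def])
 qed (use bd in auto)
 then have "\<forall>\<^sub>F k in sequentially. (LBINT w. \<bar>F n w - h k w\<bar>) < e / 2"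
  using e by (intro order_tendstoD(2)) auto
 then obtain k where k: "(LBINT w. \<bar>F n w - h k w\<bar>) < e / 2"
  by (auto simp: eventually_sequentially)
 have iF: "integrable lborel (F n)" by (rule Bochner_Integration.integrable_bound[OF f]) (auto simp: F_def)
 have ih: "integrable lborel (h k)"
  by (rule integrable_compact_support[OF hc, of "real n + 1"]) (simp add: h_def)
 have "(LBINT w. \<bar>f w - h k w\<bar>) \<le> (LBINT w. \<bar>f w - F n w\<bar> + \<bar>F n w - h k w\<bar>)"
  by (rule integral_mono) (use f iF ih in auto)
 also have "\<dots> = (LBINT w. \<bar>f w - F n w\<bar>) + (LBINT w. \<bar>F n w - h k w\<bar>)"
  using f iF ih by (intro Bochner_Integration.integral_add) auto
 also have "\<dots> < e" using n k by simp
 finally have "(\<integral>\<^sup>+w. ennreal \<bar>f w - h k w\<bar> \<partial>lborel) < ennreal e"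
  using f ih e by (subst nn_integral_eq_integral) (auto intro!: ennreal_lessI)
 then show thesis by (intro that[of "h k" "real n + 1"] hc) (auto simp: h_def)
qed

lemma nn_integral_lborel_translate:
 fixes f :: "'b::euclidean_space => ennreal"
 assumes "f \<in> borel_measurable borel"
 shows "(\<integral>\<^sup>+x. f (x + c) \<partial>lborel) = (\<integral>\<^sup>+x. f x \<partial>lborel)"
proof -
 have "(\<integral>\<^sup>+x. f x \<partial>lborel) = (\<integral>\<^sup>+x. f x \<partial>distr lborel borel ((+) c))" by (simp add: lborel_distr_plus)
 also have "\<dots> = (\<integral>\<^sup>+x. f (c + x) \<partial>lborel)" by (rule nn_integral_distr) (use assms in auto)
 finally show ?thesis by (simp add: add.commute)
qed

lemma integrable_lborel_translate:
 fixes f :: "'b::euclidean_space => real"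
 assumes "integrable lborel f"
 shows "integrable lborel (%x. f (c + x))"
proof -
 have "integrable (distr lborel borel ((+) c)) f" using assms by (simp add: lborel_distr_plus)
 then show ?thesis by (rule integrable_distr[rotated]) simp
qed

lemma L1_translation_continuous:
 fixes f :: "'b::euclidean_space => real"
 assumes f: "integrable lborel f" and e: "e > 0"
 shows "\<exists>d>0. \<forall>y. norm y < d --> (\<integral>\<^sup>+x. ennreal \<bar>f (x + y) - f x\<bar> \<partial>lborel) \<le> ennreal e"
proof -
 obtain h r where hc: "continuous_on UNIV h" and h0: "\<And>w. norm w > r ==> h w = 0"
  and fh: "(\<integral>\<^sup>+w. ennreal \<bar>f w - h w\<bar> \<partial>lborel) < ennreal (e / 3)"
  by (rule integrable_approx_continuous[OF f, of "e / 3"]) (use e in auto)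
 have [measurable]: "f \<in> borel_measurable borel" using borel_measurable_integrable[OF f] by simp
 have [measurable]: "h \<in> borel_measurable borel" using hc by (rule borel_measurable_continuous_onI)
 define V where "V = measure lborel (cball (0::'b) (r + 1))"
 have emV: "emeasure lborel (cball (0::'b) (r + 1)) = ennreal V"
  unfolding V_def by (rule emeasure_eq_ennreal_measure) (use emeasure_lborel_cball_finite[of "0::'b" "r + 1"] in auto)
 define e' where "e' = e / (3 * (V + 1))"
 have V: "V \<ge> 0" by (simp add: V_def)
 have e': "e' > 0" "e' * V \<le> e / 3" using e V by (auto simp: e'_def field_simps add_pos_nonneg)
 obtain d where d: "d > 0" "d \<le> 1" and hd: "\<And>x y. dist x y < d ==> norm (h x - h y) < e'"
  by (rule uniform_continuity_compact_support[OF hc h0 e'(1)]) (assumption | rule that)+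
 show ?thesis
 proof (intro exI[of _ d] conjI allI impI d(1))
  fix y :: 'b assume y: "norm y < d"
  have pt: "ennreal \<bar>h (x + y) - h x\<bar> \<le> ennreal e' * indicator (cball 0 (r + 1)) x" for x
  proof (cases "norm x \<le> r + 1")
   case True
   have "\<bar>h (x + y) - h x\<bar> \<le> e'" using hd[of "x + y" x] y by (simp add: dist_norm)
   then show ?thesis using True by (simp add: ennreal_leI)
  next
   case False
   have "norm x \<le> norm (x + y) + norm y" using norm_triangle_ineq4[of "x + y" y] by simp
   then have "h (x + y) = 0" "h x = 0" using False y d by (auto intro!: h0)
   then show ?thesis by simp
  qed
  have "(\<integral>\<^sup>+x. ennreal \<bar>h (x + y) - h x\<bar> \<partial>lborel) \<le> (\<integral>\<^sup>+x. ennreal e' * indicator (cball (0::'b) (r + 1)) x \<partial>lborel)"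
   by (intro nn_integral_mono pt)
  also have "\<dots> = ennreal (e' * V)"
   using e' V by (simp add: nn_integral_cmult_indicator emV ennreal_mult)
  also have "\<dots> \<le> ennreal (e / 3)" using e' by (intro ennreal_leI)
  finally have m: "(\<integral>\<^sup>+x. ennreal \<bar>h (x + y) - h x\<bar> \<partial>lborel) \<le> ennreal (e / 3)" .
  have l: "(\<integral>\<^sup>+x. ennreal \<bar>f (x + y) - h (x + y)\<bar> \<partial>lborel) \<le> ennreal (e / 3)"
   using fh nn_integral_lborel_translate[of "%x. ennreal \<bar>f x - h x\<bar>" y] by simp
  have "(\<integral>\<^sup>+x. ennreal \<bar>f (x + y) - f x\<bar> \<partial>lborel)
   \<le> (\<integral>\<^sup>+x. ennreal \<bar>f (x + y) - h (x + y)\<bar> + (ennreal \<bar>h (x + y) - h x\<bar> + ennreal \<bar>f x - h x\<bar>) \<partial>lborel)"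
   by (intro nn_integral_mono) (auto simp: ennreal_plus[symmetric] simp del: ennreal_plus intro!: ennreal_leI)
  also have "\<dots> = (\<integral>\<^sup>+x. ennreal \<bar>f (x + y) - h (x + y)\<bar> \<partial>lborel) + ((\<integral>\<^sup>+x. ennreal \<bar>h (x + y) - h x\<bar> \<partial>lborel) + (\<integral>\<^sup>+x. ennreal \<bar>f x - h x\<bar> \<partial>lborel))"
  proof -
   have [measurable]: "(%x. f (x + y)) \<in> borel_measurable borel" "(%x. h (x + y)) \<in> borel_measurable borel"
    by (rule measurable_compose[of _ borel borel], simp, simp)+
   show ?thesis by (simp add: nn_integral_add)
  qed
  also have "\<dots> \<le> ennreal (e / 3) + (ennreal (e / 3) + ennreal (e / 3))"
   by (intro add_mono l m less_imp_le fh)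
  also have "\<dots> = ennreal e" using e by (simp add: ennreal_plus[symmetric] del: ennreal_plus)
  finally show "(\<integral>\<^sup>+x. ennreal \<bar>f (x + y) - f x\<bar> \<partial>lborel) \<le> ennreal e" .
 qed
qed

text \<open>The error is at most an average of translation errors in L1, by Fubini. Truncation to
  radius \<open>R + 1\<close> does not affect the mollification on \<open>cball 0 R\<close>, since
  \<open>ep < 1\<close>.\<close>

lemma mollify_L1:
 fixes f :: "'b::euclidean_space => real"
 assumes f: "locint f" and e: "e > 0"
 shows "\<exists>d>0. \<forall>ep. 0 < ep \<and> ep < d -->
  (\<integral>\<^sup>+z\<in>cball 0 R. ennreal \<bar>(LBINT w. f w * mol ep (w - z)) - f z\<bar> \<partial>lborel) \<le> ennreal e"
proof -
 define F where "F w = indicator (cball 0 (R + 1)) w *\<^sub>R f w" for w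
 have iF: "integrable lborel F" using f by (simp add: F_def[abs_def] locint_def set_integrable_def)
 have fm [measurable]: "f \<in> borel_measurable borel" using f by (simp add: locint_def)
 have Fm [measurable]: "F \<in> borel_measurable borel" unfolding F_def[abs_def] using fm by (intro borel_measurable_scaleR borel_measurable_indicator) auto
 obtain d where d: "d > 0" and tr: "\<And>y. norm y < d ==> (\<integral>\<^sup>+x. ennreal \<bar>F (x + y) - F x\<bar> \<partial>lborel) \<le> ennreal e"
  using L1_translation_continuous[OF iF e] by blast
 show ?thesis
 proof (intro exI[of _ "min d 1"] conjI allI impI)
  fix ep :: real assume "0 < ep \<and> ep < min d 1"
  then have ep: "0 < ep" "ep < d" "ep < 1" by auto
  have mm [measurable]: "mol ep \<in> borel_measurable (borel :: 'b measure)"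
   by (rule borel_measurable_continuous_onI[OF mol_continuous(1)])
  have im: "integrable lborel (mol ep :: 'b => real)"
   by (rule integrable_compact_support[OF mol_continuous(1), of ep]) (use ep in \<open>simp add: mol_outside\<close>)
  have pt: "ennreal \<bar>(LBINT w. f w * mol ep (w - z)) - f z\<bar> * indicator (cball 0 R) z
    \<le> (\<integral>\<^sup>+y. ennreal (\<bar>F (z + y) - F z\<bar> * mol ep y) \<partial>lborel)" for z
  proof (cases "z \<in> cball 0 R")
   case True
   have i0: "integrable lborel (%w. f w * mol ep (w - z))"
    using locint_mollify[OF f mol_continuous(1), of ep ep z] ep by (simp add: mol_outside)
   have i1: "integrable lborel (%y. f (z + y) * mol ep y)"
    using integrable_lborel_translate[OF i0, of z] by simp
   have "(LBINT w. f w * mol ep (w - z)) = (LBINT y. f (z + y) * mol ep y)"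
    using integral_lborel_translate[of "%w. f w * mol ep (w - z)" z] by simp
   then have "(LBINT w. f w * mol ep (w - z)) - f z = (LBINT y. f (z + y) * mol ep y) - (LBINT y. f z * mol ep (y::'b))"
    using mol_integral[OF ep(1), where 'b = 'b] im by simp
   also have "\<dots> = (LBINT y. f (z + y) * mol ep y - f z * mol ep y)"
    using i1 im by simp
   finally have "\<bar>(LBINT w. f w * mol ep (w - z)) - f z\<bar> \<le> (LBINT y. \<bar>f (z + y) * mol ep y - f z * mol ep y\<bar>)"
    using integral_norm_bound[of lborel "%y. f (z + y) * mol ep y - f z * mol ep y"] by simp
   then have "ennreal \<bar>(LBINT w. f w * mol ep (w - z)) - f z\<bar> \<le> (\<integral>\<^sup>+y. ennreal \<bar>f (z + y) * mol ep y - f z * mol ep y\<bar> \<partial>lborel)"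
    using i1 im by (subst nn_integral_eq_integral) (auto intro!: ennreal_leI)
   also have "\<dots> = (\<integral>\<^sup>+y. ennreal (\<bar>F (z + y) - F z\<bar> * mol ep y) \<partial>lborel)"
   proof (rule nn_integral_cong)
    fix y :: 'b
    have "\<bar>f (z + y) * mol ep y - f z * mol ep y\<bar> = \<bar>F (z + y) - F z\<bar> * mol ep y"
    proof (cases "norm y < ep")
     case y: True
     have "norm (z + y) \<le> R + 1" "norm z \<le> R + 1"
      using True y ep norm_triangle_ineq[of z y] by auto
     then show ?thesis by (simp add: F_def left_diff_distrib[symmetric] abs_mult mol_nonneg)
    qed (use ep in \<open>simp add: mol_outside\<close>)
    then show "ennreal \<bar>f (z + y) * mol ep y - f z * mol ep y\<bar> = ennreal (\<bar>F (z + y) - F z\<bar> * mol ep y)" by simp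
   qed
   finally show ?thesis using True by simp
  qed simp
  have add: "(%p. fst p + snd p) \<in> lborel \<Otimes>\<^sub>M lborel \<rightarrow>\<^sub>M (borel :: 'b measure)" by measurable
  have meas: "(%(z, y). ennreal (\<bar>F (z + y) - F z\<bar> * mol ep y)) \<in> borel_measurable (lborel \<Otimes>\<^sub>M lborel)"
   unfolding split_beta
   by (intro measurable_compose[OF _ measurable_ennreal] borel_measurable_times borel_measurable_abs borel_measurable_diff
     measurable_compose[OF add Fm] measurable_compose[OF measurable_fst] measurable_compose[OF measurable_snd]) simp_all
  have "(\<integral>\<^sup>+z\<in>cball 0 R. ennreal \<bar>(LBINT w. f w * mol ep (w - z)) - f z\<bar> \<partial>lborel)
   \<le> (\<integral>\<^sup>+z. \<integral>\<^sup>+y. ennreal (\<bar>F (z + y) - F z\<bar> * mol ep y) \<partial>lborel \<partial>lborel)"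
   by (intro nn_integral_mono pt)
  also have "\<dots> = (\<integral>\<^sup>+y. \<integral>\<^sup>+z. ennreal (\<bar>F (z + y) - F z\<bar> * mol ep y) \<partial>lborel \<partial>lborel)"
   using lborel_pair.Fubini'[OF meas] by simp
  also have "\<dots> \<le> (\<integral>\<^sup>+y. ennreal e * ennreal (mol ep (y::'b)) \<partial>lborel)"
  proof (rule nn_integral_mono)
   fix y :: 'b
   show "(\<integral>\<^sup>+z. ennreal (\<bar>F (z + y) - F z\<bar> * mol ep y) \<partial>lborel) \<le> ennreal e * ennreal (mol ep y)"
   proof (cases "norm y < ep")
    case True
    have "(\<integral>\<^sup>+z. ennreal (\<bar>F (z + y) - F z\<bar> * mol ep y) \<partial>lborel) = (\<integral>\<^sup>+z. ennreal \<bar>F (z + y) - F z\<bar> \<partial>lborel) * ennreal (mol ep y)"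
     by (simp add: ennreal_mult mol_nonneg nn_integral_multc)
    then show ?thesis using tr[of y] True ep by (auto intro!: mult_right_mono)
   qed (use ep in \<open>simp add: mol_outside\<close>)
  qed
  also have "\<dots> = ennreal e * ennreal (LBINT y. mol ep (y::'b))"
   using im by (subst nn_integral_cmult) (auto simp: nn_integral_eq_integral mol_nonneg)
  also have "\<dots> = ennreal e" using mol_integral[OF ep(1), where 'b = 'b] by simp
  finally show "(\<integral>\<^sup>+z\<in>cball 0 R. ennreal \<bar>(LBINT w. f w * mol ep (w - z)) - f z\<bar> \<partial>lborel) \<le> ennreal e" .
 qed (use d in auto)
qed

lemma AE_tendsto_0_of_summable:
 fixes X :: "nat => 'c => ennreal"
 assumes [measurable]: "\<And>n. X n \<in> borel_measurable M" and fin: "(\<Sum>n. \<integral>\<^sup>+x. X n x \<partial>M) < \<infinity>"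
 shows "AE x in M. (%n. X n x) \<longlonglongrightarrow> 0"
proof -
 have "(\<integral>\<^sup>+x. (\<Sum>n. X n x) \<partial>M) \<noteq> \<infinity>" using fin by (simp add: nn_integral_suminf)
 then have "AE x in M. (\<Sum>n. X n x) \<noteq> \<infinity>" by (intro nn_integral_PInf_AE) auto
 then show ?thesis
 proof (rule eventually_mono)
  fix x assume x: "(\<Sum>n. X n x) \<noteq> \<infinity>"
  have le: "X n x \<le> (\<Sum>n. X n x)" for n using sum_le_suminf[of "%n. X n x" "{n}"] by simp
  have "X n x < top" for n by (rule le_less_trans[OF le]) (use x in \<open>simp add: less_top\<close>)
  then have eq: "ennreal (enn2real (X n x)) = X n x" for n by (rule ennreal_enn2real)
  then have "(\<Sum>n. ennreal (enn2real (X n x))) \<noteq> \<infinity>" using x by simp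
  then have "summable (%n. enn2real (X n x))" by (intro summable_suminf_not_top) auto
  then have "(%n. enn2real (X n x)) \<longlonglongrightarrow> 0" by (rule summable_LIMSEQ_zero)
  from tendsto_ennrealI[OF this] show "(%n. X n x) \<longlonglongrightarrow> 0" using eq by simp
 qed
qed

lemma mol_translate_continuous:
 "continuous_on A (%w. mol ep (w - z))" "continuous_on A (%w. molG ep (w - z))"
 by (rule continuous_on_compose2[OF mol_continuous(1)[of UNIV]] continuous_on_compose2[OF mol_continuous(2)[of UNIV]];
   auto intro!: continuous_intros)+

lemma mol_translate_outside:
 assumes "ep > 0" "norm w > norm z + ep"
 shows "mol ep (w - z) = 0" "molG ep (w - z) = 0"
 using assms norm_triangle_ineq2[of w z] by (auto intro!: mol_outside)

lemma mol_translate_integral: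
 fixes z :: "'b::euclidean_space"
 assumes "ep > 0"
 shows "integrable lborel (%w. mol ep (w - z))" "(LBINT w. mol ep (w - z)) = 1"
proof -
 show "integrable lborel (%w. mol ep (w - z))"
  by (rule integrable_compact_support[OF mol_translate_continuous(1)]) (rule mol_translate_outside(1)[OF assms])
 have "mol ep \<in> borel_measurable (borel :: 'b measure)"
  by (rule borel_measurable_continuous_onI[OF mol_continuous(1)])
 from integral_lborel_translate[OF this, of "- z"] mol_integral[OF assms, where 'b = 'b]
 show "(LBINT w. mol ep (w - z)) = 1" by simp
qed

lemma locint_times:
 fixes f \<kappa> :: "'b::euclidean_space => real"
 assumes f: "locint f" and \<kappa>: "continuous_on UNIV \<kappa>" and supp: "\<And>w. norm w > R ==> \<kappa> w = 0"
 shows "integrable lborel (%w. f w * \<kappa> w)"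
 by (rule locint_dominated[OF f \<kappa> supp])
  (use f borel_measurable_continuous_onI[OF \<kappa>] in \<open>auto simp: locint_def abs_mult\<close>)

lemma locint_inner: "locint g ==> locint (%w. g w \<bullet> i)" for g :: "'b::euclidean_space => 'a::euclidean_space"
 unfolding locint_def set_integrable_def
proof (elim conjE, intro conjI allI)
 fix R :: real assume "\<forall>R. integrable lborel (%x. indicat_real (cball 0 R) x *\<^sub>R g x)"
 then have "integrable lborel (%x. (indicat_real (cball 0 R) x *\<^sub>R g x) \<bullet> i)" by (intro integrable_inner_left) simp
 then show "integrable lborel (%x. indicat_real (cball 0 R) x *\<^sub>R (g x \<bullet> i))" by simp
qed simp

text \<open>The norm of the average is at most the average \<open>n\<close>-comparison of norms, and
  \<open>powr_tangent\<close>, the supporting line of the power at the norm of the vector average,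
  is integrated against the kernel of mass 1.\<close>

lemma jensen_mollify:
 fixes g :: "'b::euclidean_space => 'a::euclidean_space"
 assumes q: "q > 1" and g: "locint g" and F: "locint (%w. norm (g w) powr q)" and ep: "ep > 0"
 shows "norm (LBINT w. mol ep (w - z) *\<^sub>R g w) powr q \<le> (LBINT w. norm (g w) powr q * mol ep (w - z))"
proof -
 let ?k = "%w. mol ep (w - z)"
 have gm [measurable]: "g \<in> borel_measurable borel" using g by (simp add: locint_def)
 have km [measurable]: "?k \<in> borel_measurable borel" by (rule borel_measurable_continuous_onI[OF mol_translate_continuous(1)])
 note k = mol_translate_continuous(1)[of UNIV ep z] mol_translate_outside(1)[OF ep, of z]
 have ng: "integrable lborel (%w. norm (g w) * ?k w)"
  by (rule locint_dominated[OF g k]) (auto simp: abs_mult)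
 have iF: "integrable lborel (%w. norm (g w) powr q * ?k w)" by (rule locint_times[OF F k])
 note ik = mol_translate_integral[OF ep, of z]
 define n where "n = norm (LBINT w. ?k w *\<^sub>R g w)"
 have nle: "n \<le> (LBINT w. norm (g w) * ?k w)"
  using integral_norm_bound[of lborel "%w. ?k w *\<^sub>R g w"] by (simp add: n_def mol_nonneg mult.commute)
 show ?thesis
 proof (cases "n = 0")
  case True
  then have "norm (LBINT w. ?k w *\<^sub>R g w) powr q = 0" by (simp add: n_def)
  then show ?thesis using integral_nonneg_AE[of "%w. norm (g w) powr q * ?k w" lborel] by (simp add: mol_nonneg)
 next
  case False
  then have n: "n > 0" by (simp add: n_def)
  define c where "c = q * n powr (q - 1)"
  have c: "c \<ge> 0" using q by (simp add: c_def)
  have "n powr q \<le> n powr q + c * ((LBINT w. norm (g w) * ?k w) - n)" using c nle by simp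
  also have "\<dots> = (n powr q - c * n) * (LBINT w. ?k w) + c * (LBINT w. norm (g w) * ?k w)"
   using ik by (simp add: algebra_simps)
  also have "\<dots> = (LBINT w. (n powr q - c * n) * ?k w + c * (norm (g w) * ?k w))"
   using ik ng by simp
  also have "\<dots> \<le> (LBINT w. norm (g w) powr q * ?k w)"
  proof (rule integral_mono)
   show "integrable lborel (%w. (n powr q - c * n) * ?k w + c * (norm (g w) * ?k w))" using ik ng by simp
   fix w
   have "(n powr q + c * (norm (g w) - n)) * ?k w \<le> norm (g w) powr q * ?k w"
    using powr_tangent[OF q _ n, of "norm (g w)"] by (intro mult_right_mono mol_nonneg) (simp add: c_def)
   then show "(n powr q - c * n) * ?k w + c * (norm (g w) * ?k w) \<le> norm (g w) powr q * ?k w"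
    by (simp add: algebra_simps)
  qed (rule iF)
  finally show ?thesis by (simp add: n_def)
 qed
qed

lemma AE_prod_slices:
 assumes "AE p in (lborel :: ('a::euclidean_space \<times> 'c::euclidean_space) measure). P p"
 shows "AE t in lborel. AE x in lborel. P (x, t)"
proof -
 obtain N where N: "N \<in> null_sets (lborel :: ('a \<times> 'c) measure)" "{p. \<not> P p} \<subseteq> N"
  using assms unfolding eventually_ae_filter by auto
 have Nb: "N \<in> sets ((lborel :: 'a measure) \<Otimes>\<^sub>M (lborel :: 'c measure))" unfolding lborel_prod using N(1) by auto
 have "AE p in (lborel :: 'a measure) \<Otimes>\<^sub>M (lborel :: 'c measure). p \<notin> N"
  unfolding lborel_prod by (rule AE_not_in[OF N(1)])
 then have "AE x in lborel. AE t in lborel. (x, t) \<notin> N" by (rule lborel_pair.AE_pair)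
 moreover have "{p \<in> space ((lborel :: 'a measure) \<Otimes>\<^sub>M (lborel :: 'c measure)). (fst p, snd p) \<notin> N} = space (lborel \<Otimes>\<^sub>M lborel) - N" by auto
 then have "{p \<in> space ((lborel :: 'a measure) \<Otimes>\<^sub>M (lborel :: 'c measure)). (fst p, snd p) \<notin> N} \<in> sets (lborel \<Otimes>\<^sub>M lborel)"
  using sets.Diff[OF sets.top Nb] by simp
 ultimately have "AE t in lborel. AE x in lborel. (x, t) \<notin> N"
  using lborel_pair.AE_commute[of "%x t. (x, t) \<notin> N"] by simp
 then show ?thesis by (rule eventually_mono) (use N(2) in \<open>auto elim!: eventually_mono\<close>)
qed

lemma AE_prod_of_slices:
 assumes P: "{p. P p} \<in> sets (borel :: ('a::euclidean_space \<times> 'c::euclidean_space) measure)"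
  and ae: "AE t in lborel. AE x in lborel. P (x, t)"
 shows "AE p in lborel. P p"
proof -
 have Pb: "{p. P p} \<in> sets ((lborel :: 'a measure) \<Otimes>\<^sub>M (lborel :: 'c measure))" unfolding lborel_prod using P by auto
 have "AE x in lborel. AE t in lborel. P (x, t)"
  using ae by (subst lborel_pair.AE_commute) (use Pb in \<open>auto simp: pred_def space_pair_measure\<close>)
 then have "AE p in (lborel :: 'a measure) \<Otimes>\<^sub>M (lborel :: 'c measure). P p"
  by (intro lborel_pair.AE_pair_measure) (use Pb in \<open>auto simp: space_pair_measure\<close>)
 then show ?thesis unfolding lborel_prod .
qed

lemma nn_integral_prod_slices:
 fixes h :: "'a::euclidean_space \<times> 'c::euclidean_space => ennreal"
 assumes h: "h \<in> borel_measurable borel"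
 shows "(\<integral>\<^sup>+t. \<integral>\<^sup>+x. h (x, t) \<partial>lborel \<partial>lborel) = (\<integral>\<^sup>+p. h p \<partial>lborel)"
  "(%t. \<integral>\<^sup>+x. h (x, t) \<partial>lborel) \<in> borel_measurable borel"
proof -
 have hm: "h \<in> borel_measurable ((lborel :: 'a measure) \<Otimes>\<^sub>M (lborel :: 'c measure))" unfolding lborel_prod using h by auto
 show "(\<integral>\<^sup>+t. \<integral>\<^sup>+x. h (x, t) \<partial>lborel \<partial>lborel) = (\<integral>\<^sup>+p. h p \<partial>lborel)"
  using lborel_pair.nn_integral_snd[OF hm] by (simp add: lborel_prod)
 show "(%t. \<integral>\<^sup>+x. h (x, t) \<partial>lborel) \<in> borel_measurable borel"
  using lborel.borel_measurable_nn_integral_fst[OF measurable_pair_swap[OF hm]] by simp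
qed

lemma suminf_le_geometric_finite:
 fixes A :: "nat => ennreal"
 assumes "\<And>n. A n \<le> ennreal ((1/2) ^ n)"
 shows "(\<Sum>n. A n) < \<infinity>"
proof -
 have "(\<Sum>n. A n) \<le> (\<Sum>n. ennreal ((1/2) ^ n))" by (intro suminf_le assms) auto
 also have "\<dots> = ennreal (\<Sum>n. (1/2) ^ n)" by (rule suminf_ennreal2) (auto intro!: summable_geometric)
 also have "\<dots> < \<infinity>" by simp
 finally show ?thesis .
qed

section \<open>Mollified weak solutions as approximants\<close>

text \<open>\<open>grad\<close> and \<open>eqn\<close> are the weak formulation tested with
  mollifiers. The first makes the spatial gradient of the mollified \<open>U\<close> the mollified
  \<open>g\<close>; the second, with one derivative left on the kernel, writes the Laplacian as the
  divergence of that gradient and turns the defect into a Jensen gap.\<close>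

lemma mollified_approximants:
 fixes U :: "'a::euclidean_space \<times> real => real" and g :: "'a \<times> real => 'a"
 assumes q: "1 < q" "q \<le> 2" and R: "R > 0" and e0: "e0 > 0"
  and U: "locint U" "\<And>z. U z \<ge> 0" and g: "locint g" and F: "locint (%w. norm (g w) powr q)"
  and grad: "\<And>ep z i. 0 < ep ==> ep < e0 ==> snd z \<in> {a<..<b} ==> i \<in> Basis ==>
    (LBINT w. U w * (molG ep (w - z) \<bullet> (i, 0))) = - (LBINT w. (g w \<bullet> i) * mol ep (w - z))"
  and eqn: "\<And>ep z. 0 < ep ==> ep < e0 ==> snd z \<in> {a<..<b} ==>
    - (LBINT w. U w * (molG ep (w - z) \<bullet> (0, 1)))
    + (\<Sum>i\<in>Basis. LBINT w. (g w \<bullet> i) * (molG ep (w - z) \<bullet> (i, 0)))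
    + (LBINT w. norm (g w) powr q * mol ep (w - z)) = 0"
  and UV: "AE t in lborel. a < t \<and> t < b --> (AE x in lborel. U (x, t) = v x t)"
 shows "\<exists>f G D ft. approximants q a b R v f G D ft"
proof -
 define M where "M h ep z = (LBINT w. h w * mol ep (w - z))" for h ep and z :: "'a \<times> real"
 define N where "N h ep z = - (LBINT w. h w *\<^sub>R molG ep (w - z))" for h ep and z :: "'a \<times> real"
 define Fq where "Fq w = norm (g w) powr q" for w
 define gi where "gi i w = g w \<bullet> i" for i w
 have Fq: "locint Fq" using F by (simp add: Fq_def[abs_def])
 have gi: "locint (gi i)" for i using locint_inner[OF g] by (simp add: gi_def[abs_def])
 have meas: "h \<in> borel_measurable borel" if "locint h" for h :: "'a \<times> real => real" using that by (simp add: locint_def)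
 have supp: "mol ep y = 0" "molG ep y = 0" if "ep > 0" "norm y > ep" for ep and y :: "'a \<times> real" using that by (auto simp: mol_outside)
 have Mc: "continuous_on A (M h ep)" and Nc: "continuous_on A (N h ep)" if "locint h" "ep > 0" for h ep A
 proof -
  have "continuous_on UNIV (M h ep)"
   using mollify_continuous[OF that(1) mol_continuous(1) supp(1)[OF that(2)]] by (simp add: M_def[abs_def])
  then show "continuous_on A (M h ep)" by (rule continuous_on_subset) simp
  have "continuous_on UNIV (N h ep)"
   using continuous_on_minus[OF mollify_continuous[OF that(1) mol_continuous(2) supp(2)[OF that(2)]]] by (simp add: N_def[abs_def])
  then show "continuous_on A (N h ep)" by (rule continuous_on_subset) simp
 qed
 have Md: "(M h ep has_derivative (%k. N h ep z \<bullet> k)) (at z)" if "locint h" "ep > 0" for h ep z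
  unfolding M_def[abs_def] N_def
  by (rule mollify_has_derivative[OF that(1) mol_continuous(1) supp(1)[OF that(2)] mol_continuous(2) supp(2)[OF that(2)] mol_derivative])
 have Nin: "N h ep z \<bullet> k = - (LBINT w. h w * (molG ep (w - z) \<bullet> k))" if "locint h" "ep > 0" for h ep z k
 proof -
  have "integrable lborel (%w. h w *\<^sub>R molG ep (w - z))"
   by (rule locint_mollify[OF that(1) mol_continuous(2) supp(2)[OF that(2)]])
  then show ?thesis using integral_inner_left[of k lborel "%w. h w *\<^sub>R molG ep (w - z)"]
   by (simp add: N_def del: integral_inner_left)
 qed
 \<comment> \<open>The ball of this radius in space-time contains all points with
   \<open>norm x \<le> 3 * R\<close> and time in \<open>(a, b)\<close>. The bump that weighs the
   defect has support radius \<open>sqrt 5 * R\<close>, which is below \<open>3 * R\<close>.\<close>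
 define \<rho> where "\<rho> = 3 * R + \<bar>a\<bar> + \<bar>b\<bar>"
 define C where "C = cball (0 :: 'a \<times> real) \<rho>"
 have Cb [measurable]: "C \<in> sets borel" by (simp add: C_def)
 have inC: "(x, t) \<in> C" if "norm x \<le> 3 * R" "a < t" "t < b" for x t
  using that norm_Pair_le[of x t] by (auto simp: C_def \<rho>_def)
 have ev: "\<forall>\<^sub>F ep in at_right 0. (\<integral>\<^sup>+z\<in>C. ennreal \<bar>M h ep z - h z\<bar> \<partial>lborel) \<le> ennreal ((1/2) ^ n)" if h: "locint h" for h and n :: nat
 proof -
  obtain d where "d > 0" "\<forall>ep. 0 < ep \<and> ep < d --> (\<integral>\<^sup>+z\<in>C. ennreal \<bar>M h ep z - h z\<bar> \<partial>lborel) \<le> ennreal ((1/2) ^ n)"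
   using mollify_L1[OF h, of "(1/2) ^ n" \<rho>] unfolding M_def C_def by auto
  then show ?thesis unfolding eventually_at_right_field by blast
 qed
 have evg: "\<forall>\<^sub>F ep in at_right 0. \<forall>i\<in>Basis. (\<integral>\<^sup>+z\<in>C. ennreal \<bar>M (gi i) ep z - gi i z\<bar> \<partial>lborel) \<le> ennreal ((1/2) ^ n)" for n :: nat
  by (rule eventually_ball_finite) (auto intro!: ev gi)
 \<comment> \<open>Radii are selected so that all mollification errors are at most
   \<open>(1/2) ^ n\<close>. Summability gives almost everywhere convergence of the whole sequence,
   without passing to subsequences.\<close>
 define Q where "Q n ep \<longleftrightarrow> 0 < ep \<and> ep < e0 \<and> ep < 1 / real (Suc n) \<and>
   (\<integral>\<^sup>+z\<in>C. ennreal \<bar>M U ep z - U z\<bar> \<partial>lborel) \<le> ennreal ((1/2) ^ n) \<and>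
   (\<integral>\<^sup>+z\<in>C. ennreal \<bar>M Fq ep z - Fq z\<bar> \<partial>lborel) \<le> ennreal ((1/2) ^ n) \<and>
   (\<forall>i\<in>Basis. (\<integral>\<^sup>+z\<in>C. ennreal \<bar>M (gi i) ep z - gi i z\<bar> \<partial>lborel) \<le> ennreal ((1/2) ^ n))" for n ep
 have "\<exists>ep. Q n ep" for n
 proof -
  have "\<forall>\<^sub>F ep::real in at_right 0. 0 < ep \<and> ep < min e0 (1 / real (Suc n))"
   unfolding eventually_at_right_field using e0 by (intro exI[of _ "min e0 (1 / real (Suc n))"]) auto
  with ev[OF U(1), of n] ev[OF Fq, of n] evg[of n]
  have "\<forall>\<^sub>F ep in at_right 0. Q n ep" unfolding Q_def by eventually_elim auto
  then show ?thesis by (rule eventually_happens'[rotated]) simp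
 qed
 then obtain E where QE: "\<And>n. Q n (E n)" by metis
 have E: "\<And>n. 0 < E n" "\<And>n. E n < e0" "\<And>n. E n < 1 / real (Suc n)"
  and EU: "\<And>n. (\<integral>\<^sup>+z\<in>C. ennreal \<bar>M U (E n) z - U z\<bar> \<partial>lborel) \<le> ennreal ((1/2) ^ n)"
  and EF: "\<And>n. (\<integral>\<^sup>+z\<in>C. ennreal \<bar>M Fq (E n) z - Fq z\<bar> \<partial>lborel) \<le> ennreal ((1/2) ^ n)"
  and Eg: "\<And>n i. i \<in> Basis ==> (\<integral>\<^sup>+z\<in>C. ennreal \<bar>M (gi i) (E n) z - gi i z\<bar> \<partial>lborel) \<le> ennreal ((1/2) ^ n)"
  using QE unfolding Q_def by blast+
 have Mm [measurable]: "M h (E n) \<in> borel_measurable borel" if "locint h" for h n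
  by (rule borel_measurable_continuous_onI[OF Mc[OF that E(1)]])
 have Xm: "(%z. ennreal \<bar>M h (E n) z - h z\<bar> * indicator C z) \<in> borel_measurable borel" if "locint h" for h n
  using Mm[OF that] meas[OF that] by measurable
 have conv: "AE z in lborel. z \<in> C --> (%n. M h (E n) z) \<longlonglongrightarrow> h z"
  if h: "locint h" and le: "\<And>n. (\<integral>\<^sup>+z\<in>C. ennreal \<bar>M h (E n) z - h z\<bar> \<partial>lborel) \<le> ennreal ((1/2) ^ n)" for h
 proof -
  have "AE z in lborel. (%n. ennreal \<bar>M h (E n) z - h z\<bar> * indicator C z) \<longlonglongrightarrow> 0"
   by (rule AE_tendsto_0_of_summable) (use Xm[OF h] suminf_le_geometric_finite[OF le] in auto)
  then show ?thesis
  proof (rule eventually_mono, intro impI)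
   fix z assume "(%n. ennreal \<bar>M h (E n) z - h z\<bar> * indicator C z) \<longlonglongrightarrow> 0" "z \<in> C"
   then have "(%n. \<bar>M h (E n) z - h z\<bar>) \<longlonglongrightarrow> 0" by (simp add: ennreal_tendsto_0_iff)
   then show "(%n. M h (E n) z) \<longlonglongrightarrow> h z" by (simp add: tendsto_rabs_zero_iff LIM_zero_iff)
  qed
 qed
 define Gz where "Gz n z = (LBINT w. mol (E n) (w - z) *\<^sub>R g w)" for n z
 have Gi: "Gz n z \<bullet> i = M (gi i) (E n) z" for n z i
 proof -
  have "integrable lborel (%w. mol (E n) (w - z) *\<^sub>R g w)"
   by (rule locint_dominated[OF g mol_translate_continuous(1)[of UNIV "E n" z] mol_translate_outside(1)[OF E(1)[of n], of z]])
    (use g borel_measurable_continuous_onI[OF mol_translate_continuous(1)[of UNIV "E n" z]] in \<open>auto simp: locint_def\<close>)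
  then show ?thesis using integral_inner_left[of i lborel "%w. mol (E n) (w - z) *\<^sub>R g w"]
   by (simp add: Gz_def M_def gi_def mult.commute del: integral_inner_left)
 qed
 have Gsum: "Gz n z = (\<Sum>i\<in>Basis. M (gi i) (E n) z *\<^sub>R i)" for n z
  using euclidean_representation[of "Gz n z"] by (simp add: Gi)
 have Gzc: "continuous_on A (Gz n)" for A n
  unfolding Gsum[abs_def] by (intro continuous_intros Mc gi E)
 \<comment> \<open>The mollified power of the gradient minus the power of the mollified gradient;
   nonnegative by Jensen.\<close>
 define res where "res n z = M Fq (E n) z - norm (Gz n z) powr q" for n z
 have res0: "res n z \<ge> 0" for n z
  using jensen_mollify[OF q(1) g F E(1), of n z] by (simp add: res_def Gz_def M_def Fq_def)
 define f where "f n x t = M U (E n) (x, t)" for n x t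
 define G where "G n x t = Gz n (x, t)" for n x t
 define D where "D n x t k = (\<Sum>i\<in>Basis. (N (gi i) (E n) (x, t) \<bullet> (k, 0)) *\<^sub>R i)" for n x t and k :: 'a
 define ft where "ft n x t = N U (E n) (x, t) \<bullet> (0, 1)" for n x t
 have lapD: "lap (D n x t) = (\<Sum>i\<in>Basis. N (gi i) (E n) (x, t) \<bullet> (i, 0))" for n x t
  unfolding lap_def D_def
  by (rule sum.cong[OF refl]) (simp add: inner_sum_left inner_Basis if_distrib cong: if_cong)
 have reseq: "resid q (G n) (D n) (ft n) x t = res n (x, t)" if t: "t \<in> {a<..<b}" for n x t
 proof -
  have "ft n x t - lap (D n x t) + M Fq (E n) (x, t) = 0"
   using eqn[OF E(1,2), of "(x, t)" n] t
   by (simp add: ft_def lapD Nin[OF U(1) E(1)] Nin[OF gi E(1)] M_def Fq_def gi_def sum_negf)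
  then show ?thesis by (simp add: resid_def res_def G_def)
 qed
 have fstN: "fst (N U (E n) (x, t)) = Gz n (x, t)" if t: "t \<in> {a<..<b}" for n x t
 proof (rule euclidean_eqI)
  fix i :: 'a assume i: "i \<in> Basis"
  have "fst (N U (E n) (x, t)) \<bullet> i = N U (E n) (x, t) \<bullet> (i, 0)" by (simp add: inner_prod_def)
  also have "\<dots> = M (gi i) (E n) (x, t)"
   using grad[OF E(1,2) _ i, of "(x, t)" n] t by (simp add: Nin[OF U(1) E(1)] M_def gi_def)
  finally show "fst (N U (E n) (x, t)) \<bullet> i = Gz n (x, t) \<bullet> i" by (simp add: Gi)
 qed
 have C21: "C21 a b (f n) (G n) (D n) (ft n)" for n
  unfolding C21_def
 proof (intro conjI ballI allI)
  fix t assume t: "t \<in> {a<..<b}"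
  have px: "((%y. (y, t)) has_derivative (%k. (k, 0))) (at x)" for x :: 'a
   by (auto intro!: derivative_eq_intros)
  show "C2 (%x. f n x t) (%x. G n x t) (%x. D n x t)"
   unfolding C2_def
  proof (intro conjI allI)
   show "((%x. f n x t) has_derivative (%h. G n x t \<bullet> h)) (at x)" for x
    using has_derivative_compose[OF px Md[OF U(1) E(1)]] fstN[OF t] by (simp add: f_def G_def inner_prod_def)
   have "((%y. \<Sum>i\<in>Basis. M (gi i) (E n) (y, t) *\<^sub>R i) has_derivative D n x t) (at x)" for x
    unfolding D_def[abs_def]
    by (intro has_derivative_sum has_derivative_scaleR_left has_derivative_compose[OF px Md[OF gi E(1)]])
   then show "((%x. G n x t) has_derivative D n x t) (at x)" for x by (simp add: G_def Gsum)
   show "continuous_on UNIV (%x. D n x t k)" for k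
    unfolding D_def
    by (intro continuous_intros continuous_on_compose2[OF Nc[OF gi E(1), of UNIV]]) auto
  qed
  have "((%s. (x, s)) has_derivative (%k. (0, k))) (at t)" for x :: 'a
   by (auto intro!: derivative_eq_intros)
  moreover have "(%k. N U (E n) (x, t) \<bullet> (0 :: 'a, k)) = (*) (ft n x t)" for x
   by (rule ext) (simp add: ft_def inner_prod_def)
  ultimately show "((%s. f n x s) has_real_derivative ft n x t) (at t)" for x
   using has_derivative_compose[of "%s. (x, s)" "%k. (0, k)" t UNIV "M U (E n)", OF _ Md[OF U(1) E(1)]]
   unfolding f_def has_field_derivative_def by metis
 next
  have eq: "(%(x, t). h (x, t)) = h" for h :: "'a \<times> real => 'z" by auto
  show "continuous_on (UNIV \<times> {a<..<b}) (%(x, t). f n x t)" unfolding f_def eq by (rule Mc[OF U(1) E(1)])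
  show "continuous_on (UNIV \<times> {a<..<b}) (%(x, t). G n x t)"
   using Gzc unfolding G_def split_beta by simp
  show "continuous_on (UNIV \<times> {a<..<b}) (%(x, t). D n x t k)" for k
   unfolding D_def split_beta prod.collapse by (intro continuous_intros Nc gi E)
  show "continuous_on (UNIV \<times> {a<..<b}) (%(x, t). ft n x t)"
   unfolding ft_def split_beta prod.collapse by (intro continuous_intros Nc U E)
 qed
 have sub: "subsol q a b (f n) (G n) (D n) (ft n)" for n
  unfolding subsol_def using C21 reseq res0 U(2)
  by (auto simp: f_def M_def intro!: integral_nonneg_AE mult_nonneg_nonneg mol_nonneg)
 have P1: "(%n. \<integral>\<^sup>+z\<in>C. ennreal (res n z) \<partial>lborel) \<longlonglongrightarrow> 0"
 proof -
  have resm [measurable]: "res n \<in> borel_measurable borel" for n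
   unfolding res_def[abs_def] using q
   by (intro borel_measurable_continuous_onI continuous_intros continuous_on_powr' Gzc Mc[OF Fq E(1)]) auto
  have Fm [measurable]: "Fq \<in> borel_measurable borel" by (rule meas[OF Fq])
  have Fnn: "Fq z \<ge> 0" for z by (simp add: Fq_def)
  have iF: "integrable lborel (%z. indicator C z *\<^sub>R Fq z)"
   using Fq by (simp add: locint_def set_integrable_def C_def)
  \<comment> \<open>The residual has no evident majorant, but its minimum with \<open>Fq\<close> has
    one and tends to 0 almost everywhere. The excess over \<open>Fq\<close> is at most the
    mollification error of \<open>Fq\<close>, because
    \<open>res n z \<le> M Fq (E n) z\<close>.\<close>
  define s where "s n z = indicator C z *\<^sub>R min (res n z) (Fq z)" for n z
  have s0: "0 \<le> s n z" "s n z \<le> indicator C z *\<^sub>R Fq z" for n z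
   using res0[of n z] Fnn[of z] by (auto simp: s_def indicator_def)
  have sm [measurable]: "s n \<in> borel_measurable borel" for n unfolding s_def[abs_def] by measurable
  have AEg: "AE z in lborel. \<forall>i\<in>Basis. z \<in> C --> (%n. M (gi i) (E n) z) \<longlonglongrightarrow> gi i z"
   by (subst AE_ball_countable) (auto intro!: conv gi Eg countable_finite)
  have "(%n. LBINT z. s n z) \<longlonglongrightarrow> (\<integral>z. 0 \<partial>(lborel :: ('a \<times> real) measure))"
  proof (rule integral_dominated_convergence[where w = "%z. indicator C z *\<^sub>R Fq z"])
   show "AE z in lborel. (%n. s n z) \<longlonglongrightarrow> 0"
    using AEg conv[OF Fq EF]
   proof eventually_elim
    case (elim z)
    show ?case
    proof (cases "z \<in> C")
     case True
     have "(%n. Gz n z) \<longlonglongrightarrow> (\<Sum>i\<in>Basis. gi i z *\<^sub>R i)"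
      unfolding Gsum using elim True by (intro tendsto_intros) auto
     then have "(%n. Gz n z) \<longlonglongrightarrow> g z" by (simp add: gi_def euclidean_representation)
     then have "(%n. norm (Gz n z) powr q) \<longlonglongrightarrow> norm (g z) powr q"
      using q by (intro tendsto_powr' tendsto_intros) auto
     then have "(%n. res n z) \<longlonglongrightarrow> Fq z - Fq z" unfolding res_def using elim True
      by (intro tendsto_intros) (auto simp: Fq_def)
     then have "(%n. min (res n z) (Fq z)) \<longlonglongrightarrow> min 0 (Fq z)" by (intro tendsto_intros) simp
     then show ?thesis using Fnn[of z] True by (simp add: s_def min_absorb1)
    qed (simp add: s_def)
   qed
   show "AE z in lborel. norm (s n z) \<le> indicator C z *\<^sub>R Fq z" for n
    using s0[of n] by (auto simp del: real_scaleR_def)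
  qed (use iF sm in auto)
  then have sl: "(%n. ennreal (LBINT z. s n z)) \<longlonglongrightarrow> 0"
   using tendsto_ennrealI by fastforce
  have si: "integrable lborel (s n)" for n
  proof (rule Bochner_Integration.integrable_bound[OF iF])
   have "norm (s n z) \<le> norm (indicator C z *\<^sub>R Fq z)" for z
    using s0[of n z] abs_ge_self[of "indicator C z *\<^sub>R Fq z"] by (simp del: real_scaleR_def)
   then show "AE z in lborel. norm (s n z) \<le> norm (indicator C z *\<^sub>R Fq z)" by (rule AE_I2)
  qed (use sm in simp)
  have gl: "(%n. ennreal ((1/2::real) ^ n)) \<longlonglongrightarrow> 0"
   using tendsto_ennrealI[OF LIMSEQ_power_zero[of "1/2::real"]] by simp
  have le: "(\<integral>\<^sup>+z\<in>C. ennreal (res n z) \<partial>lborel) \<le> ennreal (LBINT z. s n z) + ennreal ((1/2) ^ n)" for n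
  proof -
   have "(\<integral>\<^sup>+z\<in>C. ennreal (res n z) \<partial>lborel) \<le> (\<integral>\<^sup>+z. ennreal (s n z) + ennreal \<bar>M Fq (E n) z - Fq z\<bar> * indicator C z \<partial>lborel)"
   proof (rule nn_integral_mono)
    fix z
    have "res n z \<le> min (res n z) (Fq z) + \<bar>M Fq (E n) z - Fq z\<bar>"
    proof (cases "res n z \<le> Fq z")
     case False
     have "0 \<le> norm (Gz n z) powr q" by simp
     then have "res n z \<le> Fq z + \<bar>M Fq (E n) z - Fq z\<bar>" unfolding res_def by linarith
     then show ?thesis using False by (simp add: min_def)
    qed simp
    then show "ennreal (res n z) * indicator C z \<le> ennreal (s n z) + ennreal \<bar>M Fq (E n) z - Fq z\<bar> * indicator C z"
     using res0[of n z] Fnn[of z]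
     by (auto simp: s_def indicator_def ennreal_plus[symmetric] simp del: ennreal_plus intro!: ennreal_leI)
   qed
   also have "\<dots> = (\<integral>\<^sup>+z. ennreal (s n z) \<partial>lborel) + (\<integral>\<^sup>+z\<in>C. ennreal \<bar>M Fq (E n) z - Fq z\<bar> \<partial>lborel)"
    by (rule nn_integral_add) (use sm Xm[OF Fq] in auto)
   also have "(\<integral>\<^sup>+z. ennreal (s n z) \<partial>lborel) = ennreal (LBINT z. s n z)"
    by (rule nn_integral_eq_integral[OF si]) (use s0 in auto)
   finally show ?thesis using EF[of n] by (meson add_left_mono order_trans)
  qed
  have up: "(%n. ennreal (LBINT z. s n z) + ennreal ((1/2) ^ n)) \<longlonglongrightarrow> 0"
   using tendsto_add[OF sl gl] by simp
  show ?thesis by (rule tendsto_sandwich[OF _ _ tendsto_const up]) (use le in auto)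
 qed
 have P2: "(%n. integral {s..t} (%r. LBINT x. resid q (G n) (D n) (ft n) x r * bump 0 (1 / (4 * R ^ 2)) x)) \<longlonglongrightarrow> 0"
  if st: "a < s" "s < t" "t < b" for s t
 proof -
  let ?b = "bump 0 (1 / (4 * R ^ 2)) :: 'a => real"
  define I where "I n = integral {s..t} (%r. LBINT x. resid q (G n) (D n) (ft n) x r * ?b x)" for n
  have b0: "?b x = 0" if "norm x > 3 * R" for x
  proof -
   have "sqrt (5 / (4 * (1 / (4 * R\<^sup>2)))) \<le> sqrt ((3 * R)\<^sup>2)" using R by (simp add: power_mult_distrib)
   also have "\<dots> = 3 * R" unfolding real_sqrt_abs using R by simp
   finally have "norm x \<ge> sqrt (5 / (4 * (1 / (4 * R\<^sup>2))))" using that by linarith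
   moreover have "1 / (4 * R\<^sup>2) > 0" using R by simp
   ultimately show ?thesis using bump_eq_0[of "1 / (4 * R\<^sup>2)" x] by blast
  qed
  have bc: "continuous_on A ?b" for A using C2_continuous(1)[OF C2_bump] by (rule continuous_on_subset) simp
  have sub': "{s..t} \<subseteq> {a<..<b}" using st by auto
  have Pc: "continuous_on (UNIV \<times> {s..t}) (%(x, r). resid q (G n) (D n) (ft n) x r * ?b x)" for n
   using resid_continuous[OF C21 sub', of q n] q unfolding split_beta
   by (intro continuous_intros continuous_on_compose2[OF bc[of UNIV]]) auto
  have P0: "resid q (G n) (D n) (ft n) x r * ?b x = 0" if "norm x > 3 * R" for n x r using b0[OF that] by simp
  have nn: "0 \<le> resid q (G n) (D n) (ft n) x r * ?b x" if "r \<in> {s..t}" for n x r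
   using that sub' reseq res0 by (auto simp: bump_bounds subset_iff)
  have In: "ennreal (I n) \<le> (\<integral>\<^sup>+z\<in>C. ennreal (res n z) \<partial>lborel)" and I0: "0 \<le> I n" for n
  proof -
   let ?\<phi> = "%r. LBINT x. resid q (G n) (D n) (ft n) x r * ?b x"
   have \<phi>0: "0 \<le> ?\<phi> r" if "r \<in> {s..t}" for r by (intro integral_nonneg_AE AE_I2 nn[OF that])
   have "?\<phi> integrable_on {s..t}"
    by (intro integrable_continuous_real continuous_on_lborel_integral[OF P0 Pc])
   then have hi: "(?\<phi> has_integral I n) {s..t}" unfolding I_def by (rule integrable_integral)
   show "0 \<le> I n" using has_integral_nonneg[OF hi \<phi>0] .
   have resc: "res n \<in> borel_measurable borel"
    unfolding res_def[abs_def] using q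
    by (intro borel_measurable_continuous_onI continuous_intros continuous_on_powr' Gzc Mc[OF Fq E(1)]) auto
   have "ennreal (I n) = (\<integral>\<^sup>+r. ennreal (?\<phi> r) * indicator {s..t} r \<partial>lborel)"
    using nn_integral_has_integral_lebesgue'[OF \<phi>0 hi] by simp
   also have "\<dots> \<le> (\<integral>\<^sup>+r. \<integral>\<^sup>+x. ennreal (res n (x, r)) * indicator C (x, r) \<partial>lborel \<partial>lborel)"
   proof (rule nn_integral_mono)
    fix r :: real
    show "ennreal (?\<phi> r) * indicator {s..t} r \<le> (\<integral>\<^sup>+x. ennreal (res n (x, r)) * indicator C (x, r) \<partial>lborel)"
    proof (cases "r \<in> {s..t}")
     case True
     then have r: "a < r" "r < b" using sub' by auto
     have "integrable lborel (%x. resid q (G n) (D n) (ft n) x r * ?b x)"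
      by (rule integrable_compact_support[OF continuous_on_slice[OF Pc True] P0])
     then have "ennreal (?\<phi> r) = (\<integral>\<^sup>+x. ennreal (resid q (G n) (D n) (ft n) x r * ?b x) \<partial>lborel)"
      using nn[OF True] by (subst nn_integral_eq_integral) auto
     also have "\<dots> \<le> (\<integral>\<^sup>+x. ennreal (res n (x, r)) * indicator C (x, r) \<partial>lborel)"
     proof (rule nn_integral_mono)
      fix x :: 'a
      show "ennreal (resid q (G n) (D n) (ft n) x r * ?b x) \<le> ennreal (res n (x, r)) * indicator C (x, r)"
      proof (cases "norm x \<le> 3 * R")
       case True
       have "res n (x, r) * ?b x \<le> res n (x, r) * 1" by (intro mult_left_mono bump_bounds res0)
       then show ?thesis using inC[OF True r] r by (simp add: reseq ennreal_leI)
      qed (simp add: b0)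
     qed
     finally show ?thesis using True by simp
    qed simp
   qed
   also have "\<dots> = (\<integral>\<^sup>+z\<in>C. ennreal (res n z) \<partial>lborel)"
    by (rule nn_integral_prod_slices(1)) (use resc Cb in measurable)
   finally show "ennreal (I n) \<le> (\<integral>\<^sup>+z\<in>C. ennreal (res n z) \<partial>lborel)" .
  qed
  have "(%n. ennreal (I n)) \<longlonglongrightarrow> 0"
   by (rule tendsto_sandwich[OF _ _ tendsto_const P1]) (use In in auto)
  then show ?thesis using I0 by (simp add: ennreal_tendsto_0_iff I_def)
 qed
 have P3: "AE t in lborel. a < t \<and> t < b --> (%n. \<integral>\<^sup>+x\<in>cball 0 R. ennreal \<bar>f n x t - v x t\<bar> \<partial>lborel) \<longlonglongrightarrow> 0"
 proof -
  define Y where "Y n t = (\<integral>\<^sup>+x. ennreal \<bar>M U (E n) (x, t) - U (x, t)\<bar> * indicator C (x, t) \<partial>lborel)" for n t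
  have "AE t in lborel. (%n. Y n t) \<longlonglongrightarrow> 0"
  proof (rule AE_tendsto_0_of_summable)
   show "Y n \<in> borel_measurable lborel" for n
    using nn_integral_prod_slices(2)[OF Xm[OF U(1)], of n] by (simp add: Y_def[abs_def])
   show "(\<Sum>n. \<integral>\<^sup>+t. Y n t \<partial>lborel) < \<infinity>"
    using EU by (intro suminf_le_geometric_finite) (simp add: Y_def nn_integral_prod_slices(1)[OF Xm[OF U(1)]])
  qed
  then show ?thesis using UV
  proof eventually_elim
   case (elim t)
   show ?case
   proof (intro impI, elim conjE)
   assume t: "a < t" "t < b"
   then have ae: "AE x in lborel. U (x, t) = v x t" using elim by auto
   have le: "(\<integral>\<^sup>+x\<in>cball 0 R. ennreal \<bar>f n x t - v x t\<bar> \<partial>lborel) \<le> Y n t" for n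
    unfolding Y_def
   proof (rule nn_integral_mono_AE, use ae in eventually_elim)
    case (elim x)
    then show ?case using inC[of x t] t R by (auto simp: f_def indicator_def)
   qed
   show "(%n. \<integral>\<^sup>+x\<in>cball 0 R. ennreal \<bar>f n x t - v x t\<bar> \<partial>lborel) \<longlonglongrightarrow> 0"
    by (rule tendsto_sandwich[OF _ _ tendsto_const elim(1)]) (use le in auto)
   qed
  qed
 qed
 \<comment> \<open>The shift inequality holds almost everywhere in the strip of times within
   \<open>\<delta>\<close> of \<open>t\<close>. Integrating it against a nonnegative kernel of mass
   1 and radius below \<open>\<delta>\<close> gives it at every point.\<close>
 have P4: "\<exists>n0. \<forall>n\<ge>n0. \<forall>t A B h. a + \<delta> < t \<and> t < b - \<delta> \<and> A \<ge> 0 \<and>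
   (AE r in lborel. \<bar>r - t\<bar> < \<delta> --> (AE x in lborel. v (x + h) r \<le> A * v x r + B)) -->
   (\<forall>x. f n (x + h) t \<le> A * f n x t + B)" if \<delta>: "\<delta> > 0" for \<delta>
 proof -
  obtain n0 where n0: "1 / real (Suc n0) < \<delta>" using \<delta> nat_approx_posE by metis
  show ?thesis
  proof (intro exI[of _ n0] allI impI, elim conjE)
   fix n :: nat and t A B :: real and h x :: 'a
   assume "n \<ge> n0" and t: "a + \<delta> < t" "t < b - \<delta>" and A: "A \<ge> 0"
    and ae: "AE r in lborel. \<bar>r - t\<bar> < \<delta> --> (AE x in lborel. v (x + h) r \<le> A * v x r + B)"
   have "1 / real (Suc n) \<le> 1 / real (Suc n0)" using \<open>n \<ge> n0\<close> by (intro divide_left_mono) auto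
   then have En: "E n < \<delta>" using E(3)[of n] n0 by linarith
   have Um [measurable]: "U \<in> borel_measurable borel" by (rule meas[OF U(1)])
   have Us [measurable]: "(%p. U (p + (h, 0))) \<in> borel_measurable borel"
    by (rule measurable_compose[OF _ Um]) simp
   have AEp: "AE p in lborel. \<bar>snd p - t\<bar> < \<delta> --> U (p + (h, 0)) \<le> A * U p + B"
   proof (rule AE_prod_of_slices)
    have [measurable]: "(snd :: 'a \<times> real => real) \<in> borel_measurable borel"
     by (intro borel_measurable_continuous_onI continuous_intros)
    show "{p. \<bar>snd p - t\<bar> < \<delta> --> U (p + (h, 0)) \<le> A * U p + B} \<in> sets borel" by measurable
    show "AE r in lborel. AE x in lborel. \<bar>snd (x, r) - t\<bar> < \<delta> --> U ((x, r) + (h, 0)) \<le> A * U (x, r) + B"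
     using ae UV
    proof eventually_elim
     case (elim r)
     show ?case
     proof (cases "\<bar>r - t\<bar> < \<delta>")
      case True
      then have r: "a < r" "r < b" using t by auto
      then have u: "AE x in lborel. U (x, r) = v x r" using elim by auto
      have "AE x in lborel. v (x + h) r \<le> A * v x r + B" using elim True by auto
      with u AE_lborel_translate[OF u, of h] show ?thesis by eventually_elim auto
     qed simp
    qed
   qed
   have kU0: "integrable lborel (%w. U w * mol (E n) (w - z))" for z
    by (rule locint_times[OF U(1) mol_translate_continuous(1)[of UNIV "E n" z] mol_translate_outside(1)[OF E(1)[of n], of z]])
   note kU = kU0[of "(x + h, t)"] kU0[of "(x, t)"]
   have sh: "mol (E n) ((h, 0) + w - (x + h, t)) = mol (E n) (w - (x, t))" for w :: "'a \<times> real"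
    by (rule arg_cong[where f = "mol (E n)"]) (cases w, simp)
   have im: "integrable lborel (%w. U (w + (h, 0)) * mol (E n) (w - (x, t)))"
    using integrable_lborel_translate[OF kU(1), of "(h, 0)"] unfolding sh by (simp add: add.commute)
   have "f n (x + h) t = (LBINT w. U (w + (h, 0)) * mol (E n) (w - (x, t)))"
    using integral_lborel_translate[of "%w. U w * mol (E n) (w - (x + h, t))" "(h, 0)"] kU(1)
    unfolding sh by (simp add: f_def M_def add.commute)
   also have "\<dots> \<le> (LBINT w. A * (U w * mol (E n) (w - (x, t))) + B * mol (E n) (w - (x, t)))"
   proof (rule integral_mono_AE[OF im])
    show "integrable lborel (%w. A * (U w * mol (E n) (w - (x, t))) + B * mol (E n) (w - (x, t)))"
     using kU(2) mol_translate_integral(1)[OF E(1)[of n], of "(x, t)"] by simp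
    show "AE w in lborel. U (w + (h, 0)) * mol (E n) (w - (x, t)) \<le> A * (U w * mol (E n) (w - (x, t))) + B * mol (E n) (w - (x, t))"
     using AEp
    proof eventually_elim
     case (elim w)
     show ?case
     proof (cases "norm (w - (x, t)) < E n")
      case True
      have "\<bar>snd w - t\<bar> \<le> norm (w - (x, t))"
       using norm_snd_le[of "snd w - t" "fst w - x"] by (cases w) simp
      then have "U (w + (h, 0)) \<le> A * U w + B" using elim True En by linarith
      then have "U (w + (h, 0)) * mol (E n) (w - (x, t)) \<le> (A * U w + B) * mol (E n) (w - (x, t))"
       by (intro mult_right_mono mol_nonneg)
      then show ?thesis by (simp add: algebra_simps)
     next
      case False
      then show ?thesis using E(1)[of n] by (simp add: mol_outside)
     qed
    qed
   qed
   also have "\<dots> = A * f n x t + B"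
    using kU(2) mol_translate_integral[OF E(1)[of n], of "(x, t)"] by (simp add: f_def M_def)
   finally show "f n (x + h) t \<le> A * f n x t + B" .
  qed
 qed
 have "approximants q a b R v f G D ft"
  unfolding approximants_def
  by (intro conjI) ((intro allI, rule sub), (intro allI impI, elim conjE, rule P2, assumption+), (rule P3),
   (intro allI impI, rule P4, assumption), (use q in simp))
 then show ?thesis by blast
qed

section \<open>Borel representatives and approximability of weak solutions\<close>

text \<open>A weak solution is integrable only on compact subsets of its open domain. Restriction to
  a closed strip \<open>P\<close> inside the domain, with value 0 elsewhere, makes it locally
  integrable on the whole space.\<close>

lemma locint_of_lebesgue:
 fixes f f0 :: "'b::euclidean_space => 'c::euclidean_space"
 assumes f: "f \<in> borel_measurable borel" and f0: "f0 \<in> borel_measurable lebesgue"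
  and ae: "AE p in lborel. f p = indicator P p *\<^sub>R f0 p" and P: "closed P"
  and int: "\<And>K. compact K ==> K \<subseteq> P ==> set_integrable lebesgue K f0"
 shows "locint f"
 unfolding locint_def set_integrable_def
proof (intro conjI allI f)
 fix R :: real
 let ?K = "cball 0 R \<inter> P"
 have K: "compact ?K" using P by (simp add: compact_Int_closed)
 have m: "(%p. indicator (cball 0 R) p *\<^sub>R f p) \<in> borel_measurable borel"
  using f by (intro borel_measurable_scaleR borel_measurable_indicator) auto
 then have ml: "(%p. indicator (cball 0 R) p *\<^sub>R f p) \<in> borel_measurable lborel" by simp
 have ae': "AE p in lebesgue. indicator ?K p *\<^sub>R f0 p = indicator (cball 0 R) p *\<^sub>R f p"
  unfolding AE_completion_iff using ae by (rule eventually_mono) (auto simp: indicator_def)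
 have "integrable lebesgue (%p. indicator ?K p *\<^sub>R f0 p)"
  using int[OF K] by (auto simp: set_integrable_def)
 then have "integrable lebesgue (%p. indicator (cball 0 R) p *\<^sub>R f p)"
  by (rule integrable_cong_AE_imp[OF _ measurable_completion[OF ml] ae'])
 then show "integrable lborel (%p. indicator (cball 0 R) p *\<^sub>R f p)"
  using integrable_completion[OF ml] by simp
qed

lemma integral_lebesgue_eq_lborel:
 fixes f f0 :: "'b::euclidean_space => real"
 assumes "f \<in> borel_measurable borel" "f0 \<in> borel_measurable lebesgue" and ae: "AE p in lborel. f0 p = f p"
 shows "(\<integral>p. f0 p \<partial>lebesgue) = (LBINT p. f p)"
proof -
 have l: "f \<in> borel_measurable lborel" using assms by simp
 have "(\<integral>p. f0 p \<partial>lebesgue) = (\<integral>p. f p \<partial>lebesgue)"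
  by (rule integral_cong_AE[OF assms(2) measurable_completion[OF l]]) (simp add: AE_completion_iff ae)
 then show ?thesis using integral_completion[OF l] by simp
qed

lemma ex_borel_representative:
 fixes f :: "'b::euclidean_space => real"
 assumes "f \<in> borel_measurable lebesgue"
 shows "\<exists>g. g \<in> borel_measurable borel \<and> (AE x in lborel. g x = f x)"
proof -
 obtain g where "g \<in> borel_measurable lborel" "AE x in lborel. f x = g x"
  using completion_ex_borel_measurable_real[OF assms] by blast
 then show ?thesis by (intro exI[of _ g]) (auto elim!: eventually_mono)
qed

text \<open>Two kinds of representatives are needed: one for each time slice, which inherits the L1
  continuity in time, and a jointly Borel one for mollification. They agree on almost every
  slice.\<close>

lemma weak_approximable:
 fixes u :: "'a::euclidean_space => real => real"
 assumes q: "1 < q" "q \<le> 2" and T0: "0 < T0" "ereal T0 < T"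
  and nonneg: "\<forall>(x, t) \<in> Qdom T. u x t \<ge> 0" and sol: "weak_solution q T u"
 shows "\<exists>v. approximable q T0 v \<and> (\<forall>t. 0 < t \<and> t < T0 -->
  (%x. u x t) \<in> borel_measurable lebesgue \<and> (AE x in lborel. v x t = u x t))"
proof -
 obtain g :: "'a => real => 'a" where
  slices: "\<forall>t. 0 < t \<and> ereal t < T -->
     (%x. u x t) \<in> borel_measurable lebesgue \<and>
     (\<forall>K. compact K --> set_integrable lebesgue K (%x. u x t)) \<and>
     (\<forall>K. compact K -->
      ((%s. \<integral>\<^sup>+x\<in>K. ennreal \<bar>u x s - u x t\<bar> \<partial>lebesgue) \<longlongrightarrow> 0)
       (at t within {s. 0 < s \<and> ereal s < T}))" and
  um: "(%(x, t). u x t) \<in> borel_measurable lebesgue" and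
  gm: "(%(x, t). g x t) \<in> borel_measurable lebesgue" and
  ints: "\<forall>K. compact K \<and> K \<subseteq> Qdom T -->
     set_integrable lebesgue K (%(x, t). u x t) \<and>
     set_integrable lebesgue K (%(x, t). g x t) \<and>
     set_integrable lebesgue K (%(x, t). norm (g x t) powr q)" and
  wgrad: "\<forall>\<phi> \<in> test_fun (Qdom T). \<forall>b \<in> Basis.
     (\<integral>z. (case z of (x, t) => u x t) * dd \<phi> (b, 0) z \<partial>lebesgue)
      = - (\<integral>z. (case z of (x, t) => g x t \<bullet> b) * \<phi> z \<partial>lebesgue)" and
  weq: "\<forall>\<phi> \<in> test_fun (Qdom T).
     (\<integral>z. (case z of (x, t) =>
         - u x t * dd \<phi> (0, 1) z
         - u x t * (\<Sum>b\<in>Basis. dd (dd \<phi> (b, 0)) (b, 0) z)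
         + norm (g x t) powr q * \<phi> z) \<partial>lebesgue) = 0"
  using sol unfolding weak_solution_def by (elim exE conjE) (rule that)
 have tT: "ereal t < T" if "t < T0" for t using that T0(2) by (auto intro: less_trans[of "ereal t" "ereal T0"])
 define u' where "u' p = u (fst p) (snd p)" for p
 define g' where "g' p = g (fst p) (snd p)" for p
 have um': "u' \<in> borel_measurable lebesgue" using um by (simp add: u'_def[abs_def] split_beta')
 have gm': "g' \<in> borel_measurable lebesgue" using gm by (simp add: g'_def[abs_def] split_beta')
 have "\<exists>w. w \<in> borel_measurable borel \<and> (0 < t \<and> t < T0 --> (AE x in lborel. w x = u x t))" for t
 proof (cases "0 < t \<and> t < T0")
  case True
  then have "(%x. u x t) \<in> borel_measurable lebesgue" using slices tT by blast
  from ex_borel_representative[OF this] show ?thesis by blast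
 qed (auto intro!: exI[of _ "%_. 0"])
 then obtain W where Wm: "\<And>t. W t \<in> borel_measurable borel"
  and W: "\<And>t. 0 < t ==> t < T0 ==> AE x in lborel. W t x = u x t" by metis
 \<comment> \<open>The maximum makes the representative nonnegative everywhere; it changes nothing
   almost everywhere, since \<open>u\<close> is nonnegative.\<close>
 define v where "v x t = max 0 (W t x)" for x t
 have vm: "(%x. v x t) \<in> borel_measurable borel" for t unfolding v_def using Wm by measurable
 have vu: "AE x in lborel. v x t = u x t" if t: "0 < t" "t < T0" for t
 proof -
  have "u x t \<ge> 0" for x using nonneg t tT by (auto simp: Qdom_def)
  then show ?thesis using W[OF t] by (auto simp: v_def elim!: eventually_mono)
 qed
 have "approximable q T0 v"
 proof
  show "q > 1" "T0 > 0" by fact+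
  show "(%x. v x t) \<in> borel_measurable borel" for t by (rule vm)
  show "v x t \<ge> 0" for x t by (simp add: v_def)
  show "set_integrable lborel (cball 0 R) (%x. v x t)" if t: "0 < t" "t < T0" for t R
  proof -
   have l: "AE x in lborel. v x t = indicator UNIV x *\<^sub>R u x t" using vu[OF t] by simp
   have um: "(%x. u x t) \<in> borel_measurable lebesgue"
    and ui: "\<And>K. compact K ==> K \<subseteq> UNIV ==> set_integrable lebesgue K (%x. u x t)"
    using slices t tT by blast+
   have "locint (%x. v x t)" by (rule locint_of_lebesgue[OF vm um l closed_UNIV ui])
   then show ?thesis by (simp add: locint_def)
  qed
  show "((%s. \<integral>\<^sup>+x\<in>cball 0 R. ennreal \<bar>v x s - v x t\<bar> \<partial>lborel) \<longlongrightarrow> 0) (at t)" if t: "0 < t" "t < T0" for t R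
  proof -
   have "((%s. \<integral>\<^sup>+x\<in>cball 0 R. ennreal \<bar>u x s - u x t\<bar> \<partial>lebesgue) \<longlongrightarrow> 0) (at t within {s. 0 < s \<and> ereal s < T})"
    using slices t tT[of t] compact_cball by blast
   then have "((%s. \<integral>\<^sup>+x\<in>cball 0 R. ennreal \<bar>u x s - u x t\<bar> \<partial>lebesgue) \<longlongrightarrow> 0) (at t within {0<..<T0})"
    by (rule tendsto_within_subset) (use tT in auto)
   then have lim: "((%s. \<integral>\<^sup>+x\<in>cball 0 R. ennreal \<bar>u x s - u x t\<bar> \<partial>lborel) \<longlongrightarrow> 0) (at t)"
    using t by (simp add: nn_integral_completion at_within_open[of t "{0<..<T0}"])
   have "\<forall>\<^sub>F s in at t. s \<in> {0<..<T0}" by (rule eventually_at_in_open') (use t in auto)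
   then have "\<forall>\<^sub>F s in at t. (\<integral>\<^sup>+x\<in>cball 0 R. ennreal \<bar>u x s - u x t\<bar> \<partial>lborel) = (\<integral>\<^sup>+x\<in>cball 0 R. ennreal \<bar>v x s - v x t\<bar> \<partial>lborel)"
   proof (rule eventually_mono)
    fix s assume "s \<in> {0<..<T0}"
    then have "AE x in lborel. v x s = u x s" using vu[of s] by simp
    with vu[OF t] have "AE x in lborel. ennreal \<bar>u x s - u x t\<bar> * indicator (cball 0 R) x = ennreal \<bar>v x s - v x t\<bar> * indicator (cball 0 R) x"
     by eventually_elim simp
    then show "(\<integral>\<^sup>+x\<in>cball 0 R. ennreal \<bar>u x s - u x t\<bar> \<partial>lborel) = (\<integral>\<^sup>+x\<in>cball 0 R. ennreal \<bar>v x s - v x t\<bar> \<partial>lborel)"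
     by (rule nn_integral_cong_AE)
   qed
   from Lim_transform_eventually[OF lim this] show ?thesis .
  qed
  show "\<exists>f G D ft. approximants q a b R v f G D ft" if ab: "0 < a" "a < b" "b < T0" and R: "R > 0" for a b R
  proof -
   \<comment> \<open>Safety margins in time: a mollifier of radius below \<open>e0\<close> centred
     at a time in \<open>(a, b)\<close> stays inside the closed strip \<open>P\<close>, hence inside
     the domain of the equation.\<close>
   define a' b' where "a' = a / 2" and "b' = (b + T0) / 2"
   define e0 where "e0 = min (a - a') (b' - b)"
   have "0 < a - a'" "0 < b' - b" "0 < a'" "b' < T0" using ab by (auto simp: a'_def b'_def)
   then have e0: "e0 > 0" "e0 \<le> a - a'" "e0 \<le> b' - b" "0 < a'" "b' < T0" by (simp_all add: e0_def)
   define P where "P = {p :: 'a \<times> real. a' \<le> snd p \<and> snd p \<le> b'}"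
   have cP: "closed P" unfolding P_def by (intro closed_Collect_conj closed_Collect_le continuous_intros)
   have PQ: "P \<subseteq> Qdom T" using e0 tT by (auto simp: P_def Qdom_def)
   have Pb: "P \<in> sets borel" using cP by simp
   have Pl: "P \<in> sets lebesgue" using cP by simp
   have ball: "p \<in> P" if "norm (p - z) \<le> ep" "ep < e0" "snd z \<in> {a<..<b}" for p z :: "'a \<times> real" and ep
   proof -
    have "\<bar>snd p - snd z\<bar> \<le> norm (p - z)"
     using norm_snd_le[of "snd p - snd z" "fst p - fst z"] by (cases p, cases z) simp
    then show ?thesis using that e0 by (auto simp: P_def)
   qed
   have "(%p. indicator P p * u' p) \<in> borel_measurable lebesgue"
    using um' Pl by (intro borel_measurable_times borel_measurable_indicator) auto
   from ex_borel_representative[OF this] obtain U0 where U0m: "U0 \<in> borel_measurable borel"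
    and U0: "AE p in lborel. U0 p = indicator P p * u' p" by blast
   define U where "U p = max 0 (U0 p)" for p
   have Um: "U \<in> borel_measurable borel" unfolding U_def[abs_def] using U0m by measurable
   have u'0: "u' p \<ge> 0" if "p \<in> P" for p using nonneg PQ that by (cases p) (auto simp: u'_def)
   have UP: "AE p in lborel. U p = indicator P p *\<^sub>R u' p"
    using U0 by (rule eventually_mono) (use u'0 in \<open>auto simp: U_def indicator_def\<close>)
   have "\<exists>w. w \<in> borel_measurable borel \<and> (AE p in lborel. w p = indicator P p * (g' p \<bullet> i))" for i
    by (rule ex_borel_representative)
     (use gm' Pl in \<open>auto intro!: borel_measurable_times borel_measurable_indicator borel_measurable_inner\<close>)
   then obtain w where wm: "\<And>i. w i \<in> borel_measurable borel"
    and w: "\<And>i. AE p in lborel. w i p = indicator P p * (g' p \<bullet> i)" by metis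
   define h where "h p = (\<Sum>i\<in>Basis. w i p *\<^sub>R i)" for p
   have hm: "h \<in> borel_measurable borel" unfolding h_def[abs_def] using wm by (intro borel_measurable_sum borel_measurable_scaleR) auto
   have "AE p in lborel. \<forall>i\<in>Basis. w i p = indicator P p * (g' p \<bullet> i)"
    by (subst AE_ball_countable) (auto intro!: w countable_finite)
   then have hP: "AE p in lborel. h p = indicator P p *\<^sub>R g' p"
   proof (rule eventually_mono)
    fix p assume "\<forall>i\<in>Basis. w i p = indicator P p * (g' p \<bullet> i)"
    then have "h p = (\<Sum>i\<in>Basis. ((indicator P p *\<^sub>R g' p) \<bullet> i) *\<^sub>R i)" by (simp add: h_def)
    then show "h p = indicator P p *\<^sub>R g' p" by (simp only: euclidean_representation)
   qed
   have Fm: "(%p. norm (h p) powr q) \<in> borel_measurable borel" using hm by measurable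
   have FP: "AE p in lborel. norm (h p) powr q = indicator P p *\<^sub>R (norm (g' p) powr q)"
    using hP by (rule eventually_mono) (auto simp: indicator_def)
   have g'q: "(%p. norm (g' p) powr q) \<in> borel_measurable lebesgue" using gm' by measurable
   have comp: "set_integrable lebesgue K u'" "set_integrable lebesgue K g'" "set_integrable lebesgue K (%p. norm (g' p) powr q)"
    if "compact K" "K \<subseteq> P" for K
    using ints that PQ unfolding u'_def[abs_def] g'_def[abs_def] split_beta' by blast+
   have lU: "locint U" by (rule locint_of_lebesgue[OF Um um' UP cP comp(1)])
   have lh: "locint h" by (rule locint_of_lebesgue[OF hm gm' hP cP comp(2)])
   have lF: "locint (%p. norm (h p) powr q)" by (rule locint_of_lebesgue[OF Fm g'q FP cP comp(3)])
   have UP': "AE p in lborel. p \<in> P --> U p = u' p" using UP by (rule eventually_mono) simp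
   have hP': "AE p in lborel. p \<in> P --> h p = g' p" using hP by (rule eventually_mono) simp
   note kcont = mol_translate_continuous[of UNIV]
   have km: "continuous_on UNIV \<kappa> ==> \<kappa> \<in> borel_measurable borel" for \<kappa> :: "'a \<times> real => real"
    by (rule borel_measurable_continuous_onI)
   have kml: "continuous_on UNIV \<kappa> ==> \<kappa> \<in> borel_measurable lebesgue" for \<kappa> :: "'a \<times> real => real"
    by (rule measurable_completion) (use km in simp)
   have tU: "(\<integral>p. u' p * \<kappa> p \<partial>lebesgue) = (LBINT p. U p * \<kappa> p)"
    if \<kappa>: "continuous_on UNIV \<kappa>" and z: "\<And>p. p \<notin> P ==> \<kappa> p = 0" for \<kappa> :: "'a \<times> real => real"
   proof (rule integral_lebesgue_eq_lborel)
    show "AE p in lborel. u' p * \<kappa> p = U p * \<kappa> p" using UP' by (rule eventually_mono) (use z in auto)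
   qed (use Um km[OF \<kappa>] um' kml[OF \<kappa>] in \<open>auto intro!: borel_measurable_times\<close>)
   have tg: "(\<integral>p. (g' p \<bullet> i) * \<kappa> p \<partial>lebesgue) = (LBINT p. (h p \<bullet> i) * \<kappa> p)"
    if \<kappa>: "continuous_on UNIV \<kappa>" and z: "\<And>p. p \<notin> P ==> \<kappa> p = 0" for \<kappa> :: "'a \<times> real => real" and i
   proof (rule integral_lebesgue_eq_lborel)
    show "AE p in lborel. (g' p \<bullet> i) * \<kappa> p = (h p \<bullet> i) * \<kappa> p" using hP' by (rule eventually_mono) (use z in auto)
   qed (use hm km[OF \<kappa>] gm' kml[OF \<kappa>] in \<open>auto intro!: borel_measurable_times borel_measurable_inner\<close>)
   have wgrad': "(\<integral>p. u' p * dd \<phi> (i, 0) p \<partial>lebesgue) = - (\<integral>p. (g' p \<bullet> i) * \<phi> p \<partial>lebesgue)"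
    if "\<phi> \<in> test_fun (Qdom T)" "i \<in> Basis" for \<phi> i
    using wgrad[rule_format, OF that] by (simp add: u'_def g'_def split_beta')
   have dmol: "dd (%w. mol ep (w - z)) k = (%w. molG ep (w - z) \<bullet> k)" for ep and z k :: "'a \<times> real"
    unfolding dd_def frechet_derivative_at[OF mol_translate_derivative, symmetric] ..
   have kinn: "continuous_on UNIV (%w. molG ep (w - z) \<bullet> k)" for ep and z k :: "'a \<times> real"
    by (intro continuous_intros kcont)
   {
    fix ep :: real and z :: "'a \<times> real" assume ep: "0 < ep" "ep < e0" and z: "snd z \<in> {a<..<b}"
    have cb: "cball z ep \<subseteq> Qdom T"
     using ball[OF _ ep(2) z] PQ by (auto simp: dist_norm norm_minus_commute subset_iff)
    have nb: "ep < norm (p - z)" if "p \<notin> P" for p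
     using ball[OF _ ep(2) z, of p] that not_le by blast
    have m0: "mol ep (p - z) = 0" "molG ep (p - z) = 0" if "p \<notin> P" for p
     using nb[OF that] ep(1) by (simp_all add: mol_outside)
    note tf = test_fun_mol[OF ep(1) cb]
    have "(LBINT w. U w * (molG ep (w - z) \<bullet> (i, 0))) = - (LBINT w. (h w \<bullet> i) * mol ep (w - z))"
     if i: "i \<in> Basis" for i
    proof -
     have "(LBINT w. U w * (molG ep (w - z) \<bullet> (i, 0))) = (\<integral>p. u' p * dd (%w. mol ep (w - z)) (i, 0) p \<partial>lebesgue)"
      unfolding dmol by (rule tU[symmetric]) (use kinn m0 in auto)
     also have "\<dots> = - (LBINT p. (h p \<bullet> i) * mol ep (p - z))"
      unfolding wgrad'[OF tf(1) i] by (subst tg) (use kcont m0 in auto)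
     finally show ?thesis .
    qed
    note gr = this
    \<comment> \<open>The pure second derivatives of the mollifier. Continuity and support are read
      off from smoothness of the first derivatives, without an explicit formula.\<close>
    define \<kappa> where "\<kappa> i = dd (%w. molG ep (w - z) \<bullet> (i, 0)) (i, 0)" for i :: 'a
    have \<kappa>c: "continuous_on UNIV (\<kappa> i)" and \<kappa>z: "norm (p - z) > ep ==> \<kappa> i p = 0" for i p
    proof -
     have "Ck (Suc 0) (%w. molG ep (w - z) \<bullet> (i, 0))" using smooth_mol(2)[of ep z "(i, 0)"] unfolding smooth_def by blast
     then obtain Df where Df: "\<And>p. ((%w. molG ep (w - z) \<bullet> (i, 0)) has_derivative Df p) (at p)"
      and Dfc: "\<And>k. continuous_on UNIV (%p. Df p k)" by auto
     have eq: "\<kappa> i = (%p. Df p (i, 0))"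
      unfolding \<kappa>_def dd_def frechet_derivative_at[OF Df, symmetric] ..
     show "continuous_on UNIV (\<kappa> i)" unfolding eq by (rule Dfc)
     show "\<kappa> i p = 0" if p: "norm (p - z) > ep"
     proof -
      have "open {p. norm (p - z) > ep}" by (intro open_Collect_less continuous_intros)
      from has_derivative_transform_within_open[OF Df[of p] this, of "%_. 0"]
      have "((%_. 0) has_derivative Df p) (at p)" using p ep by (auto simp: mol_outside)
      then have "Df p = (%_. 0)" using has_derivative_unique has_derivative_const by blast
      then show ?thesis by (simp add: eq)
     qed
    qed
    have \<kappa>P: "\<kappa> i p = 0" if "p \<notin> P" for i p by (rule \<kappa>z[OF nb[OF that]])
    have far: "norm (p - z) > ep" if "norm p > norm z + ep" for p using that norm_triangle_ineq2[of p z] by linarith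
    have iU: "integrable lborel (%p. U p * \<kappa> i p)" for i
     by (rule locint_times[OF lU \<kappa>c, of "norm z + ep"]) (use \<kappa>z far in auto)
    have it: "integrable lborel (%p. U p * (molG ep (p - z) \<bullet> (0, 1)))"
     by (rule locint_times[OF lU kinn, of "norm z + ep"]) (simp add: mol_translate_outside(2)[OF ep(1)])
    have iF: "integrable lborel (%p. norm (h p) powr q * mol ep (p - z))"
     by (rule locint_times[OF lF kcont(1), of "norm z + ep"]) (simp add: mol_translate_outside(1)[OF ep(1)])
    \<comment> \<open>The weak gradient identity is tested with a first derivative of the mollifier.
      This trades \<open>U\<close> against second derivatives of the kernel for \<open>h\<close>
      against first derivatives.\<close>
    have gk: "(LBINT p. (h p \<bullet> i) * (molG ep (p - z) \<bullet> (i, 0))) = - (LBINT p. U p * \<kappa> i p)" if i: "i \<in> Basis" for i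
    proof -
     have "(LBINT p. U p * \<kappa> i p) = (\<integral>p. u' p * \<kappa> i p \<partial>lebesgue)"
      by (rule tU[symmetric]) (use \<kappa>c \<kappa>P in auto)
     also have "\<dots> = - (LBINT p. (h p \<bullet> i) * (molG ep (p - z) \<bullet> (i, 0)))"
      unfolding \<kappa>_def wgrad'[OF tf(2) i] by (subst tg) (use kinn m0 in auto)
     finally show ?thesis by simp
    qed
    let ?L = "%p. - u' p * (molG ep (p - z) \<bullet> (0, 1)) - u' p * (\<Sum>i\<in>Basis. \<kappa> i p) + norm (g' p) powr q * mol ep (p - z)"
    let ?B = "%p. - (U p * (molG ep (p - z) \<bullet> (0, 1))) - (\<Sum>i\<in>Basis. U p * \<kappa> i p) + norm (h p) powr q * mol ep (p - z)"
    have "(\<integral>p. ?L p \<partial>lebesgue) = 0"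
     using weq[rule_format, OF tf(1)] unfolding dmol \<kappa>_def u'_def g'_def split_beta' .
    moreover have "(\<integral>p. ?L p \<partial>lebesgue) = (LBINT p. ?B p)"
    proof (rule integral_lebesgue_eq_lborel)
     show "AE p in lborel. ?L p = ?B p"
      using UP' hP' by eventually_elim (use m0 \<kappa>P in \<open>auto simp: sum_distrib_left\<close>)
     show "?B \<in> borel_measurable borel"
      using borel_measurable_integrable[OF it] borel_measurable_integrable[OF iU] borel_measurable_integrable[OF iF] by simp
     have ks: "continuous_on UNIV (%p. \<Sum>i\<in>Basis. \<kappa> i p)" by (intro continuous_intros \<kappa>c)
     show "?L \<in> borel_measurable lebesgue"
      using um' g'q kml[OF kinn[of ep z "(0, 1)"]] kml[OF ks] kml[OF kcont(1)[of ep z]]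
      by (intro borel_measurable_add borel_measurable_diff borel_measurable_times borel_measurable_uminus) auto
    qed
    moreover have "(LBINT p. ?B p) = - (LBINT p. U p * (molG ep (p - z) \<bullet> (0, 1))) - (\<Sum>i\<in>Basis. LBINT p. U p * \<kappa> i p)
      + (LBINT p. norm (h p) powr q * mol ep (p - z))"
     using it iU iF by simp
    ultimately have "- (LBINT w. U w * (molG ep (w - z) \<bullet> (0, 1)))
      + (\<Sum>i\<in>Basis. LBINT w. (h w \<bullet> i) * (molG ep (w - z) \<bullet> (i, 0)))
      + (LBINT w. norm (h w) powr q * mol ep (w - z)) = 0"
     by (simp add: gk sum_negf)
    note gr this
   }
   note facts = this
   show ?thesis
   proof (rule mollified_approximants[OF q R e0(1) lU _ lh lF])
    show "U p \<ge> 0" for p by (simp add: U_def)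
    \<comment> \<open>Here the jointly Borel representative is matched with the slice
      representative: by Fubini both agree with \<open>u\<close> on almost every slice.\<close>
    show "AE t in lborel. a < t \<and> t < b --> (AE x in lborel. U (x, t) = v x t)"
     using AE_prod_slices[OF UP']
    proof (rule eventually_mono, intro impI)
     fix t assume ae: "AE x in lborel. (x, t) \<in> P --> U (x, t) = u' (x, t)" and t: "a < t \<and> t < b"
     have P: "(x, t) \<in> P" for x using t e0 ab by (auto simp: P_def a'_def b'_def)
     have "AE x in lborel. v x t = u x t" using t ab by (intro vu) auto
     with ae show "AE x in lborel. U (x, t) = v x t" by eventually_elim (simp add: P u'_def)
    qed
   qed (use facts in blast)+
  qed
 qed
 moreover have "(%x. u x t) \<in> borel_measurable lebesgue" if "0 < t" "t < T0" for t
  using slices tT that by blast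
 ultimately show ?thesis using vu by blast
qed

section \<open>The limit measure of a solution with given initial trace\<close>

theorem theorem1p2:
  fixes q :: real and T :: ereal and S :: "'a::euclidean_space set"
    and u0 :: "'a measure" and u :: "'a \<Rightarrow> real \<Rightarrow> real"
  assumes q: "q > 1"
    and T: "T > 0"
    and S: "closed S" "S \<noteq> UNIV"
    and u0: "radon_on (- S) u0"
    and nonneg: "\<forall>(x, t) \<in> Qdom T. u x t \<ge> 0"
    and sol: "classical_solution q T u \<or> (q \<le> 2 \<and> weak_solution q T u)"
    and trace: "has_initial_trace u S u0"
  shows "\<exists>\<gamma> :: 'a measure.
           radon_on UNIV \<gamma> \<and> emeasure \<gamma> (- S) = 0 \<and>
           (\<forall>\<psi> \<in> Cc UNIV.
              ((\<lambda>t. t powr (1 / (q - 1)) * (\<integral>x. u x t * \<psi> x \<partial>lebesgue))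
                 \<longlongrightarrow> (\<integral>x. \<psi> x \<partial>\<gamma>)) (at_right 0)) \<and>
           (\<exists>h :: 'a \<Rightarrow> real. h \<in> borel_measurable borel \<and> (\<forall>x. h x \<ge> 0) \<and>
              \<gamma> = density lborel (\<lambda>x. ennreal (h x)) \<and>
              (\<forall>K. compact K \<longrightarrow> (\<exists>M. \<forall>x\<in>K. h x \<le> M)) \<and>
              (compact S \<longrightarrow> (\<exists>M. \<forall>x. h x \<le> M))) \<and>
           (emeasure lebesgue S = 0 \<longrightarrow> \<gamma> = null_measure borel)"
proof -
 \<comment> \<open>Only times near 0 matter, so a finite horizon strictly below the possibly
   infinite \<open>T\<close> is fixed.\<close>
 obtain T0 where T0: "0 < T0" "ereal T0 < T"
  using ereal_dense2[OF T] by (auto simp: zero_ereal_def)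
 have "\<exists>v. approximable q T0 v \<and> (\<forall>t. 0 < t \<and> t < T0 -->
  (%x. u x t) \<in> borel_measurable lebesgue \<and> (AE x in lborel. v x t = u x t))"
  using sol
 proof
  let ?v = "%x t. if 0 < t \<and> t < T0 then u x t else 0"
  assume "classical_solution q T u"
  from classical_approximable[OF q T0 nonneg this] have A: "approximable q T0 ?v" .
  have "(%x. u x t) \<in> borel_measurable lebesgue" if "0 < t" "t < T0" for t
   by (rule measurable_completion) (use approximable.v_measurable[OF A, of t] that in simp)
  with A show ?thesis by (intro exI[of _ ?v]) simp
 next
  assume "q \<le> 2 \<and> weak_solution q T u"
  then show ?thesis using weak_approximable[OF q _ T0 nonneg] by blast
 qed
 then obtain v where v: "approximable q T0 v"
  and um: "\<And>t. 0 < t ==> t < T0 ==> (%x. u x t) \<in> borel_measurable lebesgue"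
  and vu: "\<And>t. 0 < t ==> t < T0 ==> AE x in lborel. v x t = u x t" by blast
 interpret approximable q T0 v by (rule v)
 \<comment> \<open>Lebesgue integrals of \<open>u\<close> and Borel integrals of its representative
   coincide for small times, so trace and conclusion can both be moved to \<open>v\<close>.\<close>
 have eqi: "\<forall>\<^sub>F t in at_right 0. (\<integral>x. u x t * \<psi> x \<partial>lebesgue) = (LBINT x. v x t * \<psi> x)" if \<psi>: "continuous_on UNIV \<psi>" for \<psi>
 proof -
  have ev: "\<forall>\<^sub>F t in at_right 0. 0 < t \<and> t < T0"
   unfolding eventually_at_right_field using T0 by blast
  show ?thesis using ev
  proof (rule eventually_mono)
   fix t assume t: "0 < t \<and> t < T0"
   have m: "(%x. v x t * \<psi> x) \<in> borel_measurable borel"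
    using v_measurable borel_measurable_continuous_onI[OF \<psi>] by (intro borel_measurable_times) auto
   have ae: "AE x in lborel. u x t * \<psi> x = v x t * \<psi> x" using vu[of t] t by (auto elim!: eventually_mono)
   have "(%x. u x t * \<psi> x) \<in> borel_measurable lebesgue"
    using t um[of t] borel_measurable_continuous_onI[OF \<psi>]
    by (intro borel_measurable_times) (auto intro!: measurable_completion)
   then show "(\<integral>x. u x t * \<psi> x \<partial>lebesgue) = (LBINT x. v x t * \<psi> x)"
    by (rule integral_lebesgue_eq_lborel[OF m _ ae])
  qed
 qed
 have tr: "\<exists>l. ((%t. LBINT x. v x t * \<psi> x) \<longlongrightarrow> l) (at_right 0)" if \<psi>: "\<psi> \<in> Cc (- S)" for \<psi>
 proof
  have "((%t. \<integral>x. u x t * \<psi> x \<partial>lebesgue) \<longlongrightarrow> (\<integral>x. \<psi> x \<partial>u0)) (at_right 0)"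
   using trace \<psi> unfolding has_initial_trace_def by blast
  from Lim_transform_eventually[OF this eqi] \<psi>
  show "((%t. LBINT x. v x t * \<psi> x) \<longlongrightarrow> (\<integral>x. \<psi> x \<partial>u0)) (at_right 0)" by (simp add: Cc_def)
 qed
 obtain h M where hm: "h \<in> borel_measurable borel"
  and hb: "\<And>x. 0 \<le> h x \<and> h x \<le> M * (1 + norm x) powr (q / (q - 1))" and hS: "\<And>x. x \<notin> S ==> h x = 0"
  and lim: "\<And>\<psi>. \<psi> \<in> Cc UNIV ==>
   ((%t. t powr (1 / (q - 1)) * (LBINT x. v x t * \<psi> x)) \<longlongrightarrow> (LBINT x. h x * \<psi> x)) (at_right 0)"
  using trace_limit[OF S tr] by blast
 have h0: "0 \<le> h x" for x using hb by blast
 have bdd: "\<exists>M'\<ge>0. \<forall>x\<in>K. h x \<le> M'" if K: "compact K" for K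
 proof -
  obtain B where B: "\<And>x. x \<in> K ==> norm x \<le> B" using compact_imp_bounded[OF K] unfolding bounded_iff by blast
  have "h x \<le> \<bar>M\<bar> * (1 + \<bar>B\<bar>) powr (q / (q - 1))" if "x \<in> K" for x
  proof -
   have "h x \<le> M * (1 + norm x) powr (q / (q - 1))" using hb by blast
   also have "\<dots> \<le> \<bar>M\<bar> * (1 + norm x) powr (q / (q - 1))" by (intro mult_right_mono) auto
   also have "\<dots> \<le> \<bar>M\<bar> * (1 + \<bar>B\<bar>) powr (q / (q - 1))"
    using B[OF that] q by (intro mult_left_mono powr_mono2) auto
   finally show ?thesis .
  qed
  then show ?thesis by (intro exI[of _ "\<bar>M\<bar> * (1 + \<bar>B\<bar>) powr (q / (q - 1))"]) auto
 qed
 define \<gamma> where "\<gamma> = density lborel (%x. ennreal (h x))"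
 have em: "emeasure \<gamma> A = (\<integral>\<^sup>+x. ennreal (h x) * indicator A x \<partial>lborel)" if "A \<in> sets borel" for A
  unfolding \<gamma>_def using that hm by (subst emeasure_density) auto
 show ?thesis
 proof (intro exI[of _ \<gamma>] conjI ballI impI)
  show "radon_on UNIV \<gamma>"
   unfolding radon_on_def
  proof (intro conjI allI impI)
   fix K :: "'a set" assume K: "compact K \<and> K \<subseteq> UNIV"
   then obtain M' where M': "M' \<ge> 0" "\<forall>x\<in>K. h x \<le> M'" using bdd by blast
   have Kb: "K \<in> sets borel" using K by (simp add: borel_compact)
   have "emeasure \<gamma> K \<le> (\<integral>\<^sup>+x. ennreal M' * indicator K x \<partial>lborel)"
    unfolding em[OF Kb] using M' by (intro nn_integral_mono) (auto simp: indicator_def ennreal_leI)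
   also have "\<dots> = ennreal M' * emeasure lborel K" using Kb by (simp add: nn_integral_cmult_indicator)
   also have "\<dots> < \<infinity>"
    using K emeasure_compact_finite[of K] by (simp add: ennreal_mult_less_top)
   finally show "emeasure \<gamma> K < \<infinity>" .
  qed (auto simp: \<gamma>_def)
  have "- S \<in> sets borel" using S(1) by (simp add: borel_open open_Compl)
  then have "emeasure \<gamma> (- S) = (\<integral>\<^sup>+x. ennreal (h x) * indicator (- S) x \<partial>lborel)" by (rule em)
  also have "\<dots> = (\<integral>\<^sup>+x. 0 \<partial>(lborel :: 'a measure))" by (intro nn_integral_cong) (auto simp: indicator_def hS)
  finally show "emeasure \<gamma> (- S) = 0" by simp
 next
  fix \<psi> :: "'a => real" assume \<psi>: "\<psi> \<in> Cc UNIV"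
  then have c: "continuous_on UNIV \<psi>" by (simp add: Cc_def)
  have "(\<integral>x. \<psi> x \<partial>\<gamma>) = (LBINT x. h x * \<psi> x)"
   unfolding \<gamma>_def using hm h0 borel_measurable_continuous_onI[OF c] by (subst integral_density) auto
  moreover have "\<forall>\<^sub>F t in at_right 0. t powr (1 / (q - 1)) * (LBINT x. v x t * \<psi> x) = t powr (1 / (q - 1)) * (\<integral>x. u x t * \<psi> x \<partial>lebesgue)"
   using eqi[OF c] by (rule eventually_mono) simp
  ultimately show "((%t. t powr (1 / (q - 1)) * (\<integral>x. u x t * \<psi> x \<partial>lebesgue)) \<longlongrightarrow> (\<integral>x. \<psi> x \<partial>\<gamma>)) (at_right 0)"
   using Lim_transform_eventually[OF lim[OF \<psi>]] by simp
 next
  show "\<exists>h :: 'a => real. h \<in> borel_measurable borel \<and> (\<forall>x. h x \<ge> 0) \<and>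
       \<gamma> = density lborel (%x. ennreal (h x)) \<and>
       (\<forall>K. compact K --> (\<exists>M. \<forall>x\<in>K. h x \<le> M)) \<and>
       (compact S --> (\<exists>M. \<forall>x. h x \<le> M))"
  proof (intro exI[of _ h] conjI allI impI hm h0 \<gamma>_def)
   show "\<exists>M. \<forall>x\<in>K. h x \<le> M" if "compact K" for K using bdd[OF that] by blast
   assume "compact S"
   from bdd[OF this] obtain M' where "M' \<ge> 0" "\<forall>x\<in>S. h x \<le> M'" by blast
   then have "h x \<le> M'" for x using hS[of x] by (cases "x \<in> S") auto
   then show "\<exists>M. \<forall>x. h x \<le> M" by blast
  qed
 next
  assume "emeasure lebesgue S = 0"
  then have "S \<in> null_sets lborel" using S(1) by (auto simp: null_sets_def)
  then have "AE x in lborel. x \<notin> S" by (rule AE_not_in)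
  then have "AE x in lborel. ennreal (h x) = 0" by (rule eventually_mono) (simp add: hS)
  then have "\<gamma> = density lborel (%x. 0)"
   unfolding \<gamma>_def using hm by (intro density_cong) auto
  also have "\<dots> = null_measure borel"
   by (rule measure_eqI) (auto simp: emeasure_density)
  finally show "\<gamma> = null_measure borel" .
 qed
qed

end
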